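(* The Morse index of the $Y$-catenoid is one, and its nullity is three.
   Context: **The $Y$-catenoid.** It is the minimal triple junction surface $M=(\Sigma_1,\Sigma_2,\Sigma_3;\Gamma)$ in $\mathbb{R}^3$ where $\Gamma\subset\{x_3=0\}$ is a circle centered at the origin, $\Sigma_1=D_\Gamma$ is the closed flat disk in $\{x_3=0\}$ bounded by $\Gamma$, and $\Sigma_2,\Sigma_3$ are two pieces of catenoids with boundary $\Gamma$, symmetric to each other under reflection in $\{x_3=0\}$, whose conormals along $\Gamma$ form a constant angle of $120$ degrees with that of the disk. Explicitly, up to a homothety of $\mathbb{R}^3$, $\Gamma$ has radius $2/\sqrt3$, $\Sigma_1$ is the image of $X_1(t,\theta)=(\tfrac{2t}{\sqrt3}\cos\theta,\tfrac{2t}{\sqrt3}\sin\theta,0)$, $t\in[0,1]$, and $\Sigma_2,\Sigma_3$ are the images of $(\cosh(t+\ln\sqrt3)\cos\theta,\cosh(t+\ln\sqrt3)\sin\theta,\pm t)$, $t\in[0,\infty)$ (sign $+$ for one, $-$ for the other), $\theta\in[0,2\pi)$. **Index form.** Let $\eta_i$ be the outward unit conormal of $\Sigma_i$ along $\Gamma=\partial\Sigma_i$; then $\eta_1+\eta_2+\eta_3=0$. Unit normals on the faces are chosen compatibly, so that they sum to $0$ along $\Gamma$; accordingly, an admissible (normal) variation is a triple $\phi=(\phi_1,\phi_2,\phi_3)$ of functions $\phi_i$ on $\Sigma_i$ with $\phi_1+\phi_2+\phi_3=0$ on $\Gamma$ (in the sense of traces). Let $A_i$ be the second fundamental form of $\Sigma_i$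 and $\mathbf{H}_\Gamma$ the curvature vector of the curve $\Gamma$ in $\mathbb{R}^3$. The index form (second variation of area) is $$Q(\phi)=\sum_{i=1}^3\Big(\int_{\Sigma_i}|\nabla\phi_i|^2-|A_i|^2\phi_i^2-\int_\Gamma (\mathbf{H}_\Gamma\cdot\eta_i)\,\phi_i^2\Big),$$ with associated symmetric bilinear form $Q(\cdot,\cdot)$. **Morse index.** The maximal dimension of a subspace of compactly supported admissible $W^{1,2}$ triples (supports may meet $\Gamma$) on which $Q$ is negative definite. **Nullity.** Let $L^2_*$ be the completion of compactly supported smooth functions in the norm $\|f\|_{L^2_*}^2=\int f^2(1+|x|^2)^{-1}(\log(2+|x|))^{-2}$, where $|x|$ is the Euclidean norm of the position. Let $\mathcal D$ be the space of admissible triples $\phi$ with each $\phi_i\in L^2_*(\Sigma_i)$ and $|\nabla\phi_i|\in L^2(\Sigma_i)$. The nullity is the dimension of the null space $\{\phi\in\mathcal D: Q(\phi,\psi)=0\ \text{for all }\psi\in\mathcal D\}$. *)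

theory Defs
  imports "HOL-Analysis.Analysis" "HOL-Library.Extended_Nat"
begin

section \<open>The surface\<close>

datatype face = Disk | Upper | Lower

definition faces :: "face set" where
  "faces = {Disk, Upper, Lower}"

text \<open>
  The $Y$-catenoid is determined up to a homothety of space; \<open>c > 0\<close> is the homothety factor
  throughout, and \<open>c = 1\<close> is the one whose circle has radius $2/\sqrt 3$.
  Parameters are pairs \<open>(t, \<theta>)\<close>. On \<open>param_dom i\<close> the map \<open>X c i\<close> is a bijection onto the face, except
  that it collapses \<open>t = 0\<close> to the centre of the disk, which is negligible for area. The formulas make
  sense for all real \<open>(t, \<theta>)\<close>, so that derivatives may be taken at every point of \<open>param_dom i\<close>.
\<close>

definition param_dom :: "face \<Rightarrow> (real \<times> real) set" where
  "param_dom i = (case i of Disk \<Rightarrow> {0..1} | _ \<Rightarrow> {0..}) \<times> {0..<2 * pi}"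

definition X :: "real \<Rightarrow> face \<Rightarrow> real \<times> real \<Rightarrow> real^3" where
  "X c i p = (case p of (t, \<theta>) \<Rightarrow> c *\<^sub>R (case i of
      Disk \<Rightarrow> vector [2 * t / sqrt 3 * cos \<theta>, 2 * t / sqrt 3 * sin \<theta>, 0]
    | Upper \<Rightarrow> vector [cosh (t + ln (sqrt 3)) * cos \<theta>, cosh (t + ln (sqrt 3)) * sin \<theta>, t]
    | Lower \<Rightarrow> vector [cosh (t + ln (sqrt 3)) * cos \<theta>, cosh (t + ln (sqrt 3)) * sin \<theta>, - t]))"

text \<open>Partial derivatives: index 1 is the direction of \<open>t\<close>, index 2 that of \<open>\<theta>\<close>.\<close>

definition dir :: "2 \<Rightarrow> real \<times> real" where
  "dir j = (if j = 1 then (1, 0) else (0, 1))"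

definition dX :: "real \<Rightarrow> face \<Rightarrow> 2 \<Rightarrow> real \<times> real \<Rightarrow> real^3" where
  "dX c i j p = frechet_derivative (X c i) (at p) (dir j)"

definition ddX :: "real \<Rightarrow> face \<Rightarrow> 2 \<Rightarrow> 2 \<Rightarrow> real \<times> real \<Rightarrow> real^3" where
  "ddX c i j k p = frechet_derivative (dX c i j) (at p) (dir k)"

definition first_form :: "real \<Rightarrow> face \<Rightarrow> real \<times> real \<Rightarrow> real^2^2" where
  "first_form c i p = (\<chi> j k. dX c i j p \<bullet> dX c i k p)"

text \<open>
  The sign of this unit normal is that of the parametrization. It plays no role below: the normal
  enters only through its line (tangency, tangential projection) and through the square of the second
  fundamental form. The compatible choice of signs of the normals is what makes the admissibility
  condition for normal variations read \<open>\<phi>\<^sub>1 + \<phi>\<^sub>2 + \<phi>\<^sub>3 = 0\<close>.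
\<close>

definition unit_normal :: "real \<Rightarrow> face \<Rightarrow> real \<times> real \<Rightarrow> real^3" where
  "unit_normal c i p = sgn (cross3 (dX c i 1 p) (dX c i 2 p))"

definition second_form :: "real \<Rightarrow> face \<Rightarrow> real \<times> real \<Rightarrow> real^2^2" where
  "second_form c i p = (\<chi> j k. ddX c i j k p \<bullet> unit_normal c i p)"

definition shape_operator :: "real \<Rightarrow> face \<Rightarrow> real \<times> real \<Rightarrow> real^2^2" where
  "shape_operator c i p = matrix_inv (first_form c i p) ** second_form c i p"

definition normA_sq :: "real \<Rightarrow> face \<Rightarrow> real \<times> real \<Rightarrow> real" where
  "normA_sq c i p = trace (shape_operator c i p ** shape_operator c i p)"

text \<open>The area measure of a face, on the parameter domain.\<close>

definition area :: "real \<Rightarrow> face \<Rightarrow> (real \<times> real) measure" where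
  "area c i = density lborel (\<lambda>p. indicator (param_dom i) p * ennreal (sqrt (det (first_form c i p))))"

section \<open>The junction circle\<close>

definition \<gamma> :: "real \<Rightarrow> real \<Rightarrow> real^3" where
  "\<gamma> c \<theta> = X c Disk (1, \<theta>)"

definition \<Gamma> :: "real \<Rightarrow> (real^3) set" where
  "\<Gamma> c = range (\<gamma> c)"

definition d\<gamma> :: "real \<Rightarrow> real \<Rightarrow> real^3" where
  "d\<gamma> c \<theta> = vector_derivative (\<gamma> c) (at \<theta>)"

definition unit_tangent :: "real \<Rightarrow> real \<Rightarrow> real^3" where
  "unit_tangent c \<theta> = sgn (d\<gamma> c \<theta>)"

definition curvature_vector :: "real \<Rightarrow> real \<Rightarrow> real^3" where
  "curvature_vector c \<theta> = vector_derivative (unit_tangent c) (at \<theta>) /\<^sub>R norm (d\<gamma> c \<theta>)"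

definition arclength :: "real \<Rightarrow> real measure" where
  "arclength c = density lborel (\<lambda>\<theta>. indicator {0..<2 * pi} \<theta> * ennreal (norm (d\<gamma> c \<theta>)))"

text \<open>
  The disk reaches \<open>\<Gamma>\<close> at \<open>t = 1\<close>, where increasing \<open>t\<close> points outward; the catenoids start from
  \<open>\<Gamma>\<close> at \<open>t = 0\<close>, where increasing \<open>t\<close> points inward.
\<close>

definition boundary_param :: "face \<Rightarrow> real \<Rightarrow> real \<times> real" where
  "boundary_param i \<theta> = (case i of Disk \<Rightarrow> (1, \<theta>) | _ \<Rightarrow> (0, \<theta>))"

definition outward :: "face \<Rightarrow> real" where
  "outward i = (case i of Disk \<Rightarrow> 1 | _ \<Rightarrow> - 1)"

definition conormal :: "real \<Rightarrow> face \<Rightarrow> real \<Rightarrow> real^3" where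
  "conormal c i \<theta> =
     (let v = outward i *\<^sub>R dX c i 1 (boundary_param i \<theta>); \<tau> = unit_tangent c \<theta>
      in sgn (v - (v \<bullet> \<tau>) *\<^sub>R \<tau>))"

section \<open>Sobolev functions on the faces\<close>

text \<open>
  A function on a face is written in the parameters, as a function of \<open>p \<in> param_dom i\<close>; vector fields along
  a face take values in \<open>real^3\<close>. Test functions and test fields are restrictions to the face of
  functions on \<open>real^3\<close>, and are therefore also regular at the centre of the disk.
\<close>

definition C1 :: "(real^3 \<Rightarrow> 'b::real_normed_vector) \<Rightarrow> bool" where
  "C1 f \<longleftrightarrow> (\<forall>x. f differentiable (at x)) \<and>
     (\<forall>v. continuous_on UNIV (\<lambda>x. frechet_derivative f (at x) v))"

definition surface_gradient :: "real \<Rightarrow> face \<Rightarrow> (real^3 \<Rightarrow> real) \<Rightarrow> real \<times> real \<Rightarrow> real^3" where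
  "surface_gradient c i g p =
     (let G = (\<chi> k. frechet_derivative g (at (X c i p)) (axis k 1)); \<nu> = unit_normal c i p
      in G - (G \<bullet> \<nu>) *\<^sub>R \<nu>)"

definition surface_divergence :: "real \<Rightarrow> face \<Rightarrow> (real^3 \<Rightarrow> real^3) \<Rightarrow> real \<times> real \<Rightarrow> real" where
  "surface_divergence c i Y p =
     (let DY = frechet_derivative Y (at (X c i p)); \<nu> = unit_normal c i p
      in (\<Sum>k\<in>UNIV. DY (axis k 1) \<bullet> axis k 1) - DY \<nu> \<bullet> \<nu>)"

definition interior_tangent_field :: "real \<Rightarrow> face \<Rightarrow> (real^3 \<Rightarrow> real^3) \<Rightarrow> bool" where
  "interior_tangent_field c i Y \<longleftrightarrow>
     C1 Y \<and> compact (closure {x. Y x \<noteq> 0}) \<and> closure {x. Y x \<noteq> 0} \<inter> \<Gamma> c = {} \<and>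
     (\<forall>p\<in>param_dom i. Y (X c i p) \<bullet> unit_normal c i p = 0)"

definition locally_integrable ::
    "real \<Rightarrow> face \<Rightarrow> (real \<times> real \<Rightarrow> 'b::{banach, second_countable_topology}) \<Rightarrow> bool" where
  "locally_integrable c i f \<longleftrightarrow> (\<forall>R. set_integrable (area c i) {p. norm (X c i p) \<le> R} f)"

definition weak_gradient ::
    "real \<Rightarrow> face \<Rightarrow> (real \<times> real \<Rightarrow> real) \<Rightarrow> (real \<times> real \<Rightarrow> real^3) \<Rightarrow> bool" where
  "weak_gradient c i f V \<longleftrightarrow>
     f \<in> borel_measurable borel \<and> V \<in> borel_measurable borel \<and>
     locally_integrable c i f \<and> locally_integrable c i V \<and>
     (AE p in area c i. V p \<bullet> unit_normal c i p = 0) \<and>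
     (\<forall>Y. interior_tangent_field c i Y \<longrightarrow>
        (\<integral>p. f p * surface_divergence c i Y p \<partial>area c i) = - (\<integral>p. V p \<bullet> Y (X c i p) \<partial>area c i))"

definition weakly_differentiable :: "real \<Rightarrow> face \<Rightarrow> (real \<times> real \<Rightarrow> real) \<Rightarrow> bool" where
  "weakly_differentiable c i f \<longleftrightarrow> (\<exists>V. weak_gradient c i f V)"

definition grad :: "real \<Rightarrow> face \<Rightarrow> (real \<times> real \<Rightarrow> real) \<Rightarrow> real \<times> real \<Rightarrow> real^3" where
  "grad c i f = (SOME V. weak_gradient c i f V)"

text \<open>
  Traces are the continuous extension of the restriction to \<open>\<Gamma>\<close> from functions that are \<open>C\<^sup>1\<close> up to the
  boundary to $W^{1,2}$ functions; as the catenoids are unbounded, approximation is on bounded pieces.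
\<close>

definition has_trace ::
    "real \<Rightarrow> face \<Rightarrow> (real \<times> real \<Rightarrow> real) \<Rightarrow> (real \<Rightarrow> real) \<Rightarrow> bool" where
  "has_trace c i f u \<longleftrightarrow>
     u \<in> borel_measurable borel \<and>
     (\<exists>g :: nat \<Rightarrow> real^3 \<Rightarrow> real. (\<forall>n. C1 (g n)) \<and>
        (\<forall>R. (\<lambda>n. \<integral>\<^sup>+ p. indicator {p. norm (X c i p) \<le> R} p *
                 ennreal ((g n (X c i p) - f p)\<^sup>2) \<partial>area c i) \<longlonglongrightarrow> 0) \<and>
        (\<forall>R. (\<lambda>n. \<integral>\<^sup>+ p. indicator {p. norm (X c i p) \<le> R} p *
                 ennreal ((norm (surface_gradient c i (g n) p - grad c i f p))\<^sup>2) \<partial>area c i) \<longlonglongrightarrow> 0) \<and>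
        (\<lambda>n. \<integral>\<^sup>+ \<theta>. ennreal ((g n (\<gamma> c \<theta>) - u \<theta>)\<^sup>2) \<partial>arclength c) \<longlonglongrightarrow> 0)"

definition boundary_trace :: "real \<Rightarrow> face \<Rightarrow> (real \<times> real \<Rightarrow> real) \<Rightarrow> real \<Rightarrow> real" where
  "boundary_trace c i f = (SOME u. has_trace c i f u)"

definition L2 ::
    "real \<Rightarrow> face \<Rightarrow> (real \<times> real \<Rightarrow> 'b::{real_normed_vector, second_countable_topology}) \<Rightarrow> bool" where
  "L2 c i f \<longleftrightarrow> f \<in> borel_measurable borel \<and> (\<integral>\<^sup>+ p. ennreal ((norm (f p))\<^sup>2) \<partial>area c i) < \<infinity>"

text \<open>
  The completion of the compactly supported smooth functions in the weighted norm is the weighted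
  $L^2$ space.
\<close>

definition L2_star :: "real \<Rightarrow> face \<Rightarrow> (real \<times> real \<Rightarrow> real) \<Rightarrow> bool" where
  "L2_star c i f \<longleftrightarrow> f \<in> borel_measurable borel \<and>
     (\<integral>\<^sup>+ p. ennreal ((f p)\<^sup>2 * inverse (1 + (norm (X c i p))\<^sup>2) *
                    inverse ((ln (2 + norm (X c i p)))\<^sup>2)) \<partial>area c i) < \<infinity>"

section \<open>Variations\<close>

text \<open>
  Triples of measurable functions, identified when they agree almost everywhere on each face. Outside
  the centre of the disk the area density is positive on \<open>param_dom i\<close>, so that the null sets of a face are
  the Lebesgue null sets of its parameter domain, whatever the homothety factor.
\<close>

definition same_variation ::
    "(face \<Rightarrow> real \<times> real \<Rightarrow> real) \<Rightarrow> (face \<Rightarrow> real \<times> real \<Rightarrow> real) \<Rightarrow> bool" where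
  "same_variation f g \<longleftrightarrow>
     (\<forall>i. f i \<in> borel_measurable borel \<and> g i \<in> borel_measurable borel \<and>
          (AE p in lborel. p \<in> param_dom i \<longrightarrow> f i p = g i p))"

lemma same_variationI:
  assumes "\<And>i. f i \<in> borel_measurable borel" "\<And>i. g i \<in> borel_measurable borel"
    and "\<And>i. AE p in lborel. p \<in> param_dom i \<longrightarrow> f i p = g i p"
  shows "same_variation f g"
  using assms unfolding same_variation_def by blast

lemma same_variationD:
  assumes "same_variation f g"
  shows "f i \<in> borel_measurable borel" "g i \<in> borel_measurable borel"
    and "AE p in lborel. p \<in> param_dom i \<longrightarrow> f i p = g i p"
  using assms unfolding same_variation_def by blast+

lemma same_variation_refl:
  assumes "\<And>i. f i \<in> borel_measurable borel"
  shows "same_variation f f"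
  using assms by (intro same_variationI) simp_all

lemma part_equivp_same_variation: "part_equivp same_variation"
proof (rule part_equivpI)
  show "\<exists>f. same_variation f f"
    by (rule exI[of _ "\<lambda>_ _. 0"], rule same_variation_refl) simp
  show "symp same_variation"
  proof (rule sympI, rule same_variationI)
    fix f g i assume *: "same_variation f g"
    show "g i \<in> borel_measurable borel" "f i \<in> borel_measurable borel"
      using same_variationD[OF *] by blast+
    show "AE p in lborel. p \<in> param_dom i \<longrightarrow> g i p = f i p"
      using same_variationD(3)[OF *, of i] by eventually_elim simp
  qed
  show "transp same_variation"
  proof (rule transpI, rule same_variationI)
    fix f g h i assume fg: "same_variation f g" and gh: "same_variation g h"
    show "f i \<in> borel_measurable borel" "h i \<in> borel_measurable borel"
      using same_variationD[OF fg] same_variationD[OF gh] by blast+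
    show "AE p in lborel. p \<in> param_dom i \<longrightarrow> f i p = h i p"
      using same_variationD(3)[OF fg, of i] same_variationD(3)[OF gh, of i]
      by eventually_elim simp
  qed
qed

quotient_type variation = "face \<Rightarrow> real \<times> real \<Rightarrow> real" / partial: same_variation
  morphisms rep_variation abs_variation
  by (rule part_equivp_same_variation)

instantiation variation :: real_vector
begin

lift_definition zero_variation :: variation is "\<lambda>_ _. 0"
  by (rule same_variation_refl) simp

lift_definition plus_variation :: "variation \<Rightarrow> variation \<Rightarrow> variation" is "\<lambda>f g i p. f i p + g i p"
proof (rule same_variationI)
  fix f f' g g' i assume A: "same_variation f f'" and B: "same_variation g g'"
  show "(\<lambda>p. f i p + g i p) \<in> borel_measurable borel" "(\<lambda>p. f' i p + g' i p) \<in> borel_measurable borel"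
    using same_variationD[OF A, of i] same_variationD[OF B, of i]
    by (auto intro: borel_measurable_add)
  show "AE p in lborel. p \<in> param_dom i \<longrightarrow> f i p + g i p = f' i p + g' i p"
    using same_variationD(3)[OF A, of i] same_variationD(3)[OF B, of i]
    by eventually_elim simp
qed

lift_definition scaleR_variation :: "real \<Rightarrow> variation \<Rightarrow> variation" is "\<lambda>a f i p. a * f i p"
proof (rule same_variationI)
  fix a f f' i assume A: "same_variation f f'"
  show "(\<lambda>p. a * f i p) \<in> borel_measurable borel" "(\<lambda>p. a * f' i p) \<in> borel_measurable borel"
    using same_variationD[OF A, of i] by (auto intro: borel_measurable_times)
  show "AE p in lborel. p \<in> param_dom i \<longrightarrow> a * f i p = a * f' i p"
    using same_variationD(3)[OF A, of i] by eventually_elim simp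
qed

definition uminus_variation :: "variation \<Rightarrow> variation" where
  "uminus_variation f = (- 1) *\<^sub>R f"

definition minus_variation :: "variation \<Rightarrow> variation \<Rightarrow> variation" where
  "minus_variation f g = f + - g"

instance
proof
  fix a b :: real and f g h :: variation
  show "f + g + h = f + (g + h)"
    by transfer (auto simp: add.assoc intro!: same_variation_refl borel_measurable_add dest: same_variationD)
  show "f + g = g + f"
    by transfer (auto simp: add.commute intro!: same_variation_refl borel_measurable_add dest: same_variationD)
  show "0 + f = f"
    by transfer (auto intro!: same_variation_refl dest: same_variationD)
  show "- f + f = 0"
    unfolding uminus_variation_def
    by transfer (auto intro!: same_variation_refl)
  show "f - g = f + - g"
    by (rule minus_variation_def)
  show "a *\<^sub>R (f + g) = a *\<^sub>R f + a *\<^sub>R g"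
    by transfer (auto simp: distrib_left intro!: same_variation_refl borel_measurable_add
      borel_measurable_times dest: same_variationD)
  show "(a + b) *\<^sub>R f = a *\<^sub>R f + b *\<^sub>R f"
    by transfer (auto simp: distrib_right intro!: same_variation_refl borel_measurable_add
      borel_measurable_times dest: same_variationD)
  show "a *\<^sub>R b *\<^sub>R f = (a * b) *\<^sub>R f"
    by transfer (auto simp: mult.assoc intro!: same_variation_refl
      borel_measurable_times dest: same_variationD)
  show "1 *\<^sub>R f = f"
    by transfer (auto intro!: same_variation_refl dest: same_variationD)
qed

end

definition admissible :: "real \<Rightarrow> variation \<Rightarrow> bool" where
  "admissible c \<phi> \<longleftrightarrow>
     (\<forall>i\<in>faces. weakly_differentiable c i (rep_variation \<phi> i) \<and>
                 (\<exists>u. has_trace c i (rep_variation \<phi> i) u)) \<and>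
     (AE \<theta> in arclength c. (\<Sum>i\<in>faces. boundary_trace c i (rep_variation \<phi> i) \<theta>) = 0)"

definition W12_compact :: "real \<Rightarrow> variation set" where
  "W12_compact c = {\<phi>. admissible c \<phi> \<and>
     (\<forall>i\<in>faces. L2 c i (rep_variation \<phi> i) \<and> L2 c i (grad c i (rep_variation \<phi> i)) \<and>
        (\<exists>R. AE p in area c i. R < norm (X c i p) \<longrightarrow> rep_variation \<phi> i p = 0))}"

definition weighted_space :: "real \<Rightarrow> variation set" where
  "weighted_space c = {\<phi>. admissible c \<phi> \<and>
     (\<forall>i\<in>faces. L2_star c i (rep_variation \<phi> i) \<and> L2 c i (grad c i (rep_variation \<phi> i)))}"

section \<open>Index form, Morse index and nullity\<close>

definition index_form :: "real \<Rightarrow> variation \<Rightarrow> variation \<Rightarrow> real" where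
  "index_form c \<phi> \<psi> = (\<Sum>i\<in>faces.
     let f = rep_variation \<phi> i; g = rep_variation \<psi> i
     in (\<integral>p. grad c i f p \<bullet> grad c i g p - normA_sq c i p * f p * g p \<partial>area c i)
        - (\<integral>\<theta>. (curvature_vector c \<theta> \<bullet> conormal c i \<theta>) *
               boundary_trace c i f \<theta> * boundary_trace c i g \<theta> \<partial>arclength c))"

text \<open>
  \<open>dim\<close> is 0 on infinite-dimensional spaces. This is harmless for the supremum, since the
  finite-dimensional subspaces of a negative space are negative too.
\<close>

definition morse_index :: "real \<Rightarrow> enat" where
  "morse_index c = Sup {enat (dim S) | S. subspace S \<and> S \<subseteq> W12_compact c \<and>
     (\<forall>\<phi>\<in>S. \<phi> \<noteq> 0 \<longrightarrow> index_form c \<phi> \<phi> < 0)}"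

definition null_space :: "real \<Rightarrow> variation set" where
  "null_space c = {\<phi> \<in> weighted_space c. \<forall>\<psi>\<in>weighted_space c. index_form c \<phi> \<psi> = 0}"

text \<open>Again a nonzero value of \<open>dim\<close> can only be that of a finite-dimensional space.\<close>

definition nullity :: "real \<Rightarrow> nat" where
  "nullity c = dim (null_space c)"

end

theory Submission imports Defs "HOL-Real_Asymp.Real_Asymp" begin

text \<open>
  In the parameters each catenoid is the half cylinder \<open>t \<ge> 0\<close> with potential \<open>2 sech\<^sup>2\<close>, shifted by \<open>ln \<surd>3\<close>,
  and its part of the form is that potential form minus half of the integral of \<open>u\<^sup>2\<close>, where \<open>u\<close> is the trace.
  The \<open>\<theta>\<close>-mean of a function is compared with the Jacobi function \<open>tanh\<close>, the rest with \<open>sech\<close>; completing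
  squares and Wirtinger's inequality in \<open>\<theta>\<close> leave nonnegative terms and \<open>- (\<integral>u)\<^sup>2 / \<pi>\<close>. On the disk the boundary
  term has the opposite sign, and as the three traces add up to zero it pays for both deficits as soon as the traces on
  the catenoids have the same integral. So the form is nonnegative on a hyperplane, and the
  index is at most one; opposite tents on the two catenoids show that it is one.

  Pairing with the field that is \<open>\<plusminus> tanh\<close> on the catenoids and \<open>0\<close> on the disk puts every null field in this hyperplane.
  There all the squares vanish, so that the field is the normal part of a translation.
\<close>

section \<open>Square-integrable functions and limits\<close>

text \<open>The constants fit because of the 120 degree angle: it puts the circle at
  \<open>th 0 = 1/2\<close>. There \<open>se\<close> and \<open>th\<close> have logarithmic
  derivatives -1/2 and 3/2. The boundary term has coefficient 1/2, so the first leaves no deficit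
  for the part of mean zero, and the second leaves (3/2 + 1/2) times the integral of the squared
  mean of u, which is (\<integral>u)^2 / \<pi>. The obstacle is the generality of the fields:
  \<open>grad\<close> and \<open>boundary_trace\<close> are chosen among objects given by test
  fields and approximations in \<open>real^3\<close>, on faces that are unbounded or have a
  degenerate parameter at the centre. The approximations required by \<open>has_trace\<close> carry
  the identities in the parameters over from smooth functions. Test fields serve to identify the
  weak gradient, through uniqueness and a divergence theorem that rests on minimality. No Fourier
  series occur: Wirtinger's inequality is proved with a Riccati equation, and its case of equality
  through its first variation.\<close>

definition sqi :: "'a measure \<Rightarrow> ('a \<Rightarrow> real) \<Rightarrow> bool" where
  "sqi M f \<longleftrightarrow> f \<in> borel_measurable M \<and> integrable M (\<lambda>x. (f x)^2)"

lemma sqiD: assumes "sqi M f" shows "f \<in> borel_measurable M" "integrable M (\<lambda>x. (f x)^2)"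
  using assms by (auto simp: sqi_def)

lemma sqi_mult_integrable:
  assumes "sqi M f" "sqi M g"
  shows "integrable M (\<lambda>x. f x * g x)"
proof (rule Bochner_Integration.integrable_bound[of M "\<lambda>x. (f x)^2 + (g x)^2"])
  show "integrable M (\<lambda>x. (f x)^2 + (g x)^2)" using assms by (auto dest: sqiD)
  show "(\<lambda>x. f x * g x) \<in> borel_measurable M" using assms by (auto simp: sqi_def)
  have "\<bar>f x * g x\<bar> \<le> (f x)^2 + (g x)^2" for x
    using sum_squares_bound[of "\<bar>f x\<bar>" "\<bar>g x\<bar>"] abs_ge_zero[of "f x * g x"]
    unfolding abs_mult power2_abs by linarith
  then show "AE x in M. norm (f x * g x) \<le> norm ((f x)^2 + (g x)^2)" by simp
qed

lemma sqi_add: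
  assumes "sqi M f" "sqi M g"
  shows "sqi M (\<lambda>x. f x + g x)"
proof -
  have "(\<lambda>x. (f x + g x)^2) = (\<lambda>x. (f x)^2 + (g x)^2 + 2 * (f x * g x))"
    by (auto simp: power2_eq_square algebra_simps)
  then show ?thesis
    using assms sqi_mult_integrable[OF assms] by (auto simp: sqi_def)
qed

lemma sqi_bounded_mult:
  assumes "sqi M f" "b \<in> borel_measurable M" "AE x in M. \<bar>b x\<bar> \<le> B"
  shows "sqi M (\<lambda>x. b x * f x)"
proof -
  have "integrable M (\<lambda>x. (b x * f x)^2)"
  proof (rule Bochner_Integration.integrable_bound[of M "\<lambda>x. B^2 * (f x)^2"])
    show "AE x in M. norm ((b x * f x)^2) \<le> norm (B^2 * (f x)^2)"
      using assms(3)
    proof eventually_elim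
      case (elim x)
      then have "(b x)^2 \<le> B^2" using abs_le_square_iff[of "b x" B] by linarith
      then show ?case by (simp add: power_mult_distrib mult_right_mono)
    qed
  qed (use assms in \<open>auto dest: sqiD\<close>)
  then show ?thesis using assms by (auto simp: sqi_def)
qed

lemma sqi_scale: "sqi M f \<Longrightarrow> sqi M (\<lambda>x. a * f x)"
  by (rule sqi_bounded_mult[where B = "\<bar>a\<bar>"]) auto

lemma sqi_diff: "sqi M f \<Longrightarrow> sqi M g \<Longrightarrow> sqi M (\<lambda>x. f x - g x)"
  using sqi_add[of M f "\<lambda>x. -1 * g x"] sqi_scale[of M g "-1"] by simp

lemma sqi_zero [simp]: "sqi M (\<lambda>x. 0)" by (simp add: sqi_def)

lemma sqi_bounded:
  assumes "finite_measure M" "f \<in> borel_measurable M" "AE x in M. \<bar>f x\<bar> \<le> B"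
  shows "sqi M f"
proof -
  have "sqi M (\<lambda>x. 1)" using assms(1) by (simp add: sqi_def finite_measure.integrable_const)
  from sqi_bounded_mult[OF this assms(2,3)] show ?thesis by simp
qed

lemma sqi_integrable:
  assumes "finite_measure M" "sqi M f" shows "integrable M f"
  using sqi_mult_integrable[OF assms(2) sqi_bounded[OF assms(1), of "\<lambda>_. 1" 1]] by simp

lemma tendsto_0_dominated:
  fixes a b :: "nat \<Rightarrow> real"
  assumes "\<And>n. 0 \<le> a n" "\<And>n. a n \<le> b n" "b \<longlonglongrightarrow> 0"
  shows "a \<longlonglongrightarrow> 0"
  by (rule tendsto_sandwich[of "\<lambda>_. 0" a _ b]) (use assms in auto)

lemma integral_Cauchy_Schwarz:
  assumes "sqi M f" "sqi M g"
  shows "(\<integral>x. f x * g x \<partial>M)^2 \<le> (\<integral>x. (f x)^2 \<partial>M) * (\<integral>x. (g x)^2 \<partial>M)"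
proof -
  let ?a = "\<integral>x. (f x)^2 \<partial>M" and ?b = "\<integral>x. f x * g x \<partial>M" and ?c = "\<integral>x. (g x)^2 \<partial>M"
  have int: "integrable M (\<lambda>x. (f x)^2)" "integrable M (\<lambda>x. (g x)^2)" "integrable M (\<lambda>x. f x * g x)"
    using assms sqi_mult_integrable by (auto dest: sqiD)
  have q: "0 \<le> s^2 * ?a + 2 * s * r * ?b + r^2 * ?c" for s r
  proof -
    have "0 \<le> (\<integral>x. (s * f x + r * g x)^2 \<partial>M)" by simp
    also have "(\<lambda>x. (s * f x + r * g x)^2) = (\<lambda>x. s^2 * (f x)^2 + 2 * s * r * (f x * g x) + r^2 * (g x)^2)"
      by (auto simp: power2_eq_square algebra_simps)
    also have "(\<integral>x. \<dots> x \<partial>M) = s^2 * ?a + 2 * s * r * ?b + r^2 * ?c"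
      using int by simp
    finally show ?thesis .
  qed
  have a0: "0 \<le> ?a" by simp
  show ?thesis
  proof (cases "?a = 0")
    case True
    have "?b = 0"
    proof (rule ccontr)
      assume "?b \<noteq> 0"
      \<comment> \<open>With \<open>?a = 0\<close> the form is affine in s; this s makes it at most
        -1 at r = 1.\<close>
      define s where "s = - (?c + 1) / (2 * ?b)"
      have "2 * s * ?b = - (?c + 1)" using \<open>?b \<noteq> 0\<close> by (simp add: s_def field_simps)
      then have "0 \<le> - (?c + 1) + ?c"
        using q[of s 1] True by simp
      then show False by simp
    qed
    then show ?thesis using True by simp
  next
    case False
    then have "0 < ?a" using a0 by linarith
    have "?b^2 * ?a - 2 * ?a * ?b^2 + ?a^2 * ?c \<ge> 0"
      using q[of "- ?b" ?a] by (simp add: power2_eq_square algebra_simps)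
    then have "0 \<le> ?a * (?a * ?c - ?b^2)" by (simp add: power2_eq_square algebra_simps)
    then show ?thesis using \<open>0 < ?a\<close> by (simp add: zero_le_mult_iff)
  qed
qed

definition l2lim :: "'a measure \<Rightarrow> (nat \<Rightarrow> 'a \<Rightarrow> real) \<Rightarrow> ('a \<Rightarrow> real) \<Rightarrow> bool" where
  "l2lim M F f \<longleftrightarrow> (\<forall>n. sqi M (F n)) \<and> sqi M f \<and> (\<lambda>n. \<integral>x. (F n x - f x)^2 \<partial>M) \<longlonglongrightarrow> 0"

lemma l2limD:
  assumes "l2lim M F f"
  shows "sqi M (F n)" "sqi M f" "(\<lambda>n. \<integral>x. (F n x - f x)^2 \<partial>M) \<longlonglongrightarrow> 0"
  using assms by (auto simp: l2lim_def)

lemma l2lim_const: "sqi M f \<Longrightarrow> l2lim M (\<lambda>_. f) f"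
  by (simp add: l2lim_def)

lemma l2lim_bounded_mult:
  assumes "l2lim M F f" "b \<in> borel_measurable M" "AE x in M. \<bar>b x\<bar> \<le> B"
  shows "l2lim M (\<lambda>n x. b x * F n x) (\<lambda>x. b x * f x)"
proof -
  have 1: "(\<integral>x. (b x * F n x - b x * f x)^2 \<partial>M) \<le> B^2 * (\<integral>x. (F n x - f x)^2 \<partial>M)" for n
  proof -
    have d: "sqi M (\<lambda>x. F n x - f x)" using l2limD[OF assms(1)] by (intro sqi_diff)
    have "(\<integral>x. (b x * (F n x - f x))^2 \<partial>M) \<le> (\<integral>x. B^2 * (F n x - f x)^2 \<partial>M)"
    proof (rule integral_mono_AE)
      show "integrable M (\<lambda>x. (b x * (F n x - f x))^2)"
        using sqi_bounded_mult[OF d assms(2,3)] by (rule sqiD)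
      show "integrable M (\<lambda>x. B^2 * (F n x - f x)^2)" using d by (auto dest: sqiD)
      show "AE x in M. (b x * (F n x - f x))^2 \<le> B^2 * (F n x - f x)^2"
        using assms(3)
      proof eventually_elim
        case (elim x)
        then have "(b x)^2 \<le> B^2" using abs_le_square_iff[of "b x" B] by linarith
        then show ?case by (simp add: power_mult_distrib mult_right_mono)
      qed
    qed
    then show ?thesis by (simp add: right_diff_distrib)
  qed
  have "(\<lambda>n. B^2 * (\<integral>x. (F n x - f x)^2 \<partial>M)) \<longlonglongrightarrow> B^2 * 0"
    using l2limD[OF assms(1)] by (intro tendsto_intros)
  then have "(\<lambda>n. \<integral>x. (b x * F n x - b x * f x)^2 \<partial>M) \<longlonglongrightarrow> 0"
    by (intro tendsto_0_dominated[OF _ 1]) simp_all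
  then show ?thesis using sqi_bounded_mult[OF _ assms(2,3)] l2limD[OF assms(1)] unfolding l2lim_def by blast
qed

lemma l2lim_scale: "l2lim M F f \<Longrightarrow> l2lim M (\<lambda>n x. a * F n x) (\<lambda>x. a * f x)"
  by (rule l2lim_bounded_mult[where B = "\<bar>a\<bar>"]) auto

lemma l2lim_add:
  assumes "l2lim M F f" "l2lim M H h"
  shows "l2lim M (\<lambda>n x. F n x + H n x) (\<lambda>x. f x + h x)"
proof -
  note A = l2limD[OF assms(1)] and B = l2limD[OF assms(2)]
  have 1: "(\<integral>x. (F n x + H n x - (f x + h x))^2 \<partial>M)
    \<le> 2 * (\<integral>x. (F n x - f x)^2 \<partial>M) + 2 * (\<integral>x. (H n x - h x)^2 \<partial>M)" for n
  proof -
    have d: "sqi M (\<lambda>x. F n x - f x)" "sqi M (\<lambda>x. H n x - h x)" using A B by (auto intro: sqi_diff)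
    have s: "sqi M (\<lambda>x. F n x + H n x - (f x + h x))"
      by (rule sqi_diff[OF sqi_add[OF A(1) B(1)] sqi_add[OF A(2) B(2)]])
    have "(\<integral>x. (F n x + H n x - (f x + h x))^2 \<partial>M) \<le> (\<integral>x. 2 * (F n x - f x)^2 + 2 * (H n x - h x)^2 \<partial>M)"
    proof (rule integral_mono)
      fix x
      have "2 * (F n x - f x)^2 + 2 * (H n x - h x)^2 - (F n x + H n x - (f x + h x))^2
        = (F n x - f x - (H n x - h x))^2" by (simp add: power2_eq_square algebra_simps)
      then show "(F n x + H n x - (f x + h x))^2 \<le> 2 * (F n x - f x)^2 + 2 * (H n x - h x)^2"
        by (smt (verit) zero_le_power2)
    qed (use d s in \<open>auto simp: sqi_def\<close>)
    also have "\<dots> = 2 * (\<integral>x. (F n x - f x)^2 \<partial>M) + 2 * (\<integral>x. (H n x - h x)^2 \<partial>M)"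
      using d by (simp add: sqi_def)
    finally show ?thesis .
  qed
  have "(\<lambda>n. 2 * (\<integral>x. (F n x - f x)^2 \<partial>M) + 2 * (\<integral>x. (H n x - h x)^2 \<partial>M)) \<longlonglongrightarrow> 2 * 0 + 2 * 0"
    using A B by (intro tendsto_intros)
  then have "(\<lambda>n. \<integral>x. (F n x + H n x - (f x + h x))^2 \<partial>M) \<longlonglongrightarrow> 0"
    by (intro tendsto_0_dominated[OF _ 1]) simp_all
  then show ?thesis using A B unfolding l2lim_def by (blast intro: sqi_add)
qed

lemma l2lim_diff: "l2lim M F f \<Longrightarrow> l2lim M H h \<Longrightarrow> l2lim M (\<lambda>n x. F n x - H n x) (\<lambda>x. f x - h x)"
  using l2lim_add[of M F f "\<lambda>n x. -1 * H n x" "\<lambda>x. -1 * h x"] l2lim_scale[of M H h "-1"] by simp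

text \<open>Every term of the forms below is an inner product of two factors in L2, so this one
  limit carries identities from smooth functions to weak ones.\<close>

lemma l2lim_inner:
  assumes "l2lim M F f" "l2lim M H h"
  shows "(\<lambda>n. \<integral>x. F n x * H n x \<partial>M) \<longlonglongrightarrow> (\<integral>x. f x * h x \<partial>M)"
proof -
  note A = l2limD[OF assms(1)] and B = l2limD[OF assms(2)]
  have z: "(\<lambda>n. \<integral>x. P n x * R n x \<partial>M) \<longlonglongrightarrow> 0"
    if P: "\<And>n. sqi M (P n)" "\<And>n. sqi M (R n)"
      and l: "(\<lambda>n. (\<integral>x. (P n x)^2 \<partial>M) * (\<integral>x. (R n x)^2 \<partial>M)) \<longlonglongrightarrow> 0" for P R
  proof -
    have "(\<lambda>n. (\<integral>x. P n x * R n x \<partial>M)^2) \<longlonglongrightarrow> 0"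
      by (rule tendsto_0_dominated[OF _ integral_Cauchy_Schwarz[OF P] l]) simp
    then show ?thesis by simp
  qed
  have d: "sqi M (\<lambda>x. F n x - f x)" "sqi M (\<lambda>x. H n x - h x)" for n using A B by (auto intro: sqi_diff)
  have 1: "(\<lambda>n. \<integral>x. (F n x - f x) * (H n x - h x) \<partial>M) \<longlonglongrightarrow> 0"
    by (rule z[OF d]) (use A(3) B(3) in \<open>auto intro: tendsto_mult_zero\<close>)
  have 2: "(\<lambda>n. \<integral>x. (F n x - f x) * h x \<partial>M) \<longlonglongrightarrow> 0"
    by (rule z[OF d(1) B(2)]) (use A(3) in \<open>auto intro: tendsto_mult_left_zero\<close>)
  have 3: "(\<lambda>n. \<integral>x. (H n x - h x) * f x \<partial>M) \<longlonglongrightarrow> 0"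
    by (rule z[OF d(2) A(2)]) (use B(3) in \<open>auto intro: tendsto_mult_left_zero\<close>)
  have eq: "(\<integral>x. F n x * H n x \<partial>M) = (\<integral>x. (F n x - f x) * (H n x - h x) \<partial>M)
     + (\<integral>x. (F n x - f x) * h x \<partial>M) + (\<integral>x. (H n x - h x) * f x \<partial>M) + (\<integral>x. f x * h x \<partial>M)" for n
  proof -
    have "(\<lambda>x. F n x * H n x) = (\<lambda>x. (F n x - f x) * (H n x - h x) + (F n x - f x) * h x + (H n x - h x) * f x + f x * h x)"
      by (auto simp: algebra_simps)
    moreover have "integrable M (\<lambda>x. (F n x - f x) * (H n x - h x))" "integrable M (\<lambda>x. (F n x - f x) * h x)"
      "integrable M (\<lambda>x. (H n x - h x) * f x)" "integrable M (\<lambda>x. f x * h x)"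
      using d A B by (auto intro: sqi_mult_integrable)
    ultimately show ?thesis by simp
  qed
  have "(\<lambda>n. (\<integral>x. (F n x - f x) * (H n x - h x) \<partial>M) + (\<integral>x. (F n x - f x) * h x \<partial>M)
      + (\<integral>x. (H n x - h x) * f x \<partial>M) + (\<integral>x. f x * h x \<partial>M)) \<longlonglongrightarrow> 0 + 0 + 0 + (\<integral>x. f x * h x \<partial>M)"
    by (intro tendsto_add 1 2 3 tendsto_const)
  then show ?thesis unfolding eq by simp
qed

text \<open>The integrals may be infinite for finitely many n, so only a tail of the sequence
  converges in the sense of \<open>l2lim\<close>. From the first index with finite integrals on, the
  differences are square integrable, and so is f as the difference of F N and F N - f.\<close>

lemma l2lim_from_nn:
  assumes F: "\<And>n. sqi M (F n)" and f: "f \<in> borel_measurable M"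
    and l: "(\<lambda>n. \<integral>\<^sup>+x. ennreal ((F n x - f x)^2) \<partial>M) \<longlonglongrightarrow> 0"
  shows "\<exists>N. l2lim M (\<lambda>n. F (n + N)) f"
proof -
  have "eventually (\<lambda>n. (\<integral>\<^sup>+x. ennreal ((F n x - f x)^2) \<partial>M) < 1) sequentially"
    using l by (rule order_tendstoD) simp
  then obtain N where N: "\<And>n. n \<ge> N \<Longrightarrow> (\<integral>\<^sup>+x. ennreal ((F n x - f x)^2) \<partial>M) < 1"
    by (auto simp: eventually_sequentially)
  have d: "sqi M (\<lambda>x. F (n + N) x - f x)" for n
  proof -
    have "(\<integral>\<^sup>+x. ennreal ((F (n + N) x - f x)^2) \<partial>M) < \<infinity>"
      using N[of "n + N"] by (simp add: order_less_trans[OF _ ennreal_one_less_top])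
    then show ?thesis using f F[of "n + N"] unfolding sqi_def
      by (auto intro!: integrableI_bounded simp: )
  qed
  have sf: "sqi M f" using sqi_diff[OF F[of "0 + N"] d[of 0]] by simp
  have "(\<lambda>n. \<integral>\<^sup>+x. ennreal ((F (n + N) x - f x)^2) \<partial>M) \<longlonglongrightarrow> 0"
    using l by (rule LIMSEQ_ignore_initial_segment)
  moreover have "(\<integral>\<^sup>+x. ennreal ((F (n + N) x - f x)^2) \<partial>M) = ennreal (\<integral>x. (F (n + N) x - f x)^2 \<partial>M)" for n
    using d by (intro nn_integral_eq_integral) (auto dest: sqiD)
  ultimately have "(\<lambda>n. ennreal (\<integral>x. (F (n + N) x - f x)^2 \<partial>M)) \<longlonglongrightarrow> ennreal 0" by simp
  then have "(\<lambda>n. \<integral>x. (F (n + N) x - f x)^2 \<partial>M) \<longlonglongrightarrow> 0"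
    by (subst (asm) tendsto_ennreal_iff) auto
  then show ?thesis using F sf unfolding l2lim_def by blast
qed

section \<open>Sobolev functions on a cylinder\<close>

text \<open>A density on the whole line instead of a restricted space: all measures built from it
  have the Borel sets of the full space, so measurability does not depend on the interval.\<close>

definition lbI :: "real set \<Rightarrow> real measure" where
  "lbI I = density lborel (indicator I)"

definition circ :: "real measure" where "circ = lbI {0..<2 * pi}"

definition cyl :: "real set \<Rightarrow> (real \<times> real) measure" where
  "cyl I = lbI I \<Otimes>\<^sub>M circ"

lemma sets_lbI [simp, measurable_cong]: "sets (lbI I) = sets borel"
  and space_lbI [simp]: "space (lbI I) = UNIV"
  by (simp_all add: lbI_def)

lemma sets_circ [simp, measurable_cong]: "sets circ = sets borel"
  and space_circ [simp]: "space circ = UNIV"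
  by (simp_all add: circ_def)

lemma sets_cyl [simp, measurable_cong]: "sets (cyl I) = sets borel"
proof -
  have "sets (cyl I) = sets (borel \<Otimes>\<^sub>M (borel :: real measure))"
    unfolding cyl_def by (intro sets_pair_measure_cong) auto
  then show ?thesis by (simp only: borel_prod)
qed

lemma space_cyl [simp]: "space (cyl I) = UNIV"
  by (simp add: cyl_def space_pair_measure)

lemma measurable_cyl [simp]: "measurable (cyl I) N = measurable borel N"
  by (rule measurable_cong_sets) auto

lemma measurable_circ [simp]: "measurable circ N = measurable borel N"
  by (rule measurable_cong_sets) auto

lemma measurable_lbI [simp]: "measurable (lbI I) N = measurable borel N"
  by (rule measurable_cong_sets) auto

lemma sigma_finite_lbI: "I \<in> sets borel \<Longrightarrow> sigma_finite_measure (lbI I)"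
  unfolding lbI_def by (subst sigma_finite_measure.sigma_finite_iff_density_finite[OF sigma_finite_lborel]) (auto simp: indicator_def)

lemma sigma_finite_circ: "sigma_finite_measure circ"
  unfolding circ_def by (rule sigma_finite_lbI) simp

lemma pair_sigma_finite_cyl: "I \<in> sets borel \<Longrightarrow> pair_sigma_finite (lbI I) circ"
  by (simp add: pair_sigma_finite_def sigma_finite_lbI sigma_finite_circ)

lemma cyl_eq: assumes "I \<in> sets borel"
  shows "cyl I = density lborel (indicator (I \<times> {0..<2 * pi}))"
proof -
  have "cyl I = density (lborel \<Otimes>\<^sub>M lborel) (\<lambda>(x, y). indicator I x * indicator {0..<2 * pi} y)"
    unfolding cyl_def circ_def lbI_def
    by (rule pair_measure_density)
      (use assms sigma_finite_circ in \<open>auto simp: circ_def lbI_def lborel.sigma_finite_measure_axioms\<close>)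
  also have "\<dots> = density lborel (indicator (I \<times> {0..<2 * pi}))"
    by (intro arg_cong2[where f = density]) (auto simp: lborel_prod indicator_def)
  finally show ?thesis .
qed

lemma AE_lbI: "I \<in> sets borel \<Longrightarrow> (AE t in lbI I. P t) \<longleftrightarrow> (AE t in lborel. t \<in> I \<longrightarrow> P t)"
  unfolding lbI_def by (subst AE_density) (auto simp: indicator_def)

lemma AE_circ: "(AE t in circ. P t) \<longleftrightarrow> (AE t in lborel. t \<in> {0..<2 * pi} \<longrightarrow> P t)"
  unfolding circ_def by (rule AE_lbI) simp

lemma AE_cyl: "I \<in> sets borel \<Longrightarrow> (AE p in cyl I. P p) \<longleftrightarrow> (AE p in lborel. p \<in> I \<times> {0..<2 * pi} \<longrightarrow> P p)"
  unfolding cyl_eq by (subst AE_density) (auto simp: indicator_def intro!: borel_measurable_indicator borel_Times)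

lemma AE_cyl_fst_in: "I \<in> sets borel \<Longrightarrow> AE p in cyl I. fst p \<in> I"
  by (subst AE_cyl) auto

lemma AE_cyl_fst:
  assumes "I \<in> sets borel" "AE t in lbI I. P t"
  shows "AE p in cyl I. P (fst p)"
proof -
  interpret pair_sigma_finite "lbI I" circ by (rule pair_sigma_finite_cyl[OF assms(1)])
  obtain N where N: "{t. \<not> P t} \<subseteq> N" "emeasure (lbI I) N = 0" "N \<in> sets borel"
    using assms(2) by (auto elim!: AE_E)
  have "emeasure (cyl I) (N \<times> UNIV) = 0"
    unfolding cyl_def using N by (subst M2.emeasure_pair_measure_Times) auto
  moreover have "N \<times> UNIV \<in> sets (cyl I)" unfolding sets_cyl using N by (auto intro: borel_Times)
  ultimately show ?thesis using N by (intro AE_I[of _ _ "N \<times> UNIV"]) auto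
qed

lemma AE_cyl_snd:
  assumes "I \<in> sets borel" "AE \<theta> in circ. P \<theta>"
  shows "AE p in cyl I. P (snd p)"
proof -
  interpret pair_sigma_finite "lbI I" circ by (rule pair_sigma_finite_cyl[OF assms(1)])
  obtain N where N: "{t. \<not> P t} \<subseteq> N" "emeasure circ N = 0" "N \<in> sets borel"
    using assms(2) by (auto elim!: AE_E)
  have "emeasure (cyl I) (UNIV \<times> N) = 0"
    unfolding cyl_def using N by (subst M2.emeasure_pair_measure_Times) auto
  moreover have "UNIV \<times> N \<in> sets (cyl I)" unfolding sets_cyl using N by (auto intro: borel_Times)
  ultimately show ?thesis using N by (intro AE_I[of _ _ "UNIV \<times> N"]) auto
qed

lemma finite_lbI: "finite_measure (lbI {a..b})"
  by (rule finite_measureI) (simp add: lbI_def emeasure_density, simp add: emeasure_lborel_Icc_eq)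

lemma finite_circ: "finite_measure circ"
  by (rule finite_measureI) (simp add: lbI_def circ_def emeasure_density)

lemma emeasure_circ: "emeasure circ UNIV = ennreal (2 * pi)"
  by (simp add: lbI_def circ_def emeasure_density)

lemma integral_circ_const [simp]: "(\<integral>\<theta>. k \<partial>circ) = 2 * pi * (k::real)"
  by (simp add: measure_def emeasure_circ)

lemma finite_cyl: "finite_measure (cyl {a..b})"
proof -
  interpret pair_sigma_finite "lbI {a..b}" circ by (rule pair_sigma_finite_cyl) simp
  interpret A: finite_measure "lbI {a..b}" by (rule finite_lbI)
  interpret B: finite_measure circ by (rule finite_circ)
  have "emeasure (cyl {a..b}) (UNIV \<times> UNIV) = emeasure (lbI {a..b}) UNIV * emeasure circ UNIV"
    unfolding cyl_def by (rule M2.emeasure_pair_measure_Times) auto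
  also have "\<dots> < \<infinity>"
    using A.emeasure_finite[of UNIV] B.emeasure_finite[of UNIV]
    by (auto simp: ennreal_mult_eq_top_iff less_top[symmetric])
  finally show ?thesis by (intro finite_measureI) auto
qed

lemma integrable_lbI: "I \<in> sets borel \<Longrightarrow> f \<in> borel_measurable borel \<Longrightarrow>
    integrable (lbI I) f \<longleftrightarrow> integrable lborel (\<lambda>t. indicator I t * (f t :: real))"
  unfolding lbI_def by (subst integrable_density[where g = "indicator I", simplified ennreal_indicator]) auto

lemma integral_lbI: "I \<in> sets borel \<Longrightarrow> f \<in> borel_measurable borel \<Longrightarrow>
    (\<integral>t. f t \<partial>lbI I) = (\<integral>t. indicator I t * (f t :: real) \<partial>lborel)"
  unfolding lbI_def by (subst integral_density[where g = "indicator I", simplified ennreal_indicator]) auto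

lemma integrable_cyl: "I \<in> sets borel \<Longrightarrow> f \<in> borel_measurable borel \<Longrightarrow>
    integrable (cyl I) f \<longleftrightarrow> integrable lborel (\<lambda>p. indicator (I \<times> {0..<2*pi}) p * (f p :: real))"
  unfolding cyl_eq by (subst integrable_density[where g = "indicator (I \<times> {0..<2*pi})", simplified ennreal_indicator])
    (auto intro!: borel_measurable_indicator borel_Times)

lemma integral_cyl: "I \<in> sets borel \<Longrightarrow> f \<in> borel_measurable borel \<Longrightarrow>
    (\<integral>p. f p \<partial>cyl I) = (\<integral>p. indicator (I \<times> {0..<2*pi}) p * (f p :: real) \<partial>lborel)"
  unfolding cyl_eq by (subst integral_density[where g = "indicator (I \<times> {0..<2*pi})", simplified ennreal_indicator])
    (auto intro!: borel_measurable_indicator borel_Times)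

lemma integrable_cyl_subset:
  assumes "I \<in> sets borel" "J \<in> sets borel" "I \<subseteq> J" "f \<in> borel_measurable borel"
  shows "integrable (cyl I) f \<longleftrightarrow> integrable (cyl J) (\<lambda>p. indicator I (fst p) * (f p :: real))"
    and "(\<integral>p. f p \<partial>cyl I) = (\<integral>p. indicator I (fst p) * (f p :: real) \<partial>cyl J)"
proof -
  have m: "(\<lambda>p. indicator I (fst p) * f p) \<in> borel_measurable borel" using assms(1,4)
    by (intro borel_measurable_times) (auto simp: borel_prod[symmetric])
  have "(\<lambda>p. indicator (I \<times> {0..<2*pi}) p * f p) = (\<lambda>p. indicator (J \<times> {0..<2*pi}) p * (indicator I (fst p) * f p))"
    using assms(3) by (auto simp: indicator_def fun_eq_iff)
  then show "integrable (cyl I) f \<longleftrightarrow> integrable (cyl J) (\<lambda>p. indicator I (fst p) * (f p :: real))"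
    "(\<integral>p. f p \<partial>cyl I) = (\<integral>p. indicator I (fst p) * (f p :: real) \<partial>cyl J)"
    using assms m by (simp_all add: integrable_cyl integral_cyl)
qed

lemma integrable_cyl_mono:
  assumes "I \<in> sets borel" "J \<in> sets borel" "I \<subseteq> J" "integrable (cyl J) f"
  shows "integrable (cyl I) (f :: _ \<Rightarrow> real)"
proof -
  have m: "f \<in> borel_measurable borel" using borel_measurable_integrable[OF assms(4)] by simp
  have mi: "(\<lambda>p. indicator I (fst p) * f p) \<in> borel_measurable borel" using assms(1) m
    by (intro borel_measurable_times) (auto simp: borel_prod[symmetric])
  have "integrable (cyl J) (\<lambda>p. indicator I (fst p) * f p)"
    by (rule Bochner_Integration.integrable_bound[OF assms(4)]) (use mi in \<open>auto simp: indicator_def\<close>)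
  then show ?thesis using integrable_cyl_subset(1)[OF assms(1-3) m] by simp
qed

lemma Fubini_cyl:
  assumes "I \<in> sets borel" "integrable (cyl I) f"
  shows "(\<integral>p. f p \<partial>cyl I) = (\<integral>\<theta>. \<integral>t. f (t, \<theta>) \<partial>lbI I \<partial>circ)"
    and "(\<integral>p. f p \<partial>cyl I) = (\<integral>t. \<integral>\<theta>. (f (t, \<theta>) :: real) \<partial>circ \<partial>lbI I)"
    and "integrable (lbI I) (\<lambda>t. \<integral>\<theta>. f (t, \<theta>) \<partial>circ)"
    and "AE t in lbI I. integrable circ (\<lambda>\<theta>. f (t, \<theta>))"
    and "AE \<theta> in circ. integrable (lbI I) (\<lambda>t. f (t, \<theta>))"
    and "integrable circ (\<lambda>\<theta>. \<integral>t. f (t, \<theta>) \<partial>lbI I)"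
proof -
  interpret pair_sigma_finite "lbI I" circ by (rule pair_sigma_finite_cyl[OF assms(1)])
  have i: "integrable (lbI I \<Otimes>\<^sub>M circ) (\<lambda>(t, \<theta>). f (t, \<theta>))" using assms(2) by (simp add: cyl_def)
  show "(\<integral>p. f p \<partial>cyl I) = (\<integral>\<theta>. \<integral>t. f (t, \<theta>) \<partial>lbI I \<partial>circ)"
    using integral_snd[OF i] by (simp add: cyl_def)
  show "(\<integral>p. f p \<partial>cyl I) = (\<integral>t. \<integral>\<theta>. f (t, \<theta>) \<partial>circ \<partial>lbI I)"
    using integral_fst[OF i] by (simp add: cyl_def)
  show "integrable (lbI I) (\<lambda>t. \<integral>\<theta>. f (t, \<theta>) \<partial>circ)"
    using integrable_fst[OF i] by simp
  show "AE t in lbI I. integrable circ (\<lambda>\<theta>. f (t, \<theta>))"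
    using AE_integrable_fst[OF i] by simp
  show "AE \<theta> in circ. integrable (lbI I) (\<lambda>t. f (t, \<theta>))"
    using AE_integrable_snd[OF i] by simp
  show "integrable circ (\<lambda>\<theta>. \<integral>t. f (t, \<theta>) \<partial>lbI I)"
    using integrable_snd[OF i] by simp
qed

lemma integral_lbI_FTC:
  assumes "a \<le> b" "\<And>t. t \<in> {a..b} \<Longrightarrow> (F has_real_derivative f t) (at t within {a..b})"
    "continuous_on {a..b} f" "f \<in> borel_measurable borel"
  shows "(\<integral>t. f t \<partial>lbI {a..b}) = F b - F a"
proof -
  have "(\<integral>t. indicator {a..b} t *\<^sub>R f t \<partial>lborel) = F b - F a"
    by (rule integral_FTC_atLeastAtMost)
      (use assms in \<open>auto simp: has_real_derivative_iff_has_vector_derivative[symmetric]\<close>)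
  then show ?thesis using assms(4) by (simp add: integral_lbI)
qed

lemma measurable_fst_comp [measurable]: "h \<in> borel_measurable borel \<Longrightarrow> (\<lambda>p::real\<times>real. h (fst p) :: real) \<in> borel_measurable borel"
  by (auto simp: borel_prod[symmetric])

lemma measurable_snd_comp [measurable]: "h \<in> borel_measurable borel \<Longrightarrow> (\<lambda>p::real\<times>real. h (snd p) :: real) \<in> borel_measurable borel"
  by (auto simp: borel_prod[symmetric])

lemma measurable_slice_fst: "f \<in> borel_measurable borel \<Longrightarrow> (\<lambda>t::real. (f (t, \<theta>::real) :: real)) \<in> borel_measurable borel"
  by (rule measurable_compose[of "\<lambda>t. (t, \<theta>)" _ borel]) (auto simp: borel_prod[symmetric])

lemma measurable_slice_snd: "f \<in> borel_measurable borel \<Longrightarrow> (\<lambda>\<theta>::real. (f (t::real, \<theta>) :: real)) \<in> borel_measurable borel"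
  by (rule measurable_compose[of "\<lambda>\<theta>. (t, \<theta>)" _ borel]) (auto simp: borel_prod[symmetric])

text \<open>
  \<open>G1\<close> is the \<open>t\<close>-derivative of \<open>G\<close>, and \<open>wkt\<close> is the closure of such pairs in \<open>L\<^sup>2\<close>, with \<open>u\<close> the trace on
  the circle \<open>t = e\<close>; \<open>smh\<close> and \<open>wkh\<close> are the counterparts for the \<open>\<theta>\<close>-derivative.
\<close>

definition smt :: "real \<Rightarrow> real \<Rightarrow> (real \<times> real \<Rightarrow> real) \<Rightarrow> (real \<times> real \<Rightarrow> real) \<Rightarrow> bool" where
  "smt a b G G1 \<longleftrightarrow> G \<in> borel_measurable borel \<and> G1 \<in> borel_measurable borel \<and>
     continuous_on ({a..b} \<times> UNIV) G \<and> continuous_on ({a..b} \<times> UNIV) G1 \<and>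
     (\<forall>t\<in>{a..b}. \<forall>\<theta>. ((\<lambda>t. G (t, \<theta>)) has_real_derivative G1 (t, \<theta>)) (at t within {a..b}))"

definition wkt :: "real \<Rightarrow> real \<Rightarrow> real \<Rightarrow> (real \<times> real \<Rightarrow> real) \<Rightarrow> (real \<times> real \<Rightarrow> real) \<Rightarrow> (real \<Rightarrow> real) \<Rightarrow> bool" where
  "wkt a b e f f1 u \<longleftrightarrow> (\<exists>G G1. (\<forall>n. smt a b (G n) (G1 n)) \<and> l2lim (cyl {a..b}) G f \<and>
     l2lim (cyl {a..b}) G1 f1 \<and> l2lim circ (\<lambda>n \<theta>. G n (e, \<theta>)) u)"

section \<open>Integration by parts in t with a boundary trace\<close>

definition mult1 :: "real \<Rightarrow> real \<Rightarrow> (real \<Rightarrow> real) \<Rightarrow> (real \<Rightarrow> real) \<Rightarrow> bool" where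
  "mult1 a b h h' \<longleftrightarrow> h \<in> borel_measurable borel \<and> h' \<in> borel_measurable borel \<and> continuous_on {a..b} h' \<and>
     (\<forall>t\<in>{a..b}. (h has_real_derivative h' t) (at t within {a..b}))"

lemma mult1_cont: "mult1 a b h h' \<Longrightarrow> continuous_on {a..b} h"
  unfolding mult1_def by (intro DERIV_continuous_on) auto

lemma cont_bounded:
  assumes "continuous_on {a..b::real} (h :: real \<Rightarrow> real)"
  obtains B where "\<And>t. t \<in> {a..b} \<Longrightarrow> \<bar>h t\<bar> \<le> B"
proof -
  have "bounded (h ` {a..b})" using compact_continuous_image[OF assms] compact_Icc compact_imp_bounded by blast
  then obtain B where "\<forall>x\<in>h ` {a..b}. norm x \<le> B" by (auto simp: bounded_iff)
  then show ?thesis using that[of B] by auto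
qed

lemma cont_bounded_cyl:
  assumes "continuous_on {a..b::real} (h :: real \<Rightarrow> real)"
  obtains B where "AE p in cyl {a..b}. \<bar>h (fst p)\<bar> \<le> B"
proof -
  obtain B where B: "\<And>t. t \<in> {a..b} \<Longrightarrow> \<bar>h t\<bar> \<le> B" using cont_bounded[OF assms] by blast
  have "AE p in cyl {a..b}. \<bar>h (fst p)\<bar> \<le> B"
    using AE_cyl_fst_in[of "{a..b}", OF borel_closed[OF closed_atLeastAtMost]] by eventually_elim (use B in auto)
  then show ?thesis using that by blast
qed

text \<open>The fundamental theorem of calculus for \<open>h G H\<close> on every line of constant
  \<theta>, integrated over the circle. The alternatives \<open>sb\<close> and \<open>sb'\<close>
  ask for control of the boundary values only at an end where the weight does not vanish.\<close>

lemma smooth_ibp: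
  assumes "a \<le> b" "smt a b G G1" "smt a b H H1" "mult1 a b h h'"
    and sq: "sqi (cyl {a..b}) G" "sqi (cyl {a..b}) G1" "sqi (cyl {a..b}) H" "sqi (cyl {a..b}) H1"
    and sb: "h a = 0 \<or> sqi circ (\<lambda>\<theta>. G (a, \<theta>)) \<and> sqi circ (\<lambda>\<theta>. H (a, \<theta>))"
    and sb': "h b = 0 \<or> sqi circ (\<lambda>\<theta>. G (b, \<theta>)) \<and> sqi circ (\<lambda>\<theta>. H (b, \<theta>))"
  shows "(\<integral>p. h (fst p) * G p * H1 p \<partial>cyl {a..b}) + (\<integral>p. h (fst p) * H p * G1 p \<partial>cyl {a..b})
      + (\<integral>p. h' (fst p) * G p * H p \<partial>cyl {a..b})
     = h b * (\<integral>\<theta>. G (b, \<theta>) * H (b, \<theta>) \<partial>circ) - h a * (\<integral>\<theta>. G (a, \<theta>) * H (a, \<theta>) \<partial>circ)"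
proof -
  let ?F = "\<lambda>p. h (fst p) * G p * H1 p + h (fst p) * H p * G1 p + h' (fst p) * G p * H p"
  obtain B where B: "AE p in cyl {a..b}. \<bar>h (fst p)\<bar> \<le> B"
    using cont_bounded_cyl[OF mult1_cont[OF assms(4)]] by blast
  obtain B' where B': "AE p in cyl {a..b}. \<bar>h' (fst p)\<bar> \<le> B'"
    using cont_bounded_cyl[of a b h'] assms(4) unfolding mult1_def by blast
  have mh: "h \<in> borel_measurable borel" "h' \<in> borel_measurable borel" using assms(4) by (auto simp: mult1_def)
  have int: "integrable (cyl {a..b}) (\<lambda>p. h (fst p) * G p * H1 p)"
      "integrable (cyl {a..b}) (\<lambda>p. h (fst p) * H p * G1 p)"
      "integrable (cyl {a..b}) (\<lambda>p. h' (fst p) * G p * H p)"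
    using sqi_bounded_mult[OF sq(1) _ B] sqi_bounded_mult[OF sq(3) _ B] sqi_bounded_mult[OF sq(1) _ B'] mh sq
    by (auto intro!: sqi_mult_integrable)
  have intF: "integrable (cyl {a..b}) ?F" using int by simp
  have inner: "(\<integral>t. ?F (t, \<theta>) \<partial>lbI {a..b}) = h b * G (b, \<theta>) * H (b, \<theta>) - h a * G (a, \<theta>) * H (a, \<theta>)" for \<theta>
  proof (rule integral_lbI_FTC[OF assms(1)])
    have slice: "continuous_on {a..b} (\<lambda>t. K (t, \<theta>))" if "continuous_on ({a..b} \<times> UNIV) K" for K :: "real \<times> real \<Rightarrow> real"
      by (rule continuous_on_compose2[OF that]) (auto intro: continuous_intros)
    show "continuous_on {a..b} (\<lambda>t. ?F (t, \<theta>))"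
      using assms(2,3,4) mult1_cont[OF assms(4)] unfolding smt_def mult1_def
      by (auto intro!: continuous_intros slice)
    show "((\<lambda>t. h t * G (t, \<theta>) * H (t, \<theta>)) has_real_derivative ?F (t, \<theta>)) (at t within {a..b})"
      if "t \<in> {a..b}" for t
    proof -
      have 1: "(h has_real_derivative h' t) (at t within {a..b})"
        "((\<lambda>t. G (t, \<theta>)) has_real_derivative G1 (t, \<theta>)) (at t within {a..b})"
        "((\<lambda>t. H (t, \<theta>)) has_real_derivative H1 (t, \<theta>)) (at t within {a..b})"
        using assms(2,3,4) that unfolding smt_def mult1_def by auto
      show ?thesis by (rule derivative_eq_intros 1 refl | simp add: algebra_simps)+
    qed
    have "?F \<in> borel_measurable borel" using borel_measurable_integrable[OF intF] by simp
    then show "(\<lambda>t. ?F (t, \<theta>)) \<in> borel_measurable borel" by (rule measurable_slice_fst)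
  qed
  have ib: "integrable circ (\<lambda>\<theta>. h a * (G (a, \<theta>) * H (a, \<theta>)))" "integrable circ (\<lambda>\<theta>. h b * (G (b, \<theta>) * H (b, \<theta>)))"
    using sb sb' sqi_mult_integrable by auto
  have "(\<integral>p. ?F p \<partial>cyl {a..b}) = (\<integral>\<theta>. h b * G (b, \<theta>) * H (b, \<theta>) - h a * G (a, \<theta>) * H (a, \<theta>) \<partial>circ)"
    unfolding Fubini_cyl(1)[OF _ intF, simplified] using inner by simp
  also have "\<dots> = (\<integral>\<theta>. h b * (G (b, \<theta>) * H (b, \<theta>)) \<partial>circ) - (\<integral>\<theta>. h a * (G (a, \<theta>) * H (a, \<theta>)) \<partial>circ)"
    using ib by (simp add: mult.assoc)
  finally show ?thesis using int by simp
qed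

text \<open>The trace is known at the end \<open>e\<close> alone, so the weight has to vanish at the
  opposite end. The identity for the smooth approximations is then continuous under the limits in
  \<open>wkt\<close>.\<close>

lemma wkt_ibp:
  assumes "a < b" "e = a \<or> e = b" "wkt a b e f f1 u" "wkt a b e g g1 v" "mult1 a b h h'"
    and z: "h (if e = a then b else a) = 0"
  shows "(\<integral>p. h (fst p) * f p * g1 p \<partial>cyl {a..b}) + (\<integral>p. h (fst p) * g p * f1 p \<partial>cyl {a..b})
      + (\<integral>p. h' (fst p) * f p * g p \<partial>cyl {a..b})
     = (if e = a then - h a else h b) * (\<integral>\<theta>. u \<theta> * v \<theta> \<partial>circ)"
proof -
  obtain G G1 where G: "\<And>n. smt a b (G n) (G1 n)" "l2lim (cyl {a..b}) G f"
     "l2lim (cyl {a..b}) G1 f1" "l2lim circ (\<lambda>n \<theta>. G n (e, \<theta>)) u" using assms(3) unfolding wkt_def by blast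
  obtain H H1 where H: "\<And>n. smt a b (H n) (H1 n)" "l2lim (cyl {a..b}) H g"
     "l2lim (cyl {a..b}) H1 g1" "l2lim circ (\<lambda>n \<theta>. H n (e, \<theta>)) v" using assms(4) unfolding wkt_def by blast
  obtain B where B: "AE p in cyl {a..b}. \<bar>h (fst p)\<bar> \<le> B"
    using cont_bounded_cyl[OF mult1_cont[OF assms(5)]] by blast
  obtain B' where B': "AE p in cyl {a..b}. \<bar>h' (fst p)\<bar> \<le> B'"
    using cont_bounded_cyl[of a b h'] assms(5) unfolding mult1_def by blast
  have mh: "h \<in> borel_measurable borel" "h' \<in> borel_measurable borel" using assms(5) by (auto simp: mult1_def)
  have m: "(\<lambda>p. h (fst p)) \<in> borel_measurable (cyl {a..b})" "(\<lambda>p. h' (fst p)) \<in> borel_measurable (cyl {a..b})"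
    using mh by (auto intro: measurable_fst_comp)
  have eq: "(\<integral>p. h (fst p) * G n p * H1 n p \<partial>cyl {a..b}) + (\<integral>p. h (fst p) * H n p * G1 n p \<partial>cyl {a..b})
      + (\<integral>p. h' (fst p) * G n p * H n p \<partial>cyl {a..b})
     = (if e = a then - h a else h b) * (\<integral>\<theta>. G n (e, \<theta>) * H n (e, \<theta>) \<partial>circ)" for n
  proof -
    have "(\<integral>p. h (fst p) * G n p * H1 n p \<partial>cyl {a..b}) + (\<integral>p. h (fst p) * H n p * G1 n p \<partial>cyl {a..b})
      + (\<integral>p. h' (fst p) * G n p * H n p \<partial>cyl {a..b})
     = h b * (\<integral>\<theta>. G n (b, \<theta>) * H n (b, \<theta>) \<partial>circ) - h a * (\<integral>\<theta>. G n (a, \<theta>) * H n (a, \<theta>) \<partial>circ)"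
      by (rule smooth_ibp[OF _ G(1) H(1) assms(5)])
        (use assms(1,2) z l2limD(1)[OF G(2)] l2limD(1)[OF G(3)] l2limD(1)[OF H(2)] l2limD(1)[OF H(3)]
         l2limD(1)[OF G(4)] l2limD(1)[OF H(4)] in \<open>auto split: if_splits\<close>)
    also have "\<dots> = (if e = a then - h a else h b) * (\<integral>\<theta>. G n (e, \<theta>) * H n (e, \<theta>) \<partial>circ)"
      using assms(1,2) z by (auto split: if_splits)
    finally show ?thesis .
  qed
  have "(\<lambda>n. (\<integral>p. h (fst p) * G n p * H1 n p \<partial>cyl {a..b}) + (\<integral>p. h (fst p) * H n p * G1 n p \<partial>cyl {a..b})
      + (\<integral>p. h' (fst p) * G n p * H n p \<partial>cyl {a..b})) \<longlonglongrightarrow>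
    (\<integral>p. h (fst p) * f p * g1 p \<partial>cyl {a..b}) + (\<integral>p. h (fst p) * g p * f1 p \<partial>cyl {a..b})
      + (\<integral>p. h' (fst p) * f p * g p \<partial>cyl {a..b})"
    by (intro tendsto_add l2lim_inner l2lim_bounded_mult[OF G(2) m(1) B] l2lim_bounded_mult[OF H(2) m(1) B]
       l2lim_bounded_mult[OF G(2) m(2) B'] G H)
  moreover have "(\<lambda>n. (if e = a then - h a else h b) * (\<integral>\<theta>. G n (e, \<theta>) * H n (e, \<theta>) \<partial>circ)) \<longlonglongrightarrow>
     (if e = a then - h a else h b) * (\<integral>\<theta>. u \<theta> * v \<theta> \<partial>circ)"
    by (intro tendsto_mult tendsto_const l2lim_inner G H)
  ultimately show ?thesis unfolding eq using LIMSEQ_unique by blast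
qed

lemma measure_circ [simp]: "measure circ UNIV = 2 * pi"
  by (simp add: measure_def emeasure_circ)

lemma sqi_cont_cyl:
  assumes "continuous_on ({a..b} \<times> UNIV) G" "G \<in> borel_measurable borel"
  shows "sqi (cyl {a..b}) G"
proof -
  have "compact (G ` ({a..b} \<times> {0..2 * pi}))"
    by (rule compact_continuous_image[OF continuous_on_subset[OF assms(1)]]) (auto intro: compact_Times)
  then obtain B where B: "\<And>p. p \<in> {a..b} \<times> {0..2 * pi} \<Longrightarrow> \<bar>G p\<bar> \<le> B"
    using compact_imp_bounded by (force simp: bounded_iff)
  have "AE p in cyl {a..b}. \<bar>G p\<bar> \<le> B"
    by (subst AE_cyl) (use B in auto)
  then show ?thesis using assms(2) by (intro sqi_bounded[OF finite_cyl]) auto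
qed

lemma sqi_cont_circ:
  assumes "continuous_on {0..2 * pi} g" "g \<in> borel_measurable borel"
  shows "sqi circ g"
proof -
  have "compact (g ` {0..2 * pi})" by (rule compact_continuous_image[OF assms(1)]) auto
  then obtain B where B: "\<And>p. p \<in> {0..2 * pi} \<Longrightarrow> \<bar>g p\<bar> \<le> B"
    using compact_imp_bounded by (force simp: bounded_iff)
  have "AE p in circ. \<bar>g p\<bar> \<le> B"
    by (subst AE_circ) (use B in auto)
  then show ?thesis using assms(2) by (intro sqi_bounded[OF finite_circ]) auto
qed

lemma continuous_slice_snd:
  assumes "continuous_on (A \<times> UNIV) K" "t \<in> A"
  shows "continuous_on S (\<lambda>\<theta>::real. K (t, \<theta>) :: real)"
  by (rule continuous_on_compose2[OF assms(1)]) (use assms(2) in \<open>auto intro!: continuous_intros\<close>)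

lemma smt_add: "smt a b G G1 \<Longrightarrow> smt a b H H1 \<Longrightarrow> smt a b (\<lambda>p. G p + H p) (\<lambda>p. G1 p + H1 p)"
  unfolding smt_def by (auto intro!: continuous_intros derivative_intros)

lemma smt_mult:
  assumes "smt a b G G1" "mult1 a b k k'"
  shows "smt a b (\<lambda>p. k (fst p) * G p) (\<lambda>p. k' (fst p) * G p + k (fst p) * G1 p)"
proof -
  have 1: "continuous_on ({a..b} \<times> UNIV) (\<lambda>p. k (fst p))"
    by (rule continuous_on_compose2[OF mult1_cont[OF assms(2)]]) (auto intro!: continuous_intros)
  have 2: "continuous_on ({a..b} \<times> UNIV) (\<lambda>p. k' (fst p))"
    by (rule continuous_on_compose2[where g = k' and t = "{a..b}"]) (use assms(2) in \<open>auto simp: mult1_def intro!: continuous_intros\<close>)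
  have 3: "((\<lambda>t. k t * G (t, \<theta>)) has_real_derivative k' t * G (t, \<theta>) + k t * G1 (t, \<theta>)) (at t within {a..b})"
    if "t \<in> {a..b}" for t \<theta>
  proof -
    have 1: "(k has_real_derivative k' t) (at t within {a..b})"
        "((\<lambda>t. G (t, \<theta>)) has_real_derivative G1 (t, \<theta>)) (at t within {a..b})"
      using assms that by (auto simp: smt_def mult1_def)
    show ?thesis by (rule derivative_eq_intros 1 refl | simp)+
  qed
  show ?thesis using assms 1 2 3 unfolding smt_def mult1_def
    by (auto intro!: continuous_intros measurable_fst_comp)
qed

lemma wkt_add: assumes "wkt a b e f f1 u" "wkt a b e g g1 v"
  shows "wkt a b e (\<lambda>p. f p + g p) (\<lambda>p. f1 p + g1 p) (\<lambda>\<theta>. u \<theta> + v \<theta>)"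
proof -
  obtain G G1 where G: "\<And>n. smt a b (G n) (G1 n)" "l2lim (cyl {a..b}) G f"
     "l2lim (cyl {a..b}) G1 f1" "l2lim circ (\<lambda>n \<theta>. G n (e, \<theta>)) u" using assms(1) unfolding wkt_def by blast
  obtain H H1 where H: "\<And>n. smt a b (H n) (H1 n)" "l2lim (cyl {a..b}) H g"
     "l2lim (cyl {a..b}) H1 g1" "l2lim circ (\<lambda>n \<theta>. H n (e, \<theta>)) v" using assms(2) unfolding wkt_def by blast
  show ?thesis unfolding wkt_def
    by (rule exI[of _ "\<lambda>n p. G n p + H n p"], rule exI[of _ "\<lambda>n p. G1 n p + H1 n p"])
      (use G H in \<open>auto intro!: smt_add l2lim_add\<close>)
qed

lemma wkt_mult: assumes "wkt a b e f f1 u" "mult1 a b k k'"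
  shows "wkt a b e (\<lambda>p. k (fst p) * f p) (\<lambda>p. k' (fst p) * f p + k (fst p) * f1 p) (\<lambda>\<theta>. k e * u \<theta>)"
proof -
  obtain G G1 where G: "\<And>n. smt a b (G n) (G1 n)" "l2lim (cyl {a..b}) G f"
     "l2lim (cyl {a..b}) G1 f1" "l2lim circ (\<lambda>n \<theta>. G n (e, \<theta>)) u" using assms(1) unfolding wkt_def by blast
  obtain B where B: "AE p in cyl {a..b}. \<bar>k (fst p)\<bar> \<le> B"
    using cont_bounded_cyl[OF mult1_cont[OF assms(2)]] by blast
  obtain B' where B': "AE p in cyl {a..b}. \<bar>k' (fst p)\<bar> \<le> B'"
    using cont_bounded_cyl[of a b k'] assms(2) unfolding mult1_def by blast
  have m: "(\<lambda>p. k (fst p)) \<in> borel_measurable (cyl {a..b})" "(\<lambda>p. k' (fst p)) \<in> borel_measurable (cyl {a..b})"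
    using assms(2) by (auto intro: measurable_fst_comp simp: mult1_def)
  show ?thesis unfolding wkt_def
  proof (intro exI conjI allI)
    show "smt a b (\<lambda>p. k (fst p) * G n p) (\<lambda>p. k' (fst p) * G n p + k (fst p) * G1 n p)" for n
      by (rule smt_mult[OF G(1) assms(2)])
    show "l2lim (cyl {a..b}) (\<lambda>n p. k (fst p) * G n p) (\<lambda>p. k (fst p) * f p)"
      by (rule l2lim_bounded_mult[OF G(2) m(1) B])
    show "l2lim (cyl {a..b}) (\<lambda>n p. k' (fst p) * G n p + k (fst p) * G1 n p) (\<lambda>p. k' (fst p) * f p + k (fst p) * f1 p)"
      by (intro l2lim_add l2lim_bounded_mult[OF G(2) m(2) B'] l2lim_bounded_mult[OF G(3) m(1) B])
    show "l2lim circ (\<lambda>n \<theta>. k (fst (e, \<theta>)) * G n (e, \<theta>)) (\<lambda>\<theta>. k e * u \<theta>)"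
      using l2lim_scale[OF G(4)] by simp
  qed
qed

lemma mult1_const: "mult1 a b (\<lambda>_. k) (\<lambda>_. 0)"
  by (auto simp: mult1_def)

lemma wkt_scale: "wkt a b e f f1 u \<Longrightarrow> wkt a b e (\<lambda>p. k * f p) (\<lambda>p. k * f1 p) (\<lambda>\<theta>. k * u \<theta>)"
  using wkt_mult[OF _ mult1_const[of a b k]] by simp

lemma wkt_diff: "wkt a b e f f1 u \<Longrightarrow> wkt a b e g g1 v \<Longrightarrow>
   wkt a b e (\<lambda>p. f p - g p) (\<lambda>p. f1 p - g1 p) (\<lambda>\<theta>. u \<theta> - v \<theta>)"
  using wkt_add[of a b e f f1 u "\<lambda>p. -1 * g p" "\<lambda>p. -1 * g1 p" "\<lambda>p. -1 * v p"] wkt_scale[of a b e g g1 v "-1"] by simp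

lemma wkt_smooth:
  assumes "smt a b G G1" "e \<in> {a..b}" shows "wkt a b e G G1 (\<lambda>\<theta>. G (e, \<theta>))"
  unfolding wkt_def
  by (rule exI[of _ "\<lambda>_. G"], rule exI[of _ "\<lambda>_. G1"])
    (use assms in \<open>auto simp: smt_def intro!: l2lim_const sqi_cont_cyl sqi_cont_circ measurable_slice_snd elim!: continuous_slice_snd\<close>)

lemma wktD:
  assumes "wkt a b e f f1 u"
  shows "sqi (cyl {a..b}) f" "sqi (cyl {a..b}) f1" "sqi circ u"
  using assms unfolding wkt_def by (auto dest: l2limD)

lemma mult1_affine: "mult1 a b (\<lambda>t. t - k) (\<lambda>_. 1)"
  by (auto simp: mult1_def intro!: derivative_eq_intros)

text \<open>Integration by parts against \<open>t - ?o\<close>, which vanishes at the opposite end,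
  expresses (b - a) \<integral>u^2 through f and its derivative. By linearity this is uniqueness of
  traces, needed because \<open>boundary_trace\<close> is a choice.\<close>

lemma wkt_trace_zero:
  assumes "a < b" "e = a \<or> e = b" "wkt a b e f f1 u" "AE p in cyl {a..b}. f p = 0"
  shows "AE \<theta> in circ. u \<theta> = 0"
proof -
  let ?o = "if e = a then b else a"
  have z: "(\<integral>p. (fst p - ?o) * f p * f1 p \<partial>cyl {a..b}) = 0" "(\<integral>p. 1 * f p * f p \<partial>cyl {a..b}) = 0"
    using assms(4) by (auto intro!: integral_eq_zero_AE)
  have "(if e = a then b - a else b - a) * (\<integral>\<theta>. u \<theta> * u \<theta> \<partial>circ) = 0"
    using wkt_ibp[OF assms(1,2,3,3) mult1_affine[of a b ?o]] assms(1,2) z by (auto split: if_splits)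
  then have "(\<integral>\<theta>. (u \<theta>)^2 \<partial>circ) = 0" using assms(1) by (auto simp: power2_eq_square)
  then have "AE \<theta> in circ. (u \<theta>)^2 = 0"
    using wktD(3)[OF assms(3)] by (subst (asm) integral_nonneg_eq_0_iff_AE) (auto dest: sqiD)
  then show ?thesis by simp
qed

lemma cyl_snd:
  assumes "a \<le> b" "integrable circ F"
  shows "integrable (cyl {a..b}) (\<lambda>p. F (snd p) :: real)"
    "(\<integral>p. F (snd p) \<partial>cyl {a..b}) = (b - a) * (\<integral>\<theta>. F \<theta> \<partial>circ)"
proof -
  interpret pair_sigma_finite "lbI {a..b}" circ by (rule pair_sigma_finite_cyl) simp
  interpret finite_measure "lbI {a..b}" by (rule finite_lbI)
  have F: "F \<in> borel_measurable borel" using borel_measurable_integrable[OF assms(2)] by simp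
  show i: "integrable (cyl {a..b}) (\<lambda>p. F (snd p))"
    unfolding cyl_def
  proof (rule Fubini_integrable)
    have "(\<lambda>p. F (snd p)) \<in> borel_measurable (cyl {a..b})" using F by (auto intro: measurable_snd_comp)
    then show "(\<lambda>p. F (snd p)) \<in> borel_measurable (lbI {a..b} \<Otimes>\<^sub>M circ)" unfolding cyl_def .
  qed (use assms in auto)
  have m: "measure (lbI {a..b}) UNIV = b - a"
    using assms(1) by (simp add: lbI_def measure_def emeasure_density emeasure_lborel_Icc_eq)
  show "(\<integral>p. F (snd p) \<partial>cyl {a..b}) = (b - a) * (\<integral>\<theta>. F \<theta> \<partial>circ)"
    by (subst Fubini_cyl(2)[OF _ i]) (simp_all add: m)
qed

lemma l2lim_snd:
  assumes "a \<le> b" "l2lim circ F f"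
  shows "l2lim (cyl {a..b}) (\<lambda>n p. F n (snd p)) (\<lambda>p. f (snd p))"
proof -
  note A = l2limD[OF assms(2)]
  have s: "sqi (cyl {a..b}) (\<lambda>p. g (snd p))" if "sqi circ g" for g
    using that cyl_snd(1)[OF assms(1), of "\<lambda>\<theta>. (g \<theta>)^2"] by (auto simp: sqi_def intro: measurable_snd_comp)
  have "(\<integral>p. (F n (snd p) - f (snd p))^2 \<partial>cyl {a..b}) = (b - a) * (\<integral>\<theta>. (F n \<theta> - f \<theta>)^2 \<partial>circ)" for n
    using cyl_snd(2)[OF assms(1) sqiD(2)[OF sqi_diff[OF A(1)[of n] A(2)]]] by simp
  then show ?thesis using s A unfolding l2lim_def
    by (auto intro: tendsto_mult_right_zero)
qed

text \<open>The approximations are the boundary values of those of f, extended constantly in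
  t.\<close>

lemma wkt_trace_const:
  assumes "a \<le> b" "e \<in> {a..b}" "wkt a b e f f1 u"
  shows "wkt a b e (\<lambda>p. u (snd p)) (\<lambda>_. 0) u"
proof -
  obtain G G1 where G: "\<And>n. smt a b (G n) (G1 n)" "l2lim circ (\<lambda>n \<theta>. G n (e, \<theta>)) u"
    using assms(3) unfolding wkt_def by blast
  show ?thesis unfolding wkt_def
  proof (intro exI conjI allI)
    fix n
    have "continuous_on ({a..b} \<times> UNIV) (\<lambda>p. G n (e, snd p))"
      by (rule continuous_on_compose2[of "{a..b} \<times> UNIV" "G n"])
        (use G(1)[of n] assms(2) in \<open>auto simp: smt_def intro!: continuous_intros\<close>)
    moreover have "(\<lambda>\<theta>. G n (e, \<theta>)) \<in> borel_measurable borel"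
      by (rule measurable_slice_snd) (use G(1)[of n] in \<open>auto simp: smt_def\<close>)
    from measurable_snd_comp[OF this] have "(\<lambda>p::real \<times> real. G n (e, snd p)) \<in> borel_measurable borel" .
    ultimately show "smt a b (\<lambda>p. G n (e, snd p)) (\<lambda>_. 0)"
      by (auto simp: smt_def)
  next
    show "l2lim (cyl {a..b}) (\<lambda>n p. G n (e, snd p)) (\<lambda>p. u (snd p))"
      by (rule l2lim_snd[OF assms(1) G(2)])
  qed (use G in \<open>auto simp: l2lim_const\<close>)
qed

text \<open>The weight of trace uniqueness again, applied to f minus the constant extension of its
  trace: derivative and trace of the difference vanish, hence also the integral of its
  square.\<close>

lemma wkt_flat:
  assumes "a < b" "e = a \<or> e = b" "wkt a b e f f1 u" "AE p in cyl {a..b}. f1 p = 0"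
  shows "AE p in cyl {a..b}. f p = u (snd p)"
proof -
  let ?o = "if e = a then b else a"
  let ?d = "\<lambda>p. f p - u (snd p)"
  have w: "wkt a b e ?d f1 (\<lambda>\<theta>. u \<theta> - u \<theta>)"
    using wkt_diff[OF assms(3) wkt_trace_const[OF _ _ assms(3)]] assms(1,2) by auto
  have z: "(\<integral>p. (fst p - ?o) * ?d p * f1 p \<partial>cyl {a..b}) = 0"
    using assms(4) by (auto intro!: integral_eq_zero_AE)
  have "(\<integral>p. 1 * ?d p * ?d p \<partial>cyl {a..b}) = 0"
    using wkt_ibp[OF assms(1,2) w w mult1_affine[of a b ?o]] z by (auto split: if_splits)
  then have "(\<integral>p. (?d p)^2 \<partial>cyl {a..b}) = 0" by (simp add: power2_eq_square)
  then have "AE p in cyl {a..b}. (?d p)^2 = 0"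
    using wktD(1)[OF w] by (subst (asm) integral_nonneg_eq_0_iff_AE) (auto dest: sqiD)
  then show ?thesis by simp
qed

section \<open>The average over the circle\<close>

definition mean :: "(real \<times> real \<Rightarrow> real) \<Rightarrow> real \<Rightarrow> real" where
  "mean f t = (\<integral>\<theta>. f (t, \<theta>) \<partial>circ) / (2 * pi)"

lemma mean_measurable [measurable]:
  assumes "f \<in> borel_measurable borel" shows "mean f \<in> borel_measurable borel"
proof -
  interpret sigma_finite_measure circ by (rule sigma_finite_circ)
  have "(\<lambda>(t, \<theta>). f (t, \<theta>)) \<in> borel_measurable (borel \<Otimes>\<^sub>M circ)"
    using assms by (simp add: measurable_cong_sets[OF sets_pair_measure_cong[OF refl sets_circ] refl] borel_prod)
  from borel_measurable_lebesgue_integral[OF this] show ?thesis unfolding mean_def by simp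
qed

lemma cyl_fst:
  assumes I: "I \<in> sets borel" and "F \<in> borel_measurable borel"
  shows "integrable (cyl I) (\<lambda>p. F (fst p) :: real) \<longleftrightarrow> integrable (lbI I) F"
    "integrable (lbI I) F \<Longrightarrow> (\<integral>p. F (fst p) \<partial>cyl I) = 2 * pi * (\<integral>t. F t \<partial>lbI I)"
proof -
  interpret pair_sigma_finite "lbI I" circ by (rule pair_sigma_finite_cyl[OF I])
  interpret finite_measure circ by (rule finite_circ)
  have i: "integrable (cyl I) (\<lambda>p. F (fst p))" if "integrable (lbI I) F"
    unfolding cyl_def
  proof (rule Fubini_integrable)
    have "(\<lambda>p. F (fst p)) \<in> borel_measurable (cyl I)" using assms(2) by (auto intro: measurable_fst_comp)
    then show "(\<lambda>p. F (fst p)) \<in> borel_measurable (lbI I \<Otimes>\<^sub>M circ)" unfolding cyl_def .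
  qed (use that in auto)
  show eq: "(\<integral>p. F (fst p) \<partial>cyl I) = 2 * pi * (\<integral>t. F t \<partial>lbI I)" if "integrable (lbI I) F"
    by (subst Fubini_cyl(2)[OF I i[OF that]]) simp
  have "integrable (lbI I) F" if "integrable (cyl I) (\<lambda>p. F (fst p))"
    using Fubini_cyl(3)[OF I that] by simp
  then show "integrable (cyl I) (\<lambda>p. F (fst p) :: real) \<longleftrightarrow> integrable (lbI I) F" using i by blast
qed

lemma AE_sqi_slice:
  assumes "I \<in> sets borel" "sqi (cyl I) f"
  shows "AE t in lbI I. sqi circ (\<lambda>\<theta>. f (t, \<theta>))"
  using Fubini_cyl(4)[OF assms(1) sqiD(2)[OF assms(2)]]
  by eventually_elim (use sqiD(1)[OF assms(2)] in \<open>auto simp: sqi_def intro: measurable_slice_snd\<close>)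

lemma mean_sq_le:
  assumes "sqi circ (\<lambda>\<theta>. f (t, \<theta>))"
  shows "2 * pi * (mean f t)^2 \<le> (\<integral>\<theta>. (f (t, \<theta>))^2 \<partial>circ)"
proof -
  have "(\<integral>\<theta>. f (t, \<theta>) * 1 \<partial>circ)^2 \<le> (\<integral>\<theta>. (f (t, \<theta>))^2 \<partial>circ) * (\<integral>\<theta>. 1^2 \<partial>circ)"
    by (rule integral_Cauchy_Schwarz[OF assms sqi_bounded[OF finite_circ]]) auto
  then show ?thesis by (simp add: mean_def power_divide field_simps power2_eq_square)
qed

text \<open>Cauchy--Schwarz on each circle. Being a contraction of L2, averaging is compatible with
  the limits in \<open>wkt\<close>.\<close>

lemma sqi_mean:
  assumes I: "I \<in> sets borel" and f: "sqi (cyl I) f"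
  shows "sqi (cyl I) (\<lambda>p. mean f (fst p))"
    and "(\<integral>p. (mean f (fst p))^2 \<partial>cyl I) \<le> (\<integral>p. (f p)^2 \<partial>cyl I)"
proof -
  note F = Fubini_cyl[OF I sqiD(2)[OF f]]
  have m: "mean f \<in> borel_measurable borel" using sqiD(1)[OF f] by (intro mean_measurable) simp
  have le: "AE t in lbI I. 2 * pi * (mean f t)^2 \<le> (\<integral>\<theta>. (f (t, \<theta>))^2 \<partial>circ)"
    using AE_sqi_slice[OF I f] by eventually_elim (rule mean_sq_le)
  have i: "integrable (lbI I) (\<lambda>t. 2 * pi * (mean f t)^2)"
    by (rule Bochner_Integration.integrable_bound[OF F(3)]) (use m le in auto)
  then have i': "integrable (lbI I) (\<lambda>t. (mean f t)^2)" by simp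
  then show "sqi (cyl I) (\<lambda>p. mean f (fst p))"
    using m cyl_fst(1)[OF I, of "\<lambda>t. (mean f t)^2"] by (auto simp: sqi_def intro: measurable_fst_comp)
  have "(\<integral>p. (mean f (fst p))^2 \<partial>cyl I) = (\<integral>t. 2 * pi * (mean f t)^2 \<partial>lbI I)"
    using cyl_fst(2)[OF I _ i'] m by simp
  also have "\<dots> \<le> (\<integral>t. \<integral>\<theta>. (f (t, \<theta>))^2 \<partial>circ \<partial>lbI I)"
    by (rule integral_mono_AE[OF i F(3) le])
  also have "\<dots> = (\<integral>p. (f p)^2 \<partial>cyl I)" using F(2) by simp
  finally show "(\<integral>p. (mean f (fst p))^2 \<partial>cyl I) \<le> (\<integral>p. (f p)^2 \<partial>cyl I)" .
qed

lemma AE_mean_diff: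
  assumes I: "I \<in> sets borel" and "sqi (cyl I) f" "sqi (cyl I) g"
  shows "AE p in cyl I. mean (\<lambda>p. f p - g p) (fst p) = mean f (fst p) - mean g (fst p)"
  by (rule AE_cyl_fst[OF I], use AE_sqi_slice[OF I assms(2)] AE_sqi_slice[OF I assms(3)] in eventually_elim)
    (simp add: mean_def diff_divide_distrib sqi_integrable[OF finite_circ])

lemma l2lim_mean:
  assumes "l2lim (cyl {a..b}) F f"
  shows "l2lim (cyl {a..b}) (\<lambda>n p. mean (F n) (fst p)) (\<lambda>p. mean f (fst p))"
proof -
  note A = l2limD[OF assms]
  have "(\<integral>p. (mean (F n) (fst p) - mean f (fst p))^2 \<partial>cyl {a..b}) \<le> (\<integral>p. (F n p - f p)^2 \<partial>cyl {a..b})" for n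
  proof -
    have "(\<integral>p. (mean (F n) (fst p) - mean f (fst p))^2 \<partial>cyl {a..b}) = (\<integral>p. (mean (\<lambda>p. F n p - f p) (fst p))^2 \<partial>cyl {a..b})"
      using A(1)[of n] A(2) by (intro integral_cong_AE)
        (auto intro!: measurable_fst_comp mean_measurable borel_measurable_power borel_measurable_diff dest: sqiD
         intro: AE_mp[OF AE_mean_diff[OF _ A(1)[of n] A(2)]])
    also have "\<dots> \<le> (\<integral>p. (F n p - f p)^2 \<partial>cyl {a..b})"
      by (rule sqi_mean(2)[OF _ sqi_diff[OF A(1,2)]]) simp
    finally show ?thesis .
  qed
  then have "(\<lambda>n. \<integral>p. (mean (F n) (fst p) - mean f (fst p))^2 \<partial>cyl {a..b}) \<longlonglongrightarrow> 0"
    by (rule tendsto_0_dominated[OF _ _ A(3), rotated]) simp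
  then show ?thesis using A unfolding l2lim_def by (auto intro: sqi_mean(1))
qed

lemma integral_circ_eq:
  assumes "continuous_on {0..2*pi} g" "g \<in> borel_measurable borel"
  shows "(\<integral>\<theta>. g \<theta> \<partial>circ) = integral {0..2*pi} (g :: real \<Rightarrow> real)"
proof -
  have "(\<integral>\<theta>. g \<theta> \<partial>circ) = (\<integral>\<theta>. indicator {0..<2*pi} \<theta> * g \<theta> \<partial>lborel)"
    unfolding circ_def using assms(2) by (simp add: integral_lbI)
  also have "\<dots> = (\<integral>\<theta>. indicator {0..2*pi} \<theta> * g \<theta> \<partial>lborel)"
  proof (rule integral_cong_AE)
    show "AE \<theta> in lborel. indicator {0..<2 * pi} \<theta> * g \<theta> = indicator {0..2 * pi} \<theta> * g \<theta>"
      using AE_lborel_singleton[of "2 * pi"] by eventually_elim (auto simp: indicator_def)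
  qed (use assms(2) in auto)
  also have "\<dots> = set_lebesgue_integral lborel {0..2*pi} g" by (simp add: set_lebesgue_integral_def)
  also have "\<dots> = integral {0..2*pi} g"
    by (rule set_borel_integral_eq_integral(2)) (rule borel_integrable_atLeastAtMost', rule assms(1))
  finally show ?thesis .
qed

lemma smt_mean:
  assumes "smt a b G G1"
  shows "smt a b (\<lambda>p. mean G (fst p)) (\<lambda>p. mean G1 (fst p))"
proof -
  have G: "G \<in> borel_measurable borel" "G1 \<in> borel_measurable borel"
    "continuous_on ({a..b} \<times> UNIV) G" "continuous_on ({a..b} \<times> UNIV) G1"
    "\<And>t \<theta>. t \<in> {a..b} \<Longrightarrow> ((\<lambda>t. G (t, \<theta>)) has_real_derivative G1 (t, \<theta>)) (at t within {a..b})"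
    using assms by (auto simp: smt_def)
  have eq: "mean K t = integral {0..2*pi} (\<lambda>\<theta>. K (t, \<theta>)) / (2 * pi)"
    if "continuous_on ({a..b} \<times> UNIV) K" "K \<in> borel_measurable borel" "t \<in> {a..b}" for K t
    unfolding mean_def using that
    by (subst integral_circ_eq) (auto intro: continuous_slice_snd measurable_slice_snd)
  have c: "continuous_on {a..b} (mean K)"
    if "continuous_on ({a..b} \<times> UNIV) K" "K \<in> borel_measurable borel" for K
  proof -
    have "continuous_on {a..b} (\<lambda>t. integral (cbox 0 (2*pi)) (\<lambda>\<theta>. K (t, \<theta>)))"
      by (rule integral_continuous_on_param) (auto intro: continuous_on_subset[OF that(1)])
    then have "continuous_on {a..b} (\<lambda>t. integral (cbox 0 (2*pi)) (\<lambda>\<theta>. K (t, \<theta>)) / (2 * pi))"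
      by (intro continuous_intros) auto
    then show ?thesis by (rule continuous_on_eq) (use eq[OF that] in auto)
  qed
  have c2: "continuous_on ({a..b} \<times> UNIV) (\<lambda>p. mean K (fst p))"
    if "continuous_on ({a..b} \<times> UNIV) K" "K \<in> borel_measurable borel" for K
    by (rule continuous_on_compose2[OF c[OF that]]) (auto intro!: continuous_intros)
  have d: "(mean G has_real_derivative mean G1 t) (at t within {a..b})" if t: "t \<in> {a..b}" for t
  proof -
    have "((\<lambda>t. integral (cbox 0 (2*pi)) (\<lambda>\<theta>. G (t, \<theta>))) has_real_derivative integral (cbox 0 (2*pi)) (\<lambda>\<theta>. G1 (t, \<theta>))) (at t within {a..b})"
    proof (rule leibniz_rule_field_derivative)
      show "(\<lambda>\<theta>. G (x, \<theta>)) integrable_on cbox 0 (2*pi)" if "x \<in> {a..b}" for x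
        by (rule integrable_continuous) (rule continuous_slice_snd[OF G(3) that])
    qed (use G t in \<open>auto intro: continuous_on_subset\<close>)
    then have "((\<lambda>t. integral (cbox 0 (2*pi)) (\<lambda>\<theta>. G (t, \<theta>)) / (2 * pi)) has_real_derivative mean G1 t) (at t within {a..b})"
      using eq[OF G(4,2) t] by (auto intro!: DERIV_cdivide)
    then show ?thesis
      by (rule has_field_derivative_transform_within[where d = 1]) (use eq[OF G(3,1)] t in auto)
  qed
  show ?thesis unfolding smt_def using G c2 d by (auto intro!: measurable_fst_comp mean_measurable)
qed

lemma wkt_mean:
  assumes "wkt a b e f f1 u"
  shows "wkt a b e (\<lambda>p. mean f (fst p)) (\<lambda>p. mean f1 (fst p)) (\<lambda>_. (\<integral>\<theta>. u \<theta> \<partial>circ) / (2 * pi))"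
proof -
  obtain G G1 where G: "\<And>n. smt a b (G n) (G1 n)" "l2lim (cyl {a..b}) G f"
     "l2lim (cyl {a..b}) G1 f1" "l2lim circ (\<lambda>n \<theta>. G n (e, \<theta>)) u" using assms(1) unfolding wkt_def by blast
  have one: "sqi circ (\<lambda>_. k)" for k by (rule sqi_bounded[OF finite_circ, of _ "\<bar>k\<bar>"]) auto
  have "(\<lambda>n. \<integral>\<theta>. G n (e, \<theta>) * 1 \<partial>circ) \<longlonglongrightarrow> (\<integral>\<theta>. u \<theta> * 1 \<partial>circ)"
    by (rule l2lim_inner[OF G(4) l2lim_const[OF one]])
  then have "(\<lambda>n. mean (G n) e) \<longlonglongrightarrow> (\<integral>\<theta>. u \<theta> \<partial>circ) / (2 * pi)"
    unfolding mean_def by (auto intro!: tendsto_intros)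
  then have "(\<lambda>n. 2 * pi * (mean (G n) e - (\<integral>\<theta>. u \<theta> \<partial>circ) / (2 * pi))^2) \<longlonglongrightarrow>
     2 * pi * ((\<integral>\<theta>. u \<theta> \<partial>circ) / (2 * pi) - (\<integral>\<theta>. u \<theta> \<partial>circ) / (2 * pi))^2"
    by (intro tendsto_intros)
  then have "l2lim circ (\<lambda>n \<theta>. mean (G n) e) (\<lambda>_. (\<integral>\<theta>. u \<theta> \<partial>circ) / (2 * pi))"
    unfolding l2lim_def using one by simp
  then show ?thesis unfolding wkt_def
    by (intro exI[of _ "\<lambda>n p. mean (G n) (fst p)"] exI[of _ "\<lambda>n p. mean (G1 n) (fst p)"])
      (use G in \<open>auto intro: smt_mean l2lim_mean\<close>)
qed

text \<open>Averaging is an orthogonal projection: the first factor is constant on circles, so the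
  second may be averaged too.\<close>

lemma mean_inner:
  assumes I: "I \<in> sets borel" and "sqi (cyl I) f" "sqi (cyl I) g"
  shows "(\<integral>p. mean f (fst p) * g p \<partial>cyl I) = (\<integral>p. mean f (fst p) * mean g (fst p) \<partial>cyl I)"
proof -
  note 1 = sqi_mult_integrable[OF sqi_mean(1)[OF I assms(2)] assms(3)]
  note 2 = sqi_mult_integrable[OF sqi_mean(1)[OF I assms(2)] sqi_mean(1)[OF I assms(3)]]
  show ?thesis unfolding Fubini_cyl(2)[OF I 1] Fubini_cyl(2)[OF I 2] by (simp add: mean_def)
qed

section \<open>Wirtinger's inequality\<close>

text \<open>Completing a square with a solution of the Riccati equation h' = -m^2 - h^2: then z'^2 -
  m^2 z^2 differs from (z' - h z)^2 by the derivative of h z^2, whose boundary values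
  vanish.\<close>

lemma wirtinger_Dirichlet:
  fixes z z' :: "real \<Rightarrow> real"
  assumes d: "\<And>x. (z has_real_derivative z' x) (at x)" and c: "continuous_on UNIV z'"
    and z0: "z \<alpha> = 0" "z (\<alpha> + pi) = 0"
  shows "integral {\<alpha>..\<alpha>+pi} (\<lambda>x. (z x)^2) \<le> integral {\<alpha>..\<alpha>+pi} (\<lambda>x. (z' x)^2)"
proof -
  let ?I = "{\<alpha>..\<alpha>+pi}"
  have cz: "continuous_on S z" for S using d by (intro DERIV_continuous_on) (rule has_field_derivative_at_within)
  have cz': "continuous_on S z'" for S using c continuous_on_subset by blast
  have le: "m^2 * integral ?I (\<lambda>x. (z x)^2) \<le> integral ?I (\<lambda>x. (z' x)^2)" if m: "0 < m" "m < 1" for m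
  proof -
    \<comment> \<open>h is the logarithmic derivative of cos (y x), a cosine centred in the
      interval. For m < 1 this cosine is positive up to both ends; m tends to 1 afterwards.\<close>
    define y where "y x = m * (x - \<alpha> - pi / 2)" for x
    define h where "h x = - m * tan (y x)" for x
    have cos: "cos (y x) > 0" if "x \<in> ?I" for x
    proof -
      have "\<bar>x - \<alpha> - pi / 2\<bar> \<le> pi / 2" using that unfolding abs_le_iff atLeastAtMost_iff by linarith
      then have "\<bar>y x\<bar> \<le> m * (pi / 2)" using m by (simp add: y_def abs_mult)
      also have "\<dots> < pi / 2" using m by (simp add: mult_less_cancel_right1)
      finally show ?thesis by (intro cos_gt_zero_pi) auto
    qed
    have ch: "continuous_on ?I h" unfolding h_def y_def
      using cos unfolding y_def by (auto intro!: continuous_intros simp: less_le)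
    have dh: "(h has_real_derivative - m\<^sup>2 - (h x)^2) (at x within ?I)" if "x \<in> ?I" for x
    proof -
      have "cos (y x) \<noteq> 0" using cos[OF that] by simp
      have dy: "(y has_real_derivative m) (at x)"
        unfolding y_def by (auto intro!: derivative_eq_intros)
      have "(h has_real_derivative - m * ((inverse (cos (y x)))^2 * m)) (at x)"
        unfolding h_def using DERIV_cmult[OF DERIV_chain2[OF DERIV_tan[OF \<open>cos (y x) \<noteq> 0\<close>] dy], of "- m"]
        by (simp add: power_inverse)
      moreover have "- m * ((inverse (cos (y x)))^2 * m) = - m\<^sup>2 - (h x)^2"
      proof -
        show ?thesis unfolding h_def tan_sec[OF \<open>cos (y x) \<noteq> 0\<close>, symmetric]
          by (simp only: power2_eq_square algebra_simps)
      qed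
      ultimately show ?thesis by (metis has_field_derivative_at_within)
    qed
    have F: "((\<lambda>x. (- m\<^sup>2 - (h x)^2) * (z x)^2 + h x * (2 * z x * z' x)) has_integral
        h (\<alpha>+pi) * (z (\<alpha>+pi))^2 - h \<alpha> * (z \<alpha>)^2) ?I"
    proof (rule fundamental_theorem_of_calculus)
      fix x assume x: "x \<in> ?I"
      have "((\<lambda>x. h x * (z x)^2) has_real_derivative (- m\<^sup>2 - (h x)^2) * (z x)^2 + h x * (2 * z x * z' x)) (at x within ?I)"
        by (rule DERIV_cong[OF DERIV_mult[OF dh[OF x] DERIV_power[OF has_field_derivative_at_within[OF d], of 2]]]) simp
      then show "((\<lambda>x. h x * (z x)^2) has_vector_derivative (- m\<^sup>2 - (h x)^2) * (z x)^2 + h x * (2 * z x * z' x)) (at x within ?I)"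
        by (simp add: has_real_derivative_iff_has_vector_derivative)
    qed simp
    have int: "(\<lambda>x. (z x)^2) integrable_on ?I" "(\<lambda>x. (z' x)^2) integrable_on ?I"
      "(\<lambda>x. (z' x - h x * z x)^2) integrable_on ?I"
      using cz cz' ch by (auto intro!: integrable_continuous_real continuous_intros)
    have "0 \<le> integral ?I (\<lambda>x. (z' x - h x * z x)^2)"
      by (rule integral_nonneg[OF int(3)]) simp
    also have "(\<lambda>x. (z' x - h x * z x)^2) = (\<lambda>x. ((z' x)^2 - m^2 * (z x)^2) - ((- m\<^sup>2 - (h x)^2) * (z x)^2 + h x * (2 * z x * z' x)))"
      by (auto simp: power2_eq_square algebra_simps)
    also have "integral ?I \<dots> = integral ?I (\<lambda>x. (z' x)^2) - m^2 * integral ?I (\<lambda>x. (z x)^2) - 0"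
    proof (rule integral_unique, intro has_integral_diff has_integral_mult_right)
      show "((\<lambda>x. (- m\<^sup>2 - (h x)^2) * (z x)^2 + h x * (2 * z x * z' x)) has_integral 0) ?I"
        using F z0 by simp
    qed (use int in \<open>auto intro: integrable_integral\<close>)
    finally show ?thesis by simp
  qed
  have l: "(\<lambda>n. (1 - 1 / (real n + 2))) \<longlonglongrightarrow> 1" by real_asymp
  have "(\<lambda>n. (1 - 1 / (real n + 2))^2 * integral ?I (\<lambda>x. (z x)^2)) \<longlonglongrightarrow> 1^2 * integral ?I (\<lambda>x. (z x)^2)"
    by (intro tendsto_intros l)
  then have "1^2 * integral ?I (\<lambda>x. (z x)^2) \<le> integral ?I (\<lambda>x. (z' x)^2)"
    by (rule LIMSEQ_le_const2, intro exI[of _ 0] allI impI, intro le) (simp_all add: field_simps)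
  then show ?thesis by simp
qed

lemma integral_periodic_shift:
  fixes f :: "real \<Rightarrow> real"
  assumes c: "continuous_on UNIV f" and p: "\<And>x. f (x + T) = f x" and "0 \<le> \<alpha>" "\<alpha> \<le> T"
  shows "integral {\<alpha>..\<alpha> + T} f = integral {0..T} f"
proof -
  have i: "f integrable_on {a..b}" for a b using c continuous_on_subset by (blast intro: integrable_continuous_real)
  have "integral {\<alpha>..\<alpha> + T} f = integral {\<alpha>..T} f + integral {T..\<alpha> + T} f"
    using assms by (intro Henstock_Kurzweil_Integration.integral_combine[symmetric] i) auto
  also have "integral {T..\<alpha> + T} f = integral {0..\<alpha>} f"
    using integral_shift[of 0 T \<alpha> f] c p by (simp add: o_def continuous_on_subset)
  also have "integral {\<alpha>..T} f + integral {0..\<alpha>} f = integral {0..T} f"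
    using assms Henstock_Kurzweil_Integration.integral_combine[OF _ _ i, of 0 \<alpha> T] by simp
  finally show ?thesis .
qed

text \<open>The difference w(x) - w(x + \<pi>) changes sign over half a period, so w takes the same
  value k at some \<alpha> and at \<alpha> + \<pi>. Then w - k vanishes at the ends of two adjacent
  intervals of length \<pi>, and the inequality with Dirichlet conditions applies to both.\<close>

lemma wirtinger_periodic:
  fixes w w' :: "real \<Rightarrow> real"
  assumes d: "\<And>x. (w has_real_derivative w' x) (at x)" and c: "continuous_on UNIV w'"
    and p: "\<And>x. w (x + 2 * pi) = w x"
  shows "integral {0..2*pi} (\<lambda>x. (w x - integral {0..2*pi} w / (2*pi))^2) \<le> integral {0..2*pi} (\<lambda>x. (w' x)^2)"
proof -
  have cw: "continuous_on S w" for S using d by (intro DERIV_continuous_on) (rule has_field_derivative_at_within)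
  have cw': "continuous_on S w'" for S using c continuous_on_subset by blast
  have p': "w' (x + 2 * pi) = w' x" for x
  proof -
    have "((\<lambda>x. w (x + 2 * pi)) has_real_derivative w' (x + 2 * pi)) (at x)"
      using DERIV_shift[of w "w' (x + 2 * pi)" x "2 * pi"] d by blast
    then have "(w has_real_derivative w' (x + 2 * pi)) (at x)" using p by simp
    then show ?thesis using d DERIV_unique by blast
  qed
  define D where "D x = w x - w (x + pi)" for x
  have "\<exists>\<alpha>. 0 \<le> \<alpha> \<and> \<alpha> \<le> pi \<and> D \<alpha> = 0"
  proof -
    have Dpi: "D pi = - D 0" using p[of 0] by (simp add: D_def)
    have cD: "continuous_on S D" for S unfolding D_def
      by (intro continuous_intros cw continuous_on_compose2[OF cw[of UNIV]]) auto
    show ?thesis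
    proof (cases "D 0 \<le> 0")
      case True then show ?thesis using IVT'[of D 0 0 pi] Dpi cD by auto
    next
      case False then show ?thesis using IVT2'[of D pi 0 0] Dpi cD by auto
    qed
  qed
  then obtain \<alpha> where \<alpha>: "0 \<le> \<alpha>" "\<alpha> \<le> pi" "w \<alpha> = w (\<alpha> + pi)" by (auto simp: D_def)
  define k where "k = w \<alpha>"
  define z where "z x = w x - k" for x
  have dz: "(z has_real_derivative w' x) (at x)" for x unfolding z_def by (auto intro!: derivative_eq_intros d)
  have cz: "continuous_on S z" for S unfolding z_def by (intro continuous_intros cw)
  have z0: "z \<alpha> = 0" "z (\<alpha> + pi) = 0" "z (\<alpha> + pi + pi) = 0"
    using \<alpha> p[of \<alpha>] by (auto simp: z_def k_def algebra_simps)
  have i: "(\<lambda>x. (z x)^2) integrable_on {a..b}" "(\<lambda>x. (w' x)^2) integrable_on {a..b}" for a b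
    by (auto intro!: integrable_continuous_real continuous_intros cz cw')
  have split: "integral {\<alpha>..\<alpha> + 2 * pi} f = integral {\<alpha>..\<alpha>+pi} f + integral {\<alpha>+pi..\<alpha>+pi+pi} f"
    if "f integrable_on {\<alpha>..\<alpha> + 2 * pi}" for f :: "real \<Rightarrow> real"
    using Henstock_Kurzweil_Integration.integral_combine[of \<alpha> "\<alpha>+pi" "\<alpha>+2*pi" f] that by (simp add: algebra_simps)
  have "integral {\<alpha>..\<alpha> + 2 * pi} (\<lambda>x. (z x)^2) \<le> integral {\<alpha>..\<alpha> + 2 * pi} (\<lambda>x. (w' x)^2)"
    unfolding split[OF i(1)] split[OF i(2)]
    by (intro add_mono wirtinger_Dirichlet dz c z0)
  moreover have "integral {\<alpha>..\<alpha> + 2 * pi} (\<lambda>x. (z x)^2) = integral {0..2*pi} (\<lambda>x. (z x)^2)"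
    by (rule integral_periodic_shift) (use \<alpha> p in \<open>auto intro!: continuous_intros cw simp: z_def\<close>)
  moreover have "integral {\<alpha>..\<alpha> + 2 * pi} (\<lambda>x. (w' x)^2) = integral {0..2*pi} (\<lambda>x. (w' x)^2)"
    by (rule integral_periodic_shift) (use \<alpha> p' in \<open>auto intro!: continuous_intros cw'\<close>)
  ultimately have 1: "integral {0..2*pi} (\<lambda>x. (z x)^2) \<le> integral {0..2*pi} (\<lambda>x. (w' x)^2)" by simp
  \<comment> \<open>The mean is the constant closest to w in mean square: replacing M by k adds 2
    \<pi> (M - k)^2.\<close>
  define M where "M = integral {0..2*pi} w / (2*pi)"
  have ww: "w integrable_on {0..2*pi}" "(\<lambda>x. (w x - M)^2) integrable_on {0..2*pi}"
    "(\<lambda>x. a * w x) integrable_on {0..2*pi}" for a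
    by (auto intro!: integrable_continuous_real continuous_intros cw)
  have "(\<lambda>x. (z x)^2) = (\<lambda>x. (w x - M)^2 + (2 * (M - k) * w x + (k^2 - M^2)))"
    by (auto simp: z_def power2_eq_square algebra_simps)
  then have "integral {0..2*pi} (\<lambda>x. (z x)^2) = integral {0..2*pi} (\<lambda>x. (w x - M)^2 + (2 * (M - k) * w x + (k^2 - M^2)))"
    by simp
  also have "\<dots> = integral {0..2*pi} (\<lambda>x. (w x - M)^2) + (2 * (M - k) * integral {0..2*pi} w + 2 * pi * (k^2 - M^2))"
    using ww by (subst Henstock_Kurzweil_Integration.integral_add; (intro integrable_add)?)
      (simp_all add: Henstock_Kurzweil_Integration.integral_add integrable_const_ivl)
  also have "integral {0..2*pi} w = 2 * pi * M" by (simp add: M_def)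
  also have "2 * (M - k) * (2 * pi * M) + 2 * pi * (k^2 - M^2) = 2 * pi * (M - k)^2"
    by (simp add: power2_eq_square algebra_simps)
  finally have "integral {0..2*pi} (\<lambda>x. (w x - M)^2) \<le> integral {0..2*pi} (\<lambda>x. (z x)^2)" by simp
  then show ?thesis using 1 unfolding M_def by simp
qed

section \<open>Weak derivatives in the angle\<close>

definition smh :: "real \<Rightarrow> real \<Rightarrow> (real \<times> real \<Rightarrow> real) \<Rightarrow> (real \<times> real \<Rightarrow> real) \<Rightarrow> bool" where
  "smh a b G G2 \<longleftrightarrow> G \<in> borel_measurable borel \<and> G2 \<in> borel_measurable borel \<and>
     continuous_on ({a..b} \<times> UNIV) G \<and> continuous_on ({a..b} \<times> UNIV) G2 \<and>
     (\<forall>t\<in>{a..b}. \<forall>\<theta>. ((\<lambda>\<theta>. G (t, \<theta>)) has_real_derivative G2 (t, \<theta>)) (at \<theta>) \<and> G (t, \<theta> + 2 * pi) = G (t, \<theta>))"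

definition wkh :: "real \<Rightarrow> real \<Rightarrow> (real \<times> real \<Rightarrow> real) \<Rightarrow> (real \<times> real \<Rightarrow> real) \<Rightarrow> bool" where
  "wkh a b f f2 \<longleftrightarrow> (\<exists>G G2. (\<forall>n. smh a b (G n) (G2 n)) \<and> l2lim (cyl {a..b}) G f \<and> l2lim (cyl {a..b}) G2 f2)"

lemma wkhD: assumes "wkh a b f f2" shows "sqi (cyl {a..b}) f" "sqi (cyl {a..b}) f2"
  using assms unfolding wkh_def by (auto dest: l2limD)

lemma smh_add: "smh a b G G2 \<Longrightarrow> smh a b H H2 \<Longrightarrow> smh a b (\<lambda>p. G p + H p) (\<lambda>p. G2 p + H2 p)"
  unfolding smh_def by (auto intro!: continuous_intros derivative_intros)

lemma wkh_add: assumes "wkh a b f f2" "wkh a b g g2"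
  shows "wkh a b (\<lambda>p. f p + g p) (\<lambda>p. f2 p + g2 p)"
proof -
  obtain G G2 where G: "\<And>n. smh a b (G n) (G2 n)" "l2lim (cyl {a..b}) G f"
     "l2lim (cyl {a..b}) G2 f2" using assms(1) unfolding wkh_def by blast
  obtain H H2 where H: "\<And>n. smh a b (H n) (H2 n)" "l2lim (cyl {a..b}) H g"
     "l2lim (cyl {a..b}) H2 g2" using assms(2) unfolding wkh_def by blast
  show ?thesis unfolding wkh_def
    by (rule exI[of _ "\<lambda>n p. G n p + H n p"], rule exI[of _ "\<lambda>n p. G2 n p + H2 n p"])
      (use G H in \<open>auto intro!: smh_add l2lim_add\<close>)
qed

lemma smh_sqi: "smh a b G G2 \<Longrightarrow> sqi (cyl {a..b}) G \<and> sqi (cyl {a..b}) G2"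
  by (auto simp: smh_def intro!: sqi_cont_cyl)

lemma wkh_smooth: assumes "smh a b G G2" shows "wkh a b G G2"
  unfolding wkh_def
  by (rule exI[of _ "\<lambda>_. G"], rule exI[of _ "\<lambda>_. G2"]) (use assms smh_sqi in \<open>auto intro!: l2lim_const\<close>)

lemma smh_wirtinger:
  assumes "smh a b G G2"
  shows "(\<integral>p. (G p - mean G (fst p))^2 \<partial>cyl {a..b}) \<le> (\<integral>p. (G2 p)^2 \<partial>cyl {a..b})"
proof -
  have G: "G \<in> borel_measurable borel" "G2 \<in> borel_measurable borel"
    "continuous_on ({a..b} \<times> UNIV) G" "continuous_on ({a..b} \<times> UNIV) G2" using assms by (auto simp: smh_def)
  have sq: "sqi (cyl {a..b}) G" "sqi (cyl {a..b}) G2" using smh_sqi[OF assms] by auto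
  have "sqi (cyl {a..b}) (\<lambda>p. G p - mean G (fst p))" by (intro sqi_diff sqi_mean(1) sq) simp
  note 1 = sqiD(2)[OF this] and 2 = sqiD(2)[OF sq(2)]
  have AE: "AE t in lbI {a..b}. t \<in> {a..b}" by (subst AE_lbI) auto
  show ?thesis unfolding Fubini_cyl(2)[OF _ 1, simplified] Fubini_cyl(2)[OF _ 2, simplified]
  proof (rule integral_mono_AE)
    show "integrable (lbI {a..b}) (\<lambda>t. \<integral>\<theta>. (G (t, \<theta>) - mean G t)^2 \<partial>circ)"
      using Fubini_cyl(3)[OF _ 1] by simp
    show "integrable (lbI {a..b}) (\<lambda>t. \<integral>\<theta>. (G2 (t, \<theta>))^2 \<partial>circ)"
      using Fubini_cyl(3)[OF _ 2] by simp
    show "AE t in lbI {a..b}. (\<integral>\<theta>. (G (t, \<theta>) - mean G t)^2 \<partial>circ) \<le> (\<integral>\<theta>. (G2 (t, \<theta>))^2 \<partial>circ)"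
      using AE
    proof eventually_elim
      case (elim t)
      have c: "continuous_on S (\<lambda>\<theta>. G (t, \<theta>))" "continuous_on S (\<lambda>\<theta>. G2 (t, \<theta>))" for S
        using continuous_slice_snd[OF G(3) elim] continuous_slice_snd[OF G(4) elim] by auto
      have m: "mean G t = integral {0..2*pi} (\<lambda>\<theta>. G (t, \<theta>)) / (2 * pi)"
        unfolding mean_def by (subst integral_circ_eq) (auto intro: c measurable_slice_snd[OF G(1)])
      have "integral {0..2*pi} (\<lambda>\<theta>. (G (t, \<theta>) - mean G t)^2) \<le> integral {0..2*pi} (\<lambda>\<theta>. (G2 (t, \<theta>))^2)"
        unfolding m by (rule wirtinger_periodic) (use assms elim c in \<open>auto simp: smh_def\<close>)
      then show ?case
        by (subst (1 2) integral_circ_eq)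
          (auto intro!: continuous_intros c measurable_slice_snd[OF G(1)] measurable_slice_snd[OF G(2)] borel_measurable_power borel_measurable_diff)
    qed
  qed
qed

lemma wkh_wirtinger:
  assumes "wkh a b f f2"
  shows "(\<integral>p. (f p - mean f (fst p))^2 \<partial>cyl {a..b}) \<le> (\<integral>p. (f2 p)^2 \<partial>cyl {a..b})"
proof -
  obtain G G2 where G: "\<And>n. smh a b (G n) (G2 n)" "l2lim (cyl {a..b}) G f"
     "l2lim (cyl {a..b}) G2 f2" using assms(1) unfolding wkh_def by blast
  note d = l2lim_diff[OF G(2) l2lim_mean[OF G(2)]]
  show ?thesis
    using LIMSEQ_le[OF l2lim_inner[OF d d] l2lim_inner[OF G(3) G(3)]] smh_wirtinger[OF G(1)]
    by (auto simp: power2_eq_square)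
qed

lemma smh_ibp:
  assumes "smh a b G G2" "smh a b H H2"
  shows "(\<integral>p. G2 p * H p \<partial>cyl {a..b}) + (\<integral>p. G p * H2 p \<partial>cyl {a..b}) = 0"
proof -
  have sq: "sqi (cyl {a..b}) G" "sqi (cyl {a..b}) G2" "sqi (cyl {a..b}) H" "sqi (cyl {a..b}) H2"
    using smh_sqi[OF assms(1)] smh_sqi[OF assms(2)] by auto
  have i: "integrable (cyl {a..b}) (\<lambda>p. G2 p * H p)" "integrable (cyl {a..b}) (\<lambda>p. G p * H2 p)"
    using sq by (auto intro: sqi_mult_integrable)
  then have i2: "integrable (cyl {a..b}) (\<lambda>p. G2 p * H p + G p * H2 p)" by simp
  have AE: "AE t in lbI {a..b}. t \<in> {a..b}" by (subst AE_lbI) auto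
  have "(\<integral>\<theta>. G2 (t, \<theta>) * H (t, \<theta>) + G (t, \<theta>) * H2 (t, \<theta>) \<partial>circ) = 0" if t: "t \<in> {a..b}" for t
  proof -
    have c: "continuous_on S (\<lambda>\<theta>. G (t, \<theta>))" "continuous_on S (\<lambda>\<theta>. G2 (t, \<theta>))"
       "continuous_on S (\<lambda>\<theta>. H (t, \<theta>))" "continuous_on S (\<lambda>\<theta>. H2 (t, \<theta>))" for S
      using assms t by (auto simp: smh_def intro!: continuous_slice_snd[of "{a..b}"])
    have "((\<lambda>\<theta>. G2 (t, \<theta>) * H (t, \<theta>) + G (t, \<theta>) * H2 (t, \<theta>)) has_integral G (t, 2*pi) * H (t, 2*pi) - G (t, 0) * H (t, 0)) {0..2*pi}"
    proof (rule fundamental_theorem_of_calculus)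
      fix x
      have "((\<lambda>\<theta>. G (t, \<theta>)) has_real_derivative G2 (t, x)) (at x within {0..2*pi})"
          "((\<lambda>\<theta>. H (t, \<theta>)) has_real_derivative H2 (t, x)) (at x within {0..2*pi})"
        using assms t by (auto simp: smh_def intro: has_field_derivative_at_within)
      then have "((\<lambda>\<theta>. G (t, \<theta>) * H (t, \<theta>)) has_real_derivative G2 (t, x) * H (t, x) + G (t, x) * H2 (t, x)) (at x within {0..2*pi})"
        by (auto intro!: derivative_eq_intros)
      then show "((\<lambda>\<theta>. G (t, \<theta>) * H (t, \<theta>)) has_vector_derivative G2 (t, x) * H (t, x) + G (t, x) * H2 (t, x)) (at x within {0..2*pi})"
        by (simp add: has_real_derivative_iff_has_vector_derivative)
    qed simp
    moreover have "G (t, 2 * pi) = G (t, 0)" "H (t, 2 * pi) = H (t, 0)"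
      using assms t by (force simp: smh_def dest!: bspec[of _ _ t] spec[of _ 0])+
    ultimately have "integral {0..2*pi} (\<lambda>\<theta>. G2 (t, \<theta>) * H (t, \<theta>) + G (t, \<theta>) * H2 (t, \<theta>)) = 0"
      by (simp add: integral_unique)
    then show ?thesis
      using assms by (subst integral_circ_eq)
        (auto simp: smh_def intro!: continuous_intros c borel_measurable_add borel_measurable_times measurable_slice_snd)
  qed
  then have "(\<integral>t. \<integral>\<theta>. G2 (t, \<theta>) * H (t, \<theta>) + G (t, \<theta>) * H2 (t, \<theta>) \<partial>circ \<partial>lbI {a..b}) = 0"
    using AE by (intro integral_eq_zero_AE) auto
  then show ?thesis using Fubini_cyl(2)[OF _ i2] i by simp
qed

lemma wkh_ibp:
  assumes "wkh a b f f2" "smh a b H H2"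
  shows "(\<integral>p. f2 p * H p \<partial>cyl {a..b}) + (\<integral>p. f p * H2 p \<partial>cyl {a..b}) = 0"
proof -
  obtain G G2 where G: "\<And>n. smh a b (G n) (G2 n)" "l2lim (cyl {a..b}) G f"
     "l2lim (cyl {a..b}) G2 f2" using assms(1) unfolding wkh_def by blast
  have H: "l2lim (cyl {a..b}) (\<lambda>_. H) H" "l2lim (cyl {a..b}) (\<lambda>_. H2) H2"
    using smh_sqi[OF assms(2)] by (auto intro: l2lim_const)
  have "(\<lambda>n. (\<integral>p. G2 n p * H p \<partial>cyl {a..b}) + (\<integral>p. G n p * H2 p \<partial>cyl {a..b})) \<longlonglongrightarrow>
     (\<integral>p. f2 p * H p \<partial>cyl {a..b}) + (\<integral>p. f p * H2 p \<partial>cyl {a..b})"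
    by (intro tendsto_add l2lim_inner G H)
  then show ?thesis using smh_ibp[OF G(1) assms(2)] by (simp add: LIMSEQ_const_iff)
qed

section \<open>Functions determined by their polynomial moments\<close>

lemma nn_integral_pos_part_zero:
  fixes X :: "'a::euclidean_space \<Rightarrow> 'b::euclidean_space" and F :: "'a \<Rightarrow> real"
  assumes F: "integrable lborel F" and F0: "\<And>p. p \<notin> D \<Longrightarrow> F p = 0"
    and X: "continuous_on UNIV X" "inj_on X D" "bounded (X ` D)"
    and P: "\<And>h. real_polynomial_function h \<Longrightarrow> (\<integral>p. F p * h (X p) \<partial>lborel) = 0"
  shows "AE p in lborel. F p \<le> 0"
proof -
  define S where "S = closure (X ` D)"
  have S: "compact S" unfolding S_def using X(3) by (simp add: compact_closure)
  have XS: "X p \<in> S" if "F p \<noteq> 0" for p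
    using that F0[of p] closure_subset[of "X ` D"] unfolding S_def by blast
  have [measurable]: "F \<in> borel_measurable borel" using borel_measurable_integrable[OF F] by simp
  have Xm [measurable]: "X \<in> borel_measurable borel" by (rule borel_measurable_continuous_onI[OF X(1)])
  \<comment> \<open>Stone--Weierstrass on the compact closure of the image, with the error measured
    against the integral of |F|. The summand 1 in the denominator of \<open>e\<close> keeps it
    positive and makes the final estimate strict.\<close>
  have cont: "(\<integral>p. F p * h (X p) \<partial>lborel) = 0" if h: "continuous_on UNIV h" for h :: "'b \<Rightarrow> real"
  proof (rule ccontr)
    assume nz: "(\<integral>p. F p * h (X p) \<partial>lborel) \<noteq> 0"
    have [measurable]: "h \<in> borel_measurable borel" by (rule borel_measurable_continuous_onI[OF h])
    have int: "integrable lborel (\<lambda>p. F p * g (X p))" if g: "continuous_on UNIV g" for g :: "'b \<Rightarrow> real"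
    proof -
      have [measurable]: "g \<in> borel_measurable borel" by (rule borel_measurable_continuous_onI[OF g])
      have "compact (g ` S)" using g S by (intro compact_continuous_image) (auto intro: continuous_on_subset)
      then obtain B where B: "\<And>x. x \<in> S \<Longrightarrow> \<bar>g x\<bar> \<le> B" using compact_imp_bounded by (force simp: bounded_iff)
      show ?thesis
      proof (rule Bochner_Integration.integrable_bound[of _ "\<lambda>p. B * F p"])
        have "\<bar>F p * g (X p)\<bar> \<le> \<bar>B * F p\<bar>" for p
        proof (cases "F p = 0")
          case False
          then have "\<bar>g (X p)\<bar> \<le> \<bar>B\<bar>" using B[OF XS] by fastforce
          then have "\<bar>F p\<bar> * \<bar>g (X p)\<bar> \<le> \<bar>F p\<bar> * \<bar>B\<bar>" by (intro mult_left_mono) auto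
          then show ?thesis by (simp add: abs_mult mult.commute)
        qed simp
        then show "AE p in lborel. norm (F p * g (X p)) \<le> norm (B * F p)" by simp
      qed (use F in auto)
    qed
    define I where "I = (\<integral>p. \<bar>F p\<bar> \<partial>lborel)"
    define e where "e = \<bar>\<integral>p. F p * h (X p) \<partial>lborel\<bar> / (I + 1)"
    have I0: "I \<ge> 0" unfolding I_def by simp
    then have e: "e > 0" unfolding e_def using nz by simp
    obtain g where g: "real_polynomial_function g" "\<And>x. x \<in> S \<Longrightarrow> \<bar>h x - g x\<bar> < e"
      using Stone_Weierstrass_real_polynomial_function[OF S _ e] continuous_on_subset[OF h] by blast
    have cg: "continuous_on UNIV g"
      using g(1) continuous_real_polymonial_function by (auto simp: continuous_on_eq_continuous_at)
    have "(\<integral>p. F p * h (X p) \<partial>lborel) = (\<integral>p. F p * h (X p) - F p * g (X p) \<partial>lborel)"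
      using int[OF h] int[OF cg] P[OF g(1)] by simp
    also have "\<bar>\<dots>\<bar> \<le> (\<integral>p. \<bar>F p * h (X p) - F p * g (X p)\<bar> \<partial>lborel)" by (rule integral_abs_bound)
    also have "\<dots> \<le> (\<integral>p. e * \<bar>F p\<bar> \<partial>lborel)"
    proof (rule integral_mono)
      fix p
      show "\<bar>F p * h (X p) - F p * g (X p)\<bar> \<le> e * \<bar>F p\<bar>"
      proof (cases "F p = 0")
        case False
        then have "\<bar>h (X p) - g (X p)\<bar> \<le> e" using g(2)[OF XS] by force
        then have "\<bar>F p\<bar> * \<bar>h (X p) - g (X p)\<bar> \<le> \<bar>F p\<bar> * e" by (intro mult_left_mono) auto
        then show ?thesis by (simp add: right_diff_distrib[symmetric] abs_mult mult.commute)
      qed simp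
    qed (use F int[OF h] int[OF cg] in auto)
    also have "\<dots> = e * I" by (simp add: I_def)
    also have "\<dots> < e * (I + 1)" using e by simp
    also have "\<dots> = \<bar>\<integral>p. F p * h (X p) \<partial>lborel\<bar>" using I0 by (simp add: e_def)
    finally show False by simp
  qed
  \<comment> \<open>Injectivity enters here: a point of D outside K is mapped outside the compact
    image of K, so the functions \<open>h n\<close> of the distance to that image tend to the
    indicator of K wherever F is not zero.\<close>
  have comp: "(\<integral>p. F p * indicator K p \<partial>lborel) = 0" if K: "compact K" "K \<subseteq> D" for K
  proof (cases "K = {}")
    case False
    have XK: "closed (X ` K)" "X ` K \<noteq> {}"
      using compact_continuous_image[OF continuous_on_subset[OF X(1)] K(1)] False by (auto intro: compact_imp_closed)
    define h where "h n x = max 0 (1 - real n * infdist x (X ` K))" for n :: nat and x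
    have ch: "continuous_on UNIV (h n)" for n unfolding h_def by (intro continuous_intros)
    then have [measurable]: "h n \<in> borel_measurable borel" for n by (rule borel_measurable_continuous_onI)
    have "(\<lambda>n. \<integral>p. F p * h n (X p) \<partial>lborel) \<longlonglongrightarrow> (\<integral>p. F p * indicator K p \<partial>lborel)"
    proof (rule integral_dominated_convergence[where w = "\<lambda>p. \<bar>F p\<bar>"])
      show "AE p in lborel. (\<lambda>n. F p * h n (X p)) \<longlonglongrightarrow> F p * indicator K p"
      proof (rule AE_I2)
        fix p
        show "(\<lambda>n. F p * h n (X p)) \<longlonglongrightarrow> F p * indicator K p"
        proof (cases "F p = 0 \<or> p \<in> K")
          case True
          then show ?thesis by (auto simp: h_def)
        next
          case False
          then have "X p \<notin> X ` K" using F0[of p] K(2) X(2) by (auto simp: inj_on_def)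
          then have d: "infdist (X p) (X ` K) > 0"
            using XK in_closed_iff_infdist_zero[of "X ` K" "X p"] infdist_nonneg[of "X p" "X ` K"] by force
          obtain N :: nat where N: "1 / infdist (X p) (X ` K) < real N" using reals_Archimedean2 by blast
          have "h n (X p) = 0" if "n \<ge> N" for n
          proof -
            have "1 / infdist (X p) (X ` K) < real n" using N that by linarith
            then have "1 < real n * infdist (X p) (X ` K)" using d by (simp add: pos_divide_less_eq)
            then show ?thesis by (simp add: h_def)
          qed
          then have "\<forall>\<^sub>F n in sequentially. F p * h n (X p) = F p * indicator K p"
            using False by (auto simp: eventually_sequentially intro!: exI[of _ N])
          then show ?thesis by (rule tendsto_eventually)
        qed
      qed
      show "AE p in lborel. norm (F p * h n (X p)) \<le> \<bar>F p\<bar>" for n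
      proof (rule AE_I2)
        fix p
        have "\<bar>h n (X p)\<bar> \<le> 1" using infdist_nonneg[of "X p" "X ` K"] by (auto simp: h_def)
        then show "norm (F p * h n (X p)) \<le> \<bar>F p\<bar>" by (simp add: abs_mult mult_left_le)
      qed
      show "(\<lambda>p. F p * indicator K p) \<in> borel_measurable lborel"
        using K(1) by (auto intro!: borel_measurable_times borel_measurable_indicator borel_compact)
    qed (use F in auto)
    then show ?thesis using cont[OF ch] by (simp add: LIMSEQ_const_iff)
  qed simp
  \<comment> \<open>Inner regularity of the finite measure with density |F|: the set where F > 0 is
    approximated by compact subsets, and on these the integral of F is zero.\<close>
  define M where "M = density lborel (\<lambda>p. ennreal \<bar>F p\<bar>)"
  have Mfin: "emeasure M (space M) \<noteq> \<infinity>"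
    using F unfolding M_def by (simp add: emeasure_density integrable_iff_bounded)
  define A where "A = {p. F p > 0}"
  have A: "A \<in> sets borel" unfolding A_def by measurable
  have z: "emeasure M K = 0" if K: "K \<subseteq> A" "compact K" for K
  proof -
    have [measurable]: "K \<in> sets borel" using K(2) by (rule borel_compact)
    have KD: "K \<subseteq> D" using K(1) F0 unfolding A_def by force
    have int: "integrable lborel (\<lambda>p. F p * indicator K p)"
      by (rule Bochner_Integration.integrable_bound[OF F]) (auto simp: indicator_def)
    have "emeasure M K = (\<integral>\<^sup>+p. ennreal (F p * indicator K p) \<partial>lborel)"
      unfolding M_def using K(1) by (subst emeasure_density) (auto intro!: nn_integral_cong simp: A_def indicator_def)
    also have "\<dots> = ennreal (\<integral>p. F p * indicator K p \<partial>lborel)"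
      by (rule nn_integral_eq_integral[OF int], rule AE_I2) (use K(1) in \<open>auto simp: A_def indicator_def intro: less_imp_le\<close>)
    finally show ?thesis using comp[OF K(2) KD] by simp
  qed
  have "emeasure M A = (SUP K\<in>{K. K \<subseteq> A \<and> compact K}. emeasure M K)"
    by (rule inner_regular) (use A Mfin in \<open>auto simp: M_def\<close>)
  also have "\<dots> = 0" using z by (auto intro!: SUP_eq_const)
  finally have "(\<integral>\<^sup>+p. ennreal \<bar>F p\<bar> * indicator A p \<partial>lborel) = 0"
    unfolding M_def using A by (subst (asm) emeasure_density) auto
  then have "AE p in lborel. ennreal \<bar>F p\<bar> * indicator A p = 0"
    using A by (subst (asm) nn_integral_0_iff_AE) auto
  then show ?thesis by eventually_elim (auto simp: A_def indicator_def split: if_splits)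
qed

text \<open>By Stone--Weierstrass: the polynomials separate the points of \<open>D\<close> through \<open>X\<close>.\<close>

lemma AE_zero_if_polynomial_moments_zero:
  fixes X :: "'a::euclidean_space \<Rightarrow> 'b::euclidean_space" and F :: "'a \<Rightarrow> real"
  assumes F: "integrable lborel F" and F0: "\<And>p. p \<notin> D \<Longrightarrow> F p = 0"
    and X: "continuous_on UNIV X" "inj_on X D" "bounded (X ` D)"
    and P: "\<And>h. real_polynomial_function h \<Longrightarrow> (\<integral>p. F p * h (X p) \<partial>lborel) = 0"
  shows "AE p in lborel. F p = 0"
proof -
  have "AE p in lborel. F p \<le> 0" by (rule nn_integral_pos_part_zero[OF F F0 X P])
  moreover have "AE p in lborel. - F p \<le> 0"
    by (rule nn_integral_pos_part_zero[of "\<lambda>p. - F p" D X]) (use F F0 X P in auto)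
  ultimately show ?thesis by eventually_elim simp
qed

section \<open>Periodic functions and the weak equation v'' = -v\<close>

definition c1per :: "(real \<Rightarrow> real) \<Rightarrow> (real \<Rightarrow> real) \<Rightarrow> bool" where
  "c1per \<eta> \<eta>' \<longleftrightarrow> (\<forall>x. (\<eta> has_real_derivative \<eta>' x) (at x)) \<and> continuous_on UNIV \<eta>' \<and> (\<forall>x. \<eta> (x + 2 * pi) = \<eta> x)"

lemma c1per_cont: assumes "c1per \<eta> \<eta>'" shows "continuous_on S \<eta>" "continuous_on S \<eta>'"
proof -
  show "continuous_on S \<eta>"
    by (rule DERIV_continuous_on[of _ _ \<eta>'])
      (use assms in \<open>auto simp: c1per_def intro: has_field_derivative_at_within\<close>)
  show "continuous_on S \<eta>'" using assms continuous_on_subset by (auto simp: c1per_def)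
qed

lemma c1per_sqi: assumes "c1per \<eta> \<eta>'" shows "sqi circ \<eta>" "sqi circ \<eta>'"
  using c1per_cont[OF assms] by (auto intro!: sqi_cont_circ borel_measurable_continuous_onI)

lemma c1per_mult:
  assumes "c1per \<eta> \<eta>'" "c1per \<zeta> \<zeta>'"
  shows "c1per (\<lambda>x. \<zeta> x * \<eta> x) (\<lambda>x. \<zeta>' x * \<eta> x + \<zeta> x * \<eta>' x)"
  using assms c1per_cont[OF assms(1)] c1per_cont[OF assms(2)] unfolding c1per_def
  by (auto intro!: derivative_eq_intros continuous_intros)

lemma c1per_cos: "c1per cos (\<lambda>x. - sin x)" and c1per_sin: "c1per sin cos"
  by (auto simp: c1per_def intro!: derivative_eq_intros continuous_intros)

lemma c1per_integral_zero: assumes "c1per \<eta> \<eta>'" shows "(\<integral>\<theta>. \<eta>' \<theta> \<partial>circ) = 0"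
proof -
  have "(\<eta>' has_integral \<eta> (2*pi) - \<eta> 0) {0..2*pi}"
    using assms unfolding c1per_def
    by (intro fundamental_theorem_of_calculus)
     (auto simp: has_real_derivative_iff_has_vector_derivative[symmetric] intro: has_field_derivative_at_within)
  moreover have "\<eta> (2*pi) = \<eta> 0" using assms unfolding c1per_def by (metis add_0)
  ultimately show ?thesis
    using c1per_cont[OF assms] by (subst integral_circ_eq) (auto intro!: borel_measurable_continuous_onI integral_unique)
qed

lemma c1per_antiderivative:
  assumes c: "continuous_on UNIV g" and p: "\<And>x. g (x + 2 * pi) = g x" and z: "(\<integral>\<theta>. g \<theta> \<partial>circ) = 0"
  shows "\<exists>\<eta>. c1per \<eta> g"
proof -
  define \<eta> where "\<eta> x = (LBINT y=0..x. g y)" for x :: real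
  have cs: "continuous_on S g" for S using c continuous_on_subset by blast
  have d: "(\<eta> has_real_derivative g x) (at x)" for x
  proof -
    define R where "R = \<bar>x\<bar> + 1"
    have "(\<eta> has_vector_derivative g x) (at x within {-R..R})"
      unfolding \<eta>_def zero_ereal_def by (rule interval_integral_FTC2) (auto simp: R_def cs)
    moreover have "at x within {-R..R} = at x" by (rule at_within_interior) (auto simp: R_def)
    ultimately show ?thesis by (simp add: has_real_derivative_iff_has_vector_derivative)
  qed
  define D where "D x = \<eta> (x + 2 * pi) - \<eta> x" for x
  have "(D has_real_derivative 0) (at x)" for x
  proof -
    have "((\<lambda>x. \<eta> (x + 2 * pi)) has_real_derivative g (x + 2 * pi)) (at x)"
      using DERIV_shift[of \<eta> "g (x + 2 * pi)" x "2 * pi"] d by blast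
    from DERIV_diff[OF this d[of x]] show ?thesis unfolding D_def using p by simp
  qed
  then have "D x = D 0" for x using DERIV_isconst_all by blast
  moreover have "D 0 = 0"
  proof -
    have "(g has_integral \<eta> (2*pi) - \<eta> 0) {0..2*pi}"
      by (intro fundamental_theorem_of_calculus)
       (auto simp: has_real_derivative_iff_has_vector_derivative[symmetric] intro: has_field_derivative_at_within d)
    then show ?thesis using z cs by (subst (asm) integral_circ_eq) (auto simp: D_def integral_unique intro!: borel_measurable_continuous_onI)
  qed
  ultimately have "\<eta> (x + 2 * pi) = \<eta> x" for x by (metis D_def eq_iff_diff_eq_0)
  then show ?thesis using d c unfolding c1per_def by blast
qed

lemma inj_cos_sin: "inj_on (\<lambda>\<theta>. (cos \<theta>, sin \<theta>)) {0..<2 * pi}"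
proof (rule inj_onI)
  fix x y assume *: "x \<in> {0..<2 * pi}" "y \<in> {0..<2 * pi}" "(cos x, sin x) = (cos y, sin y)"
  then obtain n :: int where n: "x = y + 2 * pi * n" using sin_cos_eq_iff[of x y] by auto
  have "2 * pi * n < 2 * pi * 1" "2 * pi * (-1) < 2 * pi * n"
    using *(1,2) n unfolding atLeastLessThan_iff by linarith+
  then have "real_of_int n < 1" "-1 < real_of_int n"
    unfolding mult_less_cancel_left_pos[of "2 * pi", OF mult_pos_pos[OF zero_less_numeral pi_gt_zero]] by auto
  then have "n = 0" by linarith
  then show "x = y" using n by simp
qed

text \<open>The du Bois-Reymond lemma on the circle. A polynomial in cos and sin minus its mean is
  the derivative of a periodic function, so A minus its mean has zero moments against all such
  polynomials.\<close>

lemma circ_AE_const: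
  assumes A: "sqi circ A" and o: "\<And>\<eta> \<eta>'. c1per \<eta> \<eta>' \<Longrightarrow> (\<integral>\<theta>. A \<theta> * \<eta>' \<theta> \<partial>circ) = 0"
  shows "\<exists>k. AE \<theta> in circ. A \<theta> = k"
proof -
  define k where "k = (\<integral>\<theta>. A \<theta> \<partial>circ) / (2 * pi)"
  have iA: "integrable circ A" by (rule sqi_integrable[OF finite_circ A])
  have mA: "A \<in> borel_measurable borel" using sqiD(1)[OF A] by simp
  define F where "F \<theta> = indicator {0..<2*pi} \<theta> * (A \<theta> - k)" for \<theta>
  have one: "sqi circ (\<lambda>_. k)" for k by (rule sqi_bounded[OF finite_circ, of _ "\<bar>k\<bar>"]) auto
  have "AE \<theta> in lborel. F \<theta> = 0"
  proof (rule AE_zero_if_polynomial_moments_zero[where D = "{0..<2*pi}" and X = "\<lambda>\<theta>. (cos \<theta>, sin \<theta>)"])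
    have "integrable circ (\<lambda>\<theta>. A \<theta> - k)" using sqi_integrable[OF finite_circ sqi_diff[OF A one]] .
    then show "integrable lborel F" unfolding F_def circ_def using mA by (subst (asm) integrable_lbI) auto
    show "bounded ((\<lambda>\<theta>. (cos \<theta>, sin \<theta>)) ` {0..<2 * pi})"
      by (rule boundedI[of _ 2]) (auto simp: norm_Pair)
    show "(\<integral>\<theta>. F \<theta> * h (cos \<theta>, sin \<theta>) \<partial>lborel) = 0" if h: "real_polynomial_function h" for h
    proof -
      define g where "g \<theta> = h (cos \<theta>, sin \<theta>)" for \<theta>
      have "continuous_on UNIV h"
        using h continuous_real_polymonial_function by (auto simp: continuous_on_eq_continuous_at)
      then have cg: "continuous_on S g" for S unfolding g_def
        by (rule continuous_on_compose2) (auto intro!: continuous_intros)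
      have mg: "g \<in> borel_measurable borel" by (rule borel_measurable_continuous_onI[OF cg])
      have gper: "g (x + 2 * pi) = g x" for x by (simp add: g_def)
      define gm where "gm = (\<integral>\<theta>. g \<theta> \<partial>circ) / (2 * pi)"
      have sg: "sqi circ g" by (rule sqi_cont_circ[OF cg mg])
      have ig: "integrable circ g" by (rule sqi_integrable[OF finite_circ sg])
      have "(\<integral>\<theta>. g \<theta> - gm \<partial>circ) = 0"
        using ig finite_measure.integrable_const[OF finite_circ, of gm] by (simp add: gm_def)
      then obtain \<eta> where \<eta>: "c1per \<eta> (\<lambda>\<theta>. g \<theta> - gm)"
        using c1per_antiderivative[of "\<lambda>\<theta>. g \<theta> - gm"] gper continuous_on_diff[OF cg continuous_on_const] by auto
      have "(\<integral>\<theta>. F \<theta> * g \<theta> \<partial>lborel) = (\<integral>\<theta>. (A \<theta> - k) * g \<theta> \<partial>circ)"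
        unfolding F_def circ_def using mA mg by (subst integral_lbI) (auto simp: mult.assoc)
      also have "(\<lambda>\<theta>. (A \<theta> - k) * g \<theta>) = (\<lambda>\<theta>. A \<theta> * (g \<theta> - gm) + (gm * A \<theta> - k * g \<theta>))"
        by (auto simp: algebra_simps)
      also have "(\<integral>\<theta>. A \<theta> * (g \<theta> - gm) + (gm * A \<theta> - k * g \<theta>) \<partial>circ) = 0 + (gm * (\<integral>\<theta>. A \<theta> \<partial>circ) - k * (\<integral>\<theta>. g \<theta> \<partial>circ))"
        using iA ig o[OF \<eta>] sqi_mult_integrable[OF A sqi_diff[OF sg one]] by simp
      also have "\<dots> = 0" by (simp add: gm_def k_def)
      finally show ?thesis by (simp add: g_def)
    qed
  qed (auto simp: F_def inj_cos_sin intro!: continuous_intros)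
  then have "AE \<theta> in circ. A \<theta> = k" by (subst AE_circ) (auto simp: F_def elim!: eventually_mono)
  then show ?thesis by blast
qed

text \<open>Hypotheses \<open>2\<close> and \<open>1\<close> say weakly that z = v' and z' = -v. The
  combinations cos v - sin z and sin v + cos z are first integrals of this system: their weak
  derivatives vanish, so they are constant, and v is recovered from them by a rotation.\<close>

lemma first_harmonics:
  assumes v: "sqi circ v" and z: "sqi circ z"
    and 1: "\<And>\<eta> \<eta>'. c1per \<eta> \<eta>' \<Longrightarrow> (\<integral>\<theta>. z \<theta> * \<eta>' \<theta> \<partial>circ) = (\<integral>\<theta>. v \<theta> * \<eta> \<theta> \<partial>circ)"
    and 2: "\<And>\<eta> \<eta>'. c1per \<eta> \<eta>' \<Longrightarrow> (\<integral>\<theta>. z \<theta> * \<eta> \<theta> \<partial>circ) = - (\<integral>\<theta>. v \<theta> * \<eta>' \<theta> \<partial>circ)"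
  shows "\<exists>B C. AE \<theta> in circ. v \<theta> = B * cos \<theta> + C * sin \<theta>"
proof -
  have b: "sqi circ (\<lambda>\<theta>. cos \<theta> * w \<theta>)" "sqi circ (\<lambda>\<theta>. sin \<theta> * w \<theta>)" if "sqi circ w" for w
    using that by (auto intro!: sqi_bounded_mult[where B = 1] borel_measurable_continuous_onI continuous_intros)
  have A: "\<exists>k. AE \<theta> in circ. cos \<theta> * v \<theta> - sin \<theta> * z \<theta> = k"
  proof (rule circ_AE_const)
    show "sqi circ (\<lambda>\<theta>. cos \<theta> * v \<theta> - sin \<theta> * z \<theta>)" by (intro sqi_diff b v z)
    fix \<eta> \<eta>' assume \<eta>: "c1per \<eta> \<eta>'"
    note s = c1per_sqi[OF \<eta>]
    note i = sqi_mult_integrable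
    have e1: "(\<integral>\<theta>. z \<theta> * (cos \<theta> * \<eta> \<theta>) \<partial>circ) + (\<integral>\<theta>. z \<theta> * (sin \<theta> * \<eta>' \<theta>) \<partial>circ) = (\<integral>\<theta>. v \<theta> * (sin \<theta> * \<eta> \<theta>) \<partial>circ)"
      using 1[OF c1per_mult[OF \<eta> c1per_sin]] i[OF z b(1)[OF s(1)]] i[OF z b(2)[OF s(2)]] by (simp add: distrib_left)
    have e2: "(\<integral>\<theta>. z \<theta> * (cos \<theta> * \<eta> \<theta>) \<partial>circ) = (\<integral>\<theta>. v \<theta> * (sin \<theta> * \<eta> \<theta>) \<partial>circ) - (\<integral>\<theta>. v \<theta> * (cos \<theta> * \<eta>' \<theta>) \<partial>circ)"
      using 2[OF c1per_mult[OF \<eta> c1per_cos]] i[OF v b(2)[OF s(1)]] i[OF v b(1)[OF s(2)]]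
      by (simp add: distrib_left right_diff_distrib)
    have "(\<lambda>\<theta>. (cos \<theta> * v \<theta> - sin \<theta> * z \<theta>) * \<eta>' \<theta>) = (\<lambda>\<theta>. v \<theta> * (cos \<theta> * \<eta>' \<theta>) - z \<theta> * (sin \<theta> * \<eta>' \<theta>))"
      by (auto simp: algebra_simps)
    then show "(\<integral>\<theta>. (cos \<theta> * v \<theta> - sin \<theta> * z \<theta>) * \<eta>' \<theta> \<partial>circ) = 0"
      using e1 e2 i[OF v b(1)[OF s(2)]] i[OF z b(2)[OF s(2)]] by simp
  qed
  have B: "\<exists>k. AE \<theta> in circ. sin \<theta> * v \<theta> + cos \<theta> * z \<theta> = k"
  proof (rule circ_AE_const)
    show "sqi circ (\<lambda>\<theta>. sin \<theta> * v \<theta> + cos \<theta> * z \<theta>)" by (intro sqi_add b v z)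
    fix \<eta> \<eta>' assume \<eta>: "c1per \<eta> \<eta>'"
    note s = c1per_sqi[OF \<eta>]
    note i = sqi_mult_integrable
    have e1: "(\<integral>\<theta>. z \<theta> * (cos \<theta> * \<eta>' \<theta>) \<partial>circ) - (\<integral>\<theta>. z \<theta> * (sin \<theta> * \<eta> \<theta>) \<partial>circ) = (\<integral>\<theta>. v \<theta> * (cos \<theta> * \<eta> \<theta>) \<partial>circ)"
      using 1[OF c1per_mult[OF \<eta> c1per_cos]] i[OF z b(2)[OF s(1)]] i[OF z b(1)[OF s(2)]] by (simp add: distrib_left right_diff_distrib)
    have e2: "(\<integral>\<theta>. z \<theta> * (sin \<theta> * \<eta> \<theta>) \<partial>circ) = - (\<integral>\<theta>. v \<theta> * (cos \<theta> * \<eta> \<theta>) \<partial>circ) - (\<integral>\<theta>. v \<theta> * (sin \<theta> * \<eta>' \<theta>) \<partial>circ)"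
      using 2[OF c1per_mult[OF \<eta> c1per_sin]] i[OF v b(1)[OF s(1)]] i[OF v b(2)[OF s(2)]] by (simp add: distrib_left)
    have "(\<lambda>\<theta>. (sin \<theta> * v \<theta> + cos \<theta> * z \<theta>) * \<eta>' \<theta>) = (\<lambda>\<theta>. v \<theta> * (sin \<theta> * \<eta>' \<theta>) + z \<theta> * (cos \<theta> * \<eta>' \<theta>))"
      by (auto simp: algebra_simps)
    then show "(\<integral>\<theta>. (sin \<theta> * v \<theta> + cos \<theta> * z \<theta>) * \<eta>' \<theta> \<partial>circ) = 0"
      using e1 e2 i[OF v b(2)[OF s(2)]] i[OF z b(1)[OF s(2)]] by simp
  qed
  obtain P where P: "AE \<theta> in circ. cos \<theta> * v \<theta> - sin \<theta> * z \<theta> = P" using A by blast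
  obtain R where R: "AE \<theta> in circ. sin \<theta> * v \<theta> + cos \<theta> * z \<theta> = R" using B by blast
  have "AE \<theta> in circ. v \<theta> = P * cos \<theta> + R * sin \<theta>"
    using P R
  proof eventually_elim
    case (elim \<theta>)
    have "P * cos \<theta> + R * sin \<theta> = v \<theta> * ((sin \<theta>)^2 + (cos \<theta>)^2)"
      unfolding elim[symmetric] by algebra
    then show ?case by simp
  qed
  then show ?thesis by blast
qed

section \<open>The stability form of a half catenoid\<close>

definition th :: "real \<Rightarrow> real" where "th t = tanh (t + ln (sqrt 3))"
definition se :: "real \<Rightarrow> real" where "se t = 1 / cosh (t + ln (sqrt 3))"

lemma cosh_ln_sqrt3: "cosh (ln (sqrt 3)) = 2 / sqrt (3::real)"
  and sinh_ln_sqrt3: "sinh (ln (sqrt 3)) = 1 / sqrt (3::real)"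
proof -
  have "sqrt 3 + inverse (sqrt 3) = 4 / sqrt (3::real)" "sqrt 3 - inverse (sqrt 3) = 2 / sqrt (3::real)"
    by (simp_all add: divide_simps)
  then show "cosh (ln (sqrt 3)) = 2 / sqrt (3::real)" "sinh (ln (sqrt 3)) = 1 / sqrt (3::real)"
    by (simp_all add: cosh_ln_real sinh_ln_real)
qed

text \<open>\<open>th\<close> is the radial component of the unit tangent of the profile curve of a
  catenoid; its value 1/2 on the circle is the 120 degree condition.\<close>

lemma th_0: "th 0 = 1 / 2" by (simp add: th_def tanh_def cosh_ln_sqrt3 sinh_ln_sqrt3)
lemma se_0: "se 0 = sqrt 3 / 2" by (simp add: se_def cosh_ln_sqrt3)

lemma th_se: "(th t)^2 = 1 - (se t)^2"
proof -
  have "cosh (t + ln (sqrt 3)) \<noteq> 0" by (simp add: cosh_real_nonzero)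
  moreover have "cosh (t + ln (sqrt 3)) ^ 2 - sinh (t + ln (sqrt 3)) ^ 2 = 1" by (rule hyperbolic_pythagoras)
  then have "sinh (t + ln (sqrt 3)) ^ 2 = cosh (t + ln (sqrt 3)) ^ 2 - 1" by linarith
  ultimately show ?thesis by (simp add: th_def se_def tanh_def power_divide diff_divide_distrib)
qed

lemma se_pos: "se t > 0" by (simp add: se_def cosh_real_pos)
lemma se_le_1: "se t \<le> 1" by (simp add: se_def cosh_real_ge_1)

lemma th_ge: "t \<ge> 0 \<Longrightarrow> th t \<ge> 1 / 2"
proof -
  assume "t \<ge> 0"
  then have "tanh (0 + ln (sqrt 3)) \<le> tanh (t + ln (sqrt 3))" unfolding tanh_real_le_iff by linarith
  then show "th t \<ge> 1 / 2" using th_0 unfolding th_def by linarith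
qed

lemma th_abs: "\<bar>th t\<bar> \<le> 1"
proof -
  have "(th t)^2 \<le> 1" unfolding th_se by simp
  then show ?thesis unfolding abs_square_le_1 .
qed

lemma se_le_exp: "se t \<le> 2 * exp (- t)"
proof -
  have "exp (t + ln (sqrt 3)) / 2 \<le> cosh (t + ln (sqrt 3))" by (simp add: cosh_def)
  moreover have "exp t \<le> exp (t + ln (sqrt 3))" by simp
  ultimately have "exp t / 2 \<le> cosh (t + ln (sqrt 3))" by linarith
  then have "1 / cosh (t + ln (sqrt 3)) \<le> 1 / (exp t / 2)" by (intro divide_left_mono) (auto simp: cosh_real_pos)
  then show ?thesis by (simp add: se_def exp_minus field_simps)
qed

lemma se_sq_le: "(se t)^2 \<le> 2 * exp (- t)"
proof -
  have "(se t)^2 \<le> 1 * se t" unfolding power2_eq_square using se_le_1[of t] se_pos[of t] by (intro mult_right_mono) auto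
  then show ?thesis using se_le_exp[of t] by simp
qed

lemma th_deriv: "(th has_real_derivative (se t)^2) (at t within S)"
proof -
  have "(th has_real_derivative (1 - (tanh (t + ln (sqrt 3)))^2)) (at t within S)"
    unfolding th_def by (auto intro!: derivative_eq_intros simp: cosh_real_nonzero)
  then show ?thesis using th_se[of t] unfolding th_def[symmetric] by simp
qed

lemma se_deriv: "(se has_real_derivative - (th t * se t)) (at t within S)"
proof -
  have "(se has_real_derivative - (sinh (t + ln (sqrt 3)) / (cosh (t + ln (sqrt 3)) * cosh (t + ln (sqrt 3))))) (at t within S)"
    unfolding se_def by (auto intro!: derivative_eq_intros simp: cosh_real_nonzero)
  then show ?thesis unfolding th_def se_def tanh_def by simp
qed

lemma cont_th [continuous_intros]: "continuous_on S f \<Longrightarrow> continuous_on S (\<lambda>x. th (f x))"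
  unfolding th_def by (intro continuous_intros) (auto simp: cosh_real_nonzero)

lemma cont_se [continuous_intros]: "continuous_on S f \<Longrightarrow> continuous_on S (\<lambda>x. se (f x))"
  unfolding se_def by (intro continuous_intros) (auto simp: cosh_real_nonzero)

lemma meas_th [measurable]: "th \<in> borel_measurable borel"
  and meas_se [measurable]: "se \<in> borel_measurable borel"
  by (auto intro!: borel_measurable_continuous_onI continuous_intros)

section \<open>Integrals over the unbounded half cylinder\<close>

lemma integrable_exp_neg: "integrable (lbI {0..}) (\<lambda>t. exp (- t))"
proof -
  have "(\<integral>\<^sup>+t. ennreal (exp (- t)) * indicator {0..} t \<partial>lborel) = ennreal (0 - (- exp (- 0)))"
  proof (rule nn_integral_FTC_atLeast[where F = "\<lambda>t. - exp (- t)"])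
    show "((\<lambda>t::real. - exp (- t)) \<longlongrightarrow> 0) at_top" by real_asymp
  qed (auto intro!: derivative_eq_intros)
  then have fin: "(\<integral>\<^sup>+t. ennreal (norm (indicator {0..} t * exp (- t) :: real)) \<partial>lborel) < \<infinity>"
    by (simp add: abs_mult ennreal_mult ennreal_indicator[symmetric] mult.commute)
  have "integrable lborel (\<lambda>t. indicator {0..} t * exp (- t) :: real)"
    by (rule integrableI_bounded[OF _ fin]) measurable
  then show ?thesis by (subst integrable_lbI) auto
qed

text \<open>Square integrability against exp (-t), a weight that dominates the potential 2
  \<open>se\<close>^2 up to a constant. It is weak enough to hold in both spaces of variations, and
  strong enough for the potential term and for pairings with exponentially decaying fields to
  converge.\<close>

definition wsq :: "(real \<times> real \<Rightarrow> real) \<Rightarrow> bool" where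
  "wsq f \<longleftrightarrow> sqi (cyl {0..}) (\<lambda>p. exp (- (fst p / 2)) * f p)"

lemma AE_cyl_inf: "AE p in cyl {0..}. fst p \<ge> 0"
  using AE_cyl_fst_in[of "{0..}"] by simp

lemma meas_exp_fst: "(\<lambda>p::real\<times>real. exp (a * fst p)) \<in> borel_measurable borel"
  by (rule measurable_fst_comp) auto

lemma sqi_exp: "sqi (cyl {0..}) (\<lambda>p. exp (- (fst p / 2)))"
proof -
  have "(\<lambda>p::real\<times>real. (exp (- (fst p / 2)))^2) = (\<lambda>p. exp (- fst p))"
    by (auto simp: exp_double[symmetric])
  then show ?thesis using cyl_fst(1)[of "{0..}" "\<lambda>t. exp (- t)"] integrable_exp_neg meas_exp_fst[of "-1/2"]
    by (simp add: sqi_def)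
qed

lemma wsq_measurable: assumes "wsq f" shows "f \<in> borel_measurable borel"
proof -
  have "(\<lambda>p. exp (- (fst p / 2)) * f p) \<in> borel_measurable borel"
    using sqiD(1)[OF assms[unfolded wsq_def]] by (simp only: measurable_cyl)
  from borel_measurable_times[OF meas_exp_fst[of "1/2"] this]
  have "(\<lambda>p. exp (1/2 * fst p) * (exp (- (fst p / 2)) * f p)) \<in> borel_measurable borel" .
  moreover have eq: "exp (1/2 * fst p) * (exp (- (fst p / 2)) * f p) = f p" for p
    using exp_minus_inverse[of "fst p / 2"] by (simp add: mult.assoc[symmetric])
  ultimately show ?thesis by (simp only: eq)
qed

lemma wsq_of_sqi: "sqi (cyl {0..}) f \<Longrightarrow> wsq f"
  unfolding wsq_def using meas_exp_fst[of "-1/2"] AE_cyl_inf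
  by (intro sqi_bounded_mult[where B = 1]) (auto elim!: eventually_mono)

lemma dec_sqi:
  assumes "G \<in> borel_measurable borel" "AE p in cyl {0..}. \<bar>G p\<bar> \<le> C * exp (- fst p)"
  shows "sqi (cyl {0..}) (\<lambda>p. exp (fst p / 2) * G p)" "sqi (cyl {0..}) G"
proof -
  have "sqi (cyl {0..}) (\<lambda>p. (exp (fst p) * G p) * exp (- (fst p / 2)))"
  proof (rule sqi_bounded_mult[OF sqi_exp, where B = C])
    show "(\<lambda>p. exp (fst p) * G p) \<in> borel_measurable (cyl {0..})"
      using assms(1) meas_exp_fst[of 1] by (intro borel_measurable_times) auto
    show "AE p in cyl {0..}. \<bar>exp (fst p) * G p\<bar> \<le> C"
      using assms(2)
    proof eventually_elim
      case (elim p)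
      then have "exp (fst p) * \<bar>G p\<bar> \<le> exp (fst p) * (C * exp (- fst p))" by (intro mult_left_mono) auto
      also have "\<dots> = C" by (simp add: exp_minus)
      finally show ?case by (simp add: abs_mult)
    qed
  qed
  moreover have "exp (fst p) * G p * exp (- (fst p / 2)) = exp (fst p / 2) * G p" for p
    using exp_add[of "fst p" "- (fst p / 2)"] by (simp add: mult.commute mult.left_commute)
  ultimately show 1: "sqi (cyl {0..}) (\<lambda>p. exp (fst p / 2) * G p)" by simp
  then have "sqi (cyl {0..}) (\<lambda>p. exp (- (fst p / 2)) * (exp (fst p / 2) * G p))"
    using wsq_of_sqi unfolding wsq_def by blast
  then show "sqi (cyl {0..}) G" by (simp add: mult.assoc[symmetric] exp_add[symmetric])
qed

lemma dec_mult:
  assumes "G \<in> borel_measurable borel" "AE p in cyl {0..}. \<bar>G p\<bar> \<le> C * exp (- fst p)" "wsq F"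
  shows "integrable (cyl {0..}) (\<lambda>p. F p * G p)"
proof -
  have "integrable (cyl {0..}) (\<lambda>p. (exp (- (fst p / 2)) * F p) * (exp (fst p / 2) * G p))"
    by (rule sqi_mult_integrable[OF _ dec_sqi(1)[OF assms(1,2)]]) (use assms(3) in \<open>simp add: wsq_def\<close>)
  moreover have "(exp (- (fst p / 2)) * F p) * (exp (fst p / 2) * G p) = F p * G p" for p
  proof -
    have "(exp (- (fst p / 2)) * F p) * (exp (fst p / 2) * G p) = (exp (- (fst p / 2)) * exp (fst p / 2)) * (F p * G p)" by simp
    then show ?thesis by (simp add: exp_add[symmetric] del: mult.assoc)
  qed
  ultimately show ?thesis by simp
qed

lemma dec_mult2:
  assumes "k \<in> borel_measurable borel" "\<And>t. t \<ge> 0 \<Longrightarrow> \<bar>k t\<bar> \<le> C * exp (- t)" "wsq F" "wsq G"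
  shows "integrable (cyl {0..}) (\<lambda>p. k (fst p) * F p * G p)"
proof -
  have "sqi (cyl {0..}) (\<lambda>p. (k (fst p) * exp (1 * fst p)) * (exp (- (fst p / 2)) * F p))"
  proof (rule sqi_bounded_mult[where B = C])
    show "(\<lambda>p. k (fst p) * exp (1 * fst p)) \<in> borel_measurable (cyl {0..})"
      using meas_exp_fst[of 1] measurable_fst_comp[OF assms(1)] by (intro borel_measurable_times) auto
    show "AE p in cyl {0..}. \<bar>k (fst p) * exp (1 * fst p)\<bar> \<le> C"
      using AE_cyl_inf
    proof eventually_elim
      case (elim p)
      have "\<bar>k (fst p)\<bar> * exp (fst p) \<le> (C * exp (- fst p)) * exp (fst p)" using assms(2)[OF elim] by (intro mult_right_mono) auto
      also have "\<dots> = C" by (simp add: exp_minus)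
      finally show ?case by (simp add: abs_mult)
    qed
  qed (use assms in \<open>simp add: wsq_def\<close>)
  then have "integrable (cyl {0..}) (\<lambda>p. ((k (fst p) * exp (1 * fst p)) * (exp (- (fst p / 2)) * F p)) * (exp (- (fst p / 2)) * G p))"
    by (rule sqi_mult_integrable) (use assms in \<open>simp add: wsq_def\<close>)
  moreover have eq: "((k (fst p) * exp (1 * fst p)) * (exp (- (fst p / 2)) * F p)) * (exp (- (fst p / 2)) * G p) = k (fst p) * F p * G p" for p
  proof -
    have "((k (fst p) * exp (1 * fst p)) * (exp (- (fst p / 2)) * F p)) * (exp (- (fst p / 2)) * G p)
      = (exp (fst p) * (exp (- (fst p / 2)) * exp (- (fst p / 2)))) * (k (fst p) * F p * G p)" by simp
    also have "exp (fst p) * (exp (- (fst p / 2)) * exp (- (fst p / 2))) = 1" by (simp add: exp_add[symmetric])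
    finally show ?thesis by simp
  qed
  ultimately show ?thesis by (simp only: eq)
qed

text \<open>The cutoff 1 - t/T vanishes at the far end, as \<open>wkt_ibp\<close> demands of its
  weight. T = n + 1 is positive for every n.\<close>

lemma trunc_lim:
  assumes "integrable (cyl {0..}) F"
  shows "(\<lambda>n. \<integral>p. F p \<partial>cyl {0..real n + 1}) \<longlonglongrightarrow> (\<integral>p. F p \<partial>cyl {0..})"
    and "(\<lambda>n. \<integral>p. (1 - fst p / (real n + 1)) * F p \<partial>cyl {0..real n + 1}) \<longlonglongrightarrow> (\<integral>p. F p \<partial>cyl {0..})"
proof -
  have F [measurable]: "F \<in> borel_measurable borel" using borel_measurable_integrable[OF assms] by simp
  have mi: "(\<lambda>p::real\<times>real. indicator {0..real n + 1} (fst p) :: real) \<in> borel_measurable borel" for n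
    by (rule measurable_fst_comp) auto
  have mf: "(\<lambda>p::real\<times>real. 1 - fst p / (real n + 1)) \<in> borel_measurable borel" for n
    by (rule measurable_fst_comp[of "\<lambda>t. 1 - t / (real n + 1)"]) auto
  have ev: "\<forall>\<^sub>F n in sequentially. fst p \<le> real n + 1" for p :: "real \<times> real"
    using eventually_ge_at_top[of "nat \<lceil>fst p\<rceil>"] by eventually_elim linarith
  have "(\<lambda>n. \<integral>p. indicator {0..real n + 1} (fst p) * F p \<partial>cyl {0..}) \<longlonglongrightarrow> (\<integral>p. F p \<partial>cyl {0..})"
  proof (rule integral_dominated_convergence[where w = "\<lambda>p. \<bar>F p\<bar>"])
    show "AE p in cyl {0..}. (\<lambda>n. indicator {0..real n + 1} (fst p) * F p) \<longlonglongrightarrow> F p"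
      using AE_cyl_inf
    proof eventually_elim
      case (elim p)
      show ?case by (rule tendsto_eventually) (use ev[of p] in eventually_elim, use elim in \<open>simp add: indicator_def\<close>)
    qed
    show "AE p in cyl {0..}. norm (indicator {0..real n + 1} (fst p) * F p) \<le> \<bar>F p\<bar>" for n
      by (auto simp: indicator_def)
  qed (use assms mi in auto)
  moreover have "(\<integral>p. F p \<partial>cyl {0..real n + 1}) = (\<integral>p. indicator {0..real n + 1} (fst p) * F p \<partial>cyl {0..})" for n
    by (rule integrable_cyl_subset(2)) auto
  ultimately show "(\<lambda>n. \<integral>p. F p \<partial>cyl {0..real n + 1}) \<longlonglongrightarrow> (\<integral>p. F p \<partial>cyl {0..})" by simp
  have "(\<lambda>n. \<integral>p. indicator {0..real n + 1} (fst p) * ((1 - fst p / (real n + 1)) * F p) \<partial>cyl {0..}) \<longlonglongrightarrow> (\<integral>p. F p \<partial>cyl {0..})"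
  proof (rule integral_dominated_convergence[where w = "\<lambda>p. \<bar>F p\<bar>"])
    show "AE p in cyl {0..}. (\<lambda>n. indicator {0..real n + 1} (fst p) * ((1 - fst p / (real n + 1)) * F p)) \<longlonglongrightarrow> F p"
      using AE_cyl_inf
    proof eventually_elim
      case (elim p)
      have "(\<lambda>n. (1 - fst p / (real n + 1)) * F p) \<longlonglongrightarrow> (1 - 0) * F p"
        by (intro tendsto_intros) real_asymp
      then have "(\<lambda>n. (1 - fst p / (real n + 1)) * F p) \<longlonglongrightarrow> F p" by simp
      then show ?case
        by (rule Lim_transform_eventually) (use ev[of p] in eventually_elim, use elim in \<open>simp add: indicator_def\<close>)
    qed
    show "AE p in cyl {0..}. norm (indicator {0..real n + 1} (fst p) * ((1 - fst p / (real n + 1)) * F p)) \<le> \<bar>F p\<bar>" for n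
    proof (rule AE_I2)
      fix p :: "real \<times> real"
      have "\<bar>1 - fst p / (real n + 1)\<bar> \<le> 1" if "fst p \<in> {0..real n + 1}"
        using that by (auto simp: abs_le_iff field_simps)
      then show "norm (indicator {0..real n + 1} (fst p) * ((1 - fst p / (real n + 1)) * F p)) \<le> \<bar>F p\<bar>"
        by (auto simp: indicator_def abs_mult intro: mult_left_le_one_le)
    qed
    show "(\<lambda>p. indicator {0..real n + 1} (fst p) * ((1 - fst p / (real n + 1)) * F p)) \<in> borel_measurable (cyl {0..})" for n
      using mi[of n] mf[of n] F by simp
  qed (use assms in auto)
  moreover have "(\<integral>p. (1 - fst p / (real n + 1)) * F p \<partial>cyl {0..real n + 1}) = (\<integral>p. indicator {0..real n + 1} (fst p) * ((1 - fst p / (real n + 1)) * F p) \<partial>cyl {0..})" for n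
    by (rule integrable_cyl_subset(2)) (use mf[of n] F in auto)
  ultimately show "(\<lambda>n. \<integral>p. (1 - fst p / (real n + 1)) * F p \<partial>cyl {0..real n + 1}) \<longlonglongrightarrow> (\<integral>p. F p \<partial>cyl {0..})" by simp
qed

text \<open>Multiplying the weight by 1 - t/T removes the unknown boundary values at T. The
  derivative of this factor contributes -1/T times the integral of \<open>h f g\<close> over the
  finite piece; as \<open>h f g\<close> is integrable, this tends to zero.\<close>

lemma wkt_ibp_inf:
  assumes f: "\<And>T. T > 0 \<Longrightarrow> wkt 0 T 0 f f1 u" and g: "\<And>T. T > 0 \<Longrightarrow> wkt 0 T 0 g g1 v"
    and h: "\<And>T. T > 0 \<Longrightarrow> mult1 0 T h h'"
    and i: "integrable (cyl {0..}) (\<lambda>p. h (fst p) * f p * g1 p)" "integrable (cyl {0..}) (\<lambda>p. h (fst p) * g p * f1 p)"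
      "integrable (cyl {0..}) (\<lambda>p. h' (fst p) * f p * g p)" "integrable (cyl {0..}) (\<lambda>p. h (fst p) * f p * g p)"
  shows "(\<integral>p. h (fst p) * f p * g1 p \<partial>cyl {0..}) + (\<integral>p. h (fst p) * g p * f1 p \<partial>cyl {0..})
      + (\<integral>p. h' (fst p) * f p * g p \<partial>cyl {0..}) = - h 0 * (\<integral>\<theta>. u \<theta> * v \<theta> \<partial>circ)"
proof -
  have eq: "(\<integral>p. (1 - fst p / (real n + 1)) * (h (fst p) * f p * g1 p) \<partial>cyl {0..real n + 1})
     + (\<integral>p. (1 - fst p / (real n + 1)) * (h (fst p) * g p * f1 p) \<partial>cyl {0..real n + 1})
     + ((\<integral>p. (1 - fst p / (real n + 1)) * (h' (fst p) * f p * g p) \<partial>cyl {0..real n + 1})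
        - (\<integral>p. h (fst p) * f p * g p \<partial>cyl {0..real n + 1}) * (1 / (real n + 1))) = - h 0 * (\<integral>\<theta>. u \<theta> * v \<theta> \<partial>circ)" for n
  proof -
    let ?T = "real n + 1"
    have T: "?T > 0" by simp
    let ?k = "\<lambda>t. h t * (1 - t / ?T)" and ?k' = "\<lambda>t. h' t * (1 - t / ?T) - h t * (1 / ?T)"
    note hT = h[OF T]
    have k: "mult1 0 ?T ?k ?k'"
    proof -
      have "((\<lambda>t. 1 - t / ?T) has_real_derivative - (1 / ?T)) (at t within {0..?T})" for t
        by (auto intro!: derivative_eq_intros)
      then have "(?k has_real_derivative ?k' t) (at t within {0..?T})" if "t \<in> {0..?T}" for t
        using DERIV_mult[of h "h' t" t "{0..?T}" "\<lambda>t. 1 - t / ?T" "- (1 / ?T)"] hT that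
        by (simp add: mult1_def)
      then show ?thesis using hT mult1_cont[OF hT] unfolding mult1_def by (auto intro!: continuous_intros)
    qed
    have ii: "integrable (cyl {0..?T}) (\<lambda>p. h' (fst p) * f p * g p)" "integrable (cyl {0..?T}) (\<lambda>p. h (fst p) * f p * g p)"
      using i(3,4) by (auto intro: integrable_cyl_mono[of _ "{0..}"])
    have ik: "integrable (cyl {0..?T}) (\<lambda>p. (1 - fst p / ?T) * (h' (fst p) * f p * g p))"
    proof (rule Bochner_Integration.integrable_bound[OF ii(1)])
      show "(\<lambda>p. (1 - fst p / ?T) * (h' (fst p) * f p * g p)) \<in> borel_measurable (cyl {0..?T})"
        by (rule borel_measurable_times[OF _ borel_measurable_integrable[OF ii(1)]])
          (use measurable_fst_comp[of "\<lambda>t. 1 - t / ?T"] in auto)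
      show "AE p in cyl {0..?T}. norm ((1 - fst p / ?T) * (h' (fst p) * f p * g p)) \<le> norm (h' (fst p) * f p * g p)"
        using AE_cyl_fst_in[of "{0..?T}", OF borel_closed[OF closed_atLeastAtMost]]
      proof eventually_elim
        case (elim p)
        then have "\<bar>1 - fst p / ?T\<bar> \<le> 1" by (auto simp: abs_le_iff field_simps)
        then show ?case by (simp add: abs_mult mult_left_le_one_le)
      qed
    qed
    have "(\<integral>p. ?k (fst p) * f p * g1 p \<partial>cyl {0..?T}) + (\<integral>p. ?k (fst p) * g p * f1 p \<partial>cyl {0..?T})
      + (\<integral>p. ?k' (fst p) * f p * g p \<partial>cyl {0..?T}) = - ?k 0 * (\<integral>\<theta>. u \<theta> * v \<theta> \<partial>circ)"
      using wkt_ibp[OF T _ f[OF T] g[OF T] k] by simp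
    moreover have "(\<integral>p. ?k' (fst p) * f p * g p \<partial>cyl {0..?T})
       = (\<integral>p. (1 - fst p / ?T) * (h' (fst p) * f p * g p) \<partial>cyl {0..?T}) - (\<integral>p. h (fst p) * f p * g p \<partial>cyl {0..?T}) * (1 / ?T)"
    proof -
      have "(\<lambda>p. ?k' (fst p) * f p * g p) = (\<lambda>p. (1 - fst p / ?T) * (h' (fst p) * f p * g p) - (h (fst p) * f p * g p) * (1 / ?T))"
        by (auto simp: algebra_simps)
      then show ?thesis using ik ii(2) by simp
    qed
    ultimately show ?thesis by (simp add: mult.assoc mult.left_commute)
  qed
  have "(\<lambda>n. 1 / (real n + 1)) \<longlonglongrightarrow> 0" by real_asymp
  then have "(\<lambda>n. (\<integral>p. (1 - fst p / (real n + 1)) * (h (fst p) * f p * g1 p) \<partial>cyl {0..real n + 1})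
     + (\<integral>p. (1 - fst p / (real n + 1)) * (h (fst p) * g p * f1 p) \<partial>cyl {0..real n + 1})
     + ((\<integral>p. (1 - fst p / (real n + 1)) * (h' (fst p) * f p * g p) \<partial>cyl {0..real n + 1})
        - (\<integral>p. h (fst p) * f p * g p \<partial>cyl {0..real n + 1}) * (1 / (real n + 1)))) \<longlonglongrightarrow>
     (\<integral>p. h (fst p) * f p * g1 p \<partial>cyl {0..}) + (\<integral>p. h (fst p) * g p * f1 p \<partial>cyl {0..})
      + ((\<integral>p. h' (fst p) * f p * g p \<partial>cyl {0..}) - (\<integral>p. h (fst p) * f p * g p \<partial>cyl {0..}) * 0)"
    by (intro tendsto_intros trunc_lim i)
  then show ?thesis unfolding eq by (simp add: LIMSEQ_const_iff)
qed

lemma wkh_ibp_inf: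
  assumes f: "\<And>T. T > 0 \<Longrightarrow> wkh 0 T f f2" and H: "\<And>T. T > 0 \<Longrightarrow> smh 0 T H H2"
    and i: "integrable (cyl {0..}) (\<lambda>p. f2 p * H p)" "integrable (cyl {0..}) (\<lambda>p. f p * H2 p)"
  shows "(\<integral>p. f2 p * H p \<partial>cyl {0..}) + (\<integral>p. f p * H2 p \<partial>cyl {0..}) = 0"
proof -
  have "(\<integral>p. f2 p * H p \<partial>cyl {0..real n + 1}) + (\<integral>p. f p * H2 p \<partial>cyl {0..real n + 1}) = 0" for n
    by (rule wkh_ibp[OF f H]) auto
  moreover have "(\<lambda>n. (\<integral>p. f2 p * H p \<partial>cyl {0..real n + 1}) + (\<integral>p. f p * H2 p \<partial>cyl {0..real n + 1})) \<longlonglongrightarrow>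
     (\<integral>p. f2 p * H p \<partial>cyl {0..}) + (\<integral>p. f p * H2 p \<partial>cyl {0..})"
    by (intro tendsto_add trunc_lim i)
  ultimately show ?thesis by (simp add: LIMSEQ_const_iff)
qed

text \<open>f may fail to be square integrable on the half cylinder, but its part of mean zero does
  not: the integrals over finite pieces increase and are bounded by that of f2^2, so monotone
  convergence applies.\<close>

lemma wkh_wirtinger_inf:
  assumes f: "\<And>T. T > 0 \<Longrightarrow> wkh 0 T f f2" and f2: "sqi (cyl {0..}) f2" and m: "f \<in> borel_measurable borel"
  shows "sqi (cyl {0..}) (\<lambda>p. f p - mean f (fst p))"
    and "(\<integral>p. (f p - mean f (fst p))^2 \<partial>cyl {0..}) \<le> (\<integral>p. (f2 p)^2 \<partial>cyl {0..})"
proof -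
  let ?d = "\<lambda>p. (f p - mean f (fst p))^2"
  have md: "(\<lambda>p. f p - mean f (fst p)) \<in> borel_measurable borel"
    using m measurable_fst_comp[OF mean_measurable[OF m]] by simp
  then have md2: "?d \<in> borel_measurable borel" by simp
  define s where "s n p = indicator {0..real n + 1} (fst p) * ?d p" for n and p :: "real \<times> real"
  have eq: "(\<integral>p. s n p \<partial>cyl {0..}) = (\<integral>p. ?d p \<partial>cyl {0..real n + 1})" for n
    unfolding s_def by (rule integrable_cyl_subset(2)[symmetric]) (use md2 in auto)
  have int: "integrable (cyl {0..}) (s n)" for n
  proof -
    have "sqi (cyl {0..real n + 1}) (\<lambda>p. f p - mean f (fst p))"
      using wkhD(1)[OF f[of "real n + 1"]] by (intro sqi_diff sqi_mean(1)) auto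
    then have "integrable (cyl {0..real n + 1}) ?d" by (rule sqiD)
    then show ?thesis unfolding s_def by (subst (asm) integrable_cyl_subset(1)[of _ "{0..}"]) (use md2 in auto)
  qed
  have le: "(\<integral>p. s n p \<partial>cyl {0..}) \<le> (\<integral>p. (f2 p)^2 \<partial>cyl {0..})" for n
  proof -
    have "(\<integral>p. s n p \<partial>cyl {0..}) \<le> (\<integral>p. (f2 p)^2 \<partial>cyl {0..real n + 1})"
      unfolding eq by (rule wkh_wirtinger[OF f]) simp
    also have "\<dots> = (\<integral>p. indicator {0..real n + 1} (fst p) * (f2 p)^2 \<partial>cyl {0..})"
      by (rule integrable_cyl_subset(2)) (use sqiD(1)[OF f2] in auto)
    also have "\<dots> \<le> (\<integral>p. (f2 p)^2 \<partial>cyl {0..})"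
    proof (rule integral_mono)
      show "integrable (cyl {0..}) (\<lambda>p. indicator {0..real n + 1} (fst p) * (f2 p)^2)"
        by (subst integrable_cyl_subset(1)[of "{0..real n + 1}" "{0..}", symmetric])
          (use sqiD[OF f2] in \<open>auto intro: integrable_cyl_mono[of _ "{0..}"]\<close>)
    qed (use sqiD[OF f2] in \<open>auto simp: indicator_def\<close>)
    finally show ?thesis .
  qed
  have inc: "incseq (\<lambda>n. \<integral>p. s n p \<partial>cyl {0..})"
    by (intro incseq_SucI integral_mono int) (auto simp: s_def indicator_def)
  then obtain L where L: "(\<lambda>n. \<integral>p. s n p \<partial>cyl {0..}) \<longlonglongrightarrow> L"
    using incseq_convergent[OF inc] le by metis
  note mc = integral_monotone_convergence_nonneg[of "cyl {0..}" s ?d L, OF int _ _ _ L]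
  have a: "AE x in cyl {0..}. mono (\<lambda>n. s n x)" "\<And>i. AE x in cyl {0..}. 0 \<le> s i x"
    by (auto simp: mono_def s_def indicator_def)
  have b: "AE x in cyl {0..}. (\<lambda>i. s i x) \<longlonglongrightarrow> ?d x"
    using AE_cyl_inf
  proof eventually_elim
    case (elim p)
    have ev: "\<forall>\<^sub>F n in sequentially. fst p \<le> real n + 1"
      using eventually_ge_at_top[of "nat \<lceil>fst p\<rceil>"] by eventually_elim linarith
    show ?case by (rule tendsto_eventually) (use ev in eventually_elim, use elim in \<open>simp add: s_def indicator_def\<close>)
  qed
  have mi: "integrable (cyl {0..}) ?d" and ei: "(\<integral>p. ?d p \<partial>cyl {0..}) = L"
    using mc[OF a b] md2 by auto
  show "sqi (cyl {0..}) (\<lambda>p. f p - mean f (fst p))" using mi md by (simp add: sqi_def)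
  show "(\<integral>p. ?d p \<partial>cyl {0..}) \<le> (\<integral>p. (f2 p)^2 \<partial>cyl {0..})"
    unfolding ei by (rule LIMSEQ_le_const2[OF L]) (use le in auto)
qed

text \<open>
  A function on a half catenoid with its derivatives \<open>f1\<close>, \<open>f2\<close> and its trace \<open>u\<close>. The Dirichlet integral
  is conformally invariant, so no density appears, and \<open>|A|\<^sup>2\<close> times the area density is \<open>2 se^2\<close>.
\<close>

definition cat :: "(real \<times> real \<Rightarrow> real) \<Rightarrow> (real \<times> real \<Rightarrow> real) \<Rightarrow> (real \<times> real \<Rightarrow> real) \<Rightarrow> (real \<Rightarrow> real) \<Rightarrow> bool" where
  "cat f f1 f2 u \<longleftrightarrow> (\<forall>T>0. wkt 0 T 0 f f1 u \<and> wkh 0 T f f2) \<and>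
     sqi (cyl {0..}) f1 \<and> sqi (cyl {0..}) f2 \<and> wsq f"

lemma catD:
  assumes "cat f f1 f2 u"
  shows "\<And>T. T > 0 \<Longrightarrow> wkt 0 T 0 f f1 u" "\<And>T. T > 0 \<Longrightarrow> wkh 0 T f f2"
    "sqi (cyl {0..}) f1" "sqi (cyl {0..}) f2" "wsq f" "sqi circ u" "f \<in> borel_measurable borel"
  using assms wktD(3)[of 0 1 0 f f1 u] wsq_measurable by (auto simp: cat_def)

text \<open>The logarithmic derivative of the Jacobi function \<open>th\<close>.\<close>

definition h0 :: "real \<Rightarrow> real" where "h0 t = (se t)^2 / th t"

lemma h0_0: "h0 0 = 3 / 2" by (simp add: h0_def th_0 se_0 power_divide)

lemma meas_h0 [measurable]: "h0 \<in> borel_measurable borel"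
  unfolding h0_def by measurable

lemma h0_bound: assumes "t \<ge> 0" shows "\<bar>h0 t\<bar> \<le> 4 * exp (- t)" "\<bar>h0 t\<bar> \<le> 2"
proof -
  have t: "th t \<ge> 1/2" using th_ge[OF assms] .
  have "0 \<le> h0 t" using t by (simp add: h0_def)
  have "h0 t \<le> (se t)^2 / (1/2)" unfolding h0_def using t by (intro divide_left_mono) auto
  moreover have "(se t)^2 \<le> 1" using se_le_1[of t] se_pos[of t] by (simp add: power_le_one)
  ultimately show "\<bar>h0 t\<bar> \<le> 4 * exp (- t)" "\<bar>h0 t\<bar> \<le> 2" using se_sq_le[of t] \<open>0 \<le> h0 t\<close>
    by (simp_all add: abs_of_nonneg)
qed

text \<open>The Riccati form of the Jacobi equation th'' = -2 se^2 th.\<close>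

lemma h0_deriv: assumes "t \<ge> 0"
  shows "(h0 has_real_derivative - 2 * (se t)^2 - (h0 t)^2) (at t within S)"
proof -
  have t: "th t \<noteq> 0" using th_ge[OF assms] by simp
  have "(h0 has_real_derivative ((2 * se t * (- (th t * se t))) * th t - (se t)^2 * (se t)^2) / (th t * th t)) (at t within S)"
    unfolding h0_def
    by (rule DERIV_cong[OF DERIV_divide[OF DERIV_power[OF se_deriv, of 2] th_deriv t]]) simp
  moreover have "((2 * se t * (- (th t * se t))) * th t - (se t)^2 * (se t)^2) / (th t * th t) = - 2 * (se t)^2 - (h0 t)^2"
    using t by (simp add: h0_def field_simps power2_eq_square)
  ultimately show ?thesis by simp
qed

lemma mult1_h0: "mult1 0 T h0 (\<lambda>t. - 2 * (se t)^2 - (h0 t)^2)"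
proof -
  have "continuous_on {0..T} h0" by (rule DERIV_continuous_on, rule h0_deriv) simp
  then show ?thesis unfolding mult1_def by (auto intro!: continuous_intros h0_deriv[unfolded mult_minus_left])
qed

text \<open>The weight is the logarithmic derivative of \<open>se\<close>. Since th^2 = 1 - se^2, it
  satisfies h' = 1 - 2 se^2 - h^2, the Riccati form of se'' = (1 - 2 se^2) se.\<close>

lemma mult1_neg_th: "mult1 0 T (\<lambda>t. - th t) (\<lambda>t. - (se t)\<^sup>2)"
  unfolding mult1_def by (auto intro!: continuous_intros derivative_eq_intros th_deriv)

lemma mean_fst_mult: "mean (\<lambda>p. k (fst p) * f p) t = k t * mean f t"
  by (simp add: mean_def)

lemma wsq_mean: assumes "wsq f" shows "wsq (\<lambda>p. mean f (fst p))"
  using sqi_mean(1)[OF _ assms[unfolded wsq_def]]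
  by (simp add: wsq_def mean_fst_mult[where k = "\<lambda>t. exp (- (t / 2))"])

lemma wsq_sqi_mult: assumes "k \<in> borel_measurable borel" "\<And>t. t \<ge> 0 \<Longrightarrow> \<bar>k t\<bar> \<le> C * exp (- t)" "wsq F"
  shows "sqi (cyl {0..}) (\<lambda>p. k (fst p) * F p)"
proof -
  have "sqi (cyl {0..}) (\<lambda>p. (k (fst p) * exp (1/2 * fst p)) * (exp (- (fst p / 2)) * F p))"
  proof (rule sqi_bounded_mult[where B = "\<bar>C\<bar>"])
    show "(\<lambda>p. k (fst p) * exp (1/2 * fst p)) \<in> borel_measurable (cyl {0..})"
      unfolding measurable_cyl by (rule borel_measurable_times[OF measurable_fst_comp[OF assms(1)] meas_exp_fst])
    show "AE p in cyl {0..}. \<bar>k (fst p) * exp (1/2 * fst p)\<bar> \<le> \<bar>C\<bar>"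
      using AE_cyl_inf
    proof eventually_elim
      case (elim p)
      have "\<bar>k (fst p)\<bar> \<le> \<bar>C\<bar> * exp (- fst p)" using assms(2)[OF elim] by (simp add: order_trans[OF _ mult_right_mono[OF abs_ge_self]])
      then have "\<bar>k (fst p)\<bar> * exp (1/2 * fst p) \<le> (\<bar>C\<bar> * exp (- fst p)) * exp (1/2 * fst p)" by (intro mult_right_mono) auto
      also have "\<dots> = \<bar>C\<bar> * exp (- (fst p / 2))" by (simp add: exp_add[symmetric] mult.assoc)
      also have "\<dots> \<le> \<bar>C\<bar>" using elim by (simp add: mult_left_le)
      finally show ?case by (simp add: abs_mult)
    qed
  qed (use assms in \<open>simp add: wsq_def\<close>)
  moreover have eq: "(k (fst p) * exp (1/2 * fst p)) * (exp (- (fst p / 2)) * F p) = k (fst p) * F p" for p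
  proof -
    have "(k (fst p) * exp (1/2 * fst p)) * (exp (- (fst p / 2)) * F p) = (exp (fst p / 2) * exp (- (fst p / 2))) * (k (fst p) * F p)" by simp
    then show ?thesis by (simp only: exp_minus_inverse mult_1)
  qed
  ultimately show ?thesis by (simp only: eq)
qed

lemma integral_square_split:
  assumes "sqi M f" "sqi M g"
  shows "(\<integral>x. (f x - g x)^2 \<partial>M) = (\<integral>x. (f x)^2 \<partial>M) - 2 * (\<integral>x. g x * f x \<partial>M) + (\<integral>x. (g x)^2 \<partial>M)"
proof -
  have "(\<lambda>x. (f x - g x)^2) = (\<lambda>x. (f x)^2 - 2 * (g x * f x) + (g x)^2)"
    by (auto simp: power2_eq_square algebra_simps)
  then show ?thesis using assms sqi_mult_integrable[OF assms(2,1)] by (simp add: sqi_def)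
qed

lemma integral_mean_split:
  assumes I: "I \<in> sets borel" and f: "sqi (cyl I) f"
  shows "(\<integral>p. (f p - mean f (fst p))^2 \<partial>cyl I) = (\<integral>p. (f p)^2 \<partial>cyl I) - (\<integral>p. (mean f (fst p))^2 \<partial>cyl I)"
  using integral_square_split[OF f sqi_mean(1)[OF I f]] mean_inner[OF I f f]
  by (simp add: power2_eq_square)

lemma sqi_circ_const: "sqi circ (\<lambda>_. k)" by (rule sqi_bounded[OF finite_circ, of _ "\<bar>k\<bar>"]) auto

lemma circ_mean_split:
  assumes "sqi circ u"
  shows "(\<integral>\<theta>. (u \<theta> - (\<integral>\<theta>. u \<theta> \<partial>circ) / (2 * pi))^2 \<partial>circ) = (\<integral>\<theta>. (u \<theta>)^2 \<partial>circ) - (\<integral>\<theta>. u \<theta> \<partial>circ)^2 / (2 * pi)"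
  using integral_square_split[OF assms sqi_circ_const[of "(\<integral>\<theta>. u \<theta> \<partial>circ) / (2 * pi)"]]
  by (simp add: power2_eq_square field_simps)

lemma cat_perp_sqi:
  assumes c: "cat f f1 f2 u"
  shows "sqi (cyl {0..}) (\<lambda>p. f p - mean f (fst p))" "sqi (cyl {0..}) (\<lambda>p. f1 p - mean f1 (fst p))"
    "sqi (cyl {0..}) (\<lambda>p. mean f1 (fst p))"
    "(\<integral>p. (f p - mean f (fst p))^2 \<partial>cyl {0..}) \<le> (\<integral>p. (f2 p)^2 \<partial>cyl {0..})"
  using wkh_wirtinger_inf[OF catD(2,4,7)[OF c]] sqi_mean(1)[OF _ catD(3)[OF c]] sqi_diff[OF catD(3)[OF c]]
  by auto

text \<open>Mean and remainder are orthogonal in the integrals of f1^2, se^2 f^2 and u^2, so a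
  square can be completed for each separately. The comparison function \<open>se\<close> of the
  remainder solves the equation with an additional 1 in the potential; this costs the integral of
  the squared remainder, which the \<theta>-derivative pays back through Wirtinger's
  inequality.\<close>

lemma cat_identity:
  assumes c: "cat f f1 f2 u"
  shows "(\<integral>p. (f1 p)^2 \<partial>cyl {0..}) + (\<integral>p. (f2 p)^2 \<partial>cyl {0..}) - 2 * (\<integral>p. (se (fst p) * f p)^2 \<partial>cyl {0..})
      - (\<integral>\<theta>. (u \<theta>)^2 \<partial>circ) / 2
    = (\<integral>p. (mean f1 (fst p) - h0 (fst p) * mean f (fst p))^2 \<partial>cyl {0..})
      + (\<integral>p. (f1 p - mean f1 (fst p) + th (fst p) * (f p - mean f (fst p)))^2 \<partial>cyl {0..})
      + ((\<integral>p. (f2 p)^2 \<partial>cyl {0..}) - (\<integral>p. (f p - mean f (fst p))^2 \<partial>cyl {0..}))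
      - (\<integral>\<theta>. u \<theta> \<partial>circ)^2 / pi"
proof -
  note D = catD[OF c] and P = cat_perp_sqi[OF c]
  let ?J = "cyl {0..}"
  define U where "U = (\<integral>\<theta>. u \<theta> \<partial>circ) / (2 * pi)"
  define m m1 fp fp1 where "m p = mean f (fst p)" and "m1 p = mean f1 (fst p)"
    and "fp p = f p - mean f (fst p)" and "fp1 p = f1 p - mean f1 (fst p)" for p :: "real \<times> real"
  have wm: "wkt 0 T 0 m m1 (\<lambda>_. U)" if "T > 0" for T
    unfolding m_def m1_def U_def by (rule wkt_mean[OF D(1)[OF that]])
  have wfp: "wkt 0 T 0 fp fp1 (\<lambda>\<theta>. u \<theta> - U)" if "T > 0" for T
    using wkt_diff[OF D(1)[OF that] wm[OF that]] unfolding fp_def fp1_def m_def m1_def .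
  have qm: "wsq m" unfolding m_def by (rule wsq_mean[OF D(5)])
  have sm1: "sqi ?J m1" and sfp: "sqi ?J fp" and sfp1: "sqi ?J fp1"
    using P unfolding m1_def fp_def fp1_def by auto
  have sfm: "sqi ?J (\<lambda>p. se (fst p) * m p)" "sqi ?J (\<lambda>p. se (fst p) * f p)" "sqi ?J (\<lambda>p. h0 (fst p) * m p)"
    by (intro wsq_sqi_mult[where C = 4] meas_se meas_h0 qm D(5),
       use se_pos se_le_exp h0_bound in \<open>auto simp: abs_of_pos intro: order_trans[OF se_le_exp]\<close>)+
  have Bse: "AE p in ?J. \<bar>se (fst p)\<bar> \<le> 1" using se_pos se_le_1 by (simp add: abs_of_pos)
  have Bth: "AE p in ?J. \<bar>th (fst p)\<bar> \<le> 1" using th_abs by simp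
  have mse: "(\<lambda>p. se (fst p)) \<in> borel_measurable ?J" "(\<lambda>p. th (fst p)) \<in> borel_measurable ?J"
    using measurable_fst_comp[OF meas_se] measurable_fst_comp[OF meas_th] by simp_all
  have ssf: "sqi ?J (\<lambda>p. se (fst p) * fp p)" "sqi ?J (\<lambda>p. th (fst p) * fp p)"
    using sqi_bounded_mult[OF sfp mse(1) Bse] sqi_bounded_mult[OF sfp mse(2) Bth] by auto
  \<comment> \<open>mode zero: \<open>m1 - h0 m\<close> vanishes on the multiples of \<open>th\<close>\<close>
  have i1: "integrable ?J (\<lambda>p. h0 (fst p) * m p * m1 p)"
    by (rule sqi_mult_integrable[OF sfm(3) sm1])
  have i2: "integrable ?J (\<lambda>p. h0 (fst p) * m p * m p)"
    by (rule dec_mult2[OF meas_h0 h0_bound(1) qm qm])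
  have i3: "integrable ?J (\<lambda>p. (- 2 * (se (fst p))^2 - (h0 (fst p))^2) * m p * m p)"
  proof (rule dec_mult2[OF _ _ qm qm])
    show "\<bar>- 2 * (se t)^2 - (h0 t)^2\<bar> \<le> 12 * exp (- t)" if "t \<ge> 0" for t
    proof -
      have "(h0 t)^2 = \<bar>h0 t\<bar> * \<bar>h0 t\<bar>" by (simp add: power2_eq_square)
      also have "\<dots> \<le> 2 * (4 * exp (- t))" using h0_bound[OF that] by (intro mult_mono) auto
      finally have "(h0 t)^2 \<le> 8 * exp (- t)" by simp
      moreover have "(se t)^2 \<ge> 0" "(h0 t)^2 \<ge> 0" by auto
      ultimately show ?thesis using se_sq_le[of t] by linarith
    qed
  qed simp
  \<comment> \<open>The factor 3/2 is the weight \<open>h0\<close> on the circle; the trace of the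
    mean is the constant U.\<close>
  have "- U * U * 2 * pi * (3/2) = (\<integral>p. h0 (fst p) * m p * m1 p \<partial>?J) + (\<integral>p. h0 (fst p) * m p * m1 p \<partial>?J)
    + (\<integral>p. (- 2 * (se (fst p))^2 - (h0 (fst p))^2) * m p * m p \<partial>?J)"
    using wkt_ibp_inf[OF wm wm mult1_h0 i1 i1 i3 i2] by (simp add: h0_0)
  also have "(\<lambda>p. (- 2 * (se (fst p))^2 - (h0 (fst p))^2) * m p * m p) = (\<lambda>p. - 2 * (se (fst p) * m p)^2 - (h0 (fst p) * m p)^2)"
    by (auto simp: power2_eq_square algebra_simps)
  also have "(\<integral>p. - 2 * (se (fst p) * m p)^2 - (h0 (fst p) * m p)^2 \<partial>?J) = - 2 * (\<integral>p. (se (fst p) * m p)^2 \<partial>?J) - (\<integral>p. (h0 (fst p) * m p)^2 \<partial>?J)"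
    using sqiD(2)[OF sfm(1)] sqiD(2)[OF sfm(3)] by simp
  finally have I0: "(\<integral>p. (m1 p - h0 (fst p) * m p)^2 \<partial>?J) = (\<integral>p. (m1 p)^2 \<partial>?J) - 2 * (\<integral>p. (se (fst p) * m p)^2 \<partial>?J) + 3 * pi * U^2"
    using integral_square_split[OF sm1 sfm(3)] by (simp add: power2_eq_square algebra_simps)
  \<comment> \<open>higher modes: \<open>fp1 + th fp\<close> vanishes on the multiples of \<open>se\<close>\<close>
  have j1: "integrable ?J (\<lambda>p. - th (fst p) * fp p * fp1 p)" "integrable ?J (\<lambda>p. - th (fst p) * fp p * fp p)"
    using sqi_mult_integrable[OF ssf(2) sfp1] sqi_mult_integrable[OF ssf(2) sfp] by simp_all
  have j2: "integrable ?J (\<lambda>p. - (se (fst p))\<^sup>2 * fp p * fp p)"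
    using sqi_mult_integrable[OF ssf(1) ssf(1)] by (simp add: power2_eq_square mult_ac)
  have "(\<integral>\<theta>. (u \<theta> - U) * (u \<theta> - U) \<partial>circ) / 2 = (\<integral>p. - th (fst p) * fp p * fp1 p \<partial>?J) + (\<integral>p. - th (fst p) * fp p * fp1 p \<partial>?J)
    + (\<integral>p. - (se (fst p))\<^sup>2 * fp p * fp p \<partial>?J)"
    using wkt_ibp_inf[OF wfp wfp mult1_neg_th j1(1) j1(1) j2 j1(2)] by (simp add: th_0)
  also have "(\<integral>p. - (se (fst p))\<^sup>2 * fp p * fp p \<partial>?J) = - (\<integral>p. (se (fst p) * fp p)^2 \<partial>?J)"
    by (simp add: power2_eq_square mult_ac)
  also have "(\<integral>p. - th (fst p) * fp p * fp1 p \<partial>?J) = - (\<integral>p. th (fst p) * fp p * fp1 p \<partial>?J)" by simp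
  finally have I1: "(\<integral>\<theta>. (u \<theta> - U)^2 \<partial>circ) / 2 = - 2 * (\<integral>p. th (fst p) * fp p * fp1 p \<partial>?J) - (\<integral>p. (se (fst p) * fp p)^2 \<partial>?J)"
    by (simp add: power2_eq_square)
  \<comment> \<open>This identity brings the potential term to its full coefficient 2 and releases
    the integral of fp^2.\<close>
  have "(\<lambda>p. (th (fst p) * fp p)^2) = (\<lambda>p. (fp p)^2 - (se (fst p) * fp p)^2)"
    by (auto simp: power_mult_distrib th_se algebra_simps)
  then have "(\<integral>p. (th (fst p) * fp p)^2 \<partial>?J) = (\<integral>p. (fp p)^2 \<partial>?J) - (\<integral>p. (se (fst p) * fp p)^2 \<partial>?J)"
    using sqiD(2)[OF sfp] sqiD(2)[OF ssf(1)] by simp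
  moreover have "(\<integral>p. (fp1 p + th (fst p) * fp p)^2 \<partial>?J) = (\<integral>p. (fp1 p)^2 \<partial>?J) + 2 * (\<integral>p. th (fst p) * fp p * fp1 p \<partial>?J) + (\<integral>p. (th (fst p) * fp p)^2 \<partial>?J)"
    using integral_square_split[OF sfp1 sqi_scale[OF ssf(2), of "-1"]] by simp
  ultimately have S1: "(\<integral>p. (fp1 p + th (fst p) * fp p)^2 \<partial>?J) = (\<integral>p. (fp1 p)^2 \<partial>?J) - (\<integral>\<theta>. (u \<theta> - U)^2 \<partial>circ) / 2
       - 2 * (\<integral>p. (se (fst p) * fp p)^2 \<partial>?J) + (\<integral>p. (fp p)^2 \<partial>?J)"
    using I1 by linarith
  have f1: "(\<integral>p. (fp1 p)^2 \<partial>?J) = (\<integral>p. (f1 p)^2 \<partial>?J) - (\<integral>p. (m1 p)^2 \<partial>?J)"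
    unfolding fp1_def m1_def by (rule integral_mean_split[OF _ D(3)]) simp
  have "(\<integral>p. (se (fst p) * fp p)^2 \<partial>?J) = (\<integral>p. (se (fst p) * f p)^2 \<partial>?J) - (\<integral>p. (se (fst p) * m p)^2 \<partial>?J)"
    using integral_mean_split[OF _ sfm(2)] unfolding fp_def m_def mean_fst_mult by (simp add: right_diff_distrib)
  moreover have "(\<integral>\<theta>. (u \<theta> - U)^2 \<partial>circ) = (\<integral>\<theta>. (u \<theta>)^2 \<partial>circ) - 2 * pi * U^2"
    using circ_mean_split[OF D(6)] unfolding U_def by (simp add: power_divide power2_eq_square)
  moreover have "(\<integral>\<theta>. u \<theta> \<partial>circ)^2 / pi = 4 * pi * U^2" by (simp add: U_def power_divide power2_eq_square)
  ultimately show ?thesis using I0 S1 f1 unfolding m_def m1_def fp_def fp1_def by (simp add: field_simps)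
qed


lemma AE_cyl_exhaust:
  assumes "\<And>T. T > 0 \<Longrightarrow> AE p in cyl {0..T}. P p"
  shows "AE p in cyl {0..}. P p"
proof -
  have "AE p in lborel. p \<in> {0..real n + 1} \<times> {0..<2*pi} \<longrightarrow> P p" for n
  proof -
    have "AE p in cyl {0..real n + 1}. P p" by (rule assms) simp
    then show ?thesis by (subst (asm) AE_cyl) auto
  qed
  then have "AE p in lborel. \<forall>n::nat. p \<in> {0..real n + 1} \<times> {0..<2*pi} \<longrightarrow> P p"
    by (subst AE_all_countable) auto
  then show ?thesis
  proof (subst AE_cyl, simp, eventually_elim, intro impI)
    fix p assume *: "\<forall>n::nat. p \<in> {0..real n + 1} \<times> {0..<2*pi} \<longrightarrow> P p" "p \<in> {0..} \<times> {0..<2 * pi}"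
    obtain n :: nat where "fst p \<le> real n" using real_arch_simple by blast
    then show "P p" using *(1)[rule_format, of n] *(2) by (cases p) auto
  qed
qed

lemma sqi_zero_AE: assumes "sqi M f" "(\<integral>x. (f x)^2 \<partial>M) = 0" shows "AE x in M. f x = 0"
proof -
  have "AE x in M. (f x)^2 = 0"
    using assms sqiD(2)[OF assms(1)] by (subst (asm) integral_nonneg_eq_0_iff_AE) auto
  then show ?thesis by simp
qed

lemma AE_restrict_cyl: assumes "AE p in cyl {0..}. P p" shows "AE p in cyl {0..T}. P p"
  using assms by (subst (asm) AE_cyl, simp, subst AE_cyl, simp) (auto elim!: eventually_mono)

lemma quadratic_nonneg_linear_zero:
  fixes L Q :: real
  assumes "\<And>e. 0 \<le> 2 * e * L + e^2 * Q"
  shows "L = 0"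
proof (rule ccontr)
  assume L: "L \<noteq> 0"
  have "0 \<le> Q" using assms[of 1] assms[of "-1"] by simp
  \<comment> \<open>The minimizer would be -L/Q; with Q + 1 the denominator is positive also for Q =
    0.\<close>
  define e where "e = - L / (Q + 1)"
  have eq: "e * (Q + 1) = - L" using \<open>0 \<le> Q\<close> by (simp add: e_def)
  have "2 * e * L + e^2 * Q = - (2 * e * (e * (Q + 1))) + e^2 * Q" unfolding eq by simp
  also have "\<dots> = - (e^2 * (Q + 2))" by (simp add: power2_eq_square algebra_simps)
  also have "\<dots> < 0" using L \<open>0 \<le> Q\<close> eq by (auto simp: e_def)
  finally show False using assms[of e] by simp
qed

lemma Fubini_cyl_prod:
  fixes k w :: "real \<Rightarrow> real"
  assumes I: "I \<in> sets borel" and k: "integrable (lbI I) k" and w: "integrable circ w"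
  shows "integrable (cyl I) (\<lambda>p. k (fst p) * w (snd p))"
    "(\<integral>p. k (fst p) * w (snd p) \<partial>cyl I) = (\<integral>t. k t \<partial>lbI I) * (\<integral>\<theta>. w \<theta> \<partial>circ)"
proof -
  interpret pair_sigma_finite "lbI I" circ by (rule pair_sigma_finite_cyl[OF I])
  have km: "k \<in> borel_measurable borel" "w \<in> borel_measurable borel"
    using borel_measurable_integrable[OF k] borel_measurable_integrable[OF w] by auto
  show i: "integrable (cyl I) (\<lambda>p. k (fst p) * w (snd p))"
    unfolding cyl_def
  proof (rule Fubini_integrable)
    have "(\<lambda>p. k (fst p) * w (snd p)) \<in> borel_measurable (cyl I)"
      unfolding measurable_cyl by (intro borel_measurable_times measurable_fst_comp measurable_snd_comp km)
    then show "(\<lambda>p. k (fst p) * w (snd p)) \<in> borel_measurable (lbI I \<Otimes>\<^sub>M circ)" unfolding cyl_def .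
  qed (use k w in \<open>auto simp: abs_mult\<close>)
  show "(\<integral>p. k (fst p) * w (snd p) \<partial>cyl I) = (\<integral>t. k t \<partial>lbI I) * (\<integral>\<theta>. w \<theta> \<partial>circ)"
    by (subst Fubini_cyl(2)[OF I i]) simp
qed

lemma smh_prod:
  assumes "c1per \<eta> \<eta>'" "continuous_on UNIV k"
  shows "smh a b (\<lambda>p. k (fst p) * \<eta> (snd p)) (\<lambda>p. k (fst p) * \<eta>' (snd p))"
proof -
  have c: "continuous_on S (\<lambda>p::real\<times>real. k (fst p))" "continuous_on S (\<lambda>p::real\<times>real. \<eta> (snd p))"
      "continuous_on S (\<lambda>p::real\<times>real. \<eta>' (snd p))" for S
    by (auto intro!: continuous_on_compose2[OF assms(2)] continuous_on_compose2[OF c1per_cont(1)[OF assms(1), of UNIV]]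
      continuous_on_compose2[OF c1per_cont(2)[OF assms(1), of UNIV]] continuous_intros)
  then have "continuous_on S (\<lambda>p::real\<times>real. k (fst p) * \<eta> (snd p))" "continuous_on S (\<lambda>p::real\<times>real. k (fst p) * \<eta>' (snd p))" for S
    by (auto intro!: continuous_intros)
  then show ?thesis using assms unfolding smh_def
    by (auto intro!: borel_measurable_continuous_onI DERIV_cmult simp: c1per_def)
qed

lemma sqi_se_prod: assumes "sqi circ w" shows "sqi (cyl {0..}) (\<lambda>p. se (fst p) * w (snd p))"
proof -
  have "integrable (lbI {0..}) (\<lambda>t. (se t)^2)"
    by (rule Bochner_Integration.integrable_bound[of _ "\<lambda>t. 2 * exp (- t)"])
      (use integrable_exp_neg se_sq_le in auto)
  from Fubini_cyl_prod(1)[OF _ this sqiD(2)[OF assms]]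
  have "integrable (cyl {0..}) (\<lambda>p. (se (fst p) * w (snd p))^2)" by (simp add: power_mult_distrib)
  moreover have "w \<in> borel_measurable borel" using sqiD(1)[OF assms] by simp
  ultimately show ?thesis unfolding sqi_def measurable_cyl
    by (auto intro!: borel_measurable_times measurable_fst_comp measurable_snd_comp)
qed

text \<open>Where the squares vanish, the mean divided by \<open>th\<close> and the remainder
  divided by \<open>se\<close> do not depend on t. The remainder is then \<open>se\<close> times a
  function v of \<theta>. Equality in Wirtinger's inequality says that f minimizes the gap between
  its two sides, and the first variation along \<open>se\<close> times periodic functions is the
  weak equation of the first harmonics.\<close>

lemma cat_equality:
  assumes c: "cat f f1 f2 u"
    and S0: "(\<integral>p. (mean f1 (fst p) - h0 (fst p) * mean f (fst p))^2 \<partial>cyl {0..}) = 0"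
    and S1: "(\<integral>p. (f1 p - mean f1 (fst p) + th (fst p) * (f p - mean f (fst p)))^2 \<partial>cyl {0..}) = 0"
    and W: "(\<integral>p. (f2 p)^2 \<partial>cyl {0..}) = (\<integral>p. (f p - mean f (fst p))^2 \<partial>cyl {0..})"
  obtains B C where
    "AE p in cyl {0..}. f p = (\<integral>\<theta>. u \<theta> \<partial>circ) / pi * th (fst p) + se (fst p) * (B * cos (snd p) + C * sin (snd p))"
    "AE \<theta> in circ. u \<theta> = (\<integral>\<theta>. u \<theta> \<partial>circ) / (2 * pi) + sqrt 3 / 2 * (B * cos \<theta> + C * sin \<theta>)"
proof -
  note D = catD[OF c] and P = cat_perp_sqi[OF c]
  let ?J = "cyl {0..}"
  define U where "U = (\<integral>\<theta>. u \<theta> \<partial>circ) / (2 * pi)"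
  define m m1 fp fp1 where "m p = mean f (fst p)" and "m1 p = mean f1 (fst p)"
    and "fp p = f p - mean f (fst p)" and "fp1 p = f1 p - mean f1 (fst p)" for p :: "real \<times> real"
  have wm: "wkt 0 T 0 m m1 (\<lambda>_. U)" if "T > 0" for T
    unfolding m_def m1_def U_def by (rule wkt_mean[OF D(1)[OF that]])
  have wfp: "wkt 0 T 0 fp fp1 (\<lambda>\<theta>. u \<theta> - U)" if "T > 0" for T
    using wkt_diff[OF D(1)[OF that] wm[OF that]] unfolding fp_def fp1_def m_def m1_def .
  have qm: "wsq m" unfolding m_def by (rule wsq_mean[OF D(5)])
  have sm1: "sqi ?J m1" and sfp: "sqi ?J fp" and sfp1: "sqi ?J fp1"
    using P unfolding m1_def fp_def fp1_def by auto
  have sh: "sqi ?J (\<lambda>p. h0 (fst p) * m p)"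
    by (rule wsq_sqi_mult[OF meas_h0 h0_bound(1) qm])
  have sth: "sqi ?J (\<lambda>p. th (fst p) * fp p)"
    by (rule sqi_bounded_mult[OF sfp, where B = 1]) (use th_abs in \<open>auto intro: measurable_fst_comp\<close>)
  have z0: "AE p in ?J. m1 p - h0 (fst p) * m p = 0"
    by (rule sqi_zero_AE[OF sqi_diff[OF sm1 sh]]) (use S0 in \<open>simp add: m_def m1_def\<close>)
  have z1: "AE p in ?J. fp1 p + th (fst p) * fp p = 0"
    by (rule sqi_zero_AE[OF sqi_add[OF sfp1 sth]]) (use S1 in \<open>simp add: fp_def fp1_def\<close>)
  \<comment> \<open>Division by \<open>th\<close> turns m1 = h0 m into a vanishing derivative. The
    quotient equals its value U / th 0 = 2 U on the circle.\<close>
  have m_eq: "AE p in ?J. m p = 2 * U * th (fst p)"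
  proof (rule AE_cyl_exhaust)
    fix T :: real assume T: "T > 0"
    have k: "mult1 0 T (\<lambda>t. 1 / th t) (\<lambda>t. - ((se t)^2 / (th t)^2))"
    proof -
      have n: "th t \<noteq> 0" if "t \<in> {0..T}" for t using th_ge[of t] that by auto
      have "((\<lambda>t. 1 / th t) has_real_derivative - ((se t)^2 / (th t)^2)) (at t within {0..T})" if "t \<in> {0..T}" for t
        using DERIV_inverse_fun[OF th_deriv n[OF that], of "{0..T}"] n[OF that] by (simp add: inverse_eq_divide power2_eq_square field_simps)
      then show ?thesis using n unfolding mult1_def by (auto intro!: continuous_intros)
    qed
    have "AE p in cyl {0..T}. - ((se (fst p))^2 / (th (fst p))^2) * m p + 1 / th (fst p) * m1 p = 0"
      using AE_restrict_cyl[OF z0, of T] AE_restrict_cyl[OF AE_cyl_inf, of T]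
    proof eventually_elim
      case (elim p)
      have "m1 p = h0 (fst p) * m p" using elim(1) by simp
      moreover have "th (fst p) \<noteq> 0" using th_ge[OF elim(2)] by simp
      ultimately show ?case by (simp add: h0_def power2_eq_square)
    qed
    from wkt_flat[OF T _ wkt_mult[OF wm[OF T] k] this]
    have "AE p in cyl {0..T}. 1 / th (fst p) * m p = 1 / th 0 * U" by simp
    then show "AE p in cyl {0..T}. m p = 2 * U * th (fst p)"
      using AE_restrict_cyl[OF AE_cyl_inf, of T]
    proof eventually_elim
      case (elim p)
      have "th (fst p) \<noteq> 0" using th_ge[OF elim(2)] by simp
      then show ?case using elim(1) by (simp add: th_0 field_simps)
    qed
  qed
  \<comment> \<open>Division by se 0 = sqrt 3 / 2 gives \<open>se\<close> times v the trace of the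
    remainder.\<close>
  define v where "v \<theta> = (u \<theta> - U) / (sqrt 3 / 2)" for \<theta>
  have sv: "sqi circ v"
  proof -
    have "v = (\<lambda>\<theta>. 2 / sqrt 3 * (u \<theta> - U))" by (auto simp: v_def)
    then show ?thesis using sqi_scale[OF sqi_diff[OF D(6) sqi_circ_const[of U]], of "2 / sqrt 3"] by simp
  qed
  have fp_eq: "AE p in ?J. fp p = se (fst p) * v (snd p)"
  proof (rule AE_cyl_exhaust)
    fix T :: real assume T: "T > 0"
    have k: "mult1 0 T (\<lambda>t. 1 / se t) (\<lambda>t. th t / se t)"
    proof -
      have n: "se t \<noteq> 0" for t using se_pos[of t] by simp
      have "((\<lambda>t. 1 / se t) has_real_derivative th t / se t) (at t within {0..T})" for t
        using DERIV_inverse_fun[OF se_deriv n, of t "{0..T}"] n[of t] by (simp add: inverse_eq_divide power2_eq_square field_simps)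
      then show ?thesis using n unfolding mult1_def by (auto intro!: continuous_intros)
    qed
    have "AE p in cyl {0..T}. th (fst p) / se (fst p) * fp p + 1 / se (fst p) * fp1 p = 0"
      using AE_restrict_cyl[OF z1, of T]
    proof eventually_elim
      case (elim p)
      have "th (fst p) / se (fst p) * fp p + 1 / se (fst p) * fp1 p = (fp1 p + th (fst p) * fp p) / se (fst p)"
        by (simp add: add_divide_distrib)
      then show ?case using elim by simp
    qed
    from wkt_flat[OF T _ wkt_mult[OF wfp[OF T] k] this]
    have "AE p in cyl {0..T}. 1 / se (fst p) * fp p = 1 / se 0 * (u (snd p) - U)" by simp
    then show "AE p in cyl {0..T}. fp p = se (fst p) * v (snd p)"
    proof eventually_elim
      case (elim p)
      then show ?case using se_pos[of "fst p"] by (simp add: se_0 v_def field_simps)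
    qed
  qed
  define N where "N = (\<integral>t. (se t)^2 \<partial>lbI {0..})"
  have iN: "integrable (lbI {0..}) (\<lambda>t. (se t)^2)"
    by (rule Bochner_Integration.integrable_bound[of _ "\<lambda>t. 2 * exp (- t)"])
      (use integrable_exp_neg se_sq_le in auto)
  have N: "N > 0"
  proof -
    have "N \<ge> 0" unfolding N_def by simp
    moreover have "N \<noteq> 0"
    proof
      assume "N = 0"
      then have "AE t in lbI {0..}. (se t)^2 = 0"
        unfolding N_def using iN by (subst (asm) integral_nonneg_eq_0_iff_AE) auto
      moreover have "se t \<noteq> 0" for t using se_pos[of t] by simp
      ultimately have "AE t in lborel. t \<notin> {0::real..1}" by (subst (asm) AE_lbI) (auto elim!: eventually_mono)
      then have "{0::real..1} \<in> null_sets lborel" by (subst AE_iff_null_sets) auto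
      then show False by (simp add: null_sets_def)
    qed
    ultimately show ?thesis by simp
  qed
  have ise: "integrable ?J (\<lambda>p. f2 p * (se (fst p) * w (snd p)))" if "sqi circ w" for w
    by (rule sqi_mult_integrable[OF D(4) sqi_se_prod[OF that]])
  \<comment> \<open>It is not known yet that f2 is \<open>se\<close> times a function of \<theta>; z
    is the coefficient of its projection onto \<open>se\<close> on each line of constant \<theta>,
    and plays the part of v'.\<close>
  define z where "z \<theta> = (\<integral>t. f2 (t, \<theta>) * se t \<partial>lbI {0..}) / N" for \<theta>
  have zint: "(\<integral>p. f2 p * (se (fst p) * w (snd p)) \<partial>?J) = N * (\<integral>\<theta>. z \<theta> * w \<theta> \<partial>circ)" if w: "sqi circ w" for w
  proof -
    have "(\<integral>p. f2 p * (se (fst p) * w (snd p)) \<partial>?J) = (\<integral>\<theta>. \<integral>t. f2 (t, \<theta>) * (se t * w \<theta>) \<partial>lbI {0..} \<partial>circ)"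
      using Fubini_cyl(1)[OF _ ise[OF w]] by simp
    also have "\<dots> = (\<integral>\<theta>. N * (z \<theta> * w \<theta>) \<partial>circ)"
      using N by (simp add: z_def mult.assoc[symmetric])
    finally show ?thesis by simp
  qed
  have fint: "(\<integral>p. fp p * (se (fst p) * w (snd p)) \<partial>?J) = N * (\<integral>\<theta>. v \<theta> * w \<theta> \<partial>circ)" if w: "sqi circ w" for w
  proof -
    have wm: "w \<in> borel_measurable borel" "v \<in> borel_measurable borel" "fp \<in> borel_measurable borel"
      using sqiD(1)[OF w] sqiD(1)[OF sv] sqiD(1)[OF sfp] by auto
    have "(\<integral>p. fp p * (se (fst p) * w (snd p)) \<partial>?J) = (\<integral>p. (se (fst p))^2 * (v (snd p) * w (snd p)) \<partial>?J)"
    proof (rule integral_cong_AE)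
      show "AE p in ?J. fp p * (se (fst p) * w (snd p)) = (se (fst p))^2 * (v (snd p) * w (snd p))"
        using fp_eq by eventually_elim (simp add: power2_eq_square)
    qed (unfold measurable_cyl, (intro borel_measurable_times borel_measurable_power measurable_fst_comp measurable_snd_comp wm meas_se)+)
    also have "\<dots> = N * (\<integral>\<theta>. v \<theta> * w \<theta> \<partial>circ)"
      unfolding N_def by (rule Fubini_cyl_prod(2)[OF _ iN sqi_mult_integrable[OF sv w]]) simp
    finally show ?thesis .
  qed
  have sz: "sqi circ z"
  proof -
    interpret pair_sigma_finite "lbI {0..}" circ by (rule pair_sigma_finite_cyl) simp
    have f2m: "f2 \<in> borel_measurable borel" using sqiD(1)[OF D(4)] by simp
    have "(\<lambda>(\<theta>, t). f2 (t, \<theta>) * se t) \<in> borel_measurable (borel \<Otimes>\<^sub>M lbI {0..})"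
    proof -
      have "(\<lambda>p::real\<times>real. f2 (snd p, fst p) * se (snd p)) \<in> borel_measurable borel"
        by (intro borel_measurable_times measurable_snd_comp meas_se measurable_compose[OF _ f2m])
          (simp add: borel_prod[symmetric])
      then show ?thesis
        by (simp add: measurable_cong_sets[OF sets_pair_measure_cong[OF refl sets_lbI] refl] borel_prod case_prod_beta')
    qed
    from M1.borel_measurable_lebesgue_integral[OF this]
    have mz: "z \<in> borel_measurable borel" unfolding z_def by simp
    have iF: "integrable circ (\<lambda>\<theta>. \<integral>t. (f2 (t, \<theta>))^2 \<partial>lbI {0..})"
      using Fubini_cyl(6)[OF _ sqiD(2)[OF D(4)]] by simp
    have "integrable circ (\<lambda>\<theta>. (z \<theta>)^2)"
    proof (rule Bochner_Integration.integrable_bound)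
      show "integrable circ (\<lambda>\<theta>. (\<integral>t. (f2 (t, \<theta>))^2 \<partial>lbI {0..}) / N)" using iF by simp
      show "AE \<theta> in circ. norm ((z \<theta>)^2) \<le> norm ((\<integral>t. (f2 (t, \<theta>))^2 \<partial>lbI {0..}) / N)"
        using Fubini_cyl(5)[OF _ sqiD(2)[OF D(4)], simplified]
      proof eventually_elim
        case (elim \<theta>)
        have 1: "sqi (lbI {0..}) (\<lambda>t. f2 (t, \<theta>))" using elim measurable_slice_fst[OF f2m] by (simp add: sqi_def)
        have 2: "sqi (lbI {0..}) se" using iN by (simp add: sqi_def)
        have "(\<integral>t. f2 (t, \<theta>) * se t \<partial>lbI {0..})^2 \<le> (\<integral>t. (f2 (t, \<theta>))^2 \<partial>lbI {0..}) * N"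
          unfolding N_def by (rule integral_Cauchy_Schwarz[OF 1 2])
        then have "(z \<theta>)^2 \<le> (\<integral>t. (f2 (t, \<theta>))^2 \<partial>lbI {0..}) / N"
          using N by (simp add: z_def power_divide power2_eq_square field_simps)
        then show ?case using N by simp
      qed
    qed (use mz in simp)
    then show ?thesis using mz by (simp add: sqi_def)
  qed
  have v0: "(\<integral>\<theta>. v \<theta> \<partial>circ) = 0"
  proof -
    have "(\<integral>\<theta>. v \<theta> \<partial>circ) = (\<integral>\<theta>. 2 / sqrt 3 * (u \<theta> - U) \<partial>circ)" by (simp add: v_def mult.commute)
    also have "\<dots> = 2 / sqrt 3 * (\<integral>\<theta>. u \<theta> - U \<partial>circ)" by (rule integral_mult_right_zero)
    also have "(\<integral>\<theta>. u \<theta> - U \<partial>circ) = (\<integral>\<theta>. u \<theta> \<partial>circ) - 2 * pi * U"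
      using Bochner_Integration.integral_diff[OF sqi_integrable[OF finite_circ D(6)] finite_measure.integrable_const[OF finite_circ, of U]] by simp
    also have "(\<integral>\<theta>. u \<theta> \<partial>circ) - 2 * pi * U = 0" by (simp add: U_def)
    finally show ?thesis by simp
  qed
  have "\<exists>B C. AE \<theta> in circ. v \<theta> = B * cos \<theta> + C * sin \<theta>"
  proof (rule first_harmonics[OF sv sz])
    fix \<eta> \<eta>' assume \<eta>: "c1per \<eta> \<eta>'"
    note s\<eta> = c1per_sqi[OF \<eta>]
    define em where "em = (\<integral>\<theta>. \<eta> \<theta> \<partial>circ) / (2 * pi)"
    have sm: "smh 0 T (\<lambda>p. se (fst p) * \<eta> (snd p)) (\<lambda>p. se (fst p) * \<eta>' (snd p))" for T
      by (rule smh_prod[OF \<eta>]) (intro continuous_intros)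
    have s1: "sqi ?J (\<lambda>p. se (fst p) * \<eta> (snd p))" "sqi ?J (\<lambda>p. se (fst p) * \<eta>' (snd p))"
        "sqi ?J (\<lambda>p. se (fst p) * (\<eta> (snd p) - em))"
      using sqi_se_prod[OF s\<eta>(1)] sqi_se_prod[OF s\<eta>(2)] sqi_se_prod[OF sqi_diff[OF s\<eta>(1) sqi_circ_const]] by auto
    \<comment> \<open>The Wirtinger gap of f + e \<open>se\<close> \<eta> is nonnegative for all e
      and zero at e = 0, so its linear term vanishes. The inequality involves parts of mean zero,
      which is why the mean \<open>em\<close> of \<eta> is subtracted.\<close>
    have "0 \<le> 2 * e * ((\<integral>p. f2 p * (se (fst p) * \<eta>' (snd p)) \<partial>?J) - (\<integral>p. fp p * (se (fst p) * (\<eta> (snd p) - em)) \<partial>?J))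
      + e^2 * ((\<integral>p. (se (fst p) * \<eta>' (snd p))^2 \<partial>?J) - (\<integral>p. (se (fst p) * (\<eta> (snd p) - em))^2 \<partial>?J))" for e
    proof -
      let ?g = "\<lambda>p. f p + e * (se (fst p) * \<eta> (snd p))" and ?g2 = "\<lambda>p. f2 p + e * (se (fst p) * \<eta>' (snd p))"
      have w: "wkh 0 T ?g ?g2" if "T > 0" for T
      proof -
        have "smh 0 T (\<lambda>p. (e * se (fst p)) * \<eta> (snd p)) (\<lambda>p. (e * se (fst p)) * \<eta>' (snd p))"
          by (rule smh_prod[OF \<eta>, of "\<lambda>t. e * se t"]) (intro continuous_intros)
        then show ?thesis using wkh_add[OF D(2)[OF that] wkh_smooth] by (simp add: mult.assoc)
      qed
      have gm: "?g \<in> borel_measurable borel" using D(7) sqiD(1)[OF s1(1)] by simp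
      have sg2: "sqi ?J ?g2" by (intro sqi_add sqi_scale s1 D)
      have AEm: "AE p in ?J. ?g p - mean ?g (fst p) = fp p + e * (se (fst p) * (\<eta> (snd p) - em))"
      proof -
        have "AE t in lbI {0..}. sqi circ (\<lambda>\<theta>. f (t, \<theta>))"
        proof -
          have "AE t in lbI {0..}. sqi circ (\<lambda>\<theta>. exp (- (t / 2)) * f (t, \<theta>))"
            using AE_sqi_slice[OF _ D(5)[unfolded wsq_def]] by simp
          then show ?thesis
          proof eventually_elim
            case (elim t)
            from sqi_scale[OF elim, of "exp (t / 2)"] show ?case by (simp only: mult.assoc[symmetric] exp_minus_inverse mult_1)
          qed
        qed
        then have "AE t in lbI {0..}. mean ?g t = mean f t + e * (se t * em)"
        proof eventually_elim
          case (elim t)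
          have "mean ?g t = (\<integral>\<theta>. f (t, \<theta>) + (e * se t) * \<eta> \<theta> \<partial>circ) / (2 * pi)" by (simp add: mean_def mult.assoc)
          also have "\<dots> = mean f t + e * (se t * em)"
            using sqi_integrable[OF finite_circ elim] sqi_integrable[OF finite_circ s\<eta>(1)]
            by (simp add: mean_def em_def add_divide_distrib)
          finally show ?case .
        qed
        from AE_cyl_fst[OF borel_closed[OF closed_atLeast] this] show ?thesis
        proof eventually_elim
          case (elim p)
          show ?case unfolding elim fp_def by (simp add: algebra_simps)
        qed
      qed
      have "(\<integral>p. (?g p - mean ?g (fst p))^2 \<partial>?J) = (\<integral>p. (fp p + e * (se (fst p) * (\<eta> (snd p) - em)))^2 \<partial>?J)"
      proof (rule integral_cong_AE)
        show "AE p in ?J. (?g p - mean ?g (fst p))^2 = (fp p + e * (se (fst p) * (\<eta> (snd p) - em)))^2"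
          using AEm by eventually_elim simp
        show "(\<lambda>p. (fp p + e * (se (fst p) * (\<eta> (snd p) - em)))^2) \<in> borel_measurable ?J"
          using sqiD(1)[OF sfp] sqiD(1)[OF s1(3)] by simp
        show "(\<lambda>p. (?g p - mean ?g (fst p))^2) \<in> borel_measurable ?J"
          using gm measurable_fst_comp[OF mean_measurable[OF gm]] by simp
      qed
      also have "\<dots> = (\<integral>p. (fp p)^2 \<partial>?J) + 2 * e * (\<integral>p. fp p * (se (fst p) * (\<eta> (snd p) - em)) \<partial>?J) + e^2 * (\<integral>p. (se (fst p) * (\<eta> (snd p) - em))^2 \<partial>?J)"
        using integral_square_split[OF sfp sqi_scale[OF s1(3), of "- e"]] by (simp add: power_mult_distrib mult_ac)
      finally have 1: "(\<integral>p. (?g p - mean ?g (fst p))^2 \<partial>?J) = \<dots>" .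
      have 2: "(\<integral>p. (?g2 p)^2 \<partial>?J) = (\<integral>p. (f2 p)^2 \<partial>?J) + 2 * e * (\<integral>p. f2 p * (se (fst p) * \<eta>' (snd p)) \<partial>?J) + e^2 * (\<integral>p. (se (fst p) * \<eta>' (snd p))^2 \<partial>?J)"
        using integral_square_split[OF D(4) sqi_scale[OF s1(2), of "- e"]] by (simp add: power_mult_distrib mult_ac)
      have "(\<integral>p. (?g p - mean ?g (fst p))^2 \<partial>?J) \<le> (\<integral>p. (?g2 p)^2 \<partial>?J)"
        by (rule wkh_wirtinger_inf(2)[OF w sg2 gm])
      then show ?thesis using W unfolding 1 2 fp_def by (simp add: algebra_simps)
    qed
    from quadratic_nonneg_linear_zero[OF this]
    have "(\<integral>p. f2 p * (se (fst p) * \<eta>' (snd p)) \<partial>?J) = (\<integral>p. fp p * (se (fst p) * (\<eta> (snd p) - em)) \<partial>?J)" by simp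
    then have "(\<integral>\<theta>. z \<theta> * \<eta>' \<theta> \<partial>circ) = (\<integral>\<theta>. v \<theta> * (\<eta> \<theta> - em) \<partial>circ)"
      unfolding zint[OF s\<eta>(2)] fint[OF sqi_diff[OF s\<eta>(1) sqi_circ_const]] using N by simp
    also have "\<dots> = (\<integral>\<theta>. v \<theta> * \<eta> \<theta> \<partial>circ)"
      using sqi_mult_integrable[OF sv s\<eta>(1)] sqi_integrable[OF finite_circ sv] v0 by (simp add: right_diff_distrib)
    finally show "(\<integral>\<theta>. z \<theta> * \<eta>' \<theta> \<partial>circ) = (\<integral>\<theta>. v \<theta> * \<eta> \<theta> \<partial>circ)" .
    \<comment> \<open>Square integrability is known for fp only. The mean of f is the bounded
      function 2 U th, and \<open>se\<close> supplies the integrability in t.\<close>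
    have iw: "integrable ?J (\<lambda>p. f p * (se (fst p) * \<eta>' (snd p)))"
      using sqi_mult_integrable[OF wsq_sqi_mult[OF meas_se _ D(5), of 2]] s1(2)
    proof -
      have "(\<lambda>p. f p * (se (fst p) * \<eta>' (snd p))) = (\<lambda>p. m p * (se (fst p) * \<eta>' (snd p)) + fp p * (se (fst p) * \<eta>' (snd p)))"
        by (auto simp: m_def fp_def algebra_simps)
      moreover have "integrable ?J (\<lambda>p. m p * (se (fst p) * \<eta>' (snd p)))"
      proof -
        have "integrable ?J (\<lambda>p. (2 * U * th (fst p) * se (fst p)) * \<eta>' (snd p))"
        proof (rule Fubini_cyl_prod(1)[where k = "\<lambda>t. 2 * U * th t * se t"])
          show "integrable (lbI {0..}) (\<lambda>t. 2 * U * th t * se t)"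
          proof (rule Bochner_Integration.integrable_bound[of _ "\<lambda>t. 4 * \<bar>U\<bar> * exp (- t)"])
            have "\<bar>2 * U * th t * se t\<bar> \<le> 4 * \<bar>U\<bar> * exp (- t)" for t
            proof -
              have "\<bar>th t\<bar> * se t \<le> 1 * (2 * exp (- t))" using th_abs se_le_exp se_pos[of t] by (intro mult_mono) auto
              then have "2 * \<bar>U\<bar> * (\<bar>th t\<bar> * se t) \<le> 2 * \<bar>U\<bar> * (2 * exp (- t))" by (intro mult_left_mono) auto
              then show ?thesis using se_pos[of t] by (simp add: abs_mult abs_of_pos mult_ac)
            qed
            then show "AE t in lbI {0..}. norm (2 * U * th t * se t) \<le> norm (4 * \<bar>U\<bar> * exp (- t))" by simp
          qed (use integrable_exp_neg in auto)
        qed (auto intro: sqi_integrable[OF finite_circ s\<eta>(2)])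
        then show ?thesis
        proof (rule integrable_cong_AE_imp)
          show "AE p in ?J. (2 * U * th (fst p) * se (fst p)) * \<eta>' (snd p) = m p * (se (fst p) * \<eta>' (snd p))"
            using m_eq by eventually_elim simp
          show "(\<lambda>p. m p * (se (fst p) * \<eta>' (snd p))) \<in> borel_measurable ?J"
            using sqiD(1)[OF s1(2)] wsq_measurable[OF qm] by simp
        qed
      qed
      ultimately show ?thesis using sqi_mult_integrable[OF sfp s1(2)] by simp
    qed
    \<comment> \<open>The other half of the system: f2 is the weak \<theta>-derivative of f, and the
      mean of f drops out because \<eta>' integrates to zero.\<close>
    have "(\<integral>p. f2 p * (se (fst p) * \<eta> (snd p)) \<partial>?J) + (\<integral>p. f p * (se (fst p) * \<eta>' (snd p)) \<partial>?J) = 0"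
      by (rule wkh_ibp_inf[OF D(2) sm ise[OF s\<eta>(1)] iw])
    moreover have "(\<integral>p. f p * (se (fst p) * \<eta>' (snd p)) \<partial>?J) = (\<integral>p. fp p * (se (fst p) * \<eta>' (snd p)) \<partial>?J)"
    proof -
      have ifp: "integrable ?J (\<lambda>p. fp p * (se (fst p) * \<eta>' (snd p)))" by (rule sqi_mult_integrable[OF sfp s1(2)])
      have "(\<lambda>p. f p * (se (fst p) * \<eta>' (snd p)) - fp p * (se (fst p) * \<eta>' (snd p))) = (\<lambda>p. m p * (se (fst p) * \<eta>' (snd p)))"
        by (auto simp: m_def fp_def algebra_simps)
      then have im: "integrable ?J (\<lambda>p. m p * (se (fst p) * \<eta>' (snd p)))"
        and e: "(\<integral>p. f p * (se (fst p) * \<eta>' (snd p)) \<partial>?J) - (\<integral>p. fp p * (se (fst p) * \<eta>' (snd p)) \<partial>?J) = (\<integral>p. m p * (se (fst p) * \<eta>' (snd p)) \<partial>?J)"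
        using Bochner_Integration.integrable_diff[OF iw ifp] Bochner_Integration.integral_diff[OF iw ifp] by auto
      have "(\<integral>p. m p * (se (fst p) * \<eta>' (snd p)) \<partial>?J) = 0"
        unfolding Fubini_cyl(2)[OF _ im, simplified] by (simp add: m_def c1per_integral_zero[OF \<eta>])
      then show ?thesis using e by simp
    qed
    ultimately have "N * (\<integral>\<theta>. z \<theta> * \<eta> \<theta> \<partial>circ) + N * (\<integral>\<theta>. v \<theta> * \<eta>' \<theta> \<partial>circ) = 0"
      unfolding zint[OF s\<eta>(1)] fint[OF s\<eta>(2)] by simp
    then have "N * ((\<integral>\<theta>. z \<theta> * \<eta> \<theta> \<partial>circ) + (\<integral>\<theta>. v \<theta> * \<eta>' \<theta> \<partial>circ)) = 0"
      by (simp only: distrib_left)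
    then have "(\<integral>\<theta>. z \<theta> * \<eta> \<theta> \<partial>circ) + (\<integral>\<theta>. v \<theta> * \<eta>' \<theta> \<partial>circ) = 0"
      using N by simp
    then show "(\<integral>\<theta>. z \<theta> * \<eta> \<theta> \<partial>circ) = - (\<integral>\<theta>. v \<theta> * \<eta>' \<theta> \<partial>circ)" by linarith
  qed
  then obtain B C where BC: "AE \<theta> in circ. v \<theta> = B * cos \<theta> + C * sin \<theta>" by blast
  show ?thesis
  proof (rule that[of B C])
    show "AE p in ?J. f p = (\<integral>\<theta>. u \<theta> \<partial>circ) / pi * th (fst p) + se (fst p) * (B * cos (snd p) + C * sin (snd p))"
      using m_eq fp_eq AE_cyl_snd[OF _ BC, of "{0..}", simplified]
      by eventually_elim (simp add: m_def fp_def U_def field_simps)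
    show "AE \<theta> in circ. u \<theta> = (\<integral>\<theta>. u \<theta> \<partial>circ) / (2 * pi) + sqrt 3 / 2 * (B * cos \<theta> + C * sin \<theta>)"
      using BC
    proof eventually_elim
      case (elim \<theta>)
      have "u \<theta> = U + sqrt 3 / 2 * v \<theta>" by (simp add: v_def field_simps)
      then show ?case unfolding elim U_def .
    qed
  qed
qed

section \<open>Jacobi fields\<close>

definition wv :: "real \<Rightarrow> real \<Rightarrow> real \<Rightarrow> real" where "wv b d \<theta> = b * cos \<theta> + d * sin \<theta>"

lemma c1per_wv: "c1per (wv b d) (wv d (- b))"
  unfolding c1per_def wv_def by (auto intro!: derivative_eq_intros continuous_intros)

lemma wv_abs: "\<bar>wv b d \<theta>\<bar> \<le> \<bar>b\<bar> + \<bar>d\<bar>"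
proof -
  have "\<bar>b * cos \<theta>\<bar> \<le> \<bar>b\<bar>" "\<bar>d * sin \<theta>\<bar> \<le> \<bar>d\<bar>" by (auto simp: abs_mult mult_left_le)
  then show ?thesis unfolding wv_def by linarith
qed

text \<open>The normal components of the translations: \<open>a\<close> is the vertical one, \<open>b\<close> and \<open>d\<close> the horizontal ones.\<close>

definition KK :: "real \<Rightarrow> real \<Rightarrow> real \<Rightarrow> real \<times> real \<Rightarrow> real" where
  "KK a b d p = a * th (fst p) + se (fst p) * wv b d (snd p)"
definition KK1 :: "real \<Rightarrow> real \<Rightarrow> real \<Rightarrow> real \<times> real \<Rightarrow> real" where
  "KK1 a b d p = a * (se (fst p))^2 - th (fst p) * se (fst p) * wv b d (snd p)"
definition KK2 :: "real \<Rightarrow> real \<Rightarrow> real \<Rightarrow> real \<times> real \<Rightarrow> real" where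
  "KK2 a b d p = se (fst p) * wv d (- b) (snd p)"
definition KK11 :: "real \<Rightarrow> real \<Rightarrow> real \<Rightarrow> real \<times> real \<Rightarrow> real" where
  "KK11 a b d p = - 2 * a * (se (fst p))^2 * th (fst p) + se (fst p) * (1 - 2 * (se (fst p))^2) * wv b d (snd p)"

lemma cont_wv [continuous_intros]: fixes f :: "'a::t2_space \<Rightarrow> real" shows "continuous_on S f \<Longrightarrow> continuous_on S (\<lambda>x. wv b d (f x))"
  unfolding wv_def by (intro continuous_intros)

lemma KK_cont: "continuous_on S (KK a b d)" "continuous_on S (KK1 a b d)" "continuous_on S (KK2 a b d)" "continuous_on S (KK11 a b d)"
  unfolding KK_def[abs_def] KK1_def[abs_def] KK2_def[abs_def] KK11_def[abs_def] by (intro continuous_intros)+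

lemma KK_meas: "KK a b d \<in> borel_measurable borel" "KK1 a b d \<in> borel_measurable borel"
  "KK2 a b d \<in> borel_measurable borel" "KK11 a b d \<in> borel_measurable borel"
  by (intro borel_measurable_continuous_onI KK_cont)+

lemma KK_bound: "\<bar>KK a b d p\<bar> \<le> \<bar>a\<bar> + \<bar>b\<bar> + \<bar>d\<bar>"
proof -
  have "\<bar>a * th (fst p)\<bar> \<le> \<bar>a\<bar>" using th_abs by (simp add: abs_mult mult_left_le)
  moreover have "\<bar>se (fst p) * wv b d (snd p)\<bar> \<le> 1 * (\<bar>b\<bar> + \<bar>d\<bar>)"
    unfolding abs_mult using wv_abs se_le_1 se_pos[of "fst p"] by (intro mult_mono) auto
  ultimately show ?thesis unfolding KK_def
    using abs_triangle_ineq[of "a * th (fst p)" "se (fst p) * wv b d (snd p)"] by simp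
qed

lemma KK_decay:
  "\<bar>KK1 a b d p\<bar> \<le> 4 * (\<bar>a\<bar> + \<bar>b\<bar> + \<bar>d\<bar>) * exp (- fst p)"
  "\<bar>KK2 a b d p\<bar> \<le> 4 * (\<bar>a\<bar> + \<bar>b\<bar> + \<bar>d\<bar>) * exp (- fst p)"
  "\<bar>KK11 a b d p\<bar> \<le> 4 * (\<bar>a\<bar> + \<bar>b\<bar> + \<bar>d\<bar>) * exp (- fst p)"
proof -
  let ?e = "2 * exp (- fst p)" and ?w = "\<bar>b\<bar> + \<bar>d\<bar>"
  have s2: "\<bar>(se (fst p))^2\<bar> \<le> ?e" "\<bar>se (fst p)\<bar> \<le> ?e" using se_sq_le se_le_exp se_pos[of "fst p"] by auto
  have tp: "(se (fst p))^2 \<le> 1" using se_le_1 se_pos[of "fst p"] by (simp add: power_le_one)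
  then have tq: "\<bar>1 - 2 * (se (fst p))^2\<bar> \<le> 1" by (auto simp: abs_le_iff)
  have a: "\<bar>a * (se (fst p))^2\<bar> \<le> \<bar>a\<bar> * ?e" unfolding abs_mult using s2 by (intro mult_left_mono) auto
  have m3: "\<bar>x * se (fst p) * wv b d (snd p)\<bar> \<le> 1 * ?e * ?w" if "\<bar>x\<bar> \<le> 1" for x
    unfolding abs_mult using that wv_abs[of b d] s2 by (intro mult_mono) auto
  have "\<bar>KK1 a b d p\<bar> \<le> \<bar>a\<bar> * ?e + ?e * ?w"
    using a m3[OF th_abs, of "fst p"] abs_triangle_ineq4[of "a * (se (fst p))^2" "th (fst p) * se (fst p) * wv b d (snd p)"]
    unfolding KK1_def mult_1 by linarith
  also have "\<dots> \<le> 4 * (\<bar>a\<bar> + \<bar>b\<bar> + \<bar>d\<bar>) * exp (- fst p)" by (simp add: algebra_simps)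
  finally show "\<bar>KK1 a b d p\<bar> \<le> 4 * (\<bar>a\<bar> + \<bar>b\<bar> + \<bar>d\<bar>) * exp (- fst p)" .
  have "\<bar>KK2 a b d p\<bar> \<le> ?e * (\<bar>d\<bar> + \<bar>-b\<bar>)"
    unfolding KK2_def abs_mult using wv_abs[of d "-b"] s2 by (intro mult_mono) auto
  also have "\<dots> \<le> 4 * (\<bar>a\<bar> + \<bar>b\<bar> + \<bar>d\<bar>) * exp (- fst p)" by (simp add: algebra_simps)
  finally show "\<bar>KK2 a b d p\<bar> \<le> 4 * (\<bar>a\<bar> + \<bar>b\<bar> + \<bar>d\<bar>) * exp (- fst p)" .
  have "\<bar>2 * a * (se (fst p))^2 * th (fst p)\<bar> \<le> 2 * (\<bar>a\<bar> * ?e) * 1"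
  proof -
    have "\<bar>2 * a * (se (fst p))^2 * th (fst p)\<bar> = 2 * \<bar>a * (se (fst p))^2\<bar> * \<bar>th (fst p)\<bar>" by (simp add: abs_mult)
    also have "\<dots> \<le> 2 * (\<bar>a\<bar> * ?e) * 1" using a th_abs by (intro mult_mono) auto
    finally show ?thesis .
  qed
  moreover have "\<bar>se (fst p) * (1 - 2 * (se (fst p))^2) * wv b d (snd p)\<bar> \<le> ?e * ?w"
    using m3[OF tq] by (simp add: mult.commute mult.left_commute)
  ultimately have "\<bar>KK11 a b d p\<bar> \<le> 2 * (\<bar>a\<bar> * ?e) + ?e * ?w" unfolding KK11_def
    using abs_triangle_ineq[of "- 2 * a * (se (fst p))^2 * th (fst p)" "se (fst p) * (1 - 2 * (se (fst p))^2) * wv b d (snd p)"]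
    by simp
  also have "\<dots> \<le> 4 * (\<bar>a\<bar> + \<bar>b\<bar> + \<bar>d\<bar>) * exp (- fst p)" by (simp add: algebra_simps)
  finally show "\<bar>KK11 a b d p\<bar> \<le> 4 * (\<bar>a\<bar> + \<bar>b\<bar> + \<bar>d\<bar>) * exp (- fst p)" .
qed

lemma KK1_smt: "smt 0 T (KK1 a b d) (KK11 a b d)"
proof -
  have "((\<lambda>t. KK1 a b d (t, \<theta>)) has_real_derivative KK11 a b d (t, \<theta>)) (at t within S)" for t \<theta> S
  proof -
    have "((\<lambda>t. KK1 a b d (t, \<theta>)) has_real_derivative a * (2 * se t * (- (th t * se t)))
       - ((se t)^2 * se t + th t * (- (th t * se t))) * wv b d \<theta>) (at t within S)"
      unfolding KK1_def by (auto intro!: derivative_eq_intros th_deriv se_deriv)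
    moreover have "th t * (- (th t * se t)) = - ((1 - (se t)^2) * se t)"
      unfolding th_se[symmetric] by (simp add: power2_eq_square)
    moreover have "a * (2 * se t * (- (th t * se t))) - ((se t)^2 * se t + - ((1 - (se t)^2) * se t)) * wv b d \<theta> = KK11 a b d (t, \<theta>)"
      unfolding KK11_def by (simp add: power2_eq_square algebra_simps)
    ultimately show ?thesis by (simp only:)
  qed
  then show ?thesis unfolding smt_def using KK_meas KK_cont by auto
qed

lemma KK2_smh: "smh 0 T (KK2 a b d) (\<lambda>p. - (se (fst p) * wv b d (snd p)))"
proof -
  have "smh 0 T (\<lambda>p. se (fst p) * wv d (- b) (snd p)) (\<lambda>p. se (fst p) * wv (- b) (- d) (snd p))"
    by (rule smh_prod[OF c1per_wv]) (intro continuous_intros)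
  moreover have "se (fst p) * wv (- b) (- d) (snd p) = - (se (fst p) * wv b d (snd p))" for p :: "real \<times> real"
    by (simp add: wv_def algebra_simps)
  ultimately show ?thesis unfolding KK2_def[abs_def] by simp
qed

lemma KK_0: "KK a b d (0, \<theta>) = a / 2 + sqrt 3 / 2 * wv b d \<theta>"
  by (simp add: KK_def th_0 se_0)

text \<open>\<open>KK\<close> solves the Jacobi equation, so integration by parts leaves -u (KK1 +
  KK / 2) on the circle. There the horizontal parts, with coefficients -sqrt 3 / 4 and sqrt 3 / 4,
  cancel, and the vertical parts 3/4 a and 1/4 a add up to a.\<close>

lemma cat_pairing:
  assumes c: "cat f f1 f2 u"
  shows "integrable (cyl {0..}) (\<lambda>p. f1 p * KK1 a b d p)"
    "integrable (cyl {0..}) (\<lambda>p. f2 p * KK2 a b d p)"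
    "integrable (cyl {0..}) (\<lambda>p. 2 * (se (fst p))^2 * f p * KK a b d p)"
    "(\<integral>p. f1 p * KK1 a b d p \<partial>cyl {0..}) + (\<integral>p. f2 p * KK2 a b d p \<partial>cyl {0..})
      - (\<integral>p. 2 * (se (fst p))^2 * f p * KK a b d p \<partial>cyl {0..}) - (\<integral>\<theta>. u \<theta> * KK a b d (0, \<theta>) \<partial>circ) / 2
     = - a * (\<integral>\<theta>. u \<theta> \<partial>circ)"
proof -
  note D = catD[OF c]
  let ?J = "cyl {0..}"
  have wf: "wsq f1" "wsq f2" using D(3,4) by (auto intro: wsq_of_sqi)
  show i1: "integrable ?J (\<lambda>p. f1 p * KK1 a b d p)" by (rule dec_mult[OF KK_meas(2) _ wf(1)]) (rule AE_I2, rule KK_decay(1))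
  show i2: "integrable ?J (\<lambda>p. f2 p * KK2 a b d p)" by (rule dec_mult[OF KK_meas(3) _ wf(2)]) (rule AE_I2, rule KK_decay(2))
  have i3: "integrable ?J (\<lambda>p. f p * KK11 a b d p)" by (rule dec_mult[OF KK_meas(4) _ D(5)]) (rule AE_I2, rule KK_decay(3))
  have i4: "integrable ?J (\<lambda>p. f p * KK1 a b d p)" by (rule dec_mult[OF KK_meas(2) _ D(5)]) (rule AE_I2, rule KK_decay(1))
  have m5: "(\<lambda>p. - (se (fst p) * wv b d (snd p))) \<in> borel_measurable borel"
    by (intro borel_measurable_continuous_onI continuous_intros)
  have i5: "integrable ?J (\<lambda>p. f p * - (se (fst p) * wv b d (snd p)))"
  proof (rule dec_mult[OF m5 _ D(5)])
    have "\<bar>- (se (fst p) * wv b d (snd p))\<bar> \<le> (2 * (\<bar>b\<bar> + \<bar>d\<bar>)) * exp (- fst p)" for p :: "real \<times> real"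
    proof -
      have "\<bar>se (fst p)\<bar> * \<bar>wv b d (snd p)\<bar> \<le> (2 * exp (- fst p)) * (\<bar>b\<bar> + \<bar>d\<bar>)"
        using wv_abs se_le_exp se_pos[of "fst p"] by (intro mult_mono) auto
      then show ?thesis by (simp add: abs_mult algebra_simps)
    qed
    then show "AE p in ?J. \<bar>- (se (fst p) * wv b d (snd p))\<bar> \<le> (2 * (\<bar>b\<bar> + \<bar>d\<bar>)) * exp (- fst p)" by simp
  qed
  \<comment> \<open>The Jacobi equation for \<open>KK\<close>, whose second \<theta>-derivative is
    -se wv, multiplied by f.\<close>
  have alg: "2 * (se (fst p))^2 * f p * KK a b d p = - (f p * KK11 a b d p) - f p * - (se (fst p) * wv b d (snd p))" for p
    by (simp add: KK_def KK11_def power2_eq_square algebra_simps)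
  show "integrable ?J (\<lambda>p. 2 * (se (fst p))^2 * f p * KK a b d p)"
    unfolding alg using i3 i5 by simp
  have sm1: "wkt 0 T 0 (KK1 a b d) (KK11 a b d) (\<lambda>\<theta>. KK1 a b d (0, \<theta>))" if "T > 0" for T
    by (rule wkt_smooth[OF KK1_smt]) (use that in auto)
  have "(\<integral>p. 1 * f p * KK11 a b d p \<partial>?J) + (\<integral>p. 1 * KK1 a b d p * f1 p \<partial>?J) + (\<integral>p. 0 * f p * KK1 a b d p \<partial>?J)
    = - 1 * (\<integral>\<theta>. u \<theta> * KK1 a b d (0, \<theta>) \<partial>circ)"
    by (rule wkt_ibp_inf[OF D(1) sm1 mult1_const]) (use i1 i3 i4 in \<open>auto simp: mult.commute\<close>)
  then have e1: "(\<integral>p. f1 p * KK1 a b d p \<partial>?J) = - (\<integral>p. f p * KK11 a b d p \<partial>?J) - (\<integral>\<theta>. u \<theta> * KK1 a b d (0, \<theta>) \<partial>circ)"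
    by (simp add: mult.commute)
  have e2: "(\<integral>p. f2 p * KK2 a b d p \<partial>?J) + (\<integral>p. f p * - (se (fst p) * wv b d (snd p)) \<partial>?J) = 0"
    by (rule wkh_ibp_inf[OF D(2) KK2_smh i2 i5])
  have e3: "(\<integral>p. 2 * (se (fst p))^2 * f p * KK a b d p \<partial>?J) = - (\<integral>p. f p * KK11 a b d p \<partial>?J) - (\<integral>p. f p * - (se (fst p) * wv b d (snd p)) \<partial>?J)"
    unfolding alg using i3 i5 by simp
  have sw: "sqi circ (wv b d)" by (rule c1per_sqi(1)[OF c1per_wv])
  have iu: "integrable circ u" "integrable circ (\<lambda>\<theta>. u \<theta> * wv b d \<theta>)"
    using sqi_integrable[OF finite_circ D(6)] sqi_mult_integrable[OF D(6) sw] by auto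
  have "(\<lambda>\<theta>. u \<theta> * KK1 a b d (0, \<theta>)) = (\<lambda>\<theta>. 3/4 * a * u \<theta> - sqrt 3 / 4 * (u \<theta> * wv b d \<theta>))"
    by (auto simp: KK1_def th_0 se_0 power_divide algebra_simps)
  then have b1: "(\<integral>\<theta>. u \<theta> * KK1 a b d (0, \<theta>) \<partial>circ) = 3/4 * a * (\<integral>\<theta>. u \<theta> \<partial>circ) - sqrt 3 / 4 * (\<integral>\<theta>. u \<theta> * wv b d \<theta> \<partial>circ)"
    using iu by simp
  have "(\<lambda>\<theta>. u \<theta> * KK a b d (0, \<theta>)) = (\<lambda>\<theta>. a / 2 * u \<theta> + sqrt 3 / 2 * (u \<theta> * wv b d \<theta>))"
    by (auto simp: KK_0 algebra_simps)
  then have b2: "(\<integral>\<theta>. u \<theta> * KK a b d (0, \<theta>) \<partial>circ) = a / 2 * (\<integral>\<theta>. u \<theta> \<partial>circ) + sqrt 3 / 2 * (\<integral>\<theta>. u \<theta> * wv b d \<theta> \<partial>circ)"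
    using iu by simp
  show "(\<integral>p. f1 p * KK1 a b d p \<partial>?J) + (\<integral>p. f2 p * KK2 a b d p \<partial>?J)
      - (\<integral>p. 2 * (se (fst p))^2 * f p * KK a b d p \<partial>?J) - (\<integral>\<theta>. u \<theta> * KK a b d (0, \<theta>) \<partial>circ) / 2
     = - a * (\<integral>\<theta>. u \<theta> \<partial>circ)"
    using e1 e2 e3 unfolding b1 b2 by (simp add: field_simps)
qed

section \<open>Geometry of the faces\<close>

definition er :: "real \<Rightarrow> real^3" where "er \<theta> = vector [cos \<theta>, sin \<theta>, 0]"
definition et :: "real \<Rightarrow> real^3" where "et \<theta> = vector [- sin \<theta>, cos \<theta>, 0]"
definition ez :: "real^3" where "ez = vector [0, 0, 1]"

lemma frame_inner [simp]:
  "er \<theta> \<bullet> er \<theta> = 1" "et \<theta> \<bullet> et \<theta> = 1" "ez \<bullet> ez = 1" "er \<theta> \<bullet> et \<theta> = 0" "et \<theta> \<bullet> er \<theta> = 0"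
  "er \<theta> \<bullet> ez = 0" "ez \<bullet> er \<theta> = 0" "et \<theta> \<bullet> ez = 0" "ez \<bullet> et \<theta> = 0"
  by (simp_all add: er_def et_def ez_def inner_vec_def sum_3 power2_eq_square[symmetric])

lemma frame_norm [simp]: "norm (er \<theta>) = 1" "norm (et \<theta>) = 1" "norm ez = 1"
  by (simp_all add: norm_eq_sqrt_inner)

lemma frame_cross [simp]: "cross3 (er \<theta>) (et \<theta>) = ez" "cross3 ez (et \<theta>) = - er \<theta>"
  by (simp_all add: er_def et_def ez_def cross3_def vec_eq_iff forall_3 power2_eq_square[symmetric])

lemma frame_expand: "(v \<bullet> er \<theta>) *\<^sub>R er \<theta> + (v \<bullet> et \<theta>) *\<^sub>R et \<theta> + (v \<bullet> ez) *\<^sub>R ez = v"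
proof -
  have e: "v = vector [v$1, v$2, v$3]" by (simp add: vec_eq_iff forall_3)
  have s: "cos \<theta> * (cos \<theta> * x) + sin \<theta> * (sin \<theta> * x) = x" for x :: real
    by (simp only: mult.assoc[symmetric] distrib_right[symmetric] power2_eq_square[symmetric] sin_cos_squared_add2 mult_1)
  show ?thesis
    by (subst (4) e) (simp add: er_def et_def ez_def inner_vec_def sum_3 vec_eq_iff forall_3 algebra_simps s)
qed

lemma er_eq: "er \<theta> = cos \<theta> *\<^sub>R vector [1, 0, 0] + sin \<theta> *\<^sub>R vector [0, 1, 0]"
  by (simp add: er_def vec_eq_iff forall_3)

lemma et_eq: "et \<theta> = (- sin \<theta>) *\<^sub>R vector [1, 0, 0] + cos \<theta> *\<^sub>R vector [0, 1, 0]"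
  by (simp add: et_def vec_eq_iff forall_3)

lemma er_deriv: "(er has_vector_derivative et \<theta>) (at \<theta> within S)"
  unfolding er_eq[abs_def] et_eq
  by (auto intro!: derivative_eq_intros simp: has_real_derivative_iff_has_vector_derivative[symmetric])

lemma et_deriv: "(et has_vector_derivative - er \<theta>) (at \<theta> within S)"
  unfolding er_eq et_eq[abs_def]
  by (auto intro!: derivative_eq_intros simp: has_real_derivative_iff_has_vector_derivative[symmetric])

section \<open>The faces as surfaces of revolution\<close>

definition rr :: "face \<Rightarrow> real \<Rightarrow> real" where
  "rr i t = (case i of Disk \<Rightarrow> 2 * t / sqrt 3 | _ \<Rightarrow> cosh (t + ln (sqrt 3)))"
definition rr1 :: "face \<Rightarrow> real \<Rightarrow> real" where
  "rr1 i t = (case i of Disk \<Rightarrow> 2 / sqrt 3 | _ \<Rightarrow> sinh (t + ln (sqrt 3)))"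
definition rr2 :: "face \<Rightarrow> real \<Rightarrow> real" where
  "rr2 i t = (case i of Disk \<Rightarrow> 0 | _ \<Rightarrow> cosh (t + ln (sqrt 3)))"
definition sgf :: "face \<Rightarrow> real" where
  "sgf i = (case i of Disk \<Rightarrow> 0 | Upper \<Rightarrow> 1 | Lower \<Rightarrow> - 1)"

lemma rr_deriv: "(rr i has_real_derivative rr1 i t) (at t within S)"
proof (cases "i = Disk")
  case True
  have "rr Disk = (*) (2 / sqrt 3)" "rr1 Disk t = 2 / sqrt 3" by (auto simp: rr_def rr1_def)
  then show ?thesis using DERIV_cmult_Id[of "2 / sqrt 3" t S] True by (simp only:)
next
  case False
  then show ?thesis by (cases i) (auto simp: rr_def[abs_def] rr1_def intro!: derivative_eq_intros)
qed

lemma rr1_deriv: "(rr1 i has_real_derivative rr2 i t) (at t within S)"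
  by (cases i) (auto simp: rr1_def[abs_def] rr2_def intro!: derivative_eq_intros)

text \<open>One formula for the three faces, the disk being the profile of constant height. All
  geometry is computed from the radius \<open>rr\<close>, its derivatives and the sign
  \<open>sgf\<close> of the height.\<close>

lemma X_eq: "X c i = (\<lambda>p. (c * rr i (fst p)) *\<^sub>R er (snd p) + (c * (sgf i * fst p)) *\<^sub>R ez)"
  by (rule ext, cases i) (auto simp: X_def rr_def sgf_def er_def ez_def vec_eq_iff forall_3 split: prod.split)

lemma scaleR_prod_deriv:
  fixes w :: "real \<Rightarrow> 'a::real_normed_vector"
  assumes "(a has_real_derivative a') (at (fst p))" "(w has_vector_derivative w') (at (snd p))"
  shows "((\<lambda>p. a (fst p) *\<^sub>R w (snd p)) has_derivative
     (\<lambda>h. fst h *\<^sub>R (a' *\<^sub>R w (snd p)) + snd h *\<^sub>R (a (fst p) *\<^sub>R w'))) (at p)"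
proof -
  have 1: "((\<lambda>p. a (fst p)) has_derivative (\<lambda>h. a' * fst h)) (at p)"
    using has_derivative_compose[OF has_derivative_fst[OF has_derivative_ident] assms(1)[unfolded has_field_derivative_def]] .
  have 2: "((\<lambda>p. w (snd p)) has_derivative (\<lambda>h. snd h *\<^sub>R w')) (at p)"
    using has_derivative_compose[OF has_derivative_snd[OF has_derivative_ident] assms(2)[unfolded has_vector_derivative_def]] .
  from has_derivative_scaleR[OF 1 2] show ?thesis by (simp add: algebra_simps)
qed

lemma X_deriv: "(X c i has_derivative (\<lambda>h. fst h *\<^sub>R (c *\<^sub>R (rr1 i (fst p) *\<^sub>R er (snd p) + sgf i *\<^sub>R ez))
    + snd h *\<^sub>R ((c * rr i (fst p)) *\<^sub>R et (snd p)))) (at p)"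
proof -
  have 1: "((\<lambda>p. (c * rr i (fst p)) *\<^sub>R er (snd p)) has_derivative
     (\<lambda>h. fst h *\<^sub>R ((c * rr1 i (fst p)) *\<^sub>R er (snd p)) + snd h *\<^sub>R ((c * rr i (fst p)) *\<^sub>R et (snd p)))) (at p)"
    by (rule scaleR_prod_deriv[where a = "\<lambda>t. c * rr i t"]) (auto intro!: derivative_eq_intros rr_deriv er_deriv)
  have 2: "((\<lambda>p. (c * (sgf i * fst p)) *\<^sub>R ez) has_derivative
     (\<lambda>h. fst h *\<^sub>R ((c * sgf i) *\<^sub>R ez) + snd h *\<^sub>R ((c * (sgf i * fst p)) *\<^sub>R 0))) (at p)"
    by (rule scaleR_prod_deriv[where a = "\<lambda>t. c * (sgf i * t)" and w = "\<lambda>_. ez"]) (auto intro!: derivative_eq_intros)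
  show ?thesis unfolding X_eq
    by (rule has_derivative_eq_rhs[OF has_derivative_add[OF 1 2]]) (auto simp: algebra_simps)
qed

lemma dir_simps [simp]: "dir 1 = (1, 0)" "dir 2 = (0, 1)" by (auto simp: dir_def)

lemma dX1: "dX c i 1 = (\<lambda>p. c *\<^sub>R (rr1 i (fst p) *\<^sub>R er (snd p) + sgf i *\<^sub>R ez))"
  and dX2: "dX c i 2 = (\<lambda>p. (c * rr i (fst p)) *\<^sub>R et (snd p))"
  by (auto simp: dX_def fun_eq_iff frechet_derivative_at[OF X_deriv, symmetric])

lemma ddX:
  "ddX c i 1 1 p = (c * rr2 i (fst p)) *\<^sub>R er (snd p)" "ddX c i 1 2 p = (c * rr1 i (fst p)) *\<^sub>R et (snd p)"
  "ddX c i 2 1 p = (c * rr1 i (fst p)) *\<^sub>R et (snd p)" "ddX c i 2 2 p = - ((c * rr i (fst p)) *\<^sub>R er (snd p))"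
proof -
  have 1: "((\<lambda>p. (c * rr1 i (fst p)) *\<^sub>R er (snd p)) has_derivative
     (\<lambda>h. fst h *\<^sub>R ((c * rr2 i (fst p)) *\<^sub>R er (snd p)) + snd h *\<^sub>R ((c * rr1 i (fst p)) *\<^sub>R et (snd p)))) (at p)"
    by (rule scaleR_prod_deriv[where a = "\<lambda>t. c * rr1 i t"]) (auto intro!: derivative_eq_intros rr1_deriv er_deriv)
  have 2: "(dX c i 1 has_derivative
     (\<lambda>h. fst h *\<^sub>R ((c * rr2 i (fst p)) *\<^sub>R er (snd p)) + snd h *\<^sub>R ((c * rr1 i (fst p)) *\<^sub>R et (snd p)))) (at p)"
    using has_derivative_add[OF 1 has_derivative_const[of "c *\<^sub>R sgf i *\<^sub>R ez"]] unfolding dX1 by (simp add: scaleR_right_distrib)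
  have 3: "(dX c i 2 has_derivative
     (\<lambda>h. fst h *\<^sub>R ((c * rr1 i (fst p)) *\<^sub>R et (snd p)) + snd h *\<^sub>R ((c * rr i (fst p)) *\<^sub>R (- er (snd p))))) (at p)"
    unfolding dX2
    by (rule scaleR_prod_deriv[where a = "\<lambda>t. c * rr i t"]) (auto intro!: derivative_eq_intros rr_deriv et_deriv)
  show "ddX c i 1 1 p = (c * rr2 i (fst p)) *\<^sub>R er (snd p)" "ddX c i 1 2 p = (c * rr1 i (fst p)) *\<^sub>R et (snd p)"
    "ddX c i 2 1 p = (c * rr1 i (fst p)) *\<^sub>R et (snd p)" "ddX c i 2 2 p = - ((c * rr i (fst p)) *\<^sub>R er (snd p))"
    unfolding ddX_def frechet_derivative_at[OF 2, symmetric] frechet_derivative_at[OF 3, symmetric] by simp_all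
qed

text \<open>The squared speed of the profile curve for c = 1. On the catenoids it equals the squared
  radius, so the parametrization is conformal there; on the disk it is constant.\<close>

definition v2 :: "face \<Rightarrow> real \<Rightarrow> real" where "v2 i t = (rr1 i t)^2 + (sgf i)^2"

lemma v2_Disk: "v2 Disk t = 4 / 3" by (simp add: v2_def rr1_def sgf_def power_divide)

lemma rr_cat: "i \<noteq> Disk \<Longrightarrow> rr i t = 1 / se t" "i \<noteq> Disk \<Longrightarrow> rr1 i t = th t / se t" "i \<noteq> Disk \<Longrightarrow> rr2 i t = 1 / se t"
  "i \<noteq> Disk \<Longrightarrow> (sgf i)^2 = 1"
  by (cases i; simp add: rr_def rr1_def rr2_def sgf_def se_def th_def tanh_def cosh_real_nonzero)+

lemma v2_cat: assumes "i \<noteq> Disk" shows "v2 i t = (1 / se t)^2"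
proof -
  have "se t \<noteq> 0" using se_pos[of t] by simp
  then show ?thesis using assms th_se[of t] by (simp add: v2_def rr_cat power_divide field_simps)
qed

lemma v2_pos: "v2 i t > 0"
  using se_pos[of t] by (cases "i = Disk") (auto simp: v2_Disk v2_cat)

lemma dX_inner: "dX c i 1 p \<bullet> dX c i 1 p = c^2 * v2 i (fst p)" "dX c i 2 p \<bullet> dX c i 2 p = c^2 * (rr i (fst p))^2"
  "dX c i 1 p \<bullet> dX c i 2 p = 0" "dX c i 2 p \<bullet> dX c i 1 p = 0"
  by (simp_all add: dX1 dX2 v2_def inner_add_left inner_add_right power2_eq_square algebra_simps)

lemma first_form_entries:
  "first_form c i p $ 1 $ 1 = c^2 * v2 i (fst p)" "first_form c i p $ 2 $ 2 = c^2 * (rr i (fst p))^2"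
  "first_form c i p $ 1 $ 2 = 0" "first_form c i p $ 2 $ 1 = 0"
  by (simp_all add: first_form_def dX_inner)

lemma det_first_form: "det (first_form c i p) = c^2 * v2 i (fst p) * (c^2 * (rr i (fst p))^2)"
  by (simp add: det_2 first_form_entries)

definition dens :: "real \<Rightarrow> face \<Rightarrow> real \<Rightarrow> real" where
  "dens c i t = (case i of Disk \<Rightarrow> 4 / 3 * c^2 * t | _ \<Rightarrow> c^2 / (se t)^2)"

lemma sqrt_det: assumes "i = Disk \<longrightarrow> fst p \<ge> 0" shows "sqrt (det (first_form c i p)) = dens c i (fst p)"
proof -
  have "det (first_form c i p) = (c^2 * (sqrt (v2 i (fst p)) * rr i (fst p)))^2"
    using v2_pos[of i "fst p"] by (simp add: det_first_form power_mult_distrib power2_eq_square)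
  moreover have "0 \<le> rr i (fst p)"
  proof (cases "i = Disk")
    case True then show ?thesis using assms by (simp add: rr_def)
  next
    case False then show ?thesis using se_pos[of "fst p"] by (simp add: rr_cat)
  qed
  ultimately have "sqrt (det (first_form c i p)) = c^2 * (sqrt (v2 i (fst p)) * rr i (fst p))"
    using v2_pos[of i "fst p"] by (simp add: abs_mult)
  also have "\<dots> = dens c i (fst p)"
  proof (cases "i = Disk")
    case True
    have "sqrt (4 / 3) = 2 / sqrt 3" by (simp add: real_sqrt_divide)
    then show ?thesis using True by (simp add: v2_Disk rr_def dens_def)
  next
    case False
    have "sqrt ((1 / se (fst p))^2) = 1 / se (fst p)" using se_pos[of "fst p"] by simp
    then show ?thesis using False by (cases i) (simp_all add: v2_cat rr_cat dens_def power2_eq_square)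
  qed
  finally show ?thesis .
qed

text \<open>The unit normal by its formula. It also has length one at the centre of the disk, where
  \<open>unit_normal\<close> is zero because the \<theta>-derivative of X vanishes.\<close>

definition nu :: "face \<Rightarrow> real \<times> real \<Rightarrow> real^3" where
  "nu i p = (rr1 i (fst p) *\<^sub>R ez - sgf i *\<^sub>R er (snd p)) /\<^sub>R sqrt (v2 i (fst p))"

lemma unit_normal_eq:
  assumes "c > 0" "rr i (fst p) > 0"
  shows "unit_normal c i p = nu i p"
proof -
  have "cross3 (dX c i 1 p) (dX c i 2 p) = (c^2 * rr i (fst p)) *\<^sub>R (rr1 i (fst p) *\<^sub>R ez - sgf i *\<^sub>R er (snd p))"
    by (simp add: dX1 dX2 cross_mult_left cross_mult_right cross_add_left scaleR_right_distrib power2_eq_square algebra_simps)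
  moreover have "norm (rr1 i (fst p) *\<^sub>R ez - sgf i *\<^sub>R er (snd p)) = sqrt (v2 i (fst p))"
    by (simp add: norm_eq_sqrt_inner inner_diff_left inner_diff_right v2_def power2_eq_square)
  moreover have "sgn (k *\<^sub>R w) = sgn w" if "k > 0" for k and w :: "real^3" using that by (simp add: sgn_scaleR)
  moreover have "c^2 * rr i (fst p) > 0" using assms by simp
  ultimately have "unit_normal c i p = sgn (rr1 i (fst p) *\<^sub>R ez - sgf i *\<^sub>R er (snd p))"
    unfolding unit_normal_def by simp
  then show ?thesis unfolding nu_def sgn_div_norm
    using \<open>norm (rr1 i (fst p) *\<^sub>R ez - sgf i *\<^sub>R er (snd p)) = sqrt (v2 i (fst p))\<close> by simp
qed

text \<open>The case of radius zero is included: a cross product is orthogonal to its factors even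
  where it vanishes.\<close>

lemma unit_normal_orth: assumes "c > 0" "rr i (fst p) \<ge> 0"
  shows "unit_normal c i p \<bullet> dX c i 1 p = 0" "unit_normal c i p \<bullet> dX c i 2 p = 0"
  by (simp_all add: unit_normal_def sgn_div_norm dot_cross_self)

lemma nu_orth: "nu i p \<bullet> dX c i 1 p = 0" "nu i p \<bullet> dX c i 2 p = 0" "nu i p \<bullet> nu i p = 1"
proof -
  have "sqrt (v2 i (fst p)) \<noteq> 0" using v2_pos[of i "fst p"] by simp
  show "nu i p \<bullet> dX c i 1 p = 0" "nu i p \<bullet> dX c i 2 p = 0"
    by (simp_all add: nu_def dX1 dX2 inner_diff_left inner_add_right)
  define w where "w = inverse (sqrt (v2 i (fst p)))"
  have "nu i p \<bullet> nu i p = v2 i (fst p) * (w * w)"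
    unfolding nu_def w_def[symmetric]
    by (simp add: inner_diff_left inner_diff_right v2_def power2_eq_square algebra_simps)
  also have "w * w = inverse (v2 i (fst p))"
    unfolding w_def inverse_mult_distrib[symmetric] using v2_pos[of i "fst p"] by simp
  finally show "nu i p \<bullet> nu i p = 1" using v2_pos[of i "fst p"] by simp
qed

lemma tangent_inner:
  assumes "c > 0" "rr i (fst p) > 0" "V \<bullet> nu i p = 0"
  shows "V \<bullet> W = (V \<bullet> dX c i 1 p) * (W \<bullet> dX c i 1 p) / (c^2 * v2 i (fst p))
     + (V \<bullet> dX c i 2 p) * (W \<bullet> dX c i 2 p) / (c^2 * (rr i (fst p))^2)"
proof -
  let ?v = "v2 i (fst p)" and ?a = "rr1 i (fst p)" and ?s = "sgf i"
  obtain x y z where V: "x = V \<bullet> er (snd p)" "y = V \<bullet> et (snd p)" "z = V \<bullet> ez" by blast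
  obtain x' y' z' where W: "x' = W \<bullet> er (snd p)" "y' = W \<bullet> et (snd p)" "z' = W \<bullet> ez" by blast
  have v: "?v > 0" by (rule v2_pos)
  have "V \<bullet> (?a *\<^sub>R ez - ?s *\<^sub>R er (snd p)) = 0"
    using assms(3) v by (simp add: nu_def)
  then have 0: "?a * z = ?s * x" by (simp add: V inner_diff_right)
  have VW: "V \<bullet> W = x * x' + y * y' + z * z'"
    unfolding V W by (subst (1) frame_expand[of W "snd p", symmetric]) (simp add: inner_add_right mult.commute)
  have v1: "(V \<bullet> dX c i 1 p) * (W \<bullet> dX c i 1 p) / (c^2 * ?v) = (?a * x + ?s * z) * (?a * x' + ?s * z') / ?v"
    using assms(1) by (simp add: dX1 inner_add_right V W power2_eq_square)
  have v2': "(V \<bullet> dX c i 2 p) * (W \<bullet> dX c i 2 p) / (c^2 * (rr i (fst p))^2) = y * y'"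
    using assms(1,2) by (simp add: dX2 V W power2_eq_square)
  \<comment> \<open>Tangency in the form \<open>?a * z = ?s * x\<close> exchanges the mixed terms
    for squares.\<close>
  have "(?a * x + ?s * z) * (?a * x' + ?s * z') = ?v * (x * x' + z * z')"
  proof -
    have "(?a * x + ?s * z) * (?a * x' + ?s * z') = ?a^2 * x * x' + ?s * x' * (?a * z) + ?a * z' * (?s * x) + ?s^2 * z * z'"
      by (simp add: power2_eq_square algebra_simps)
    also have "\<dots> = ?a^2 * x * x' + ?s * x' * (?s * x) + ?a * z' * (?a * z) + ?s^2 * z * z'" unfolding 0 by simp
    also have "\<dots> = ?v * (x * x' + z * z')" by (simp add: v2_def power2_eq_square algebra_simps)
    finally show ?thesis .
  qed
  then show ?thesis unfolding v1 v2' VW using v by simp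
qed

lemma matrix_inv_eqI:
  fixes A B :: "real^'n^'n"
  assumes "A ** B = mat 1" "B ** A = mat 1"
  shows "matrix_inv A = B"
proof -
  have "A ** matrix_inv A = mat 1 \<and> matrix_inv A ** A = mat 1"
    unfolding matrix_inv_def by (rule someI[of _ B]) (use assms in auto)
  then have "(matrix_inv A ** A) ** B = B" by simp
  moreover have "matrix_inv A ** (A ** B) = matrix_inv A" using assms by simp
  ultimately show ?thesis by (simp only: matrix_mul_assoc)
qed

lemma normA_sq_eq:
  assumes "c > 0" "i = Disk \<longrightarrow> fst p \<ge> 0"
  shows "normA_sq c i p = (if i = Disk then 0 else 2 * (se (fst p))^4 / c^2)"
proof (cases "i = Disk")
  case True
  have "second_form c i p = 0"
  \<comment> \<open>At the centre the \<theta>-derivative of X vanishes and the normal degenerates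
    to zero.\<close>
  proof (cases "fst p = 0")
    case True
    then have "unit_normal c i p = 0" using \<open>i = Disk\<close> by (simp add: unit_normal_def dX2 rr_def)
    then show ?thesis unfolding second_form_def \<open>unit_normal c i p = 0\<close> by (simp add: vec_eq_iff)
  next
    case False
    then have "unit_normal c i p = nu i p" using assms True by (intro unit_normal_eq) (auto simp: rr_def)
    then show ?thesis using True unfolding second_form_def \<open>unit_normal c i p = nu i p\<close> nu_def
      by (simp add: vec_eq_iff forall_2 ddX sgf_def rr2_def)
  qed
  then show ?thesis using True by (simp add: normA_sq_def shape_operator_def trace_def matrix_matrix_mult_def)
next
  case False
  let ?k = "c^2 / (se (fst p))^2" and ?s = "se (fst p)"
  have s: "?s > 0" by (rule se_pos)
  have un: "unit_normal c i p = nu i p" using s False assms(1) by (intro unit_normal_eq) (auto simp: rr_cat)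
  have sv: "sqrt (v2 i (fst p)) = 1 / ?s" using s False by (simp add: v2_cat real_sqrt_divide)
  \<comment> \<open>The diagonal entries are opposite and the first form is a multiple of the
    identity: the catenoid is minimal and its parametrization conformal.\<close>
  have II: "second_form c i p $ 1 $ 1 = - c * sgf i" "second_form c i p $ 2 $ 2 = c * sgf i"
     "second_form c i p $ 1 $ 2 = 0" "second_form c i p $ 2 $ 1 = 0"
    using s False by (simp_all add: second_form_def un ddX nu_def sv rr_cat inner_diff_right)
  have I: "first_form c i p = ?k *\<^sub>R mat 1"
    using s False by (simp add: vec_eq_iff forall_2 first_form_entries v2_cat rr_cat mat_def power_divide)
  have k: "?k \<noteq> 0" using s assms(1) by simp
  have inv: "matrix_inv (first_form c i p) = (1 / ?k) *\<^sub>R mat 1"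
    unfolding I using k by (intro matrix_inv_eqI) (auto simp: scalar_matrix_assoc[symmetric] matrix_scalar_ac)
  have so: "shape_operator c i p = (1 / ?k) *\<^sub>R second_form c i p"
    unfolding shape_operator_def inv by (simp add: scalar_matrix_assoc[symmetric])
  have "normA_sq c i p = (1 / ?k)^2 * (2 * c^2 * (sgf i)^2)"
    unfolding normA_sq_def so by (simp add: trace_def matrix_matrix_mult_def sum_2 II power2_eq_square algebra_simps)
  also have "\<dots> = 2 * ?s^4 / c^2" unfolding rr_cat(4)[OF False] using assms(1) s by (simp add: power_divide power2_eq_square power4_eq_xxxx field_simps)
  finally show ?thesis using False by simp
qed

section \<open>The circle: length, curvature and conormals\<close>

lemma dgamma: "d\<gamma> c \<theta> = (2 * c / sqrt 3) *\<^sub>R et \<theta>"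
proof -
  have "(\<gamma> c has_vector_derivative (2 * c / sqrt 3) *\<^sub>R et \<theta>) (at \<theta>)"
  proof -
    have "\<gamma> c = (\<lambda>\<theta>. (2 * c / sqrt 3) *\<^sub>R er \<theta>)"
      by (auto simp: \<gamma>_def X_eq rr_def sgf_def mult.commute)
    then show ?thesis by (auto intro!: derivative_eq_intros er_deriv)
  qed
  then show ?thesis unfolding d\<gamma>_def by (rule vector_derivative_at)
qed

lemma unit_tangent_eq: "c > 0 \<Longrightarrow> unit_tangent c = et"
  by (rule ext) (simp add: unit_tangent_def dgamma sgn_scaleR sgn_div_norm)

text \<open>The curvature vector points inward and has length sqrt 3 / (2 c), the inverse of the
  radius. The conormal of the disk is radial; those of the catenoids form 120 degrees with it, which
  gives the factor -1/2.\<close>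

lemma curvature_conormal:
  assumes "c > 0"
  shows "curvature_vector c \<theta> \<bullet> conormal c i \<theta> = (if i = Disk then - sqrt 3 / (2 * c) else sqrt 3 / (4 * c))"
proof -
  have cv: "curvature_vector c \<theta> = - (sqrt 3 / (2 * c)) *\<^sub>R er \<theta>"
    unfolding curvature_vector_def unit_tangent_eq[OF assms] vector_derivative_at[OF et_deriv] dgamma
    using assms by (simp add: divide_simps)
  define v where "v = outward i *\<^sub>R dX c i 1 (boundary_param i \<theta>)"
  have o: "v \<bullet> et \<theta> = 0" by (cases i) (auto simp: v_def dX1 boundary_param_def inner_add_left)
  have con: "conormal c i \<theta> = sgn v"
    unfolding conormal_def Let_def unit_tangent_eq[OF assms] v_def[symmetric] o by simp
  have nv: "norm v = 2 * c / sqrt 3"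
  proof -
    have "v \<bullet> v = c^2 * v2 i (fst (boundary_param i \<theta>))"
      by (cases i) (simp_all add: v_def outward_def dX_inner)
    also have "\<dots> = (2 * c / sqrt 3)^2"
      by (cases i) (simp_all add: v2_Disk v2_cat boundary_param_def se_0 power_divide)
    finally show ?thesis unfolding norm_eq_sqrt_inner using assms by (simp add: real_sqrt_divide abs_mult)
  qed
  have ve: "er \<theta> \<bullet> v = c * (if i = Disk then 2 / sqrt 3 else - (1 / sqrt 3))"
    unfolding v_def using sinh_ln_sqrt3 by (cases i) (simp_all add: dX1 boundary_param_def outward_def rr1_def inner_add_right)
  have "curvature_vector c \<theta> \<bullet> conormal c i \<theta> = (- (sqrt 3 / (2 * c))) * (inverse (2 * c / sqrt 3) * (er \<theta> \<bullet> v))"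
    unfolding con sgn_div_norm nv cv by (simp only: inner_scaleR_left inner_scaleR_right mult.left_commute)
  then show ?thesis unfolding ve using assms by (cases "i = Disk") (simp_all add: field_simps)
qed

section \<open>Area and arc length in the parameters\<close>

definition Idom :: "face \<Rightarrow> real set" where
  "Idom i = (case i of Disk \<Rightarrow> {0..1} | _ \<Rightarrow> {0..})"

lemma Idom_borel [simp]: "Idom i \<in> sets borel" by (cases i) (auto simp: Idom_def)

lemma param_dom_eq: "param_dom i = Idom i \<times> {0..<2 * pi}" by (simp add: param_dom_def Idom_def)

lemma Idom_nonneg: "t \<in> Idom i \<Longrightarrow> t \<ge> 0" by (cases i) (auto simp: Idom_def)

lemma meas_dens: "(\<lambda>p::real \<times> real. dens c i (fst p)) \<in> borel_measurable borel"
proof (rule measurable_fst_comp)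
  show "dens c i \<in> borel_measurable borel" by (cases i) (simp_all add: dens_def[abs_def])
qed

lemma dens_nonneg: "t \<in> Idom i \<Longrightarrow> dens c i t \<ge> 0"
  using Idom_nonneg[of t i] by (cases i) (auto simp: dens_def)

lemma area_eq: "area c i = density (cyl (Idom i)) (\<lambda>p. ennreal (dens c i (fst p)))"
proof -
  have m: "(\<lambda>p::real \<times> real. ennreal (dens c i (fst p))) \<in> borel_measurable borel" using meas_dens by simp
  have "area c i = density lborel (\<lambda>p. indicator (param_dom i) p * ennreal (dens c i (fst p)))"
    unfolding area_def
    by (rule arg_cong2[where f = density, OF refl], rule ext)
      (auto simp: indicator_def param_dom_eq sqrt_det dest: Idom_nonneg)
  also have "\<dots> = density (density lborel (indicator (param_dom i))) (\<lambda>p. ennreal (dens c i (fst p)))"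
    using m by (subst density_density_eq) (auto simp: param_dom_eq intro!: borel_measurable_indicator borel_Times)
  finally show ?thesis by (simp add: cyl_eq param_dom_eq)
qed

lemma sets_area [simp, measurable_cong]: "sets (area c i) = sets borel" by (simp add: area_def)
lemma space_area [simp]: "space (area c i) = UNIV" by (simp add: area_def)
lemma measurable_area [simp]: "measurable (area c i) N = measurable borel N"
  by (rule measurable_cong_sets) auto

lemma AE_Idom: "AE p in cyl (Idom i). fst p \<in> Idom i" by (rule AE_cyl_fst_in) simp

lemma AE_dens_nonneg: "AE p in cyl (Idom i). 0 \<le> dens c i (fst p)"
  using AE_Idom by eventually_elim (rule dens_nonneg)

lemma integrable_area:
  fixes f :: "real \<times> real \<Rightarrow> 'b::{banach, second_countable_topology}"
  assumes "f \<in> borel_measurable borel"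
  shows "integrable (area c i) f \<longleftrightarrow> integrable (cyl (Idom i)) (\<lambda>p. dens c i (fst p) *\<^sub>R f p)"
  unfolding area_eq using assms meas_dens AE_dens_nonneg by (subst integrable_density) auto

lemma integral_area:
  fixes f :: "real \<times> real \<Rightarrow> 'b::{banach, second_countable_topology}"
  assumes "f \<in> borel_measurable borel"
  shows "(\<integral>p. f p \<partial>area c i) = (\<integral>p. dens c i (fst p) *\<^sub>R f p \<partial>cyl (Idom i))"
  unfolding area_eq using assms meas_dens AE_dens_nonneg by (subst integral_density) auto

lemma nn_integral_area:
  assumes "f \<in> borel_measurable borel"
  shows "(\<integral>\<^sup>+p. f p \<partial>area c i) = (\<integral>\<^sup>+p. ennreal (dens c i (fst p)) * f p \<partial>cyl (Idom i))"
  unfolding area_eq using assms meas_dens by (subst nn_integral_density) auto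

lemma AE_fst_pos: "AE p in cyl (Idom i). fst p > 0"
proof -
  have "AE t in lborel. t \<noteq> (0::real)" by (rule AE_lborel_singleton)
  then have "AE t in lbI (Idom i). t > 0" by (subst AE_lbI) (auto elim!: eventually_mono dest: Idom_nonneg simp: less_le)
  from AE_cyl_fst[OF _ this] show ?thesis by simp
qed

lemma dens_pos: "c > 0 \<Longrightarrow> t > 0 \<Longrightarrow> dens c i t > 0"
  using se_pos[of t] by (cases i) (auto simp: dens_def)

text \<open>On the parameter domain the density can vanish only at t = 0, which is a null set of the
  cylinder.\<close>

lemma AE_area: assumes "c > 0"
  shows "(AE p in area c i. P p) \<longleftrightarrow> (AE p in cyl (Idom i). P p)"
proof -
  have "(AE p in area c i. P p) \<longleftrightarrow> (AE p in cyl (Idom i). 0 < ennreal (dens c i (fst p)) \<longrightarrow> P p)"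
    unfolding area_eq using meas_dens by (subst AE_density) auto
  also have "\<dots> \<longleftrightarrow> (AE p in cyl (Idom i). P p)"
  proof
    assume "AE p in cyl (Idom i). 0 < ennreal (dens c i (fst p)) \<longrightarrow> P p"
    then show "AE p in cyl (Idom i). P p" using AE_fst_pos by eventually_elim (use dens_pos[OF assms] in auto)
  qed (auto elim!: eventually_mono)
  finally show ?thesis .
qed

lemma AE_area_param: assumes "c > 0"
  shows "(AE p in area c i. P p) \<longleftrightarrow> (AE p in lborel. p \<in> param_dom i \<longrightarrow> P p)"
  unfolding AE_area[OF assms] param_dom_eq by (rule AE_cyl) simp

lemma rr_pos: assumes "t > 0" shows "rr i t > 0"
proof (cases "i = Disk")
  case True then show ?thesis using assms by (simp add: rr_def)
next
  case False then show ?thesis using se_pos[of t] by (simp add: rr_cat)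
qed

lemma AE_area_fst_pos: assumes "c > 0" shows "AE p in area c i. fst p > 0 \<and> fst p \<in> Idom i"
  unfolding AE_area[OF assms] using AE_fst_pos AE_Idom by eventually_elim simp

lemma AE_unit_normal: assumes "c > 0" shows "AE p in area c i. unit_normal c i p = nu i p"
  using AE_area_fst_pos[OF assms] by eventually_elim (intro unit_normal_eq assms rr_pos, auto)

lemma arclength_eq: assumes "c > 0" shows "arclength c = density circ (\<lambda>_. ennreal (2 * c / sqrt 3))"
proof -
  have "norm (d\<gamma> c \<theta>) = 2 * c / sqrt 3" for \<theta> using assms by (simp add: dgamma)
  then have "arclength c = density lborel (\<lambda>\<theta>. indicator {0..<2 * pi} \<theta> * ennreal (2 * c / sqrt 3))"
    unfolding arclength_def by simp
  also have "\<dots> = density (density lborel (indicator {0..<2 * pi})) (\<lambda>_. ennreal (2 * c / sqrt 3))"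
    by (subst density_density_eq) auto
  finally show ?thesis by (simp add: circ_def lbI_def)
qed

lemma AE_arclength: assumes "c > 0" shows "(AE \<theta> in arclength c. P \<theta>) \<longleftrightarrow> (AE \<theta> in circ. P \<theta>)"
  unfolding arclength_eq[OF assms] using assms by (subst AE_density) auto

lemma integral_arclength: assumes "c > 0" "f \<in> borel_measurable borel"
  shows "(\<integral>\<theta>. (f \<theta> :: real) \<partial>arclength c) = 2 * c / sqrt 3 * (\<integral>\<theta>. f \<theta> \<partial>circ)"
  unfolding arclength_eq[OF assms(1)] using assms by (subst integral_density) auto

lemma nn_integral_arclength: assumes "c > 0" "f \<in> borel_measurable borel"
  shows "(\<integral>\<^sup>+\<theta>. f \<theta> \<partial>arclength c) = ennreal (2 * c / sqrt 3) * (\<integral>\<^sup>+\<theta>. f \<theta> \<partial>circ)"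
  unfolding arclength_eq[OF assms(1)] using assms by (subst nn_integral_density) (auto simp: nn_integral_cmult)

section \<open>C1 functions on space and their restrictions to a face\<close>

abbreviation fd :: "(real^3 \<Rightarrow> 'b::real_normed_vector) \<Rightarrow> real^3 \<Rightarrow> real^3 \<Rightarrow> 'b" where
  "fd g x \<equiv> frechet_derivative g (at x)"

lemma C1_has_derivative: "C1 g \<Longrightarrow> (g has_derivative fd g x) (at x)"
  unfolding C1_def using frechet_derivative_works by blast

lemma C1I:
  assumes "\<And>x. (g has_derivative g' x) (at x)" "\<And>v. continuous_on UNIV (\<lambda>x. g' x v)"
  shows "C1 g" "fd g x = g' x"
proof -
  have e: "fd g x = g' x" for x using frechet_derivative_at[OF assms(1)] by simp
  then show "fd g x = g' x" .
  show "C1 g" unfolding C1_def e using assms by (auto simp: differentiable_def)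
qed

lemma C1_continuous: "C1 g \<Longrightarrow> continuous_on S g"
  unfolding C1_def by (meson continuous_at_imp_continuous_on differentiable_imp_continuous_within)

lemma C1_fd_cont: "C1 g \<Longrightarrow> continuous_on UNIV (\<lambda>x. fd g x v)"
  unfolding C1_def by blast

lemma C1_linear: "C1 g \<Longrightarrow> linear (fd g x)"
  using C1_has_derivative has_derivative_linear by blast

lemma C1_scaleR:
  assumes "C1 (g :: real^3 \<Rightarrow> real)" "C1 Y"
  shows "C1 (\<lambda>x. g x *\<^sub>R Y x)" "fd (\<lambda>x. g x *\<^sub>R Y x) x = (\<lambda>v. g x *\<^sub>R fd Y x v + fd g x v *\<^sub>R Y x)"
proof -
  have d: "((\<lambda>x. g x *\<^sub>R Y x) has_derivative (\<lambda>v. g x *\<^sub>R fd Y x v + fd g x v *\<^sub>R Y x)) (at x)" for x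
    by (rule has_derivative_scaleR[OF C1_has_derivative[OF assms(1)] C1_has_derivative[OF assms(2)]])
  have c: "continuous_on UNIV (\<lambda>x. g x *\<^sub>R fd Y x v + fd g x v *\<^sub>R Y x)" for v
    by (intro continuous_intros C1_continuous C1_fd_cont assms)
  show "C1 (\<lambda>x. g x *\<^sub>R Y x)" "fd (\<lambda>x. g x *\<^sub>R Y x) x = (\<lambda>v. g x *\<^sub>R fd Y x v + fd g x v *\<^sub>R Y x)"
    using C1I[OF d c] by auto
qed

lemma C1_mult: "C1 (g :: real^3 \<Rightarrow> real) \<Longrightarrow> C1 h \<Longrightarrow> C1 (\<lambda>x. g x * h x)"
  using C1_scaleR(1)[of g h] by simp

lemma C1_add: assumes "C1 g" "C1 h" shows "C1 (\<lambda>x. g x + h x)"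
  by (rule C1I(1)[OF has_derivative_add[OF C1_has_derivative[OF assms(1)] C1_has_derivative[OF assms(2)]]])
    (intro continuous_intros C1_fd_cont assms)

lemma C1_const: "C1 (\<lambda>_. k)"
  by (rule C1I(1)[of _ "\<lambda>_ _. 0"]) auto

lemma C1_blinear: "bounded_linear f \<Longrightarrow> C1 f"
  by (rule C1I(1)[of _ "\<lambda>_. f"]) (auto intro: bounded_linear_imp_has_derivative)

lemma C1_polynomial: "real_polynomial_function p \<Longrightarrow> C1 p"
  by (induction rule: real_polynomial_function.induct) (auto intro: C1_blinear C1_const C1_add C1_mult)

lemma C1_compose:
  assumes "\<And>u. (\<phi> has_real_derivative \<phi>' u) (at u)" "continuous_on UNIV \<phi>'" "C1 (g :: real^3 \<Rightarrow> real)"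
  shows "C1 (\<lambda>x. \<phi> (g x))"
proof (rule C1I(1))
  show "((\<lambda>x. \<phi> (g x)) has_derivative (\<lambda>v. \<phi>' (g x) * fd g x v)) (at x)" for x
    using has_derivative_compose[OF C1_has_derivative[OF assms(3)] assms(1)[unfolded has_field_derivative_def]] .
  show "continuous_on UNIV (\<lambda>x. \<phi>' (g x) * fd g x v)" for v
    by (intro continuous_intros C1_fd_cont assms continuous_on_compose2[OF assms(2)] C1_continuous) auto
qed

lemma C1_nth: "C1 (\<lambda>x. x $ k)"
  by (rule C1_blinear) (rule bounded_linear_vec_nth)

lemma linear_expand:
  fixes L :: "real^3 \<Rightarrow> 'b::real_vector"
  assumes "linear L" shows "L v = (\<Sum>k\<in>UNIV. v $ k *\<^sub>R L (axis k 1))"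
proof -
  have "v = (\<Sum>k\<in>UNIV. v $ k *\<^sub>R axis k 1)" by (simp add: basis_expansion scalar_mult_eq_scaleR[symmetric])
  then have "L v = L (\<Sum>k\<in>UNIV. v $ k *\<^sub>R axis k 1)" by simp
  also have "\<dots> = (\<Sum>k\<in>UNIV. v $ k *\<^sub>R L (axis k 1))" using assms by (simp add: linear_sum linear_scale)
  finally show ?thesis .
qed

lemma C1_fd_cont_comp:
  assumes "C1 g" "continuous_on S a" "continuous_on S b"
  shows "continuous_on S (\<lambda>p. fd g (a p) (b p))"
proof -
  have "continuous_on S (\<lambda>p. \<Sum>k\<in>UNIV. b p $ k *\<^sub>R fd g (a p) (axis k 1))"
    by (intro continuous_intros assms continuous_on_compose2[OF C1_fd_cont[OF assms(1)] assms(2)]) auto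
  then show ?thesis by (subst linear_expand[OF C1_linear[OF assms(1)]])
qed

lemma C1_fd_meas_comp:
  fixes g :: "real^3 \<Rightarrow> 'b::euclidean_space"
  assumes "C1 g" "a \<in> borel_measurable M" "b \<in> borel_measurable M"
  shows "(\<lambda>p. fd g (a p) (b p)) \<in> borel_measurable M"
proof -
  have "(\<lambda>p. fd g (a p) (axis k 1)) \<in> borel_measurable M" for k
    by (rule measurable_compose[OF assms(2) borel_measurable_continuous_onI[OF C1_fd_cont[OF assms(1)]]])
  moreover have "(\<lambda>p. b p $ k) \<in> borel_measurable M" for k
    by (rule measurable_compose[OF assms(3)]) (intro borel_measurable_continuous_onI continuous_intros)
  ultimately have "(\<lambda>p. \<Sum>k\<in>UNIV. b p $ k *\<^sub>R fd g (a p) (axis k 1)) \<in> borel_measurable M"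
    by (intro borel_measurable_sum borel_measurable_scaleR)
  then show ?thesis by (subst linear_expand[OF C1_linear[OF assms(1)]])
qed

lemma cont_er [continuous_intros]: fixes f :: "'a::t2_space \<Rightarrow> real" shows "continuous_on S f \<Longrightarrow> continuous_on S (\<lambda>x. er (f x))"
  and cont_et [continuous_intros]: "continuous_on S f \<Longrightarrow> continuous_on S (\<lambda>x. et (f x))"
  unfolding er_eq et_eq by (intro continuous_intros; assumption)+

lemma cont_rr [continuous_intros]: fixes f :: "'a::t2_space \<Rightarrow> real" assumes "continuous_on S f"
  shows "continuous_on S (\<lambda>x. rr i (f x))" "continuous_on S (\<lambda>x. rr1 i (f x))"
  using continuous_on_compose2[OF DERIV_continuous_on[OF rr_deriv] assms, of UNIV i]
    continuous_on_compose2[OF DERIV_continuous_on[OF rr1_deriv] assms, of UNIV i] by auto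

lemma cont_X: "continuous_on S (X c i)" unfolding X_eq by (intro continuous_intros)
lemma cont_dX1: "continuous_on S (dX c i 1)" unfolding dX1 by (intro continuous_intros)
lemma cont_dX2: "continuous_on S (dX c i 2)" unfolding dX2 by (intro continuous_intros)

lemma meas_X: "X c i \<in> borel_measurable borel" by (rule borel_measurable_continuous_onI[OF cont_X])

lemma meas_unit_normal: "unit_normal c i \<in> borel_measurable borel"
proof -
  have "(\<lambda>p. cross3 (dX c i 1 p) (dX c i 2 p)) \<in> borel_measurable borel"
    by (intro borel_measurable_continuous_onI continuous_on_cross cont_dX1 cont_dX2)
  then show ?thesis unfolding unit_normal_def[abs_def] sgn_div_norm by measurable
qed

lemma norm_unit_normal: "norm (unit_normal c i p) \<le> 1"
  by (simp add: unit_normal_def norm_sgn)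

lemma gradient_inner:
  assumes "C1 (g :: real^3 \<Rightarrow> real)"
  shows "(\<chi> k. fd g x (axis k 1)) \<bullet> w = fd g x w"
  by (subst linear_expand[OF C1_linear[OF assms], of x w]) (simp add: inner_vec_def mult.commute)

lemma gradient_cont:
  assumes "C1 (g :: real^3 \<Rightarrow> real)"
  shows "continuous_on UNIV (\<lambda>x. \<chi> k. fd g x (axis k 1))"
  by (intro continuous_on_vec_lambda C1_fd_cont assms)

lemma surface_gradient_meas:
  assumes "C1 g" shows "surface_gradient c i g \<in> borel_measurable borel"
proof -
  have "(\<lambda>p. \<chi> k. fd g (X c i p) (axis k 1)) \<in> borel_measurable borel"
    by (intro borel_measurable_continuous_onI continuous_on_compose2[OF gradient_cont[OF assms] cont_X]) auto
  then show ?thesis unfolding surface_gradient_def[abs_def] Let_def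
    using meas_unit_normal[of c i] by measurable
qed

lemma surface_gradient_dX:
  assumes "c > 0" "fst p \<ge> 0" "C1 g"
  shows "surface_gradient c i g p \<bullet> dX c i 1 p = fd g (X c i p) (dX c i 1 p)"
    "surface_gradient c i g p \<bullet> dX c i 2 p = fd g (X c i p) (dX c i 2 p)"
proof -
  have "rr i (fst p) \<ge> 0" using rr_pos[of "fst p" i] assms(2) by (cases "fst p = 0"; cases i) (auto simp: rr_def)
  note o = unit_normal_orth[OF assms(1) this]
  show "surface_gradient c i g p \<bullet> dX c i 1 p = fd g (X c i p) (dX c i 1 p)"
    "surface_gradient c i g p \<bullet> dX c i 2 p = fd g (X c i p) (dX c i 2 p)"
    by (simp_all add: surface_gradient_def Let_def inner_diff_left gradient_inner[OF assms(3)] o)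
qed

lemma surface_gradient_bound:
  assumes "C1 g"
  shows "\<exists>B. \<forall>p. norm (X c i p) \<le> R \<longrightarrow> norm (surface_gradient c i g p) \<le> B"
proof -
  have "compact ((\<lambda>x. \<chi> k. fd g x (axis k 1)) ` cball 0 R)"
    by (rule compact_continuous_image[OF continuous_on_subset[OF gradient_cont[OF assms]]]) auto
  then obtain B where B: "\<And>x. x \<in> cball 0 R \<Longrightarrow> norm (\<chi> k. fd g x (axis k 1)) \<le> B"
    using compact_imp_bounded by (force simp: bounded_iff)
  have "norm (surface_gradient c i g p) \<le> 2 * B" if "norm (X c i p) \<le> R" for p
  proof -
    let ?G = "\<chi> k. fd g (X c i p) (axis k 1)" and ?n = "unit_normal c i p"
    have G: "norm ?G \<le> B" using B[of "X c i p"] that by simp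
    have "\<bar>?G \<bullet> ?n\<bar> \<le> norm ?G * norm ?n" by (rule Cauchy_Schwarz_ineq2)
    also have "\<dots> \<le> norm ?G * 1" using norm_unit_normal by (intro mult_left_mono) auto
    finally have 1: "\<bar>?G \<bullet> ?n\<bar> \<le> norm ?G" by simp
    have "norm (surface_gradient c i g p) \<le> norm ?G + norm ((?G \<bullet> ?n) *\<^sub>R ?n)"
      unfolding surface_gradient_def Let_def by (rule norm_triangle_ineq4)
    also have "norm ((?G \<bullet> ?n) *\<^sub>R ?n) \<le> norm ?G * 1"
      unfolding norm_scaleR using 1 norm_unit_normal by (intro mult_mono) auto
    finally show ?thesis using G by simp
  qed
  then show ?thesis by blast
qed

text \<open>Rotation invariance of the trace in a plane, without mention of a basis of the space. It
  is applied twice: from the coordinate axes to the radial and angular directions, and from the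
  radial and vertical directions to the tangent of the profile and the normal.\<close>

lemma trace_rotate:
  fixes L :: "real^3 \<Rightarrow> real^3"
  assumes "linear L" "a^2 + b^2 = 1"
  shows "L (a *\<^sub>R x + b *\<^sub>R y) \<bullet> (a *\<^sub>R x + b *\<^sub>R y) + L (a *\<^sub>R y - b *\<^sub>R x) \<bullet> (a *\<^sub>R y - b *\<^sub>R x) = L x \<bullet> x + L y \<bullet> y"
proof -
  have "L (a *\<^sub>R x + b *\<^sub>R y) \<bullet> (a *\<^sub>R x + b *\<^sub>R y) + L (a *\<^sub>R y - b *\<^sub>R x) \<bullet> (a *\<^sub>R y - b *\<^sub>R x)
    = (a^2 + b^2) * (L x \<bullet> x) + (a^2 + b^2) * (L y \<bullet> y)"
    using assms(1) by (simp add: linear_add linear_diff linear_scale inner_add_left inner_add_right inner_diff_left inner_diff_right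
      power2_eq_square algebra_simps)
  then show ?thesis using assms(2) by simp
qed

lemma divergence_frame:
  assumes c: "c > 0" and r: "rr i (fst p) > 0" and Y: "C1 Y"
  shows "surface_divergence c i Y p = fd Y (X c i p) (dX c i 1 p) \<bullet> dX c i 1 p / (c^2 * v2 i (fst p))
     + fd Y (X c i p) (dX c i 2 p) \<bullet> dX c i 2 p / (c^2 * (rr i (fst p))^2)"
proof -
  let ?L = "fd Y (X c i p)" and ?e = "er (snd p)" and ?f = "et (snd p)"
  have L: "linear ?L" by (rule C1_linear[OF Y])
  define w where "w = sqrt (v2 i (fst p))"
  have w: "w > 0" "w^2 = v2 i (fst p)" using v2_pos[of i "fst p"] by (auto simp: w_def)
  \<comment> \<open>(a, b) is the unit tangent of the profile in the frame of \<open>er\<close> and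
    \<open>ez\<close>; the same rotation takes \<open>ez\<close> to the normal.\<close>
  define a b where "a = rr1 i (fst p) / w" and "b = sgf i / w"
  have ab: "a^2 + b^2 = 1" using w v2_pos[of i "fst p"]
    by (simp add: a_def b_def power_divide add_divide_distrib[symmetric]) (simp add: v2_def)
  have nu: "unit_normal c i p = a *\<^sub>R ez - b *\<^sub>R ?e"
    unfolding unit_normal_eq[OF c r] nu_def w_def[symmetric] a_def b_def by (simp add: divide_inverse algebra_simps)
  have d1: "dX c i 1 p = (c * w) *\<^sub>R (a *\<^sub>R ?e + b *\<^sub>R ez)"
    using w unfolding dX1 a_def b_def by (simp add: algebra_simps)
  have t1: "?L (dX c i 1 p) \<bullet> dX c i 1 p / (c^2 * v2 i (fst p)) = ?L (a *\<^sub>R ?e + b *\<^sub>R ez) \<bullet> (a *\<^sub>R ?e + b *\<^sub>R ez)"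
    unfolding d1 w(2)[symmetric] using L w(1) c by (simp only: linear_scale inner_scaleR_left inner_scaleR_right) (simp add: power2_eq_square)
  have t2: "?L (dX c i 2 p) \<bullet> dX c i 2 p / (c^2 * (rr i (fst p))^2) = ?L ?f \<bullet> ?f"
    unfolding dX2 using L r c by (simp only: linear_scale inner_scaleR_left inner_scaleR_right) (simp add: power2_eq_square)
  have ax: "er t = cos t *\<^sub>R axis 1 1 + sin t *\<^sub>R axis 2 1" "et t = cos t *\<^sub>R axis 2 1 - sin t *\<^sub>R axis 1 1" "ez = axis 3 1" for t
    by (simp_all add: er_def et_def ez_def vec_eq_iff forall_3 axis_def)
  have "(\<Sum>k\<in>UNIV. ?L (axis k 1) \<bullet> axis k 1) = ?L (axis 1 1) \<bullet> axis 1 1 + ?L (axis 2 1) \<bullet> axis 2 1 + ?L ez \<bullet> ez"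
    by (simp add: sum_3 ax)
  also have "?L (axis 1 1) \<bullet> axis 1 1 + ?L (axis 2 1) \<bullet> axis 2 1 = ?L ?e \<bullet> ?e + ?L ?f \<bullet> ?f"
    unfolding ax(1,2) by (rule trace_rotate[OF L, symmetric]) simp
  finally have "(\<Sum>k\<in>UNIV. ?L (axis k 1) \<bullet> axis k 1) = (?L ?e \<bullet> ?e + ?L ez \<bullet> ez) + ?L ?f \<bullet> ?f" by simp
  also have "?L ?e \<bullet> ?e + ?L ez \<bullet> ez = ?L (a *\<^sub>R ?e + b *\<^sub>R ez) \<bullet> (a *\<^sub>R ?e + b *\<^sub>R ez) + ?L (unit_normal c i p) \<bullet> unit_normal c i p"
    unfolding nu by (rule trace_rotate[OF L ab, symmetric])
  finally show ?thesis unfolding surface_divergence_def Let_def t1 t2 by simp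
qed

lemma surface_divergence_meas:
  assumes "C1 Y" shows "surface_divergence c i Y \<in> borel_measurable borel"
proof -
  have 1: "(\<lambda>p. fd Y (X c i p) (axis k 1)) \<in> borel_measurable borel" for k
    by (rule C1_fd_meas_comp[OF assms meas_X]) simp
  have 2: "(\<lambda>p. fd Y (X c i p) (unit_normal c i p)) \<in> borel_measurable borel"
    by (rule C1_fd_meas_comp[OF assms meas_X meas_unit_normal])
  show ?thesis unfolding surface_divergence_def[abs_def] Let_def
    using 1 2 meas_unit_normal[of c i] by (intro borel_measurable_diff borel_measurable_sum borel_measurable_inner) auto
qed

lemma C1_X_partials:
  fixes g :: "real^3 \<Rightarrow> 'b::real_normed_vector"
  assumes "C1 g"
  shows "((\<lambda>t. g (X c i (t, \<theta>))) has_vector_derivative fd g (X c i (t, \<theta>)) (dX c i 1 (t, \<theta>))) (at t within S)"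
    "((\<lambda>\<theta>. g (X c i (t, \<theta>))) has_vector_derivative fd g (X c i (t, \<theta>)) (dX c i 2 (t, \<theta>))) (at \<theta> within S)"
proof -
  note L = C1_linear[OF assms]
  have D: "((\<lambda>p. g (X c i p)) has_derivative (\<lambda>h. fd g (X c i p) (fst h *\<^sub>R dX c i 1 p + snd h *\<^sub>R dX c i 2 p))) (at p)" for p
    using has_derivative_compose[OF X_deriv C1_has_derivative[OF assms]] unfolding dX1 dX2 .
  have a: "((\<lambda>t. (t, \<theta>)) has_derivative (\<lambda>h. (h, 0))) (at t within S)" by (auto intro!: derivative_eq_intros)
  have b: "((\<lambda>\<theta>. (t, \<theta>)) has_derivative (\<lambda>h. (0, h))) (at \<theta> within S)" by (auto intro!: derivative_eq_intros)
  show "((\<lambda>t. g (X c i (t, \<theta>))) has_vector_derivative fd g (X c i (t, \<theta>)) (dX c i 1 (t, \<theta>))) (at t within S)"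
    unfolding has_vector_derivative_def using has_derivative_compose[OF a D] by (simp add: linear_scale[OF L])
  show "((\<lambda>\<theta>. g (X c i (t, \<theta>))) has_vector_derivative fd g (X c i (t, \<theta>)) (dX c i 2 (t, \<theta>))) (at \<theta> within S)"
    unfolding has_vector_derivative_def using has_derivative_compose[OF b D] by (simp add: linear_scale[OF L])
qed

lemma X_periodic: "X c i (t, \<theta> + 2 * pi) = X c i (t, \<theta>)"
  by (simp add: X_eq er_def)

lemma norm_X_sq: "(norm (X c i p))^2 = c^2 * ((rr i (fst p))^2 + (sgf i * fst p)^2)"
  unfolding power2_norm_eq_inner X_eq
  by (simp add: inner_add_left inner_add_right power2_eq_square algebra_simps)

text \<open>The height alone gives the bound. It turns bounded supports in space into bounded ranges
  of t.\<close>

lemma norm_X_ge: assumes "c > 0" "i \<noteq> Disk" "fst p \<ge> 0" shows "c * fst p \<le> norm (X c i p)"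
proof (rule power2_le_imp_le)
  have "(c * fst p)^2 = c^2 * (sgf i * fst p)^2" using assms(2) by (simp add: power_mult_distrib rr_cat)
  also have "\<dots> \<le> (norm (X c i p))^2" unfolding norm_X_sq by (intro mult_left_mono) auto
  finally show "(c * fst p)^2 \<le> (norm (X c i p))^2" .
qed simp

section \<open>Weak gradients and traces on the faces\<close>

definition bnd :: "face \<Rightarrow> real" where "bnd i = (case i of Disk \<Rightarrow> 1 | _ \<Rightarrow> 0)"

lemma gamma_X: "\<gamma> c \<theta> = X c i (bnd i, \<theta>)"
  using cosh_ln_sqrt3 by (cases i) (auto simp: \<gamma>_def X_eq bnd_def rr_def sgf_def)

section \<open>The divergence theorem on a face\<close>

lemma fd_zero_outside:
  assumes "C1 Z" "x \<notin> closure {x. Z x \<noteq> 0}" shows "fd Z x = (\<lambda>_. 0)" "Z x = 0"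
proof -
  have "((\<lambda>_. 0) has_derivative (\<lambda>_. 0)) (at x)" by simp
  then have "(Z has_derivative (\<lambda>_. 0)) (at x)"
    by (rule has_derivative_transform_within_open[of _ _ _ _ "- closure {x. Z x \<noteq> 0}"])
      (use assms(2) closure_subset[of "{x. Z x \<noteq> 0}"] in auto)
  from frechet_derivative_at[OF this] show "fd Z x = (\<lambda>_. 0)" by simp
  show "Z x = 0" using assms(2) closure_subset[of "{x. Z x \<noteq> 0}"] by auto
qed

lemma inner_dX2: "w \<bullet> dX c i 2 p = c * rr i (fst p) * (w \<bullet> et (snd p))"
  by (simp add: dX2)

lemma inner_dX1_Disk: "w \<bullet> dX c Disk 1 p = (2 * c / sqrt 3) * (w \<bullet> er (snd p))"
  by (simp add: dX1 rr1_def sgf_def)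

text \<open>On a catenoid the density cancels both squared lengths by conformality. On the disk the
  powers of t are cancelled so far that no quotient is left at the centre.\<close>

lemma dens_divergence:
  assumes c: "c > 0" and t: "fst p > 0" and Z: "C1 Z"
  shows "i \<noteq> Disk \<Longrightarrow> dens c i (fst p) * surface_divergence c i Z p =
      fd Z (X c i p) (dX c i 1 p) \<bullet> dX c i 1 p + fd Z (X c i p) (dX c i 2 p) \<bullet> dX c i 2 p"
    and "i = Disk \<Longrightarrow> dens c i (fst p) * surface_divergence c i Z p =
      (2 * c / sqrt 3) * (fst p * (fd Z (X c i p) (dX c i 1 p) \<bullet> er (snd p)) + fd Z (X c i p) (dX c i 2 p) \<bullet> et (snd p))"
proof -
  note D = divergence_frame[OF c rr_pos[OF t] Z]
  have s: "se (fst p) \<noteq> 0" using se_pos[of "fst p"] by simp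
  show "dens c i (fst p) * surface_divergence c i Z p =
      fd Z (X c i p) (dX c i 1 p) \<bullet> dX c i 1 p + fd Z (X c i p) (dX c i 2 p) \<bullet> dX c i 2 p" if i: "i \<noteq> Disk"
  proof -
    have "dens c i (fst p) = c^2 * (1 / se (fst p))^2" using i by (cases i) (auto simp: dens_def power_divide)
    then show ?thesis unfolding D v2_cat[OF i] rr_cat(1)[OF i] using c s by (simp add: distrib_left)
  qed
  show "dens c i (fst p) * surface_divergence c i Z p =
      (2 * c / sqrt 3) * (fst p * (fd Z (X c i p) (dX c i 1 p) \<bullet> er (snd p)) + fd Z (X c i p) (dX c i 2 p) \<bullet> et (snd p))" if i: "i = Disk"
  proof -
    let ?A = "fd Z (X c Disk p) (dX c Disk 1 p) \<bullet> er (snd p)" and ?B = "fd Z (X c Disk p) (dX c Disk 2 p) \<bullet> et (snd p)"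
    have e3: "4 / 3 * c^2 * fst p * ((2 * c / sqrt 3) * a / (c^2 * (4 / 3)) + (2 * c / sqrt 3) * fst p * b / (c^2 * (2 * fst p / sqrt 3)^2))
      = (2 * c / sqrt 3) * (fst p * a + b)" for a b
    proof -
      have "c^2 * (2 * fst p / sqrt 3)^2 = 4 / 3 * c^2 * fst p * fst p" by (simp add: power_divide power2_eq_square)
      moreover have "k * (m * a / k + m * fst p * b / (k * fst p)) = m * (a + b)" if "k \<noteq> 0" for k m
        using that t by (simp add: distrib_left)
      ultimately show ?thesis using c t by (simp add: field_simps)
    qed
    have r: "rr Disk (fst p) = 2 * fst p / sqrt 3" "dens c Disk (fst p) = 4 / 3 * c^2 * fst p"
      by (simp_all add: rr_def dens_def)
    have e4: "w \<bullet> dX c Disk 2 p = (2 * c / sqrt 3) * fst p * (w \<bullet> et (snd p))" for w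
      by (simp add: inner_dX2 r)
    show ?thesis unfolding i D[unfolded i] v2_Disk r inner_dX1_Disk e4 by (rule e3)
  qed
qed

lemma smt_face:
  assumes "C1 Z"
  shows "smt a b (\<lambda>p. Z (X c i p) \<bullet> dX c i 1 p)
      (\<lambda>p. fd Z (X c i p) (dX c i 1 p) \<bullet> dX c i 1 p + Z (X c i p) \<bullet> ((c * rr2 i (fst p)) *\<^sub>R er (snd p)))"
proof -
  have d: "((\<lambda>t. dX c i 1 (t, \<theta>)) has_vector_derivative (c * rr2 i t) *\<^sub>R er \<theta>) (at t within S)" for t \<theta> S
    unfolding dX1 by (auto intro!: derivative_eq_intros rr1_deriv simp: has_real_derivative_iff_has_vector_derivative[symmetric])
  have cr2: "continuous_on S (\<lambda>p::real\<times>real. rr2 i (fst p))" for S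
    by (cases i) (auto simp: rr2_def intro!: continuous_intros)
  have c1: "continuous_on S (\<lambda>p. Z (X c i p) \<bullet> dX c i 1 p)" for S
    by (intro continuous_intros continuous_on_compose2[OF C1_continuous[OF assms, of UNIV] cont_X] cont_dX1) auto
  have c2: "continuous_on S (\<lambda>p. fd Z (X c i p) (dX c i 1 p) \<bullet> dX c i 1 p + Z (X c i p) \<bullet> ((c * rr2 i (fst p)) *\<^sub>R er (snd p)))" for S
    by (intro continuous_intros continuous_on_compose2[OF C1_continuous[OF assms, of UNIV] cont_X] cont_dX1 cr2
      C1_fd_cont_comp[OF assms] cont_X) auto
  show ?thesis unfolding smt_def
  proof (intro conjI ballI allI)
    fix t \<theta>
    have "((\<lambda>t. Z (X c i (t, \<theta>)) \<bullet> dX c i 1 (t, \<theta>)) has_vector_derivative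
      (Z (X c i (t, \<theta>)) \<bullet> ((c * rr2 i t) *\<^sub>R er \<theta>) + fd Z (X c i (t, \<theta>)) (dX c i 1 (t, \<theta>)) \<bullet> dX c i 1 (t, \<theta>))) (at t within {a..b})"
      using has_derivative_inner[OF C1_X_partials(1)[OF assms, unfolded has_vector_derivative_def] d[unfolded has_vector_derivative_def]]
      unfolding has_vector_derivative_def by (simp add: algebra_simps)
    then show "((\<lambda>t. Z (X c i (t, \<theta>)) \<bullet> dX c i 1 (t, \<theta>)) has_real_derivative
      fd Z (X c i (t, \<theta>)) (dX c i 1 (t, \<theta>)) \<bullet> dX c i 1 (t, \<theta>) + Z (X c i (t, \<theta>)) \<bullet> ((c * rr2 i (fst (t, \<theta>))) *\<^sub>R er (snd (t, \<theta>)))) (at t within {a..b})"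
      by (simp add: has_real_derivative_iff_has_vector_derivative add.commute)
  qed (use c1 c2 in \<open>auto intro: borel_measurable_continuous_onI\<close>)
qed

lemma smh_face:
  assumes "C1 Z"
  shows "smh a b (\<lambda>p. Z (X c i p) \<bullet> et (snd p))
      (\<lambda>p. fd Z (X c i p) (dX c i 2 p) \<bullet> et (snd p) - Z (X c i p) \<bullet> er (snd p))"
proof -
  have c1: "continuous_on S (\<lambda>p. Z (X c i p) \<bullet> et (snd p))" for S
    by (intro continuous_intros continuous_on_compose2[OF C1_continuous[OF assms, of UNIV] cont_X]) auto
  have c2: "continuous_on S (\<lambda>p. fd Z (X c i p) (dX c i 2 p) \<bullet> et (snd p) - Z (X c i p) \<bullet> er (snd p))" for S
    by (intro continuous_intros continuous_on_compose2[OF C1_continuous[OF assms, of UNIV] cont_X] cont_dX2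
      C1_fd_cont_comp[OF assms] cont_X) auto
  have d: "((\<lambda>\<theta>. Z (X c i (t, \<theta>)) \<bullet> et \<theta>) has_real_derivative
      fd Z (X c i (t, \<theta>)) (dX c i 2 (t, \<theta>)) \<bullet> et \<theta> - Z (X c i (t, \<theta>)) \<bullet> er \<theta>) (at \<theta>)" for t \<theta>
  proof -
    have "((\<lambda>\<theta>. Z (X c i (t, \<theta>)) \<bullet> et \<theta>) has_vector_derivative
      (Z (X c i (t, \<theta>)) \<bullet> (- er \<theta>) + fd Z (X c i (t, \<theta>)) (dX c i 2 (t, \<theta>)) \<bullet> et \<theta>)) (at \<theta>)"
      using has_derivative_inner[OF C1_X_partials(2)[OF assms, unfolded has_vector_derivative_def] et_deriv[unfolded has_vector_derivative_def]]
      unfolding has_vector_derivative_def by (simp add: algebra_simps)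
    then show ?thesis by (simp add: has_real_derivative_iff_has_vector_derivative)
  qed
  show ?thesis unfolding smh_def using c1 c2 d
    by (auto intro: borel_measurable_continuous_onI simp: X_periodic et_def)
qed

lemma smh_scale_fst:
  assumes "smh a b G G2" "continuous_on UNIV k"
  shows "smh a b (\<lambda>p. k (fst p) * G p) (\<lambda>p. k (fst p) * G2 p)"
proof -
  have c: "continuous_on S (\<lambda>p::real\<times>real. k (fst p))" for S
    by (rule continuous_on_compose2[OF assms(2)]) (auto intro!: continuous_intros)
  have m: "(\<lambda>p::real\<times>real. k (fst p)) \<in> borel_measurable borel" by (rule borel_measurable_continuous_onI[OF c])
  show ?thesis using assms(1) c m unfolding smh_def by (auto intro!: continuous_intros DERIV_cmult)
qed

lemma strip_divergence:
  assumes ab: "a \<le> b" and G: "smt a b G G1" and H: "smh a b H H2"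
    and z: "\<And>\<theta>. G (a, \<theta>) = 0" "\<And>\<theta>. G (b, \<theta>) = 0"
  shows "(\<integral>p. G1 p + H2 p \<partial>cyl {a..b}) = 0" "integrable (cyl {a..b}) (\<lambda>p. G1 p + H2 p)"
proof -
  have sG: "sqi (cyl {a..b}) G" "sqi (cyl {a..b}) G1" using G by (auto simp: smt_def intro: sqi_cont_cyl)
  have sH: "sqi (cyl {a..b}) H2" using smh_sqi[OF H] by simp
  have one: "smt a b (\<lambda>_. 1) (\<lambda>_. 0)" "smh a b (\<lambda>_. 1) (\<lambda>_. 0)" by (auto simp: smt_def smh_def)
  have s1: "sqi (cyl {a..b}) (\<lambda>_. 1)" by (rule sqi_bounded[OF finite_cyl, where B = 1]) auto
  have i: "integrable (cyl {a..b}) G1" "integrable (cyl {a..b}) H2"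
    using sqi_integrable[OF finite_cyl sG(2)] sqi_integrable[OF finite_cyl sH] by auto
  then show "integrable (cyl {a..b}) (\<lambda>p. G1 p + H2 p)" by simp
  have "(\<integral>p. G1 p \<partial>cyl {a..b}) = 0"
    using smooth_ibp[OF ab G one(1) mult1_const[of a b 1] sG s1] z by (simp add: sqi_circ_const)
  moreover have "(\<integral>p. H2 p \<partial>cyl {a..b}) = 0" using smh_ibp[OF H one(2)] by simp
  ultimately show "(\<integral>p. G1 p + H2 p \<partial>cyl {a..b}) = 0" using i by simp
qed

text \<open>Z is an arbitrary field and not only a tangential one, so this rests on minimality. On a
  catenoid X is harmonic in the conformal parameters, hence the density times the divergence of Z is
  the sum of the derivatives of the components of Z along the two coordinate fields. On the disk it
  is the divergence theorem in polar coordinates.\<close>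

lemma divergence_theorem:
  assumes c: "c > 0" and Z: "C1 Z" and K: "compact (closure {x. Z x \<noteq> 0})" "closure {x. Z x \<noteq> 0} \<inter> \<Gamma> c = {}"
  shows "integrable (area c i) (surface_divergence c i Z)" "(\<integral>p. surface_divergence c i Z p \<partial>area c i) = 0"
proof -
  have Zg: "Z (X c i (bnd i, \<theta>)) = 0" for \<theta>
  proof -
    have "\<gamma> c \<theta> \<in> \<Gamma> c" by (simp add: \<Gamma>_def)
    then have "\<gamma> c \<theta> \<notin> closure {x. Z x \<noteq> 0}" using K(2) by blast
    then show ?thesis using closure_subset[of "{x. Z x \<noteq> 0}"] unfolding gamma_X[of c \<theta> i] by auto
  qed
  have m: "surface_divergence c i Z \<in> borel_measurable borel" by (rule surface_divergence_meas[OF Z])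
  have md: "(\<lambda>p. dens c i (fst p) *\<^sub>R surface_divergence c i Z p) \<in> borel_measurable borel"
    using m meas_dens by simp
  have "integrable (cyl (Idom i)) (\<lambda>p. dens c i (fst p) *\<^sub>R surface_divergence c i Z p) \<and>
     (\<integral>p. dens c i (fst p) *\<^sub>R surface_divergence c i Z p \<partial>cyl (Idom i)) = 0"
  proof (cases "i = Disk")
    case True
    let ?k = "2 * c / sqrt 3"
    \<comment> \<open>The factor t makes the flux vanish at the centre, the end of the strip where Z
      itself is not zero.\<close>
    let ?G = "\<lambda>p. fst p * (Z (X c Disk p) \<bullet> dX c Disk 1 p)"
    let ?G1 = "\<lambda>p. 1 * (Z (X c Disk p) \<bullet> dX c Disk 1 p) + fst p * (fd Z (X c Disk p) (dX c Disk 1 p) \<bullet> dX c Disk 1 p + Z (X c Disk p) \<bullet> ((c * rr2 Disk (fst p)) *\<^sub>R er (snd p)))"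
    let ?H = "\<lambda>p. ?k * (Z (X c Disk p) \<bullet> et (snd p))"
    let ?H2 = "\<lambda>p. ?k * (fd Z (X c Disk p) (dX c Disk 2 p) \<bullet> et (snd p) - Z (X c Disk p) \<bullet> er (snd p))"
    have G: "smt 0 1 ?G ?G1"
      by (rule smt_mult[OF smt_face[OF Z], where k = "\<lambda>t. t" and k' = "\<lambda>_. 1"]) (auto simp: mult1_def)
    have H: "smh 0 1 ?H ?H2"
      using smh_scale_fst[OF smh_face[OF Z], of "\<lambda>_. ?k"] by simp
    have S: "(\<integral>p. ?G1 p + ?H2 p \<partial>cyl {0..1}) = 0" "integrable (cyl {0..1}) (\<lambda>p. ?G1 p + ?H2 p)"
      using Zg True by (intro strip_divergence[OF _ G H]; simp add: bnd_def)+
    have ID: "Idom Disk = {0..1}" by (simp add: Idom_def)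
    have eq: "AE p in cyl {0..1}. ?G1 p + ?H2 p = dens c i (fst p) *\<^sub>R surface_divergence c i Z p"
      using AE_fst_pos[of Disk, unfolded ID]
    proof eventually_elim
      case (elim p)
      show ?case unfolding True real_scaleR_def dens_divergence(2)[OF c elim Z refl]
        unfolding inner_dX1_Disk by (simp add: rr2_def algebra_simps)
    qed
    have mm: "(\<lambda>p. ?G1 p + ?H2 p) \<in> borel_measurable (cyl {0..1})" using borel_measurable_integrable[OF S(2)] .
    have "integrable (cyl {0..1}) (\<lambda>p. dens c i (fst p) *\<^sub>R surface_divergence c i Z p)"
      by (rule integrable_cong_AE_imp[OF S(2) _ eq]) (use md in simp)
    moreover have "(\<integral>p. dens c i (fst p) *\<^sub>R surface_divergence c i Z p \<partial>cyl {0..1}) = 0"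
      using integral_cong_AE[OF mm _ eq] md S(1) by simp
    ultimately show ?thesis by (simp add: True Idom_def)
  next
    case False
    obtain R where R: "\<And>x. x \<in> closure {x. Z x \<noteq> 0} \<Longrightarrow> norm x \<le> R"
      using compact_imp_bounded[OF K(1)] by (auto simp: bounded_iff)
    \<comment> \<open>From T on the face has left the ball that contains the support of Z:
      \<open>c * T\<close> is |R| + c, strictly larger than R.\<close>
    define T where "T = \<bar>R\<bar> / c + 1"
    have T: "T > 0" using c by (simp add: T_def add_nonneg_pos)
    have out: "X c i p \<notin> closure {x. Z x \<noteq> 0}" if "fst p \<ge> T" for p
    proof
      assume "X c i p \<in> closure {x. Z x \<noteq> 0}"
      then have "norm (X c i p) \<le> R" by (rule R)
      moreover have "c * T \<le> c * fst p" using that c by simp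
      moreover have "c * fst p \<le> norm (X c i p)" by (rule norm_X_ge[OF c False]) (use that T in simp)
      moreover have "c * T = \<bar>R\<bar> + c" using c by (simp add: T_def distrib_left)
      ultimately show False using c by linarith
    qed
    let ?G = "\<lambda>p. Z (X c i p) \<bullet> dX c i 1 p"
    let ?G1 = "\<lambda>p. fd Z (X c i p) (dX c i 1 p) \<bullet> dX c i 1 p + Z (X c i p) \<bullet> ((c * rr2 i (fst p)) *\<^sub>R er (snd p))"
    let ?H = "\<lambda>p. (c * rr i (fst p)) * (Z (X c i p) \<bullet> et (snd p))"
    let ?H2 = "\<lambda>p. (c * rr i (fst p)) * (fd Z (X c i p) (dX c i 2 p) \<bullet> et (snd p) - Z (X c i p) \<bullet> er (snd p))"
    have H: "smh 0 T ?H ?H2"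
      by (rule smh_scale_fst[OF smh_face[OF Z], of "\<lambda>t. c * rr i t"]) (intro continuous_intros)
    have S: "(\<integral>p. ?G1 p + ?H2 p \<partial>cyl {0..T}) = 0" "integrable (cyl {0..T}) (\<lambda>p. ?G1 p + ?H2 p)"
      using Zg False T fd_zero_outside(2)[OF Z out] by (intro strip_divergence[OF _ smt_face[OF Z] H]; cases i; simp add: bnd_def)+
    have eq: "?G1 p + ?H2 p = dens c i (fst p) *\<^sub>R surface_divergence c i Z p" if "fst p > 0" for p
      unfolding real_scaleR_def dens_divergence(1)[OF c that Z False]
      unfolding inner_dX2 rr_cat[OF False] by (simp add: algebra_simps)
    let ?D = "\<lambda>p. dens c i (fst p) *\<^sub>R surface_divergence c i Z p"
    have ID: "Idom i = {0..}" using False by (cases i) (auto simp: Idom_def)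
    have mi: "(\<lambda>p. indicator {0..T} (fst p) * ?D p) \<in> borel_measurable borel"
      using md measurable_fst_comp[of "indicator {0..T}"] by (intro borel_measurable_times) auto
    have eq2: "AE p in cyl {0..}. indicator {0..T} (fst p) * ?D p = ?D p"
      using AE_fst_pos[of i, unfolded ID]
    proof eventually_elim
      case (elim p)
      show ?case
      proof (cases "fst p \<le> T")
        case False
        then have "fd Z (X c i p) = (\<lambda>_. 0)" using fd_zero_outside(1)[OF Z out[of p]] by simp
        then show ?thesis by (simp add: surface_divergence_def)
      qed (use elim in simp)
    qed
    have AEpos: "AE p in cyl {0..T}. fst p > 0" by (rule AE_restrict_cyl) (use AE_fst_pos[of i, unfolded ID] in simp)
    have eq3: "AE p in cyl {0..T}. ?G1 p + ?H2 p = ?D p" using AEpos by eventually_elim (rule eq)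
    have mm: "(\<lambda>p. ?G1 p + ?H2 p) \<in> borel_measurable (cyl {0..T})" using borel_measurable_integrable[OF S(2)] .
    have iT: "integrable (cyl {0..T}) ?D"
      by (rule integrable_cong_AE_imp[OF S(2) _ eq3]) (use md in simp)
    have eT: "(\<integral>p. ?D p \<partial>cyl {0..T}) = 0"
      using integral_cong_AE[OF mm _ eq3] md S(1) by simp
    have sub: "{0..T} \<in> sets borel" "{0::real..} \<in> sets borel" "{0..T} \<subseteq> {0..}" by auto
    have iI: "integrable (cyl {0..}) (\<lambda>p. indicator {0..T} (fst p) * ?D p)"
      using iT by (simp only: integrable_cyl_subset(1)[OF sub md])
    have mD: "?D \<in> borel_measurable (cyl {0..})" "(\<lambda>p. indicator {0..T} (fst p) * ?D p) \<in> borel_measurable (cyl {0..})"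
      using md mi by (simp_all only: measurable_cyl)
    have "integrable (cyl {0..}) ?D"
      by (rule integrable_cong_AE_imp[OF iI mD(1) eq2])
    moreover have "(\<integral>p. ?D p \<partial>cyl {0..}) = (\<integral>p. indicator {0..T} (fst p) * ?D p \<partial>cyl {0..})"
      by (rule integral_cong_AE[OF mD(2) mD(1) eq2, symmetric])
    ultimately show ?thesis using eT unfolding ID integrable_cyl_subset(2)[OF sub md] by simp
  qed
  then show "integrable (area c i) (surface_divergence c i Z)" "(\<integral>p. surface_divergence c i Z p \<partial>area c i) = 0"
    using integrable_area[OF m] integral_area[OF m] by auto
qed

lemma integrable_bounded_region:
  fixes F :: "real \<times> real \<Rightarrow> 'b::{banach, second_countable_topology}"
  assumes c: "c > 0" and m: "F \<in> borel_measurable borel"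
    and B: "\<And>p. norm (X c i p) \<le> R \<Longrightarrow> norm (F p) \<le> B" and z: "\<And>p. R < norm (X c i p) \<Longrightarrow> F p = 0"
  shows "integrable (area c i) F"
proof -
  define T where "T = \<bar>R\<bar> / c + 1"
  have T: "T > 0" using c by (simp add: T_def add_nonneg_pos)
  have out: "F p = 0" if "i \<noteq> Disk" "fst p > T" for p
  proof (rule z)
    have "c * T < c * fst p" using that c by simp
    moreover have "c * fst p \<le> norm (X c i p)" by (rule norm_X_ge[OF c that(1)]) (use that T in simp)
    moreover have "c * T = \<bar>R\<bar> + c" using c by (simp add: T_def distrib_left)
    ultimately show "R < norm (X c i p)" using c by linarith
  qed
  define J where "J = {0..max T 1}"
  have Jm: "J \<in> sets borel" by (simp add: J_def)
  have dm: "(\<lambda>p::real \<times> real. dens c i (fst p)) \<in> borel_measurable borel" by (rule meas_dens)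
  have cd: "continuous_on UNIV (dens c i)"
  proof -
    have "se t \<noteq> 0" for t using se_pos[of t] by simp
    then show ?thesis by (cases i) (auto simp: dens_def[abs_def] intro!: continuous_intros)
  qed
  have "continuous_on S (\<lambda>p::real\<times>real. dens c i (fst p))" for S
    by (rule continuous_on_compose2[OF cd]) (auto intro!: continuous_intros)
  then have "integrable (cyl J) (\<lambda>p. dens c i (fst p))"
    unfolding J_def by (intro sqi_integrable[OF finite_cyl] sqi_cont_cyl dm)
  then have "integrable (cyl (Idom i \<inter> J)) (\<lambda>p. dens c i (fst p))"
    by (rule integrable_cyl_mono[rotated 3]) (use Jm in auto)
  then have "integrable (cyl (Idom i)) (\<lambda>p. indicator (Idom i \<inter> J) (fst p) * dens c i (fst p))"
    by (subst (asm) integrable_cyl_subset(1)[where J = "Idom i"]) (use Jm dm in auto)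
  then have "integrable (cyl (Idom i)) (\<lambda>p. B * (indicator (Idom i \<inter> J) (fst p) * dens c i (fst p)))" by simp
  then have "integrable (cyl (Idom i)) (\<lambda>p. dens c i (fst p) *\<^sub>R F p)"
  proof (rule Bochner_Integration.integrable_bound)
    show "(\<lambda>p. dens c i (fst p) *\<^sub>R F p) \<in> borel_measurable (cyl (Idom i))" using m dm by simp
    show "AE p in cyl (Idom i). norm (dens c i (fst p) *\<^sub>R F p) \<le> norm (B * (indicator (Idom i \<inter> J) (fst p) * dens c i (fst p)))"
      using AE_Idom[of i]
    proof eventually_elim
      case (elim p)
      show ?case
      proof (cases "F p = 0")
        case False
        then have "norm (X c i p) \<le> R" using z[of p] by force
        then have F: "norm (F p) \<le> \<bar>B\<bar>" using B[of p] by linarith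
        have "fst p \<le> max T 1"
        proof (cases "i = Disk")
          case True then show ?thesis using elim by (simp add: Idom_def le_max_iff_disj)
        next
          case i: False
          then have "\<not> T < fst p" using out[of p] False by blast
          then show ?thesis by simp
        qed
        then have "fst p \<in> J" using Idom_nonneg[OF elim] by (simp add: J_def)
        then show ?thesis using mult_left_mono[OF F, of "\<bar>dens c i (fst p)\<bar>"] elim by (simp add: abs_mult mult.commute)
      qed simp
    qed
  qed
  then show ?thesis using integrable_area[OF m] by simp
qed

lemma locally_integrable_bounded:
  fixes F :: "real \<times> real \<Rightarrow> 'b::{banach, second_countable_topology}"
  assumes c: "c > 0" and m: "F \<in> borel_measurable borel"
    and B: "\<And>R. \<exists>B. \<forall>p. norm (X c i p) \<le> R \<longrightarrow> norm (F p) \<le> B"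
  shows "locally_integrable c i F"
  unfolding locally_integrable_def set_integrable_def
proof
  fix R
  obtain B where B: "\<And>p. norm (X c i p) \<le> R \<Longrightarrow> norm (F p) \<le> B" using B[of R] by blast
  have S: "{p. norm (X c i p) \<le> R} \<in> sets borel"
    using borel_measurable_le[of "\<lambda>p. norm (X c i p)" borel "\<lambda>_. R"] meas_X[of c i] by simp
  show "integrable (area c i) (\<lambda>p. indicator {p. norm (X c i p) \<le> R} p *\<^sub>R F p)"
    by (rule integrable_bounded_region[OF c, where R = R and B = B])
      (simp_all add: borel_measurable_scaleR[OF borel_measurable_indicator[OF S] m] B)
qed

lemma C1_bounded_on:
  assumes "C1 g" shows "\<exists>B. \<forall>p. norm (X c i p) \<le> R \<longrightarrow> norm (g (X c i p)) \<le> B"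
proof -
  have "compact (g ` cball 0 R)" by (rule compact_continuous_image[OF C1_continuous[OF assms]]) auto
  then obtain B where "\<And>x. x \<in> cball 0 R \<Longrightarrow> norm (g x) \<le> B" using compact_imp_bounded by (force simp: bounded_iff)
  then show ?thesis by auto
qed

lemma C1_X_meas:
  fixes g :: "real^3 \<Rightarrow> 'b::euclidean_space"
  assumes "C1 g" shows "(\<lambda>p. g (X c i p)) \<in> borel_measurable borel"
  by (rule borel_measurable_continuous_onI, rule continuous_on_compose2[OF C1_continuous[OF assms, of UNIV] cont_X]) auto

text \<open>The divergence theorem for the field \<open>g Y\<close>. Equality of f with g on the
  face is only almost everywhere, because \<open>rep_variation\<close> returns some representative
  of its class.\<close>

lemma weak_gradient_C1:
  assumes c: "c > 0" and g: "C1 g" and f: "f \<in> borel_measurable borel" and eq: "AE p in area c i. f p = g (X c i p)"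
  shows "weak_gradient c i f (surface_gradient c i g)"
  unfolding weak_gradient_def
proof (intro conjI allI impI)
  let ?V = "surface_gradient c i g"
  note gm = C1_X_meas[OF g, of c i]
  show "f \<in> borel_measurable borel" by (rule f)
  show Vm: "?V \<in> borel_measurable borel" by (rule surface_gradient_meas[OF g])
  have lg: "locally_integrable c i (\<lambda>p. g (X c i p))"
    by (rule locally_integrable_bounded[OF c gm C1_bounded_on[OF g]])
  show "locally_integrable c i f"
    unfolding locally_integrable_def set_integrable_def
  proof
    fix R
    have S: "{p. norm (X c i p) \<le> R} \<in> sets borel"
      using borel_measurable_le[of "\<lambda>p. norm (X c i p)" borel "\<lambda>_. R"] meas_X[of c i] by simp
    have "integrable (area c i) (\<lambda>p. indicator {p. norm (X c i p) \<le> R} p *\<^sub>R g (X c i p))"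
      using lg unfolding locally_integrable_def set_integrable_def by blast
    then show "integrable (area c i) (\<lambda>p. indicator {p. norm (X c i p) \<le> R} p *\<^sub>R f p)"
    proof (rule integrable_cong_AE_imp)
      show "AE p in area c i. indicator {p. norm (X c i p) \<le> R} p *\<^sub>R g (X c i p) = indicator {p. norm (X c i p) \<le> R} p *\<^sub>R f p"
        using eq by eventually_elim simp
      show "(\<lambda>p. indicator {p. norm (X c i p) \<le> R} p *\<^sub>R f p) \<in> borel_measurable (area c i)"
        unfolding measurable_area by (rule borel_measurable_scaleR[OF borel_measurable_indicator[OF S] f])
    qed
  qed
  show lV: "locally_integrable c i ?V"
    by (rule locally_integrable_bounded[OF c Vm surface_gradient_bound[OF g]])
  have nn: "AE p in area c i. unit_normal c i p \<bullet> unit_normal c i p = 1"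
    using AE_unit_normal[OF c] by eventually_elim (simp add: nu_orth)
  then show "AE p in area c i. ?V p \<bullet> unit_normal c i p = 0"
    by eventually_elim (simp add: surface_gradient_def Let_def inner_diff_left)
  fix Y assume Y: "interior_tangent_field c i Y"
  then have Y1: "C1 Y" and Yc: "compact (closure {x. Y x \<noteq> 0})" "closure {x. Y x \<noteq> 0} \<inter> \<Gamma> c = {}"
    and Yt: "\<And>p. p \<in> param_dom i \<Longrightarrow> Y (X c i p) \<bullet> unit_normal c i p = 0"
    by (auto simp: interior_tangent_field_def)
  let ?Z = "\<lambda>x. g x *\<^sub>R Y x"
  have Z1: "C1 ?Z" by (rule C1_scaleR(1)[OF g Y1])
  have sub: "closure {x. ?Z x \<noteq> 0} \<subseteq> closure {x. Y x \<noteq> 0}" by (rule closure_mono) auto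
  have Zc: "compact (closure {x. ?Z x \<noteq> 0})"
    using compact_Int_closed[OF Yc(1) closed_closure, of "{x. ?Z x \<noteq> 0}"] sub by (simp add: Int_absorb1 Int_commute)
  have Zc2: "closure {x. ?Z x \<noteq> 0} \<inter> \<Gamma> c = {}" using sub Yc(2) by blast
  note DT = divergence_theorem[OF c Z1 Zc Zc2, of i]
  have AEdom: "AE p in area c i. p \<in> param_dom i" by (subst AE_area_param[OF c]) simp
  \<comment> \<open>The product rule. Tangency of Y enters twice: it removes the normal derivative
    of g from the divergence, and it replaces the gradient of g by its tangential part.\<close>
  have id: "AE p in area c i. surface_divergence c i ?Z p = f p * surface_divergence c i Y p + ?V p \<bullet> Y (X c i p)"
    using eq AEdom
  proof eventually_elim
    case (elim p)
    let ?n = "unit_normal c i p" and ?x = "X c i p"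
    have "surface_divergence c i ?Z p = (\<Sum>k\<in>UNIV. g ?x * (fd Y ?x (axis k 1) \<bullet> axis k 1) + fd g ?x (axis k 1) * (Y ?x \<bullet> axis k 1))
        - (g ?x * (fd Y ?x ?n \<bullet> ?n) + fd g ?x ?n * (Y ?x \<bullet> ?n))"
      by (simp add: surface_divergence_def Let_def C1_scaleR(2)[OF g Y1] inner_add_left)
    also have "\<dots> = g ?x * surface_divergence c i Y p + (\<Sum>k\<in>UNIV. fd g ?x (axis k 1) * (Y ?x \<bullet> axis k 1))"
      by (simp add: Yt[OF elim(2)] surface_divergence_def Let_def sum.distrib sum_distrib_left right_diff_distrib)
    also have "(\<Sum>k\<in>UNIV. fd g ?x (axis k 1) * (Y ?x \<bullet> axis k 1)) = (\<chi> k. fd g ?x (axis k 1)) \<bullet> Y ?x"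
      by (simp add: inner_vec_def[of _ "Y ?x"] inner_axis)
    also have "\<dots> = ?V p \<bullet> Y ?x"
      using Yt[OF elim(2)] inner_commute[of ?n "Y ?x"] by (simp add: surface_gradient_def Let_def inner_diff_left)
    finally show ?case using elim(1) by simp
  qed
  obtain R where R: "\<And>x. x \<in> closure {x. Y x \<noteq> 0} \<Longrightarrow> norm x \<le> R"
    using compact_imp_bounded[OF Yc(1)] by (auto simp: bounded_iff)
  have Y0: "Y x = 0" if "R < norm x" for x using R[of x] that closure_subset[of "{x. Y x \<noteq> 0}"] by force
  have iV: "integrable (area c i) (\<lambda>p. ?V p \<bullet> Y (X c i p))"
  proof -
    obtain B1 where B1: "\<And>p. norm (X c i p) \<le> R \<Longrightarrow> norm (?V p) \<le> B1" using surface_gradient_bound[OF g, of c i R] by blast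
    obtain B2 where B2: "\<And>p. norm (X c i p) \<le> R \<Longrightarrow> norm (Y (X c i p)) \<le> B2" using C1_bounded_on[OF Y1, of c i R] by blast
    show ?thesis
    proof (rule integrable_bounded_region[OF c, where R = R and B = "B1 * B2"])
      show "(\<lambda>p. ?V p \<bullet> Y (X c i p)) \<in> borel_measurable borel" using Vm C1_X_meas[OF Y1] by simp
      show "norm (?V p \<bullet> Y (X c i p)) \<le> B1 * B2" if "norm (X c i p) \<le> R" for p
      proof -
        have "\<bar>?V p \<bullet> Y (X c i p)\<bar> \<le> norm (?V p) * norm (Y (X c i p))" by (rule Cauchy_Schwarz_ineq2)
        also have "\<dots> \<le> B1 * B2" using B1[OF that] B2[OF that] by (intro mult_mono) (auto intro: order_trans[OF norm_ge_zero])
        finally show ?thesis by simp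
      qed
    qed (simp add: Y0)
  qed
  have mf: "(\<lambda>p. f p * surface_divergence c i Y p) \<in> borel_measurable borel"
    using f surface_divergence_meas[OF Y1] by simp
  have "(\<integral>p. f p * surface_divergence c i Y p \<partial>area c i) = (\<integral>p. surface_divergence c i ?Z p - ?V p \<bullet> Y (X c i p) \<partial>area c i)"
  proof (rule integral_cong_AE)
    show "AE p in area c i. f p * surface_divergence c i Y p = surface_divergence c i ?Z p - ?V p \<bullet> Y (X c i p)"
      using id by eventually_elim simp
  qed (use mf borel_measurable_integrable[OF DT(1)] borel_measurable_integrable[OF iV] in auto)
  also have "\<dots> = - (\<integral>p. ?V p \<bullet> Y (X c i p) \<partial>area c i)" using DT iV by simp
  finally show "(\<integral>p. f p * surface_divergence c i Y p \<partial>area c i) = - (\<integral>p. ?V p \<bullet> Y (X c i p) \<partial>area c i)" .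
qed

section \<open>Uniqueness of the weak gradient\<close>

lemma inj_X: assumes "c > 0" shows "inj_on (X c i) {p \<in> param_dom i. rr i (fst p) > 0}"
proof (rule inj_onI)
  fix p q assume p: "p \<in> {p \<in> param_dom i. rr i (fst p) > 0}" and q: "q \<in> {p \<in> param_dom i. rr i (fst p) > 0}"
    and eq: "X c i p = X c i q"
  have "X c i p \<bullet> ez = X c i q \<bullet> ez" by (simp add: eq)
  then have z: "sgf i * fst p = sgf i * fst q" using assms unfolding X_eq by (simp add: inner_add_left)
  have "(norm (X c i p))^2 = (norm (X c i q))^2" by (simp add: eq)
  then have "(rr i (fst p))^2 = (rr i (fst q))^2" unfolding norm_X_sq z using assms by simp
  then have r: "rr i (fst p) = rr i (fst q)" using p q by (simp add: power2_eq_iff_nonneg)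
  have t: "fst p = fst q" using z r by (cases i) (auto simp: sgf_def rr_def)
  have "X c i p - (c * (sgf i * fst p)) *\<^sub>R ez = X c i q - (c * (sgf i * fst q)) *\<^sub>R ez" by (simp add: eq t)
  then have "(c * rr i (fst p)) *\<^sub>R er (snd p) = (c * rr i (fst p)) *\<^sub>R er (snd q)" unfolding X_eq by (simp add: r)
  then have "er (snd p) = er (snd q)" using assms p by simp
  then have "(cos (snd p), sin (snd p)) = (cos (snd q), sin (snd q))"
    by (simp add: er_def vec_eq_iff forall_3)
  then have "snd p = snd q"
    using p q by (intro inj_onD[OF inj_cos_sin]) (auto simp: param_dom_eq mem_Times_iff)
  then show "p = q" using t by (simp add: prod_eq_iff)
qed

text \<open>A polynomial times a cutoff times a tangent field is again an admissible test field.
  Hence the product of W with the cut-off field T has zero moments against all polynomials in the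
  position, and these determine it as X is injective off the centre of the disk.\<close>

lemma test_vanish:
  assumes c: "c > 0" and W: "W \<in> borel_measurable borel" "locally_integrable c i W"
    and o: "\<And>Y. interior_tangent_field c i Y \<Longrightarrow> (\<integral>p. W p \<bullet> Y (X c i p) \<partial>area c i) = 0"
    and ch: "C1 ch" "compact (closure {x. ch x \<noteq> (0::real)})" "closure {x. ch x \<noteq> 0} \<inter> \<Gamma> c = {}"
    and T: "C1 T" "\<And>p. p \<in> param_dom i \<Longrightarrow> T (X c i p) \<bullet> unit_normal c i p = 0"
  shows "AE p in area c i. ch (X c i p) = 0 \<or> W p \<bullet> T (X c i p) = 0"
proof -
  obtain R where R: "\<And>x. x \<in> closure {x. ch x \<noteq> 0} \<Longrightarrow> norm x \<le> R"
    using compact_imp_bounded[OF ch(2)] by (auto simp: bounded_iff)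
  have ch0: "ch x = 0" if "R < norm x" for x using R[of x] that closure_subset[of "{x. ch x \<noteq> 0}"] by force
  have C1T: "C1 (\<lambda>x. ch x *\<^sub>R T x)" by (rule C1_scaleR(1)[OF ch(1) T(1)])
  obtain B where B: "\<And>p. norm (X c i p) \<le> R \<Longrightarrow> norm (ch (X c i p) *\<^sub>R T (X c i p)) \<le> B"
    using C1_bounded_on[OF C1T, of c i R] by blast
  define A where "A p = W p \<bullet> (ch (X c i p) *\<^sub>R T (X c i p))" for p
  have mA: "A \<in> borel_measurable borel"
    unfolding A_def using W(1) C1_X_meas[OF C1T] by (rule borel_measurable_inner)
  have iA: "integrable (area c i) A"
  proof (rule Bochner_Integration.integrable_bound)
    show "integrable (area c i) (\<lambda>p. B *\<^sub>R (indicator {p. norm (X c i p) \<le> R} p *\<^sub>R W p))"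
      using W(2) unfolding locally_integrable_def set_integrable_def by (intro integrable_scaleR_right) auto
    have "norm (A p) \<le> norm (B *\<^sub>R (indicator {p. norm (X c i p) \<le> R} p *\<^sub>R W p))" for p
    proof (cases "norm (X c i p) \<le> R")
      case True
      have "\<bar>A p\<bar> \<le> norm (W p) * norm (ch (X c i p) *\<^sub>R T (X c i p))" unfolding A_def by (rule Cauchy_Schwarz_ineq2)
      also have "\<dots> \<le> norm (W p) * \<bar>B\<bar>" using B[OF True] by (intro mult_left_mono) auto
      finally show ?thesis using True by (simp add: mult.commute)
    next
      case False
      then show ?thesis using ch0 by (simp add: A_def)
    qed
    then show "AE p in area c i. norm (A p) \<le> norm (B *\<^sub>R (indicator {p. norm (X c i p) \<le> R} p *\<^sub>R W p))" by simp
  qed (use mA in simp)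
  define F where "F p = indicator (Idom i \<times> {0..<2*pi}) p * (dens c i (fst p) *\<^sub>R A p)" for p
  have md: "(\<lambda>p. dens c i (fst p) *\<^sub>R A p) \<in> borel_measurable borel"
    by (rule borel_measurable_scaleR[OF meas_dens mA])
  have "AE p in lborel. F p = 0"
  \<comment> \<open>The centre of the disk, where X is not injective, is left out of D; there F
    vanishes together with the density.\<close>
  proof (rule AE_zero_if_polynomial_moments_zero[where D = "{p \<in> param_dom i. rr i (fst p) > 0} \<inter> {p. norm (X c i p) \<le> R}" and X = "X c i"])
    show "integrable lborel F"
      using iA unfolding integrable_area[OF mA] integrable_cyl[OF Idom_borel md[unfolded real_scaleR_def]] real_scaleR_def F_def .
    show "F p = 0" if "p \<notin> {p \<in> param_dom i. rr i (fst p) > 0} \<inter> {p. norm (X c i p) \<le> R}" for p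
    proof (cases "p \<in> param_dom i \<and> norm (X c i p) \<le> R")
      case True
      then have "rr i (fst p) \<le> 0" and pd: "p \<in> param_dom i" using that by auto
      then have "i = Disk \<and> fst p = 0"
        using rr_pos[of "fst p" i] se_pos[of "fst p"] Idom_nonneg[of "fst p" i]
        by (cases "i = Disk") (auto simp: rr_cat param_dom_eq mem_Times_iff not_le[symmetric] less_le_not_le)
      then show ?thesis by (simp add: F_def dens_def)
    next
      case False
      then show ?thesis using ch0 by (auto simp: F_def param_dom_eq A_def)
    qed
    show "continuous_on UNIV (X c i)" by (rule cont_X)
    show "inj_on (X c i) ({p \<in> param_dom i. rr i (fst p) > 0} \<inter> {p. norm (X c i p) \<le> R})"
      by (rule inj_on_subset[OF inj_X[OF c]]) auto
    show "bounded (X c i ` ({p \<in> param_dom i. rr i (fst p) > 0} \<inter> {p. norm (X c i p) \<le> R}))"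
      by (rule boundedI[of _ R]) auto
    fix h :: "real^3 \<Rightarrow> real" assume h: "real_polynomial_function h"
    let ?Y = "\<lambda>x. h x *\<^sub>R (ch x *\<^sub>R T x)"
    have sub: "closure {x. ?Y x \<noteq> 0} \<subseteq> closure {x. ch x \<noteq> 0}" by (rule closure_mono) auto
    have "interior_tangent_field c i ?Y"
      unfolding interior_tangent_field_def
    proof (intro conjI ballI)
      show "C1 ?Y" by (rule C1_scaleR(1)[OF C1_polynomial[OF h] C1T])
      show "compact (closure {x. ?Y x \<noteq> 0})"
        using compact_Int_closed[OF ch(2) closed_closure, of "{x. ?Y x \<noteq> 0}"] sub by (simp add: Int_absorb1 Int_commute)
      show "closure {x. ?Y x \<noteq> 0} \<inter> \<Gamma> c = {}" using sub ch(3) by blast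
    qed (simp add: T(2))
    then have 0: "(\<integral>p. W p \<bullet> ?Y (X c i p) \<partial>area c i) = 0" by (rule o)
    have hm: "(\<lambda>p. h (X c i p)) \<in> borel_measurable borel" by (rule C1_X_meas[OF C1_polynomial[OF h]])
    have m1: "(\<lambda>p. A p * h (X c i p)) \<in> borel_measurable borel" by (rule borel_measurable_times[OF mA hm])
    have m2: "(\<lambda>p. dens c i (fst p) *\<^sub>R (A p * h (X c i p))) \<in> borel_measurable borel"
      by (rule borel_measurable_scaleR[OF meas_dens m1])
    have "(\<integral>p. A p * h (X c i p) \<partial>area c i) = 0" using 0 by (simp add: A_def mult_ac)
    then have "(\<integral>p. indicator (Idom i \<times> {0..<2*pi}) p * (dens c i (fst p) *\<^sub>R (A p * h (X c i p))) \<partial>lborel) = 0"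
      unfolding integral_area[OF m1] by (subst (asm) integral_cyl[OF Idom_borel m2])
    then show "(\<integral>p. F p * h (X c i p) \<partial>lborel) = 0" by (simp add: F_def mult.assoc)
  qed
  then have "AE p in area c i. F p = 0" unfolding AE_area_param[OF c] by eventually_elim simp
  moreover have "AE p in area c i. p \<in> param_dom i" by (subst AE_area_param[OF c]) simp
  ultimately show ?thesis using AE_area_fst_pos[OF c, of i]
  proof eventually_elim
    case (elim p)
    have "dens c i (fst p) > 0" using dens_pos[OF c] elim by blast
    then show ?case using elim by (auto simp: F_def A_def param_dom_eq)
  qed
qed

text \<open>The squared positive part is a C1 function that vanishes on a half line; all cutoffs are
  built from it.\<close>

lemma max0_sq_deriv: "((\<lambda>u. (max 0 u)^2) has_real_derivative 2 * max 0 u) (at (u::real))"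
proof -
  consider "u > 0" | "u < 0" | "u = 0" by linarith
  then show ?thesis
  proof cases
    case 1
    have "((\<lambda>u. u^2) has_real_derivative 2 * u) (at u)" by (auto intro!: derivative_eq_intros)
    then have "((\<lambda>u. (max 0 u)^2) has_real_derivative 2 * u) (at u)"
      by (rule has_field_derivative_transform_within_open[where S = "{0<..}"]) (use 1 in auto)
    then show ?thesis using 1 by simp
  next
    case 2
    have "((\<lambda>u. 0) has_real_derivative 0) (at u)" by simp
    then have "((\<lambda>u. (max 0 u)^2) has_real_derivative 0) (at u)"
      by (rule has_field_derivative_transform_within_open[where S = "{..<0}"]) (use 2 in auto)
    then show ?thesis using 2 by simp
  next
    case 3
    have "((\<lambda>h. (max 0 h)^2 / h) \<longlongrightarrow> 0) (at (0::real))"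
    proof (rule Lim_null_comparison[where g = "\<lambda>h. \<bar>h\<bar>"])
      have "norm ((max 0 h)^2 / h) \<le> \<bar>h\<bar>" for h :: real
        by (cases "h > 0") (auto simp: power2_eq_square max_def)
      then show "\<forall>\<^sub>F h in at 0. norm ((max 0 h)^2 / h) \<le> \<bar>h\<bar>" for h :: real by simp
      show "((\<lambda>h. \<bar>h\<bar>) \<longlongrightarrow> 0) (at (0::real))" by (rule tendsto_rabs_zero) simp
    qed
    then show ?thesis using 3 by (simp add: DERIV_def)
  qed
qed

lemma C1_max0_sq: assumes "C1 g" shows "C1 (\<lambda>x. (max 0 (g x))^2 :: real)"
proof (rule C1_compose[where \<phi> = "\<lambda>u. (max 0 u)^2" and \<phi>' = "\<lambda>u. 2 * max 0 u"])
  show "((\<lambda>u. (max 0 u)^2) has_real_derivative 2 * max 0 u) (at u)" for u :: real by (rule max0_sq_deriv)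
qed (use assms in \<open>auto intro!: continuous_intros\<close>)

lemma C1_norm_sq: "C1 (\<lambda>x. x \<bullet> x)"
  by (rule C1I(1)[of _ "\<lambda>x v. x \<bullet> v + v \<bullet> x"]) (auto intro!: derivative_eq_intros continuous_intros)

lemma C1_diff_const: "C1 g \<Longrightarrow> C1 (\<lambda>x. k - g x :: real)" "C1 g \<Longrightarrow> C1 (\<lambda>x. g x - k)"
  using C1_add[OF C1_const[of k] C1_mult[OF C1_const[of "-1"], of g]] C1_add[OF _ C1_const[of "-k"], of g] by auto

text \<open>Fields on space that span the tangent planes along a face. \<open>T2\<close> is the
  rotation field, the \<theta>-derivative of X. \<open>T1\<close> extends the t-derivative: on a
  catenoid t is recovered from the height, and the radial component is \<open>th\<close> times the
  radius; on the disk it is the position field, t times the t-derivative, which is regular at the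
  centre.\<close>

definition R12 :: "real^3 \<Rightarrow> real^3" where "R12 x = vector [x $ 1, x $ 2, 0]"
definition T2 :: "real^3 \<Rightarrow> real^3" where "T2 x = vector [- x $ 2, x $ 1, 0]"
definition T1 :: "real \<Rightarrow> face \<Rightarrow> real^3 \<Rightarrow> real^3" where
  "T1 c i x = (if i = Disk then R12 x else th (sgf i / c * x $ 3) *\<^sub>R R12 x + (c * sgf i) *\<^sub>R ez)"

lemma bounded_linear_R12: "bounded_linear R12"
  by (rule linear_conv_bounded_linear[THEN iffD1], rule linearI) (simp_all add: R12_def vec_eq_iff forall_3)

lemma bounded_linear_T2: "bounded_linear T2"
  by (rule linear_conv_bounded_linear[THEN iffD1], rule linearI) (simp_all add: T2_def vec_eq_iff forall_3)

lemma C1_linear_nth: "C1 (\<lambda>x. k * x $ j)"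
  by (rule C1_mult[OF C1_const C1_nth])

lemma C1_th: "C1 g \<Longrightarrow> C1 (\<lambda>x. th (g x))"
  by (rule C1_compose[OF th_deriv]) (intro continuous_intros)

lemma C1_T1: "C1 (T1 c i)"
proof (cases "i = Disk")
  case True
  then show ?thesis using C1_blinear[OF bounded_linear_R12] unfolding T1_def[abs_def] by simp
next
  case False
  have "C1 (\<lambda>x. th (sgf i / c * x $ 3) *\<^sub>R R12 x + (c * sgf i) *\<^sub>R ez)"
    by (intro C1_add C1_scaleR(1) C1_th C1_linear_nth C1_const C1_blinear[OF bounded_linear_R12])
  then show ?thesis using False unfolding T1_def[abs_def] by simp
qed

lemma C1_T2: "C1 T2" by (rule C1_blinear[OF bounded_linear_T2])

lemma X_nth: "X c i p $ 1 = c * rr i (fst p) * cos (snd p)" "X c i p $ 2 = c * rr i (fst p) * sin (snd p)"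
  "X c i p $ 3 = c * (sgf i * fst p)"
  by (simp_all add: X_eq er_def ez_def)

lemma T2_X: "T2 (X c i p) = dX c i 2 p"
  by (simp add: T2_def X_nth dX2 et_def vec_eq_iff forall_3)

lemma R12_X: "R12 (X c i p) = (c * rr i (fst p)) *\<^sub>R er (snd p)"
  by (simp add: R12_def X_nth er_def vec_eq_iff forall_3)

lemma T1_X: assumes "c > 0"
  shows "T1 c i (X c i p) = (if i = Disk then fst p else 1) *\<^sub>R dX c i 1 p"
proof (cases "i = Disk")
  case True
  then show ?thesis by (simp add: T1_def R12_X dX1 rr_def rr1_def sgf_def mult.commute)
next
  case False
  have "sgf i / c * (X c i p $ 3) = (sgf i)^2 * fst p" using assms by (simp add: X_nth power2_eq_square)
  then have "sgf i / c * (X c i p $ 3) = fst p" using rr_cat(4)[OF False] by simp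
  then show ?thesis using False by (simp add: T1_def R12_X dX1 rr_cat algebra_simps)
qed

lemma T_tangent: assumes c: "c > 0" and p: "p \<in> param_dom i"
  shows "T1 c i (X c i p) \<bullet> unit_normal c i p = 0" "T2 (X c i p) \<bullet> unit_normal c i p = 0"
proof -
  have "fst p \<ge> 0" using p Idom_nonneg by (auto simp: param_dom_eq mem_Times_iff)
  then have "rr i (fst p) \<ge> 0" using rr_pos[of "fst p" i] by (cases "fst p = 0"; cases i) (auto simp: rr_def)
  note unit_normal_orth[OF c this]
  then show "T1 c i (X c i p) \<bullet> unit_normal c i p = 0" "T2 (X c i p) \<bullet> unit_normal c i p = 0"
    unfolding T1_X[OF c] T2_X by (simp_all add: inner_commute)
qed

lemma Gamma_props: assumes "x \<in> \<Gamma> c" shows "x \<bullet> x = (2 * c / sqrt 3)^2" "x $ 3 = 0"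
proof -
  obtain \<theta> where x: "x = X c Disk (1, \<theta>)" using assms unfolding \<Gamma>_def \<gamma>_def by auto
  show "x \<bullet> x = (2 * c / sqrt 3)^2" unfolding x dot_square_norm norm_X_sq by (simp add: rr_def sgf_def power_divide power_mult_distrib)
  show "x $ 3 = 0" unfolding x by (simp add: X_nth sgf_def)
qed

text \<open>The supports are compact and avoid the circle, on the disk by a smaller radius and on a
  catenoid by a positive height, and they exhaust the interior of the face as n grows.\<close>

definition cutoff :: "real \<Rightarrow> face \<Rightarrow> nat \<Rightarrow> real^3 \<Rightarrow> real" where
  "cutoff c i n x = (if i = Disk then (max 0 ((2 * c / sqrt 3)^2 * (1 - 1 / (real n + 1)) - x \<bullet> x))^2
     else (max 0 (sgf i * x $ 3 - c / (real n + 1)))^2 * (max 0 (real n - x \<bullet> x))^2)"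

lemma cutoff_props:
  assumes c: "c > 0"
  shows "C1 (cutoff c i n)" "compact (closure {x. cutoff c i n x \<noteq> 0})" "closure {x. cutoff c i n x \<noteq> 0} \<inter> \<Gamma> c = {}"
proof -
  show "C1 (cutoff c i n)"
    unfolding cutoff_def[abs_def]
    by (cases "i = Disk") (auto intro!: C1_max0_sq C1_mult C1_diff_const C1_norm_sq C1_linear_nth)
  let ?r = "(2 * c / sqrt 3)^2 * (1 - 1 / (real n + 1))"
  have r: "?r < (2 * c / sqrt 3)^2" using c by (simp add: right_diff_distrib)
  have bd: "bounded {x. cutoff c i n x \<noteq> 0}"
  proof (rule boundedI)
    fix x assume x: "x \<in> {x. cutoff c i n x \<noteq> 0}"
    have "x \<bullet> x \<le> max (real n) ((2 * c / sqrt 3)^2)" using x r by (auto simp: cutoff_def max_def split: if_splits)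
    then show "norm x \<le> sqrt (max (real n) ((2 * c / sqrt 3)^2))" unfolding norm_eq_sqrt_inner by (rule real_sqrt_le_mono)
  qed
  then show "compact (closure {x. cutoff c i n x \<noteq> 0})" by (simp add: compact_closure)
  show "closure {x. cutoff c i n x \<noteq> 0} \<inter> \<Gamma> c = {}"
  proof (cases "i = Disk")
    case True
    have "closure {x. cutoff c i n x \<noteq> 0} \<subseteq> {x. x \<bullet> x \<le> ?r}"
      by (rule closure_minimal) (use True in \<open>auto simp: cutoff_def max_def split: if_splits intro!: closed_Collect_le continuous_intros\<close>)
    then show ?thesis using Gamma_props(1) r by fastforce
  next
    case False
    have "closure {x. cutoff c i n x \<noteq> 0} \<subseteq> {x. c / (real n + 1) \<le> sgf i * x $ 3}"
      by (rule closure_minimal) (use False in \<open>auto simp: cutoff_def max_def split: if_splits intro!: closed_Collect_le continuous_intros\<close>)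
    moreover have "c / (real n + 1) > 0" using c by simp
    ultimately show ?thesis using Gamma_props(2) by fastforce
  qed
qed

lemma cutoff_nonzero:
  assumes c: "c > 0" and p: "fst p > 0" "fst p \<in> Idom i" "fst p \<noteq> 1"
  shows "\<exists>n. cutoff c i n (X c i p) \<noteq> 0"
proof (cases "i = Disk")
  case True
  let ?t = "fst p"
  have t: "?t < 1" using p True by (auto simp: Idom_def)
  have t2: "?t^2 < 1" using p t by (simp add: power_less_one_iff)
  obtain n :: nat where n: "1 / (1 - ?t^2) < real n" using reals_Archimedean2 by blast
  have "1 < (real n + 1) * (1 - ?t^2)"
  proof -
    have "1 < real n * (1 - ?t^2)" using n t2 by (simp add: pos_divide_less_eq)
    also have "\<dots> \<le> (real n + 1) * (1 - ?t^2)" using t2 by (intro mult_right_mono) auto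
    finally show ?thesis .
  qed
  then have "1 / (real n + 1) < 1 - ?t^2" by (simp add: divide_less_eq mult.commute)
  then have "(2 * c / sqrt 3)^2 * ?t^2 < (2 * c / sqrt 3)^2 * (1 - 1 / (real n + 1))"
    using c by (intro mult_strict_left_mono) auto
  moreover have "X c i p \<bullet> X c i p = (2 * c / sqrt 3)^2 * ?t^2"
    unfolding dot_square_norm norm_X_sq using True by (simp add: rr_def sgf_def power_divide power_mult_distrib)
  moreover define D where "D = (2 * c / sqrt 3)^2 * (1 - 1 / (real n + 1)) - X c i p \<bullet> X c i p"
  ultimately have "D > 0" by linarith
  moreover have "cutoff c i n (X c i p) = (max 0 D)^2" using True by (simp add: cutoff_def D_def)
  ultimately have "cutoff c i n (X c i p) \<noteq> 0" by simp
  then show ?thesis by blast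
next
  case False
  obtain n :: nat where n: "max (X c i p \<bullet> X c i p) (1 / fst p) < real n" using reals_Archimedean2 by blast
  have "sgf i * X c i p $ 3 = (sgf i)^2 * (c * fst p)" by (simp add: X_nth power2_eq_square)
  then have 1: "sgf i * X c i p $ 3 = c * fst p" using rr_cat(4)[OF False] by simp
  have "1 < real n * fst p" using n p by (simp add: pos_divide_less_eq)
  then have "1 < fst p * (real n + 1)" using p by (simp add: algebra_simps add_strict_increasing2)
  then have "c / (real n + 1) < c * fst p" using c by (simp add: divide_less_eq)
  moreover have "X c i p \<bullet> X c i p < real n" using n by (simp only: max_less_iff_conj)
  ultimately show ?thesis using False 1 by (intro exI[of _ n]) (simp add: cutoff_def max_def)
qed

lemma locally_integrable_diff:
  fixes V V' :: "real \<times> real \<Rightarrow> 'b::{banach, second_countable_topology}"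
  assumes "locally_integrable c i V" "locally_integrable c i V'"
  shows "locally_integrable c i (\<lambda>p. V p - V' p)"
  using assms unfolding locally_integrable_def by (auto intro: set_integral_diff(1))

lemma test_integrable:
  fixes V :: "real \<times> real \<Rightarrow> real^3"
  assumes V: "V \<in> borel_measurable borel" "locally_integrable c i V" and Y: "interior_tangent_field c i Y"
  shows "integrable (area c i) (\<lambda>p. V p \<bullet> Y (X c i p))"
proof -
  have Y1: "C1 Y" and Yc: "compact (closure {x. Y x \<noteq> 0})" using Y by (auto simp: interior_tangent_field_def)
  obtain R where R: "\<And>x. x \<in> closure {x. Y x \<noteq> 0} \<Longrightarrow> norm x \<le> R"
    using compact_imp_bounded[OF Yc] by (auto simp: bounded_iff)
  have Y0: "Y x = 0" if "R < norm x" for x using R[of x] that closure_subset[of "{x. Y x \<noteq> 0}"] by force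
  obtain B where B: "\<And>p. norm (X c i p) \<le> R \<Longrightarrow> norm (Y (X c i p)) \<le> B"
    using C1_bounded_on[OF Y1, of c i R] by blast
  show ?thesis
  proof (rule Bochner_Integration.integrable_bound)
    show "integrable (area c i) (\<lambda>p. B *\<^sub>R (indicator {p. norm (X c i p) \<le> R} p *\<^sub>R V p))"
      using V(2) unfolding locally_integrable_def set_integrable_def by (intro integrable_scaleR_right) auto
    have "norm (V p \<bullet> Y (X c i p)) \<le> norm (B *\<^sub>R (indicator {p. norm (X c i p) \<le> R} p *\<^sub>R V p))" for p
    proof (cases "norm (X c i p) \<le> R")
      case True
      have "\<bar>V p \<bullet> Y (X c i p)\<bar> \<le> norm (V p) * norm (Y (X c i p))" by (rule Cauchy_Schwarz_ineq2)
      also have "\<dots> \<le> norm (V p) * \<bar>B\<bar>" using B[OF True] by (intro mult_left_mono) auto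
      finally show ?thesis using True by (simp add: mult.commute)
    qed (simp add: Y0)
    then show "AE p in area c i. norm (V p \<bullet> Y (X c i p)) \<le> norm (B *\<^sub>R (indicator {p. norm (X c i p) \<le> R} p *\<^sub>R V p))" by simp
    show "(\<lambda>p. V p \<bullet> Y (X c i p)) \<in> borel_measurable (area c i)"
      unfolding measurable_area by (rule borel_measurable_inner[OF V(1) C1_X_meas[OF Y1]])
  qed
qed

text \<open>Without this nothing could be computed with \<open>grad\<close>, which is an arbitrary
  choice. Test fields see the tangential part of the difference, through \<open>T1\<close> and
  \<open>T2\<close> at every point reached by some cutoff; the normal part is zero by the tangency
  required in \<open>weak_gradient\<close>.\<close>

lemma weak_gradient_unique:
  assumes c: "c > 0" and "weak_gradient c i f V" "weak_gradient c i f V'"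
  shows "AE p in area c i. V p = V' p"
proof -
  let ?W = "\<lambda>p. V p - V' p"
  note V = assms(2)[unfolded weak_gradient_def] and V' = assms(3)[unfolded weak_gradient_def]
  have Wm: "?W \<in> borel_measurable borel" using V V' by (intro borel_measurable_diff) auto
  have Wl: "locally_integrable c i ?W" using V V' by (intro locally_integrable_diff) auto
  have o: "(\<integral>p. ?W p \<bullet> Y (X c i p) \<partial>area c i) = 0" if Y: "interior_tangent_field c i Y" for Y
  proof -
    have "(\<integral>p. V p \<bullet> Y (X c i p) \<partial>area c i) = (\<integral>p. V' p \<bullet> Y (X c i p) \<partial>area c i)" using V V' Y by fastforce
    moreover have "integrable (area c i) (\<lambda>p. V p \<bullet> Y (X c i p))" "integrable (area c i) (\<lambda>p. V' p \<bullet> Y (X c i p))"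
      using V V' Y by (auto intro!: test_integrable)
    ultimately show ?thesis by (simp add: inner_diff_left)
  qed
  have "AE p in area c i. \<forall>n. cutoff c i n (X c i p) = 0 \<or> ?W p \<bullet> T1 c i (X c i p) = 0"
    unfolding AE_all_countable
    by (intro allI test_vanish[OF c Wm Wl o cutoff_props[OF c] C1_T1 T_tangent(1)[OF c]])
  moreover have "AE p in area c i. \<forall>n. cutoff c i n (X c i p) = 0 \<or> ?W p \<bullet> T2 (X c i p) = 0"
    unfolding AE_all_countable
    by (intro allI test_vanish[OF c Wm Wl o cutoff_props[OF c] C1_T2 T_tangent(2)[OF c]])
  moreover have "AE p in area c i. fst p \<noteq> 1"
  proof -
    have "AE t in lborel. t \<noteq> (1::real)" by (rule AE_lborel_singleton)
    then have "AE t in lbI (Idom i). t \<noteq> 1" by (subst AE_lbI) (auto elim!: eventually_mono)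
    then show ?thesis unfolding AE_area[OF c] by (rule AE_cyl_fst[OF Idom_borel])
  qed
  moreover have "AE p in area c i. V p \<bullet> unit_normal c i p = 0" "AE p in area c i. V' p \<bullet> unit_normal c i p = 0"
    using V V' by auto
  ultimately show ?thesis using AE_area_fst_pos[OF c, of i] AE_unit_normal[OF c, of i]
  proof eventually_elim
    case (elim p)
    obtain n where "cutoff c i n (X c i p) \<noteq> 0" using cutoff_nonzero[OF c] elim by blast
    then have "?W p \<bullet> T1 c i (X c i p) = 0" "?W p \<bullet> T2 (X c i p) = 0" using elim by blast+
    then have d: "?W p \<bullet> dX c i 1 p = 0" "?W p \<bullet> dX c i 2 p = 0"
      using elim unfolding T1_X[OF c] T2_X by (auto split: if_splits)
    have "?W p \<bullet> nu i p = 0" using elim by (simp add: inner_diff_left)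
    then have "?W p \<bullet> ?W p = 0"
      by (subst tangent_inner[OF c rr_pos]) (use elim d in auto)
    then show ?case by simp
  qed
qed

lemma grad_eq:
  assumes c: "c > 0" and w: "weak_gradient c i f V"
  shows "weak_gradient c i f (grad c i f)" "AE p in area c i. grad c i f p = V p"
proof -
  show 1: "weak_gradient c i f (grad c i f)" unfolding grad_def by (rule someI[of "weak_gradient c i f" V, OF w])
  show "AE p in area c i. grad c i f p = V p" by (rule weak_gradient_unique[OF c 1 w])
qed

section \<open>From traces in space to weak derivatives on strips\<close>

lemma l2lim_shift: assumes "l2lim M F f" shows "l2lim M (\<lambda>n. F (n + k)) f"
  using assms LIMSEQ_ignore_initial_segment[of "\<lambda>n. \<integral>x. (F n x - f x)^2 \<partial>M" 0 k]
  unfolding l2lim_def by simp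

lemma C1_smt:
  assumes "C1 (g :: real^3 \<Rightarrow> real)"
  shows "smt a b (\<lambda>p. g (X c i p)) (\<lambda>p. fd g (X c i p) (dX c i 1 p))"
    "smh a b (\<lambda>p. g (X c i p)) (\<lambda>p. fd g (X c i p) (dX c i 2 p))"
proof -
  have c: "continuous_on S (\<lambda>p. g (X c i p))" "continuous_on S (\<lambda>p. fd g (X c i p) (dX c i 1 p))"
    "continuous_on S (\<lambda>p. fd g (X c i p) (dX c i 2 p))" for S
    by (auto intro!: continuous_on_compose2[OF C1_continuous[OF assms, of UNIV] cont_X] C1_fd_cont_comp[OF assms] cont_X cont_dX1 cont_dX2)
  then have m: "(\<lambda>p. g (X c i p)) \<in> borel_measurable borel" "(\<lambda>p. fd g (X c i p) (dX c i 1 p)) \<in> borel_measurable borel"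
    "(\<lambda>p. fd g (X c i p) (dX c i 2 p)) \<in> borel_measurable borel"
    by (auto intro!: borel_measurable_continuous_onI)
  show "smt a b (\<lambda>p. g (X c i p)) (\<lambda>p. fd g (X c i p) (dX c i 1 p))"
    "smh a b (\<lambda>p. g (X c i p)) (\<lambda>p. fd g (X c i p) (dX c i 2 p))"
    unfolding smt_def smh_def using c m C1_X_partials[OF assms, of c i]
    by (auto simp: has_real_derivative_iff_has_vector_derivative X_periodic)
qed

text \<open>Convergence is given for the area measure and wanted for the flat measure of the
  parameters. A lower bound for the density passes from one to the other, and keeps the strip away
  from the centre of the disk.\<close>

lemma nn_integral_strip_le:
  assumes c: "c > 0" and \<delta>: "\<delta> > 0" and sub: "{a..b} \<subseteq> Idom i" and lb: "\<And>t. t \<in> {a..b} \<Longrightarrow> \<delta> \<le> dens c i t"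
    and R: "\<And>p. fst p \<in> {a..b} \<Longrightarrow> norm (X c i p) \<le> R" and m: "\<phi> \<in> borel_measurable borel"
  shows "(\<integral>\<^sup>+p. \<phi> p \<partial>cyl {a..b}) \<le> ennreal (1 / \<delta>) * (\<integral>\<^sup>+p. indicator {p. norm (X c i p) \<le> R} p * \<phi> p \<partial>area c i)"
proof -
  have S: "{p. norm (X c i p) \<le> R} \<in> sets borel"
    using borel_measurable_le[of "\<lambda>p. norm (X c i p)" borel "\<lambda>_. R"] meas_X[of c i] by simp
  have m1: "(\<lambda>p. indicator {p. norm (X c i p) \<le> R} p * \<phi> p) \<in> borel_measurable borel"
    by (rule borel_measurable_times_ennreal[OF borel_measurable_indicator[OF S] m])
  have md: "(\<lambda>p::real\<times>real. ennreal (dens c i (fst p))) \<in> borel_measurable borel"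
    by (rule measurable_compose[OF meas_dens measurable_ennreal])
  have m2: "(\<lambda>p. ennreal (dens c i (fst p)) * (indicator {p. norm (X c i p) \<le> R} p * \<phi> p)) \<in> borel_measurable borel"
    by (rule borel_measurable_times_ennreal[OF md m1])
  have bs: "{a..b} \<times> {0..<2*pi} \<in> sets borel" "Idom i \<times> {0..<2*pi} \<in> sets borel" by (auto intro!: borel_Times)
  have "(\<integral>\<^sup>+p. \<phi> p \<partial>cyl {a..b}) = (\<integral>\<^sup>+p. indicator ({a..b} \<times> {0..<2*pi}) p * \<phi> p \<partial>lborel)"
    using m bs by (subst cyl_eq) (auto simp: nn_integral_density)
  also have "\<dots> \<le> (\<integral>\<^sup>+p. ennreal (1 / \<delta>) * (indicator (Idom i \<times> {0..<2*pi}) p * (ennreal (dens c i (fst p)) * (indicator {p. norm (X c i p) \<le> R} p * \<phi> p))) \<partial>lborel)"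
  proof (rule nn_integral_mono)
    fix p
    show "indicator ({a..b} \<times> {0..<2*pi}) p * \<phi> p \<le> ennreal (1 / \<delta>) * (indicator (Idom i \<times> {0..<2*pi}) p * (ennreal (dens c i (fst p)) * (indicator {p. norm (X c i p) \<le> R} p * \<phi> p)))"
    proof (cases "p \<in> {a..b} \<times> {0..<2*pi}")
      case True
      then have p: "fst p \<in> {a..b}" "p \<in> Idom i \<times> {0..<2*pi}" using sub by (auto simp: mem_Times_iff)
      have "1 \<le> 1 / \<delta> * dens c i (fst p)" using lb[OF p(1)] \<delta> by (simp add: field_simps)
      then have "ennreal 1 \<le> ennreal (1 / \<delta> * dens c i (fst p))" by (rule ennreal_leI)
      also have "\<dots> = ennreal (1 / \<delta>) * ennreal (dens c i (fst p))" using \<delta> lb[OF p(1)] by (intro ennreal_mult) auto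
      finally have "1 * \<phi> p \<le> (ennreal (1 / \<delta>) * ennreal (dens c i (fst p))) * \<phi> p" by (intro mult_right_mono) auto
      then show ?thesis using True p R[OF p(1)] by (simp add: mult.assoc)
    qed simp
  qed
  also have "\<dots> = ennreal (1 / \<delta>) * (\<integral>\<^sup>+p. indicator (Idom i \<times> {0..<2*pi}) p * (ennreal (dens c i (fst p)) * (indicator {p. norm (X c i p) \<le> R} p * \<phi> p)) \<partial>lborel)"
    using m2 bs by (intro nn_integral_cmult) (auto intro!: borel_measurable_times_ennreal borel_measurable_indicator)
  also have "(\<integral>\<^sup>+p. indicator (Idom i \<times> {0..<2*pi}) p * (ennreal (dens c i (fst p)) * (indicator {p. norm (X c i p) \<le> R} p * \<phi> p)) \<partial>lborel)
     = (\<integral>\<^sup>+p. indicator {p. norm (X c i p) \<le> R} p * \<phi> p \<partial>area c i)"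
    using m2 bs unfolding nn_integral_area[OF m1] by (subst cyl_eq) (auto simp: nn_integral_density)
  finally show ?thesis .
qed

lemma tendsto_ennreal_cmult_le:
  fixes A B :: "nat \<Rightarrow> ennreal"
  assumes "\<And>n. A n \<le> ennreal k * B n" "B \<longlonglongrightarrow> 0"
  shows "A \<longlonglongrightarrow> 0"
proof -
  have "(\<lambda>n. ennreal k * B n) \<longlonglongrightarrow> ennreal k * 0"
    by (rule ennreal_tendsto_cmult[OF _ assms(2)]) simp
  then have l: "(\<lambda>n. ennreal k * B n) \<longlonglongrightarrow> 0" by simp
  show ?thesis by (rule tendsto_sandwich[of "\<lambda>_. 0" A _ "\<lambda>n. ennreal k * B n"]) (use assms l in auto)
qed

definition wdt :: "real \<Rightarrow> face \<Rightarrow> (real \<times> real \<Rightarrow> real) \<Rightarrow> (real \<Rightarrow> real) \<Rightarrow> bool" where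
  "wdt c i f u \<longleftrightarrow> weakly_differentiable c i f \<and> has_trace c i f u"

definition g1 :: "real \<Rightarrow> face \<Rightarrow> (real \<times> real \<Rightarrow> real) \<Rightarrow> real \<times> real \<Rightarrow> real" where
  "g1 c i f p = grad c i f p \<bullet> dX c i 1 p"
definition g2 :: "real \<Rightarrow> face \<Rightarrow> (real \<times> real \<Rightarrow> real) \<Rightarrow> real \<times> real \<Rightarrow> real" where
  "g2 c i f p = grad c i f p \<bullet> dX c i 2 p"

lemma grad_weak: "weakly_differentiable c i f \<Longrightarrow> weak_gradient c i f (grad c i f)"
  unfolding weakly_differentiable_def grad_def by (rule someI_ex[of "weak_gradient c i f"])

lemma wdt_meas:
  assumes "weakly_differentiable c i f"
  shows "f \<in> borel_measurable borel" "grad c i f \<in> borel_measurable borel"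
    "g1 c i f \<in> borel_measurable borel" "g2 c i f \<in> borel_measurable borel"
proof -
  show 1: "f \<in> borel_measurable borel" "grad c i f \<in> borel_measurable borel"
    using grad_weak[OF assms] by (auto simp: weak_gradient_def)
  show "g1 c i f \<in> borel_measurable borel" "g2 c i f \<in> borel_measurable borel"
    unfolding g1_def[abs_def] g2_def[abs_def]
    by (intro borel_measurable_inner 1 borel_measurable_continuous_onI[OF cont_dX1] borel_measurable_continuous_onI[OF cont_dX2])+
qed

lemma AE_grad_tangent: assumes "c > 0" "weakly_differentiable c i f"
  shows "AE p in area c i. grad c i f p \<bullet> nu i p = 0"
  using grad_weak[OF assms(2)] AE_unit_normal[OF assms(1), of i] unfolding weak_gradient_def by auto

text \<open>The bridge from the faces to the cylinder: the C1 functions in \<open>has_trace\<close>,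
  composed with X, are the smooth approximations in \<open>wkt\<close> and \<open>wkh\<close>.
  Convergence of the surface gradients gives that of both partial derivatives by Cauchy--Schwarz
  against the coordinate fields, which are bounded on the strip.\<close>

lemma trace_wk:
  assumes c: "c > 0" and w: "wdt c i f u" and ab: "a < b" and sub: "{a..b} \<subseteq> Idom i"
    and \<delta>: "\<delta> > 0" "\<And>t. t \<in> {a..b} \<Longrightarrow> \<delta> \<le> dens c i t"
  shows "wkt a b (bnd i) f (g1 c i f) u" "wkh a b f (g2 c i f)"
proof -
  have wd: "weakly_differentiable c i f" and ht: "has_trace c i f u" using w by (auto simp: wdt_def)
  note M = wdt_meas[OF wd]
  have um: "u \<in> borel_measurable borel" using ht by (simp add: has_trace_def)
  obtain g where g: "\<And>n. C1 (g n)"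
    and l0: "\<And>R. (\<lambda>n. \<integral>\<^sup>+ p. indicator {p. norm (X c i p) \<le> R} p * ennreal ((g n (X c i p) - f p)^2) \<partial>area c i) \<longlonglongrightarrow> 0"
    and l1: "\<And>R. (\<lambda>n. \<integral>\<^sup>+ p. indicator {p. norm (X c i p) \<le> R} p * ennreal ((norm (surface_gradient c i (g n) p - grad c i f p))^2) \<partial>area c i) \<longlonglongrightarrow> 0"
    and lt: "(\<lambda>n. \<integral>\<^sup>+ \<theta>. ennreal ((g n (\<gamma> c \<theta>) - u \<theta>)^2) \<partial>arclength c) \<longlonglongrightarrow> 0"
    using ht unfolding has_trace_def by blast
  have crr: "continuous_on {a..b} (\<lambda>t. c^2 * ((rr i t)^2 + (sgf i * t)^2))" "continuous_on {a..b} (\<lambda>t. c^2 * v2 i t)"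
     "continuous_on {a..b} (\<lambda>t. c^2 * (rr i t)^2)"
    unfolding v2_def by (intro continuous_intros)+
  obtain R2 where R2: "\<And>t. t \<in> {a..b} \<Longrightarrow> \<bar>c^2 * ((rr i t)^2 + (sgf i * t)^2)\<bar> \<le> R2" using cont_bounded[OF crr(1)] by blast
  obtain M1 where M1: "\<And>t. t \<in> {a..b} \<Longrightarrow> \<bar>c^2 * v2 i t\<bar> \<le> M1" using cont_bounded[OF crr(2)] by blast
  obtain M2 where M2: "\<And>t. t \<in> {a..b} \<Longrightarrow> \<bar>c^2 * (rr i t)^2\<bar> \<le> M2" using cont_bounded[OF crr(3)] by blast
  have R: "norm (X c i p) \<le> sqrt R2" if "fst p \<in> {a..b}" for p
    using R2[OF that] norm_X_sq[of c i p] by (intro real_le_rsqrt) simp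
  let ?S = "{p. norm (X c i p) \<le> sqrt R2}"
  have strip: "(\<integral>\<^sup>+p. \<phi> p \<partial>cyl {a..b}) \<le> ennreal (1 / \<delta>) * (\<integral>\<^sup>+p. indicator ?S p * \<phi> p \<partial>area c i)"
    if "\<phi> \<in> borel_measurable borel" for \<phi>
    by (rule nn_integral_strip_le[OF c \<delta>(1) sub \<delta>(2) R that])
  define G Ga Gb where "G n p = g n (X c i p)" and "Ga n p = fd (g n) (X c i p) (dX c i 1 p)"
    and "Gb n p = fd (g n) (X c i p) (dX c i 2 p)" for n p
  have sm: "smt a b (G n) (Ga n)" "smh a b (G n) (Gb n)" for n
    unfolding G_def[abs_def] Ga_def[abs_def] Gb_def[abs_def] by (rule C1_smt[OF g])+
  have sq: "sqi (cyl {a..b}) (G n)" "sqi (cyl {a..b}) (Ga n)" "sqi (cyl {a..b}) (Gb n)" for n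
    using sm[of n] smh_sqi[OF sm(2)] by (auto simp: smt_def intro: sqi_cont_cyl)
  have Gm: "G n \<in> borel_measurable borel" "Ga n \<in> borel_measurable borel" "Gb n \<in> borel_measurable borel" for n
    using sm[of n] by (auto simp: smt_def smh_def)
  have sgm: "surface_gradient c i (g n) \<in> borel_measurable borel" for n by (rule surface_gradient_meas[OF g])
  have c0: "(\<lambda>n. \<integral>\<^sup>+p. ennreal ((G n p - f p)^2) \<partial>cyl {a..b}) \<longlonglongrightarrow> 0"
  proof (rule tendsto_ennreal_cmult_le[OF _ l0[of "sqrt R2"]])
    fix n
    have "(\<lambda>p. ennreal ((G n p - f p)^2)) \<in> borel_measurable borel" using Gm M(1) by simp
    from strip[OF this] show "(\<integral>\<^sup>+p. ennreal ((G n p - f p)^2) \<partial>cyl {a..b})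
      \<le> ennreal (1 / \<delta>) * (\<integral>\<^sup>+ p. indicator ?S p * ennreal ((g n (X c i p) - f p)^2) \<partial>area c i)" by (simp add: G_def)
  qed
  have cd: "(\<lambda>n. \<integral>\<^sup>+p. ennreal ((H n p - h p)^2) \<partial>cyl {a..b}) \<longlonglongrightarrow> 0"
    if H: "\<And>n p. fst p \<in> {a..b} \<Longrightarrow> H n p - h p = (surface_gradient c i (g n) p - grad c i f p) \<bullet> d p"
      and d: "\<And>p. fst p \<in> {a..b} \<Longrightarrow> d p \<bullet> d p \<le> K" for H :: "nat \<Rightarrow> real \<times> real \<Rightarrow> real" and h d K
  proof (rule tendsto_ennreal_cmult_le[OF _ l1[of "sqrt R2"]])
    fix n
    let ?N = "\<lambda>p. (norm (surface_gradient c i (g n) p - grad c i f p))^2"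
    have m: "(\<lambda>p. ennreal (?N p)) \<in> borel_measurable borel" using sgm M(2) by simp
    have K: "K \<ge> 0" using d[of "(a, 0)"] ab by (auto intro: order_trans[OF inner_ge_zero])
    have "(\<integral>\<^sup>+p. ennreal ((H n p - h p)^2) \<partial>cyl {a..b}) \<le> (\<integral>\<^sup>+p. ennreal K * ennreal (?N p) \<partial>cyl {a..b})"
    proof (rule nn_integral_mono_AE)
      show "AE p in cyl {a..b}. ennreal ((H n p - h p)^2) \<le> ennreal K * ennreal (?N p)"
        using AE_cyl_fst_in[of "{a..b}", OF borel_closed[OF closed_atLeastAtMost]]
      proof eventually_elim
        case (elim p)
        let ?v = "surface_gradient c i (g n) p - grad c i f p"
        have "(?v \<bullet> d p)^2 \<le> (?v \<bullet> ?v) * (d p \<bullet> d p)" by (rule Cauchy_Schwarz_ineq)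
        also have "\<dots> \<le> (?v \<bullet> ?v) * K" using d[OF elim] by (intro mult_left_mono) auto
        finally have "(H n p - h p)^2 \<le> K * ?N p" using H[OF elim] by (simp add: power2_norm_eq_inner mult.commute)
        then have "ennreal ((H n p - h p)^2) \<le> ennreal (K * ?N p)" by (rule ennreal_leI)
        then show ?case using K by (simp add: ennreal_mult)
      qed
    qed
    also have "\<dots> = ennreal K * (\<integral>\<^sup>+p. ennreal (?N p) \<partial>cyl {a..b})" using m by (intro nn_integral_cmult) simp
    also have "\<dots> \<le> ennreal K * (ennreal (1 / \<delta>) * (\<integral>\<^sup>+p. indicator ?S p * ennreal (?N p) \<partial>area c i))"
      using strip[OF m] by (intro mult_left_mono) auto
    also have "\<dots> = ennreal (K * (1 / \<delta>)) * (\<integral>\<^sup>+p. indicator ?S p * ennreal (?N p) \<partial>area c i)"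
      using K \<delta>(1) by (subst ennreal_mult) (auto simp: mult.assoc)
    finally show "(\<integral>\<^sup>+p. ennreal ((H n p - h p)^2) \<partial>cyl {a..b}) \<le> ennreal (K * (1 / \<delta>)) * (\<integral>\<^sup>+p. indicator ?S p * ennreal (?N p) \<partial>area c i)" .
  qed
  have nn: "fst p \<ge> 0" if "fst p \<in> {a..b}" for p :: "real \<times> real" using that sub Idom_nonneg by blast
  have c1: "(\<lambda>n. \<integral>\<^sup>+p. ennreal ((Ga n p - g1 c i f p)^2) \<partial>cyl {a..b}) \<longlonglongrightarrow> 0"
  proof (rule cd[where d = "dX c i 1" and K = M1])
    show "Ga n p - g1 c i f p = (surface_gradient c i (g n) p - grad c i f p) \<bullet> dX c i 1 p" if "fst p \<in> {a..b}" for n p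
      unfolding inner_diff_left surface_gradient_dX(1)[OF c nn[OF that] g] Ga_def g1_def ..
    show "dX c i 1 p \<bullet> dX c i 1 p \<le> M1" if "fst p \<in> {a..b}" for p
      unfolding dX_inner using M1[OF that] by simp
  qed
  have c2: "(\<lambda>n. \<integral>\<^sup>+p. ennreal ((Gb n p - g2 c i f p)^2) \<partial>cyl {a..b}) \<longlonglongrightarrow> 0"
  proof (rule cd[where d = "dX c i 2" and K = M2])
    show "Gb n p - g2 c i f p = (surface_gradient c i (g n) p - grad c i f p) \<bullet> dX c i 2 p" if "fst p \<in> {a..b}" for n p
      unfolding inner_diff_left surface_gradient_dX(2)[OF c nn[OF that] g] Gb_def g2_def ..
    show "dX c i 2 p \<bullet> dX c i 2 p \<le> M2" if "fst p \<in> {a..b}" for p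
      unfolding dX_inner using M2[OF that] by simp
  qed
  have tm: "(\<lambda>\<theta>. G n (bnd i, \<theta>)) \<in> borel_measurable borel" for n
    by (rule measurable_slice_snd[OF Gm(1)])
  have ct: "(\<lambda>n. \<integral>\<^sup>+\<theta>. ennreal ((G n (bnd i, \<theta>) - u \<theta>)^2) \<partial>circ) \<longlonglongrightarrow> 0"
  proof (rule tendsto_ennreal_cmult_le[OF _ lt])
    fix n
    have m: "(\<lambda>\<theta>. ennreal ((G n (bnd i, \<theta>) - u \<theta>)^2)) \<in> borel_measurable borel" using tm um by simp
    have "ennreal (sqrt 3 / (2 * c)) * (\<integral>\<^sup>+ \<theta>. ennreal ((g n (\<gamma> c \<theta>) - u \<theta>)^2) \<partial>arclength c)
      = ennreal (sqrt 3 / (2 * c)) * ennreal (2 * c / sqrt 3) * (\<integral>\<^sup>+\<theta>. ennreal ((G n (bnd i, \<theta>) - u \<theta>)^2) \<partial>circ)"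
      using nn_integral_arclength[OF c m] by (simp add: G_def gamma_X[of c _ i] mult.assoc)
    also have "ennreal (sqrt 3 / (2 * c)) * ennreal (2 * c / sqrt 3) = 1"
      using c by (subst ennreal_mult[symmetric]) auto
    finally show "(\<integral>\<^sup>+\<theta>. ennreal ((G n (bnd i, \<theta>) - u \<theta>)^2) \<partial>circ) \<le> ennreal (sqrt 3 / (2 * c)) * (\<integral>\<^sup>+ \<theta>. ennreal ((g n (\<gamma> c \<theta>) - u \<theta>)^2) \<partial>arclength c)" by simp
  qed
  have sqt: "sqi circ (\<lambda>\<theta>. G n (bnd i, \<theta>))" for n
  proof (rule sqi_cont_circ[OF _ tm])
    have "continuous_on UNIV (G n)" unfolding G_def[abs_def]
      by (rule continuous_on_compose2[OF C1_continuous[OF g, of UNIV] cont_X]) auto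
    then show "continuous_on {0..2*pi} (\<lambda>\<theta>. G n (bnd i, \<theta>))"
      by (rule continuous_on_compose2) (auto intro!: continuous_intros)
  qed
  obtain N0 where N0: "l2lim (cyl {a..b}) (\<lambda>n. G (n + N0)) f" using l2lim_from_nn[OF sq(1) _ c0] M(1) by auto
  obtain N1 where N1: "l2lim (cyl {a..b}) (\<lambda>n. Ga (n + N1)) (g1 c i f)" using l2lim_from_nn[OF sq(2) _ c1] M(3) by auto
  obtain N2 where N2: "l2lim (cyl {a..b}) (\<lambda>n. Gb (n + N2)) (g2 c i f)" using l2lim_from_nn[OF sq(3) _ c2] M(4) by auto
  obtain N3 where N3: "l2lim circ (\<lambda>n \<theta>. G (n + N3) (bnd i, \<theta>)) u" using l2lim_from_nn[OF sqt _ ct] um by auto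
  \<comment> \<open>Each of the four limits is available from some index on; the sum of the indices
    serves all of them.\<close>
  let ?N = "N0 + N1 + N2 + N3"
  have L: "l2lim (cyl {a..b}) (\<lambda>n. G (n + ?N)) f" "l2lim (cyl {a..b}) (\<lambda>n. Ga (n + ?N)) (g1 c i f)"
    "l2lim (cyl {a..b}) (\<lambda>n. Gb (n + ?N)) (g2 c i f)" "l2lim circ (\<lambda>n \<theta>. G (n + ?N) (bnd i, \<theta>)) u"
    using l2lim_shift[OF N0, of "N1 + N2 + N3"] l2lim_shift[OF N1, of "N0 + N2 + N3"]
      l2lim_shift[OF N2, of "N0 + N1 + N3"] l2lim_shift[OF N3, of "N0 + N1 + N2"]
    by (simp_all add: ac_simps)
  show "wkt a b (bnd i) f (g1 c i f) u" unfolding wkt_def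
    by (rule exI[of _ "\<lambda>n. G (n + ?N)"], rule exI[of _ "\<lambda>n. Ga (n + ?N)"]) (use sm L in auto)
  show "wkh a b f (g2 c i f)" unfolding wkh_def
    by (rule exI[of _ "\<lambda>n. G (n + ?N)"], rule exI[of _ "\<lambda>n. Gb (n + ?N)"]) (use sm L in auto)
qed

lemma trace_wk_cat:
  assumes c: "c > 0" and w: "wdt c i f u" and i: "i \<noteq> Disk" and T: "T > 0"
  shows "wkt 0 T 0 f (g1 c i f) u" "wkh 0 T f (g2 c i f)"
proof -
  have b: "bnd i = 0" using i by (cases i) (auto simp: bnd_def)
  have sub: "{0..T} \<subseteq> Idom i" using i by (cases i) (auto simp: Idom_def)
  have d: "c^2 \<le> dens c i t" for t
  proof -
    have "(se t)^2 \<le> 1" "se t > 0" using se_le_1[of t] se_pos[of t] by (auto simp: power_le_one)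
    then have "c^2 / 1 \<le> c^2 / (se t)^2" by (intro divide_left_mono) auto
    then show ?thesis using i by (cases i) (auto simp: dens_def)
  qed
  show "wkt 0 T 0 f (g1 c i f) u" "wkh 0 T f (g2 c i f)"
    using trace_wk[OF c w T sub, of "c^2"] d c unfolding b by auto
qed

text \<open>Only away from the centre does the density 4/3 c^2 t have a positive lower
  bound.\<close>

lemma trace_wk_disk:
  assumes c: "c > 0" and w: "wdt c Disk f u" and e: "0 < e" "e < 1"
  shows "wkt e 1 1 f (g1 c Disk f) u"
  using trace_wk(1)[OF c w e(2), of "4 / 3 * c^2 * e"] c e by (auto simp: Idom_def bnd_def dens_def)

lemma AE_strip: assumes "c > 0" "AE p in area c i. P p" "{a..b} \<subseteq> Idom i"
  shows "AE p in cyl {a..b}. P p"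
  using assms(2) unfolding AE_area[OF assms(1)] using assms(3)
  by (subst (asm) AE_cyl, simp, subst AE_cyl, simp) (auto elim!: eventually_mono)

text \<open>The three traces are unrelated choices. The difference of the two sides is the trace of
  a function that vanishes almost everywhere on a strip next to the circle.\<close>

lemma trace_combination:
  assumes c: "c > 0" and w: "wdt c i f u" "wdt c i f' u'" "wdt c i f'' u''"
    and eq: "AE p in area c i. f'' p = \<alpha> * f p + \<beta> * f' p"
  shows "AE \<theta> in circ. u'' \<theta> = \<alpha> * u \<theta> + \<beta> * u' \<theta>"
proof -
  \<comment> \<open>The strip from 1/2 to 1 on the disk and from 0 to 1 on a catenoid.\<close>
  obtain a b where ab: "a < b" "{a..b} \<subseteq> Idom i" "bnd i = a \<or> bnd i = b"
    and wk: "\<And>f u. wdt c i f u \<Longrightarrow> wkt a b (bnd i) f (g1 c i f) u"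
  proof (cases "i = Disk")
    case True
    show thesis by (rule that[of "1/2" 1]) (use True trace_wk_disk[OF c, of _ _ "1/2"] in \<open>auto simp: Idom_def bnd_def\<close>)
  next
    case False
    show thesis
      by (rule that[of 0 1]) (use False trace_wk_cat(1)[OF c _ False, of _ _ 1] in \<open>cases i; auto simp: Idom_def bnd_def\<close>)+
  qed
  have d: "wkt a b (bnd i) (\<lambda>p. f'' p - (\<alpha> * f p + \<beta> * f' p))
     (\<lambda>p. g1 c i f'' p - (\<alpha> * g1 c i f p + \<beta> * g1 c i f' p)) (\<lambda>\<theta>. u'' \<theta> - (\<alpha> * u \<theta> + \<beta> * u' \<theta>))"
    by (intro wkt_diff wkt_add wkt_scale wk w)
  have "AE p in cyl {a..b}. f'' p - (\<alpha> * f p + \<beta> * f' p) = 0"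
    using AE_strip[OF c eq ab(2)] by eventually_elim simp
  from wkt_trace_zero[OF ab(1,3) d this] show ?thesis by eventually_elim simp
qed

lemma boundary_trace_wdt:
  assumes "weakly_differentiable c i f" "\<exists>u. has_trace c i f u"
  shows "wdt c i f (boundary_trace c i f)"
  using someI_ex[OF assms(2)] assms(1) unfolding wdt_def boundary_trace_def by blast

text \<open>The constant sequence g serves as the approximation in \<open>has_trace\<close>, and
  uniqueness identifies the chosen trace and gradient.\<close>

lemma explicit:
  assumes c: "c > 0" and g: "C1 g" and f: "f \<in> borel_measurable borel" and eq: "AE p in area c i. f p = g (X c i p)"
  shows "weakly_differentiable c i f" "has_trace c i f (\<lambda>\<theta>. g (\<gamma> c \<theta>))"
    "AE \<theta> in circ. boundary_trace c i f \<theta> = g (\<gamma> c \<theta>)"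
    "AE p in area c i. grad c i f p = surface_gradient c i g p"
proof -
  note wg = weak_gradient_C1[OF c g f eq]
  show wd: "weakly_differentiable c i f" unfolding weakly_differentiable_def using wg by blast
  show ge: "AE p in area c i. grad c i f p = surface_gradient c i g p" by (rule grad_eq(2)[OF c wg])
  have gm: "(\<lambda>\<theta>. g (\<gamma> c \<theta>)) \<in> borel_measurable borel"
    unfolding gamma_X[of c _ i] by (rule measurable_slice_snd[OF C1_X_meas[OF g]])
  have z0: "(\<integral>\<^sup>+ p. indicator {p. norm (X c i p) \<le> R} p * ennreal ((g (X c i p) - f p)^2) \<partial>area c i) = 0" for R
  proof -
    have "(\<integral>\<^sup>+ p. indicator {p. norm (X c i p) \<le> R} p * ennreal ((g (X c i p) - f p)^2) \<partial>area c i) = (\<integral>\<^sup>+ p. 0 \<partial>area c i)"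
      by (rule nn_integral_cong_AE) (use eq in eventually_elim, simp)
    then show ?thesis by simp
  qed
  have z1: "(\<integral>\<^sup>+ p. indicator {p. norm (X c i p) \<le> R} p * ennreal ((norm (surface_gradient c i g p - grad c i f p))^2) \<partial>area c i) = 0" for R
  proof -
    have "(\<integral>\<^sup>+ p. indicator {p. norm (X c i p) \<le> R} p * ennreal ((norm (surface_gradient c i g p - grad c i f p))^2) \<partial>area c i) = (\<integral>\<^sup>+ p. 0 \<partial>area c i)"
      by (rule nn_integral_cong_AE) (use ge in eventually_elim, simp)
    then show ?thesis by simp
  qed
  show ht: "has_trace c i f (\<lambda>\<theta>. g (\<gamma> c \<theta>))"
    unfolding has_trace_def using gm z0 z1 g by (intro conjI exI[of _ "\<lambda>_. g"]) auto
  have w1: "wdt c i f (\<lambda>\<theta>. g (\<gamma> c \<theta>))" using wd ht by (simp add: wdt_def)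
  have w2: "wdt c i f (boundary_trace c i f)" by (rule boundary_trace_wdt[OF wd]) (use ht in blast)
  show "AE \<theta> in circ. boundary_trace c i f \<theta> = g (\<gamma> c \<theta>)"
    using trace_combination[OF c w1 w1 w2, of 1 0] by simp
qed

section \<open>The index form in the parameters\<close>

lemma Idom_cat: "i \<noteq> Disk \<Longrightarrow> Idom i = {0..}" by (cases i) (auto simp: Idom_def)

lemma dens_cat: "i \<noteq> Disk \<Longrightarrow> dens c i t = c^2 / (se t)^2" by (cases i) (auto simp: dens_def)

lemma AE_area_cat: assumes "c > 0" "i \<noteq> Disk"
  shows "(AE p in area c i. P p) \<longleftrightarrow> (AE p in cyl {0..}. P p)"
  unfolding AE_area[OF assms(1)] Idom_cat[OF assms(2)] by (rule refl)

text \<open>Conformality: on a catenoid both coordinate fields have squared length equal to the area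
  density.\<close>

lemma grad_inner_cat:
  assumes c: "c > 0" and i: "i \<noteq> Disk" and w: "weakly_differentiable c i f" "weakly_differentiable c i g"
  shows "AE p in cyl {0..}. dens c i (fst p) * (grad c i f p \<bullet> grad c i g p) = g1 c i f p * g1 c i g p + g2 c i f p * g2 c i g p"
proof -
  have "AE p in area c i. dens c i (fst p) * (grad c i f p \<bullet> grad c i g p) = g1 c i f p * g1 c i g p + g2 c i f p * g2 c i g p"
    using AE_grad_tangent[OF c w(1)] AE_area_fst_pos[OF c, of i]
  proof eventually_elim
    case (elim p)
    have "se (fst p) > 0" by (rule se_pos)
    then show ?case
      unfolding g1_def g2_def using c i elim
      by (subst tangent_inner[OF c rr_pos]) (auto simp: v2_cat rr_cat(1) dens_cat power_divide field_simps)
  qed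
  then show ?thesis by (simp add: AE_area_cat[OF c i])
qed

lemma L2_grad_cat:
  assumes c: "c > 0" and i: "i \<noteq> Disk" and w: "weakly_differentiable c i f"
  shows "L2 c i (grad c i f) \<longleftrightarrow> sqi (cyl {0..}) (g1 c i f) \<and> sqi (cyl {0..}) (g2 c i f)"
proof -
  note M = wdt_meas[OF w]
  have m: "(\<lambda>p. ennreal ((norm (grad c i f p))^2)) \<in> borel_measurable borel" using M(2) by simp
  have "(\<integral>\<^sup>+p. ennreal ((norm (grad c i f p))^2) \<partial>area c i) = (\<integral>\<^sup>+p. ennreal ((g1 c i f p)^2) + ennreal ((g2 c i f p)^2) \<partial>cyl {0..})"
    unfolding nn_integral_area[OF m] Idom_cat[OF i]
  proof (rule nn_integral_cong_AE)
    show "AE p in cyl {0..}. ennreal (dens c i (fst p)) * ennreal ((norm (grad c i f p))^2) = ennreal ((g1 c i f p)^2) + ennreal ((g2 c i f p)^2)"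
      using grad_inner_cat[OF c i w w]
    proof eventually_elim
      case (elim p)
      have "ennreal (dens c i (fst p)) * ennreal ((norm (grad c i f p))^2) = ennreal (dens c i (fst p) * (norm (grad c i f p))^2)"
        by (rule ennreal_mult[symmetric]) (auto simp: dens_cat[OF i])
      also have "dens c i (fst p) * (norm (grad c i f p))^2 = (g1 c i f p)^2 + (g2 c i f p)^2"
        unfolding power2_norm_eq_inner elim by (simp add: power2_eq_square)
      also have "ennreal \<dots> = ennreal ((g1 c i f p)^2) + ennreal ((g2 c i f p)^2)" by (simp add: ennreal_plus)
      finally show ?case .
    qed
  qed
  also have "\<dots> = (\<integral>\<^sup>+p. ennreal ((g1 c i f p)^2) \<partial>cyl {0..}) + (\<integral>\<^sup>+p. ennreal ((g2 c i f p)^2) \<partial>cyl {0..})"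
    using M by (intro nn_integral_add) auto
  finally have eq: "(\<integral>\<^sup>+p. ennreal ((norm (grad c i f p))^2) \<partial>area c i) = \<dots>" .
  have s: "sqi (cyl {0..}) h \<longleftrightarrow> (\<integral>\<^sup>+p. ennreal ((h p)^2) \<partial>cyl {0..}) < \<infinity>" if "h \<in> borel_measurable borel" for h
    using that by (auto simp: sqi_def integrable_iff_bounded)
  show ?thesis unfolding L2_def eq s[OF M(3)] s[OF M(4)] using M(2) by (simp add: less_top[symmetric])
qed

section \<open>Comparison of the weights at infinity\<close>

definition wgt :: "real \<Rightarrow> face \<Rightarrow> real \<times> real \<Rightarrow> real" where
  "wgt c i p = inverse (1 + (norm (X c i p))^2) * inverse ((ln (2 + norm (X c i p)))^2)"

lemma wgt_meas: "wgt c i \<in> borel_measurable borel"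
  unfolding wgt_def[abs_def] using meas_X[of c i] by measurable

lemma wgt_nonneg: "0 \<le> wgt c i p" by (simp add: wgt_def)

lemma norm_X_cat:
  assumes "i \<noteq> Disk" shows "(norm (X c i p))^2 = c^2 * ((1 / se (fst p))^2 + (fst p)^2)"
  unfolding norm_X_sq using assms by (simp add: rr_cat power_mult_distrib)

lemma inv_se_bounds: assumes "t \<ge> 0" shows "t \<le> 1 / se t" "1 / se t \<le> 2 * exp t" "exp t / 2 \<le> 1 / se t" "1 \<le> 1 / se t"
proof -
  show 3: "exp t / 2 \<le> 1 / se t" using se_le_exp[of t] se_pos[of t] by (simp add: exp_minus field_simps)
  show "1 \<le> 1 / se t" using se_le_1[of t] se_pos[of t] by simp
  have "cosh (t + ln (sqrt 3)) \<le> exp (t + ln (sqrt 3))"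
  proof -
    have "0 \<le> ln (sqrt (3::real))" by simp
    then have "exp (- (t + ln (sqrt 3))) \<le> exp (t + ln (sqrt 3))" using assms by (intro exp_mono) linarith
    then show ?thesis by (simp add: cosh_def)
  qed
  also have "\<dots> = sqrt 3 * exp t" by (simp add: exp_add)
  also have "\<dots> \<le> 2 * exp t" by (intro mult_right_mono) (auto intro: real_le_lsqrt)
  finally show "1 / se t \<le> 2 * exp t" by (simp add: se_def)
  have "sinh (t + ln (sqrt 3)) \<le> cosh (t + ln (sqrt 3))" by (simp add: sinh_le_cosh_real)
  moreover have "t \<le> sinh (t + ln (sqrt 3))"
  proof -
    have "t + ln (sqrt 3) \<le> sinh (t + ln (sqrt 3))"
    proof -
      have "0 \<le> t + ln (sqrt 3)" using assms by simp
      define s where "s = t + ln (sqrt (3::real))"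
      have s: "0 \<le> s" unfolding s_def by fact
      have "sinh 0 - 0 \<le> sinh s - s"
      proof (rule DERIV_nonneg_imp_nondecreasing[OF s, of "\<lambda>x. sinh x - x"])
        fix x :: real
        have "((\<lambda>x. sinh x - x) has_real_derivative cosh x - 1) (at x)" by (auto intro!: derivative_eq_intros)
        then show "\<exists>y. ((\<lambda>x. sinh x - x) has_real_derivative y) (at x) \<and> 0 \<le> y" using cosh_real_ge_1[of x] by auto
      qed
      then show ?thesis unfolding s_def by simp
    qed
    moreover have "0 \<le> ln (sqrt (3::real))" by simp
    ultimately show ?thesis by linarith
  qed
  ultimately show "t \<le> 1 / se t" by (simp add: se_def)
qed

text \<open>The distance from the origin is at most a multiple of K = 1 / \<open>se\<close>, so the
  density absorbs 1 + |x|^2, and the squared logarithm is crudely bounded by a multiple of exp t.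
  The constants of these two estimates make up the factor.\<close>

lemma wgt_lower:
  assumes c: "c > 0" and i: "i \<noteq> Disk" and t: "fst p \<ge> 0"
  shows "exp (- fst p) \<le> (1 + 2 * c^2) / c^2 * (8 + 16 * c) * (dens c i (fst p) * wgt c i p)"
proof -
  define K where "K = 1 / se (fst p)"
  define N where "N = norm (X c i p)"
  note b = inv_se_bounds[OF t, folded K_def]
  have N0: "N \<ge> 0" by (simp add: N_def)
  have N2: "N^2 = c^2 * (K^2 + (fst p)^2)" unfolding N_def K_def by (rule norm_X_cat[OF i])
  have "(fst p)^2 \<le> K^2" using b(1) t by (intro power_mono) auto
  then have N2': "N^2 \<le> 2 * c^2 * K^2" unfolding N2 using c by simp
  have K1: "1 \<le> K^2" using b(4) by (simp add: one_le_power)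
  have "1 + N^2 \<le> K^2 + 2 * c^2 * K^2" using N2' K1 by linarith
  then have A: "1 + N^2 \<le> (1 + 2 * c^2) * K^2" by (simp add: algebra_simps)
  have d: "dens c i (fst p) = c^2 * K^2" unfolding dens_cat[OF i] K_def by (simp add: power_divide)
  have "0 \<le> c^2 * K^2" by simp
  then have "N^2 \<le> 4 * (c^2 * K^2)" using N2' by linarith
  then have "N^2 \<le> (2 * c * K)^2" by (simp add: power_mult_distrib)
  moreover have "0 \<le> 2 * c * K" using b(4) c by simp
  ultimately have "N \<le> 2 * c * K" by (rule power2_le_imp_le)
  also have "\<dots> \<le> 2 * c * (2 * exp (fst p))" using b(2) c by (intro mult_left_mono) auto
  finally have "N \<le> 4 * c * exp (fst p)" by simp
  moreover have "1 \<le> exp (fst p)" using t by simp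
  moreover have "(2 + 4 * c) * exp (fst p) = 2 * exp (fst p) + 4 * c * exp (fst p)" by (simp only: distrib_right)
  ultimately have Nl: "2 + N \<le> (2 + 4 * c) * exp (fst p)" by linarith
  have y: "2 + N > 0" "ln (2 + N) > 0" using N0 by auto
  \<comment> \<open>ln y = 2 ln (sqrt y) is at most 2 sqrt y, so the squared logarithm grows at most
    linearly in the distance.\<close>
  have "ln (sqrt (2 + N)) \<le> sqrt (2 + N)" using y by (intro order_less_imp_le ln_less_self) simp
  then have "ln (2 + N) \<le> 2 * sqrt (2 + N)" using y by (simp add: ln_sqrt)
  then have "(ln (2 + N))^2 \<le> (2 * sqrt (2 + N))^2" using y by (intro power_mono) auto
  also have "\<dots> = 4 * (2 + N)" using y by (simp add: power_mult_distrib)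
  also have "\<dots> \<le> 4 * ((2 + 4 * c) * exp (fst p))" using Nl by simp
  finally have B: "(ln (2 + N))^2 \<le> (8 + 16 * c) * exp (fst p)" by (simp add: algebra_simps)
  have p1: "inverse ((1 + 2 * c^2) * K^2) \<le> inverse (1 + N^2)" by (rule le_imp_inverse_le[OF A]) (simp add: add_pos_nonneg)
  have p2: "inverse ((8 + 16 * c) * exp (fst p)) \<le> inverse ((ln (2 + N))^2)" by (rule le_imp_inverse_le[OF B]) (use y in simp)
  have w: "inverse ((1 + 2 * c^2) * K^2) * inverse ((8 + 16 * c) * exp (fst p)) \<le> wgt c i p"
    unfolding wgt_def N_def[symmetric] by (intro mult_mono p1 p2) (use c K1 in auto)
  have pos: "1 + 2 * c^2 > 0" "8 + 16 * c > 0" "K^2 > 0" using c K1 by (auto intro: add_pos_nonneg)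
  have "exp (- fst p) = (1 + 2 * c^2) / c^2 * (8 + 16 * c) * (c^2 * K^2 * (inverse ((1 + 2 * c^2) * K^2) * inverse ((8 + 16 * c) * exp (fst p))))"
  proof -
    have "x = A / L * B * (L * M * (inverse (A * M) * inverse (B * y)))" if "x = inverse y" "A > 0" "B > 0" "M > 0" "L > 0" "y > 0" for x y A B L M :: real
      using that by (simp add: field_simps)
    from this[OF exp_minus pos] c show ?thesis by simp
  qed
  also have "\<dots> \<le> (1 + 2 * c^2) / c^2 * (8 + 16 * c) * (c^2 * K^2 * wgt c i p)"
    by (intro mult_left_mono w) (use pos in simp_all)
  finally show ?thesis unfolding d .
qed

text \<open>The weight h is kept general to serve both spaces: it is the weight of
  \<open>L2_star\<close> for one and the constant 1 for the other.\<close>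

lemma wsq_of_weighted:
  assumes c: "c > 0" and i: "i \<noteq> Disk" and f: "f \<in> borel_measurable borel"
    and h: "h \<in> borel_measurable borel" and le: "\<And>p. fst p \<ge> 0 \<Longrightarrow> exp (- fst p) \<le> C * (dens c i (fst p) * h p)"
    and h0: "\<And>p. 0 \<le> h p" and C: "C \<ge> 0"
    and fin: "(\<integral>\<^sup>+p. ennreal ((f p)^2 * h p) \<partial>area c i) < \<infinity>"
  shows "wsq f"
proof -
  have e2: "(exp (- (t / 2)) * x)^2 = exp (- t) * x^2" for t x :: real by (simp add: power_mult_distrib exp_double[symmetric])
  have fm: "(\<lambda>p. exp (- (fst p / 2)) * f p) \<in> borel_measurable borel"
  proof -
    have e: "exp (- (fst p / 2)) = exp (- 1 / 2 * fst p)" for p :: "real \<times> real" by (rule arg_cong[where f = exp]) simp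
    show ?thesis unfolding e by (rule borel_measurable_times[OF meas_exp_fst f])
  qed
  have m: "(\<lambda>p. ennreal ((f p)^2 * h p)) \<in> borel_measurable borel"
    by (intro measurable_compose[OF _ measurable_ennreal] borel_measurable_times[OF borel_measurable_power] f h)
  have md: "(\<lambda>p. ennreal (dens c i (fst p)) * ennreal ((f p)^2 * h p)) \<in> borel_measurable borel"
    by (rule borel_measurable_times_ennreal[OF measurable_compose[OF meas_dens measurable_ennreal] m])
  have "(\<integral>\<^sup>+p. ennreal ((exp (- (fst p / 2)) * f p)^2) \<partial>cyl {0..}) \<le> (\<integral>\<^sup>+p. ennreal C * (ennreal (dens c i (fst p)) * ennreal ((f p)^2 * h p)) \<partial>cyl {0..})"
  proof (rule nn_integral_mono_AE)
    show "AE p in cyl {0..}. ennreal ((exp (- (fst p / 2)) * f p)^2) \<le> ennreal C * (ennreal (dens c i (fst p)) * ennreal ((f p)^2 * h p))"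
      using AE_cyl_inf
    proof eventually_elim
      case (elim p)
      have dn: "dens c i (fst p) \<ge> 0" by (simp add: dens_cat[OF i])
      have "exp (- fst p) * (f p)^2 \<le> (C * (dens c i (fst p) * h p)) * (f p)^2" using le[OF elim] by (intro mult_right_mono) auto
      then have "ennreal ((exp (- (fst p / 2)) * f p)^2) \<le> ennreal (C * (dens c i (fst p) * ((f p)^2 * h p)))"
        unfolding e2 by (intro ennreal_leI) (simp add: mult_ac)
      then show ?case using C dn h0[of p] by (simp add: ennreal_mult)
    qed
  qed
  also have "\<dots> = ennreal C * (\<integral>\<^sup>+p. ennreal ((f p)^2 * h p) \<partial>area c i)"
    unfolding nn_integral_area[OF m] Idom_cat[OF i] using md by (intro nn_integral_cmult) simp
  also have "\<dots> < \<infinity>" using fin by (simp add: ennreal_mult_less_top)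
  finally have "integrable (cyl {0..}) (\<lambda>p. (exp (- (fst p / 2)) * f p)^2)"
    using borel_measurable_power[OF fm, of 2] by (intro integrableI_bounded) (simp_all only: measurable_cyl real_norm_def abs_power2)
  then show ?thesis unfolding wsq_def sqi_def using fm by (simp only: measurable_cyl simp_thms)
qed

text \<open>Both spaces of variations consist of tame variations, on which the index form is computed.\<close>

definition tame :: "real \<Rightarrow> variation \<Rightarrow> bool" where
  "tame c \<phi> \<longleftrightarrow> admissible c \<phi> \<and> (\<forall>i. L2 c i (grad c i (rep_variation \<phi> i))) \<and> (\<forall>i. i \<noteq> Disk \<longrightarrow> wsq (rep_variation \<phi> i))"

lemma faces_UNIV: "i \<in> faces" by (cases i) (auto simp: faces_def)

lemma weighted_tame:
  assumes c: "c > 0" and \<phi>: "\<phi> \<in> weighted_space c" shows "tame c \<phi>"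
proof -
  have ad: "admissible c \<phi>" and L: "\<And>i. L2_star c i (rep_variation \<phi> i)" "\<And>i. L2 c i (grad c i (rep_variation \<phi> i))"
    using \<phi> faces_UNIV by (auto simp: weighted_space_def)
  have "wsq (rep_variation \<phi> i)" if i: "i \<noteq> Disk" for i
  proof (rule wsq_of_weighted[OF c i _ wgt_meas wgt_lower[OF c i] wgt_nonneg])
    show "(\<integral>\<^sup>+p. ennreal ((rep_variation \<phi> i p)^2 * wgt c i p) \<partial>area c i) < \<infinity>"
      using L(1)[of i] by (simp add: L2_star_def wgt_def mult.assoc)
  qed (use L(1)[of i] c in \<open>auto simp: L2_star_def\<close>)
  then show ?thesis using ad L by (simp add: tame_def)
qed

lemma W12_tame:
  assumes c: "c > 0" and \<phi>: "\<phi> \<in> W12_compact c" shows "tame c \<phi>"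
proof -
  have ad: "admissible c \<phi>" and L: "\<And>i. L2 c i (rep_variation \<phi> i)" "\<And>i. L2 c i (grad c i (rep_variation \<phi> i))"
    using \<phi> faces_UNIV by (auto simp: W12_compact_def)
  have "wsq (rep_variation \<phi> i)" if i: "i \<noteq> Disk" for i
  proof (rule wsq_of_weighted[OF c i, where h = "\<lambda>_. 1" and C = "1 / c^2"])
    fix p :: "real \<times> real" assume t: "fst p \<ge> 0"
    have "exp (- fst p) \<le> 1" using t by simp
    also have "1 \<le> (1 / se (fst p))^2" using inv_se_bounds(4)[OF t] by (rule one_le_power)
    finally show "exp (- fst p) \<le> 1 / c^2 * (dens c i (fst p) * 1)" using c by (simp add: dens_cat[OF i] power_divide)
  next
    show "(\<integral>\<^sup>+p. ennreal ((rep_variation \<phi> i p)^2 * 1) \<partial>area c i) < \<infinity>" using L(1)[of i] by (simp add: L2_def)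
  qed (use L(1)[of i] in \<open>auto simp: L2_def\<close>)
  then show ?thesis using ad L by (simp add: tame_def)
qed

abbreviation tr :: "real \<Rightarrow> variation \<Rightarrow> face \<Rightarrow> real \<Rightarrow> real" where
  "tr c \<phi> i \<equiv> boundary_trace c i (rep_variation \<phi> i)"

lemma tameD:
  assumes c: "c > 0" and \<phi>: "tame c \<phi>"
  shows "weakly_differentiable c i (rep_variation \<phi> i)" "wdt c i (rep_variation \<phi> i) (tr c \<phi> i)"
    "sqi circ (tr c \<phi> i)" "L2 c i (grad c i (rep_variation \<phi> i))"
    "AE \<theta> in circ. tr c \<phi> Disk \<theta> + tr c \<phi> Upper \<theta> + tr c \<phi> Lower \<theta> = 0"
    "i \<noteq> Disk \<Longrightarrow> cat (rep_variation \<phi> i) (g1 c i (rep_variation \<phi> i)) (g2 c i (rep_variation \<phi> i)) (tr c \<phi> i)"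
proof -
  have ad: "admissible c \<phi>" using \<phi> by (simp add: tame_def)
  show w: "weakly_differentiable c i (rep_variation \<phi> i)" using ad faces_UNIV by (auto simp: admissible_def)
  show t: "wdt c i (rep_variation \<phi> i) (tr c \<phi> i)"
    by (rule boundary_trace_wdt[OF w]) (use ad faces_UNIV in \<open>auto simp: admissible_def\<close>)
  show L: "L2 c i (grad c i (rep_variation \<phi> i))" using \<phi> by (simp add: tame_def)
  show "AE \<theta> in circ. tr c \<phi> Disk \<theta> + tr c \<phi> Upper \<theta> + tr c \<phi> Lower \<theta> = 0"
    using ad unfolding admissible_def AE_arclength[OF c] faces_def by (simp add: add.assoc)
  show "sqi circ (tr c \<phi> i)"
  proof (cases "i = Disk")
    case True
    have "wdt c Disk (rep_variation \<phi> i) (tr c \<phi> i)" using t True by simp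
    from trace_wk_disk[OF c this, of "1/2"] show ?thesis by (intro wktD(3)) auto
  next
    case False
    show ?thesis using wktD(3)[OF trace_wk_cat(1)[OF c t False zero_less_one]] .
  qed
  show "cat (rep_variation \<phi> i) (g1 c i (rep_variation \<phi> i)) (g2 c i (rep_variation \<phi> i)) (tr c \<phi> i)" if i: "i \<noteq> Disk"
    unfolding cat_def using trace_wk_cat[OF c t i] L2_grad_cat[OF c i w] L \<phi> i by (auto simp: tame_def)
qed

text \<open>At all parameters, including the centre and negative t, so that the term disappears from
  the integrand by rewriting.\<close>

lemma normA_Disk: "normA_sq c Disk p = 0"
proof -
  have "cross3 (dX c Disk 1 p) (dX c Disk 2 p) = (c^2 * rr Disk (fst p) * rr1 Disk (fst p)) *\<^sub>R ez"
    by (simp add: dX1 dX2 sgf_def cross_mult_left cross_mult_right power2_eq_square mult_ac)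
  then have "unit_normal c Disk p = sgn (c^2 * rr Disk (fst p) * rr1 Disk (fst p)) *\<^sub>R sgn ez"
    unfolding unit_normal_def by (simp only: sgn_scaleR)
  then have un: "unit_normal c Disk p = sgn (c^2 * rr Disk (fst p) * rr1 Disk (fst p)) *\<^sub>R ez" by (simp add: sgn_div_norm[of ez])
  have "second_form c Disk p = 0"
    unfolding second_form_def un by (simp add: vec_eq_iff forall_2 ddX rr2_def)
  then show ?thesis by (simp add: normA_sq_def shape_operator_def trace_def matrix_matrix_mult_def)
qed

text \<open>Curvature scales like 1/c and length like c, so the homothety factor cancels and only
  the cosines of the angles remain.\<close>

lemma boundary_term:
  assumes c: "c > 0" and u: "u \<in> borel_measurable borel" "v \<in> borel_measurable borel"
  shows "(\<integral>\<theta>. (curvature_vector c \<theta> \<bullet> conormal c i \<theta>) * u \<theta> * v \<theta> \<partial>arclength c)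
    = (if i = Disk then - 1 else 1 / 2) * (\<integral>\<theta>. u \<theta> * v \<theta> \<partial>circ)"
proof -
  let ?k = "if i = Disk then - sqrt 3 / (2 * c) else sqrt 3 / (4 * c)"
  have "(\<integral>\<theta>. (curvature_vector c \<theta> \<bullet> conormal c i \<theta>) * u \<theta> * v \<theta> \<partial>arclength c) = (\<integral>\<theta>. ?k * (u \<theta> * v \<theta>) \<partial>arclength c)"
    unfolding curvature_conormal[OF c] by (simp add: mult.assoc)
  also have "\<dots> = 2 * c / sqrt 3 * (\<integral>\<theta>. ?k * (u \<theta> * v \<theta>) \<partial>circ)"
    by (rule integral_arclength[OF c]) (use u in simp)
  also have "\<dots> = (2 * c / sqrt 3 * ?k) * (\<integral>\<theta>. u \<theta> * v \<theta> \<partial>circ)"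
    unfolding integral_mult_right_zero by (simp only: mult.assoc)
  also have "2 * c / sqrt 3 * ?k = (if i = Disk then - 1 else 1 / 2)" using c by simp
  finally show ?thesis .
qed

lemma area_term_cat:
  assumes c: "c > 0" and i: "i \<noteq> Disk" and C: "cat f (g1 c i f) (g2 c i f) u" "cat g (g1 c i g) (g2 c i g) v"
    and w: "weakly_differentiable c i f" "weakly_differentiable c i g"
  shows "(\<integral>p. grad c i f p \<bullet> grad c i g p - normA_sq c i p * f p * g p \<partial>area c i)
    = (\<integral>p. g1 c i f p * g1 c i g p \<partial>cyl {0..}) + (\<integral>p. g2 c i f p * g2 c i g p \<partial>cyl {0..}) - (\<integral>p. 2 * (se (fst p))^2 * f p * g p \<partial>cyl {0..})"
proof -
  note Mf = wdt_meas[OF w(1)] and Mg = wdt_meas[OF w(2)] and Cf = catD[OF C(1)] and Cg = catD[OF C(2)]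
  have nA: "normA_sq c i p = 2 * (se (fst p))^4 / c^2" for p using normA_sq_eq[OF c, of i p] i by simp
  have sem: "(\<lambda>p::real\<times>real. se (fst p)) \<in> borel_measurable borel" by (rule measurable_fst_comp) simp
  have m: "(\<lambda>p. grad c i f p \<bullet> grad c i g p - normA_sq c i p * f p * g p) \<in> borel_measurable borel"
    unfolding nA using Mf Mg sem by measurable
  have i1: "integrable (cyl {0..}) (\<lambda>p. g1 c i f p * g1 c i g p)" "integrable (cyl {0..}) (\<lambda>p. g2 c i f p * g2 c i g p)"
    using Cf Cg by (auto intro: sqi_mult_integrable)
  have i2: "integrable (cyl {0..}) (\<lambda>p. 2 * (se (fst p))^2 * f p * g p)"
    by (rule dec_mult2[where C = 4, OF _ _ Cf(5) Cg(5)]) (use se_sq_le in auto)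
  have "(\<integral>p. grad c i f p \<bullet> grad c i g p - normA_sq c i p * f p * g p \<partial>area c i)
    = (\<integral>p. dens c i (fst p) *\<^sub>R (grad c i f p \<bullet> grad c i g p - normA_sq c i p * f p * g p) \<partial>cyl {0..})"
    using integral_area[OF m, of c i] by (simp add: Idom_cat[OF i])
  also have "\<dots> = (\<integral>p. g1 c i f p * g1 c i g p + g2 c i f p * g2 c i g p - 2 * (se (fst p))^2 * f p * g p \<partial>cyl {0..})"
  proof (rule integral_cong_AE)
    show "(\<lambda>p. dens c i (fst p) *\<^sub>R (grad c i f p \<bullet> grad c i g p - normA_sq c i p * f p * g p)) \<in> borel_measurable (cyl {0..})"
      unfolding measurable_cyl by (rule borel_measurable_scaleR[OF meas_dens m])
    show "AE p in cyl {0..}. dens c i (fst p) *\<^sub>R (grad c i f p \<bullet> grad c i g p - normA_sq c i p * f p * g p)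
      = g1 c i f p * g1 c i g p + g2 c i f p * g2 c i g p - 2 * (se (fst p))^2 * f p * g p"
      using grad_inner_cat[OF c i w]
    proof eventually_elim
      case (elim p)
      have "se (fst p) > 0" by (rule se_pos)
      then have "dens c i (fst p) * (normA_sq c i p * f p * g p) = 2 * (se (fst p))^2 * f p * g p"
        using c unfolding nA dens_cat[OF i] by (simp add: power2_eq_square power4_eq_xxxx)
      then show ?case using elim by (simp add: right_diff_distrib)
    qed
  qed (use borel_measurable_integrable[OF i1(1)] borel_measurable_integrable[OF i1(2)] borel_measurable_integrable[OF i2] in \<open>intro borel_measurable_diff borel_measurable_add\<close>)
  also have "\<dots> = (\<integral>p. g1 c i f p * g1 c i g p \<partial>cyl {0..}) + (\<integral>p. g2 c i f p * g2 c i g p \<partial>cyl {0..}) - (\<integral>p. 2 * (se (fst p))^2 * f p * g p \<partial>cyl {0..})"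
    using i1 i2 by simp
  finally show ?thesis .
qed

definition cat_form :: "real \<Rightarrow> face \<Rightarrow> variation \<Rightarrow> variation \<Rightarrow> real" where
  "cat_form c i \<phi> \<psi> = (let f = rep_variation \<phi> i; g = rep_variation \<psi> i in
    (\<integral>p. g1 c i f p * g1 c i g p \<partial>cyl {0..}) + (\<integral>p. g2 c i f p * g2 c i g p \<partial>cyl {0..})
      - (\<integral>p. 2 * (se (fst p))^2 * f p * g p \<partial>cyl {0..}) - (\<integral>\<theta>. tr c \<phi> i \<theta> * tr c \<psi> i \<theta> \<partial>circ) / 2)"

text \<open>The disk has no potential term, and the circle curves away from its conormal, which
  makes the boundary term there positive.\<close>

lemma index_form_eq:
  assumes c: "c > 0" and t: "tame c \<phi>" "tame c \<psi>"
  shows "index_form c \<phi> \<psi> = (\<integral>p. grad c Disk (rep_variation \<phi> Disk) p \<bullet> grad c Disk (rep_variation \<psi> Disk) p \<partial>area c Disk)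
     + (\<integral>\<theta>. tr c \<phi> Disk \<theta> * tr c \<psi> Disk \<theta> \<partial>circ) + cat_form c Upper \<phi> \<psi> + cat_form c Lower \<phi> \<psi>"
proof -
  note A = tameD[OF c t(1)] and B = tameD[OF c t(2)]
  have um: "tr c \<phi> i \<in> borel_measurable borel" "tr c \<psi> i \<in> borel_measurable borel" for i
    using sqiD(1)[OF A(3)] sqiD(1)[OF B(3)] by auto
  have cf: "(\<integral>p. grad c i (rep_variation \<phi> i) p \<bullet> grad c i (rep_variation \<psi> i) p - normA_sq c i p * rep_variation \<phi> i p * rep_variation \<psi> i p \<partial>area c i)
    - (\<integral>\<theta>. (curvature_vector c \<theta> \<bullet> conormal c i \<theta>) * tr c \<phi> i \<theta> * tr c \<psi> i \<theta> \<partial>arclength c) = cat_form c i \<phi> \<psi>"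
    if i: "i \<noteq> Disk" for i
    unfolding boundary_term[OF c um] area_term_cat[OF c i A(6)[OF i] B(6)[OF i] A(1) B(1)] cat_form_def Let_def using i by simp
  show ?thesis
    unfolding index_form_def faces_def Let_def
    using cf[of Upper] cf[of Lower] by (simp add: normA_Disk boundary_term[OF c um])
qed

section \<open>Variations induced from functions on space\<close>

lemma rep_same: "same_variation (rep_variation \<phi>) (rep_variation \<phi>)"
  by (rule Quotient3_rep_reflp[OF Quotient3_variation])

lemma rep_meas: "rep_variation \<phi> i \<in> borel_measurable borel"
  using same_variationD(1)[OF rep_same] .

lemma AE_same:
  assumes "c > 0" "same_variation f g" shows "AE p in area c i. f i p = g i p"
  unfolding AE_area_param[OF assms(1)] using same_variationD(3)[OF assms(2)] .

text \<open>\<open>rep_variation\<close> returns some member of the class, so formulas for explicit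
  variations hold almost everywhere.\<close>

lemma rep_abs_AE:
  assumes c: "c > 0" and h: "\<And>i. h i \<in> borel_measurable borel"
  shows "AE p in area c i. rep_variation (abs_variation h) i p = h i p"
proof -
  have "same_variation h h" by (rule same_variation_refl[OF h])
  then have "same_variation (rep_variation (abs_variation h)) h"
    by (rule rep_abs_rsp_left[OF Quotient3_variation])
  then show ?thesis by (rule AE_same[OF c])
qed

lemma rep_combination:
  assumes c: "c > 0"
  shows "AE p in area c i. rep_variation (\<alpha> *\<^sub>R \<phi> + \<beta> *\<^sub>R \<psi>) i p = \<alpha> * rep_variation \<phi> i p + \<beta> * rep_variation \<psi> i p"
proof -
  have m: "same_variation (\<lambda>i p. \<alpha> * rep_variation \<phi> i p) (\<lambda>i p. \<alpha> * rep_variation \<phi> i p)" for \<alpha> \<phi>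
    by (rule same_variation_refl) (use rep_meas in measurable)
  have s: "\<alpha> *\<^sub>R \<phi> = abs_variation (\<lambda>i p. \<alpha> * rep_variation \<phi> i p)" for \<alpha> \<phi>
    using scaleR_variation.abs_eq[OF rep_same, of \<alpha> \<phi>] by (simp only: Quotient3_abs_rep[OF Quotient3_variation])
  show ?thesis
    unfolding s[of \<alpha> \<phi>] s[of \<beta> \<psi>] plus_variation.abs_eq[OF m m]
    by (rule rep_abs_AE[OF c]) (use rep_meas in measurable)
qed

lemma variation_eqI:
  assumes c: "c > 0" and eq: "\<And>i. AE p in area c i. rep_variation \<phi> i p = rep_variation \<psi> i p"
  shows "\<phi> = \<psi>"
proof -
  have "same_variation (rep_variation \<phi>) (rep_variation \<psi>)"
    using eq unfolding AE_area_param[OF c] by (intro same_variationI rep_meas)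
  then show ?thesis using Quotient3_rel_rep[OF Quotient3_variation] by blast
qed

definition induced :: "real \<Rightarrow> (face \<Rightarrow> real^3 \<Rightarrow> real) \<Rightarrow> variation" where
  "induced c G = abs_variation (\<lambda>i p. G i (X c i p))"

lemma induced:
  assumes c: "c > 0" and G: "\<And>i. C1 (G i)"
  shows "AE p in area c i. rep_variation (induced c G) i p = G i (X c i p)"
    "weakly_differentiable c i (rep_variation (induced c G) i)"
    "AE \<theta> in circ. tr c (induced c G) i \<theta> = G i (\<gamma> c \<theta>)"
    "AE p in area c i. grad c i (rep_variation (induced c G) i) p = surface_gradient c i (G i) p"
    "\<exists>u. has_trace c i (rep_variation (induced c G) i) u"
proof -
  show eq: "AE p in area c i. rep_variation (induced c G) i p = G i (X c i p)"
    unfolding induced_def by (rule rep_abs_AE[OF c C1_X_meas[OF G]])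
  note e = explicit[OF c G rep_meas eq]
  show "weakly_differentiable c i (rep_variation (induced c G) i)" "AE \<theta> in circ. tr c (induced c G) i \<theta> = G i (\<gamma> c \<theta>)"
    "AE p in area c i. grad c i (rep_variation (induced c G) i) p = surface_gradient c i (G i) p"
    "\<exists>u. has_trace c i (rep_variation (induced c G) i) u"
    using e by blast+
qed

text \<open>The weak gradient is the tangential part of the gradient in space; tested against the
  coordinate fields it gives the derivatives of G along X by the chain rule, and f1 and f2 are
  identified by uniqueness of derivatives.\<close>

lemma induced_partials:
  assumes c: "c > 0" and G: "\<And>i. C1 (G i)"
    and d: "\<And>t \<theta>. ((\<lambda>t. G i (X c i (t, \<theta>))) has_real_derivative f1 (t, \<theta>)) (at t)"
      "\<And>t \<theta>. ((\<lambda>\<theta>. G i (X c i (t, \<theta>))) has_real_derivative f2 (t, \<theta>)) (at \<theta>)"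
  shows "AE p in area c i. g1 c i (rep_variation (induced c G) i) p = f1 p"
    "AE p in area c i. g2 c i (rep_variation (induced c G) i) p = f2 p"
proof -
  have "AE p in area c i. g1 c i (rep_variation (induced c G) i) p = f1 p \<and> g2 c i (rep_variation (induced c G) i) p = f2 p"
    using induced(4)[where G = G and i = i, OF c G] AE_area_fst_pos[OF c, of i]
  proof eventually_elim
    case (elim p)
    have p: "fst p \<ge> 0" using elim by simp
    have "g1 c i (rep_variation (induced c G) i) p = fd (G i) (X c i p) (dX c i 1 p)"
      "g2 c i (rep_variation (induced c G) i) p = fd (G i) (X c i p) (dX c i 2 p)"
      unfolding g1_def g2_def elim(1) by (rule surface_gradient_dX[OF c p G])+
    moreover have "fd (G i) (X c i p) (dX c i 1 p) = f1 p" "fd (G i) (X c i p) (dX c i 2 p) = f2 p"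
      using DERIV_unique[OF C1_X_partials(1)[OF G[of i], where c = c and S = UNIV and i = i and t = "fst p" and \<theta> = "snd p", folded has_real_derivative_iff_has_vector_derivative] d(1)]
        DERIV_unique[OF C1_X_partials(2)[OF G[of i], where c = c and S = UNIV and i = i and t = "fst p" and \<theta> = "snd p", folded has_real_derivative_iff_has_vector_derivative] d(2)] by simp_all
    ultimately show ?case by simp
  qed
  then show "AE p in area c i. g1 c i (rep_variation (induced c G) i) p = f1 p"
    "AE p in area c i. g2 c i (rep_variation (induced c G) i) p = f2 p" by auto
qed

lemma admissible_induced:
  assumes c: "c > 0" and G: "\<And>i. C1 (G i)" and sum: "\<And>\<theta>. G Disk (\<gamma> c \<theta>) + G Upper (\<gamma> c \<theta>) + G Lower (\<gamma> c \<theta>) = 0"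
  shows "admissible c (induced c G)"
proof -
  have "AE \<theta> in circ. (\<Sum>i\<in>faces. tr c (induced c G) i \<theta>) = 0"
    using induced(3)[where G = G and i = Disk, OF c G] induced(3)[where G = G and i = Upper, OF c G] induced(3)[where G = G and i = Lower, OF c G]
  proof eventually_elim
    case (elim \<theta>)
    then show ?case using sum[of \<theta>] by (simp add: faces_def)
  qed
  then show ?thesis unfolding admissible_def AE_arclength[OF c]
    using induced(2,5)[where G = G, OF c G] by auto
qed

section \<open>Explicit Jacobi fields as functions on space\<close>

definition KG :: "real \<Rightarrow> face \<Rightarrow> real \<Rightarrow> real \<Rightarrow> real \<Rightarrow> real^3 \<Rightarrow> real" where
  "KG c i a b d x = a * th (sgf i / c * x $ 3) + (1 - th (sgf i / c * x $ 3) * th (sgf i / c * x $ 3)) * (b / c * x $ 1 + d / c * x $ 2)"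

lemma C1_KG: "C1 (KG c i a b d)"
  unfolding KG_def[abs_def]
  by (intro C1_add C1_mult C1_const C1_diff_const(1) C1_th C1_linear_nth)

text \<open>The height gives back t, and 1 - th^2 = se^2. Since x1 and x2 carry the radius c /
  \<open>se\<close>, the linear term becomes \<open>se\<close> times the first harmonic.\<close>

lemma KG_X: assumes "c > 0" "i \<noteq> Disk" shows "KG c i a b d (X c i p) = KK a b d p"
proof -
  have s: "sgf i / c * (c * (sgf i * fst p)) = fst p"
    using assms(1) rr_cat(4)[OF assms(2)] by (simp add: power2_eq_square mult.assoc[symmetric])
  have "1 - th (fst p) * th (fst p) = (se (fst p))^2" using th_se[of "fst p"] by (simp add: power2_eq_square)
  moreover have "b / c * (c * rr i (fst p) * cos (snd p)) + d / c * (c * rr i (fst p) * sin (snd p)) = wv b d (snd p) / se (fst p)"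
    using assms by (simp add: rr_cat wv_def add_divide_distrib)
  ultimately show ?thesis unfolding KG_def KK_def X_nth s using se_pos[of "fst p"]
    by (simp add: power2_eq_square)
qed

lemma KK_partials:
  "((\<lambda>t. KK a b d (t, \<theta>)) has_real_derivative KK1 a b d (t, \<theta>)) (at t)"
  "((\<lambda>\<theta>. KK a b d (t, \<theta>)) has_real_derivative KK2 a b d (t, \<theta>)) (at \<theta>)"
  unfolding KK_def KK1_def KK2_def wv_def
  by (auto intro!: derivative_eq_intros th_deriv se_deriv simp: algebra_simps)

text \<open>Jacobi fields with independent coefficients on the faces, so in general not admissible.
  The family contains the translations as well as the field that singles out the hyperplane.\<close>

definition jac :: "real \<Rightarrow> real \<Rightarrow> (face \<Rightarrow> real) \<Rightarrow> (face \<Rightarrow> real) \<Rightarrow> (face \<Rightarrow> real) \<Rightarrow> variation" where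
  "jac c k a b d = induced c (\<lambda>i. if i = Disk then (\<lambda>_. k) else KG c i (a i) (b i) (d i))"

lemma C1_jac: "C1 (if i = Disk then (\<lambda>_. k) else KG c i (a i) (b i) (d i))"
  by (simp add: C1_const C1_KG)

lemma jac_cat:
  assumes c: "c > 0" and i: "i \<noteq> Disk"
  shows "AE p in cyl {0..}. rep_variation (jac c k a b d) i p = KK (a i) (b i) (d i) p"
    "AE p in cyl {0..}. g1 c i (rep_variation (jac c k a b d) i) p = KK1 (a i) (b i) (d i) p"
    "AE p in cyl {0..}. g2 c i (rep_variation (jac c k a b d) i) p = KK2 (a i) (b i) (d i) p"
    "AE \<theta> in circ. tr c (jac c k a b d) i \<theta> = KK (a i) (b i) (d i) (0, \<theta>)"
proof -
  let ?G = "\<lambda>i. if i = Disk then (\<lambda>_. k) else KG c i (a i) (b i) (d i)"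
  have CG: "C1 (?G j)" for j by (rule C1_jac)
  have GX: "?G i (X c i p) = KK (a i) (b i) (d i) p" for p using i KG_X[OF c i] by simp
  have Gg: "?G i (\<gamma> c \<theta>) = KK (a i) (b i) (d i) (0, \<theta>)" for \<theta>
    unfolding gamma_X[of c \<theta> i] GX using i by (cases i) (auto simp: bnd_def)
  note I = induced[where G = ?G and i = i, OF c CG, folded jac_def]
  note D = induced_partials[where G = ?G and i = i, OF c CG, folded jac_def, unfolded GX, OF KK_partials]
  show "AE p in cyl {0..}. rep_variation (jac c k a b d) i p = KK (a i) (b i) (d i) p"
    using I(1) unfolding GX AE_area_cat[OF c i] .
  show "AE p in cyl {0..}. g1 c i (rep_variation (jac c k a b d) i) p = KK1 (a i) (b i) (d i) p"
    "AE p in cyl {0..}. g2 c i (rep_variation (jac c k a b d) i) p = KK2 (a i) (b i) (d i) p"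
    using D unfolding AE_area_cat[OF c i] .
  show "AE \<theta> in circ. tr c (jac c k a b d) i \<theta> = KK (a i) (b i) (d i) (0, \<theta>)" using I(3) unfolding Gg .
qed

lemma surface_gradient_const: "surface_gradient c i (\<lambda>_. k) p = 0"
  by (simp add: surface_gradient_def Let_def vec_eq_iff zero_vec_def[symmetric])

lemma jac_Disk:
  assumes c: "c > 0"
  shows "AE p in area c Disk. rep_variation (jac c k a b d) Disk p = k"
    "AE p in area c Disk. grad c Disk (rep_variation (jac c k a b d) Disk) p = 0"
    "AE \<theta> in circ. tr c (jac c k a b d) Disk \<theta> = k"
proof -
  let ?G = "\<lambda>i. if i = Disk then (\<lambda>_. k) else KG c i (a i) (b i) (d i)"
  have CG: "C1 (?G j)" for j by (rule C1_jac)
  note I = induced[where G = ?G and i = Disk, OF c CG, folded jac_def]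
  show "AE p in area c Disk. rep_variation (jac c k a b d) Disk p = k" "AE \<theta> in circ. tr c (jac c k a b d) Disk \<theta> = k"
    using I(1,3) by simp_all
  show "AE p in area c Disk. grad c Disk (rep_variation (jac c k a b d) Disk) p = 0" using I(4) by (simp add: surface_gradient_const)
qed

section \<open>Bounded fields in the weighted space\<close>

lemma finite_area_Disk: "emeasure (area c Disk) UNIV < \<infinity>"
proof -
  have "emeasure (area c Disk) UNIV = (\<integral>\<^sup>+p. 1 \<partial>area c Disk)"
    by (simp add: area_def)
  also have "\<dots> = (\<integral>\<^sup>+p. ennreal (dens c Disk (fst p)) * 1 \<partial>cyl (Idom Disk))" by (rule nn_integral_area) simp
  also have "\<dots> \<le> (\<integral>\<^sup>+p. ennreal (4 / 3 * c^2) \<partial>cyl {0..1})"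
    unfolding Idom_def face.case
  proof (rule nn_integral_mono_AE)
    have "AE p in cyl {0..1::real}. fst p \<in> {0..1}" by (rule AE_cyl_fst_in) simp
    then show "AE p in cyl {0..1}. ennreal (dens c Disk (fst p)) * 1 \<le> ennreal (4 / 3 * c^2)"
    proof eventually_elim
      case (elim p)
      then have "4 / 3 * c^2 * fst p \<le> 4 / 3 * c^2 * 1" by (intro mult_left_mono) auto
      then show ?case by (simp add: dens_def ennreal_leI)
    qed
  qed
  also have "\<dots> < \<infinity>"
    using finite_measure.emeasure_finite[OF finite_cyl[of 0 1]] by (simp add: ennreal_mult_eq_top_iff less_top[symmetric])
  finally show ?thesis .
qed

lemma nn_integral_area_Disk_finite:
  assumes "AE p in area c Disk. f p \<le> ennreal B" shows "(\<integral>\<^sup>+p. f p \<partial>area c Disk) < \<infinity>"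
proof -
  have "(\<integral>\<^sup>+p. f p \<partial>area c Disk) \<le> (\<integral>\<^sup>+p. ennreal B \<partial>area c Disk)" by (rule nn_integral_mono_AE[OF assms])
  also have "\<dots> = ennreal B * emeasure (area c Disk) UNIV" by (simp add: area_def)
  also have "\<dots> < \<infinity>" using finite_area_Disk[of c] by (simp add: ennreal_mult_less_top)
  finally show ?thesis .
qed

text \<open>Here the logarithm in the weight is essential: the density divided by 1 + |x|^2 is
  merely bounded, while the logarithm grows linearly in t and its square makes the bound
  integrable.\<close>

lemma wgt_upper:
  assumes c: "c > 0" and i: "i \<noteq> Disk" and t: "fst p \<ge> 0"
  shows "dens c i (fst p) * wgt c i p \<le> (2 + 1 / min 1 (c / 2))^2 * (1 / (1 + fst p)^2)"
proof -
  define e where "e = min 1 (c / 2)"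
  define N where "N = norm (X c i p)"
  define K where "K = 1 / se (fst p)"
  define L where "L = ln (2 + N)"
  note b = inv_se_bounds[OF t, folded K_def]
  have e: "0 < e" "e \<le> 1" "e \<le> c / 2" using c by (auto simp: e_def)
  have N0: "N \<ge> 0" by (simp add: N_def)
  have N2: "N^2 = c^2 * (K^2 + (fst p)^2)" unfolding N_def K_def by (rule norm_X_cat[OF i])
  have cK: "(c * K)^2 \<le> N^2" unfolding N2 by (simp add: power_mult_distrib distrib_left)
  then have NK: "c * K \<le> N" using N0 by (rule power2_le_imp_le)
  have "e * exp (fst p) \<le> c / 2 * exp (fst p)" using e by (intro mult_right_mono) auto
  also have "\<dots> = c * (exp (fst p) / 2)" by simp
  also have "\<dots> \<le> c * K" using b(3) c by (intro mult_left_mono) auto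
  finally have "e * exp (fst p) \<le> N" using NK by linarith
  \<comment> \<open>Convexity of exp turns \<open>e * exp (fst p)\<close>, which is at most N, into
    an exponential with rate e. This needs e between 0 and 1, hence the minimum in its
    definition.\<close>
  moreover have "exp ((1 - e) *\<^sub>R 0 + e *\<^sub>R fst p) \<le> (1 - e) * exp 0 + e * exp (fst p)"
    by (rule convex_onD[OF exp_convex]) (use e in auto)
  ultimately have "exp (e * fst p) \<le> 2 + N" using e by simp
  then have "ln (exp (e * fst p)) \<le> ln (2 + N)" using N0 by (subst ln_le_cancel_iff) auto
  then have l1: "e * fst p \<le> L" by (simp add: L_def)
  have "ln (2::real) \<ge> 1 / 2" using ln2_ge_two_thirds by simp
  moreover have "ln (2::real) \<le> L" unfolding L_def using N0 by (subst ln_le_cancel_iff) auto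
  ultimately have l2: "1 / 2 \<le> L" by simp
  have "fst p \<le> L / e" using l1 e by (simp add: field_simps)
  then have T: "1 + fst p \<le> (2 + 1 / e) * L" using l2 by (simp add: distrib_right)
  have L0: "L > 0" using l2 by linarith
  have "(1 + fst p)^2 \<le> ((2 + 1 / e) * L)^2" using T t by (intro power_mono) auto
  moreover have "1 / L^2 \<le> M^2 * (1 / y^2)" if "y^2 \<le> (M * L)^2" "y > 0" for M y :: real
    using that L0 by (simp add: power_mult_distrib field_simps)
  ultimately have T2: "1 / L^2 \<le> (2 + 1 / e)^2 * (1 / (1 + fst p)^2)" using t by simp
  have "dens c i (fst p) = (c * K)^2" unfolding dens_cat[OF i] K_def by (simp add: power_divide power_mult_distrib)
  then have "dens c i (fst p) \<le> 1 + N^2" using cK by simp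
  then have "dens c i (fst p) * inverse (1 + N^2) \<le> 1"
    by (simp add: divide_inverse[symmetric] divide_le_eq_1 add_pos_nonneg)
  then have "dens c i (fst p) * inverse (1 + N^2) * inverse (L^2) \<le> 1 * inverse (L^2)"
    by (rule mult_right_mono) simp
  then have "dens c i (fst p) * wgt c i p \<le> 1 / L^2"
    unfolding wgt_def N_def[symmetric] L_def[symmetric] by (simp add: divide_inverse mult.assoc)
  with T2 show ?thesis unfolding e_def by linarith
qed

lemma integrable_inverse_square: "integrable (cyl {0..}) (\<lambda>p. 1 / (1 + fst p)^2 :: real)"
proof -
  have "(\<integral>\<^sup>+t. ennreal (1 / (1 + t)^2) * indicator {0..} t \<partial>lborel) = ennreal (0 - (- (1 / (1 + 0))))"
  proof (rule nn_integral_FTC_atLeast[where F = "\<lambda>t. - (1 / (1 + t))"])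
    show "((\<lambda>t::real. - (1 / (1 + t))) \<longlongrightarrow> 0) at_top" by real_asymp
    show "((\<lambda>t. - (1 / (1 + t))) has_real_derivative 1 / (1 + t)^2) (at t)" if "0 \<le> t" for t :: real
      using that by (auto intro!: derivative_eq_intros simp: power2_eq_square)
  qed auto
  moreover have "ennreal (norm (indicator {0..} t * (1 / (1 + t)^2) :: real)) = ennreal (1 / (1 + t)^2) * indicator {0..} t" for t :: real
    by (simp add: indicator_def)
  ultimately have fin: "(\<integral>\<^sup>+t. ennreal (norm (indicator {0..} t * (1 / (1 + t)^2) :: real)) \<partial>lborel) < \<infinity>"
    by simp
  have m: "(\<lambda>t::real. 1 / (1 + t)^2) \<in> borel_measurable borel" by measurable
  have "integrable lborel (\<lambda>t. indicator {0..} t * (1 / (1 + t)^2) :: real)"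
    by (rule integrableI_bounded[OF _ fin]) measurable
  then have "integrable (lbI {0..}) (\<lambda>t. 1 / (1 + t)^2 :: real)" using m by (subst integrable_lbI) auto
  then show ?thesis by (simp add: cyl_fst(1)[OF _ m])
qed

lemma bounded_L2_star:
  assumes c: "c > 0" and f: "f \<in> borel_measurable borel" and b: "AE p in area c i. \<bar>f p\<bar> \<le> B"
  shows "L2_star c i f"
proof -
  have fB: "AE p in area c i. (f p)^2 * wgt c i p \<le> B^2 * wgt c i p"
    using b
  proof eventually_elim
    case (elim p)
    have "(f p)^2 \<le> B^2" using elim power_mono[OF elim abs_ge_zero, of 2] by simp
    then show ?case by (rule mult_right_mono[OF _ wgt_nonneg])
  qed
  have m: "(\<lambda>p. ennreal (B^2 * wgt c i p)) \<in> borel_measurable borel"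
    by (intro measurable_compose[OF _ measurable_ennreal] borel_measurable_times borel_measurable_const wgt_meas)
  have "(\<integral>\<^sup>+p. ennreal ((f p)^2 * wgt c i p) \<partial>area c i) \<le> (\<integral>\<^sup>+p. ennreal (B^2 * wgt c i p) \<partial>area c i)"
    by (rule nn_integral_mono_AE) (use fB in \<open>auto intro: ennreal_leI\<close>)
  also have "\<dots> < \<infinity>"
  proof (cases "i = Disk")
    case True
    have "wgt c i p \<le> 4" for p
    proof -
      have "ln (2::real) \<ge> 1 / 2" using ln2_ge_two_thirds by simp
      moreover have "ln (2::real) \<le> ln (2 + norm (X c i p))" by (subst ln_le_cancel_iff) (auto intro: add_pos_nonneg)
      ultimately have "1 / 2 \<le> ln (2 + norm (X c i p))" by simp
      then have "(1 / 2)^2 \<le> (ln (2 + norm (X c i p)))^2" by (intro power_mono) auto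
      then have "inverse ((ln (2 + norm (X c i p)))^2) \<le> inverse ((1 / 2)^2)" by (rule le_imp_inverse_le) simp
      moreover have "inverse (1 + (norm (X c i p))^2) \<le> 1" by (simp add: inverse_le_1_iff)
      ultimately have "wgt c i p \<le> 1 * inverse ((1 / 2)^2)" unfolding wgt_def by (intro mult_mono) auto
      then show ?thesis by (simp add: power2_eq_square)
    qed
    then have "B^2 * wgt c i p \<le> B^2 * 4" for p by (intro mult_left_mono) auto
    then show ?thesis unfolding True by (intro nn_integral_area_Disk_finite[where B = "B^2 * 4"] AE_I2 ennreal_leI)
  next
    case False
    let ?C = "B^2 * (2 + 1 / min 1 (c / 2))^2"
    have "(\<integral>\<^sup>+p. ennreal (B^2 * wgt c i p) \<partial>area c i) = (\<integral>\<^sup>+p. ennreal (dens c i (fst p)) * ennreal (B^2 * wgt c i p) \<partial>cyl {0..})"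
      unfolding nn_integral_area[OF m] Idom_cat[OF False] ..
    also have "\<dots> \<le> (\<integral>\<^sup>+p. ennreal (?C * (1 / (1 + fst p)^2)) \<partial>cyl {0..})"
    proof (rule nn_integral_mono_AE)
      show "AE p in cyl {0..}. ennreal (dens c i (fst p)) * ennreal (B^2 * wgt c i p) \<le> ennreal (?C * (1 / (1 + fst p)^2))"
        using AE_cyl_inf
      proof eventually_elim
        case (elim p)
        have d0: "dens c i (fst p) \<ge> 0" by (simp add: dens_cat[OF False])
        have "dens c i (fst p) * (B^2 * wgt c i p) = B^2 * (dens c i (fst p) * wgt c i p)" by simp
        also have "\<dots> \<le> B^2 * ((2 + 1 / min 1 (c / 2))^2 * (1 / (1 + fst p)^2))"
          by (rule mult_left_mono[OF wgt_upper[OF c False elim]]) simp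
        finally show ?case using d0 by (simp add: ennreal_mult'[symmetric] ennreal_leI mult.assoc)
      qed
    qed
    also have "\<dots> < \<infinity>"
      using integrable_mult_right[OF integrable_inverse_square, of ?C] by (simp add: integrable_iff_bounded)
    finally show ?thesis .
  qed
  finally show ?thesis unfolding L2_star_def using f by (simp add: wgt_def mult.assoc)
qed

text \<open>The conditions are admissibility on the circle, where the vertical fields contribute
  half their coefficient since th 0 = 1/2. The fields are bounded and their derivatives decay
  exponentially.\<close>

lemma jac_weighted:
  assumes c: "c > 0" and s: "k + a Upper / 2 + a Lower / 2 = 0" "b Upper + b Lower = 0" "d Upper + d Lower = 0"
  shows "jac c k a b d \<in> weighted_space c"
proof -
  let ?f = "\<lambda>i. rep_variation (jac c k a b d) i"
  let ?G = "\<lambda>i. if i = Disk then (\<lambda>_. k) else KG c i (a i) (b i) (d i)"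
  have CG: "C1 (?G j)" for j by (rule C1_jac)
  have Gg: "?G i (\<gamma> c \<theta>) = a i / 2 + sqrt 3 / 2 * wv (b i) (d i) \<theta>" if i: "i \<noteq> Disk" for i \<theta>
    unfolding gamma_X[of c \<theta> i] using i KG_X[OF c i] by (cases i) (auto simp: bnd_def KK_0)
  have "k + (a Upper / 2 + sqrt 3 / 2 * wv (b Upper) (d Upper) \<theta>) + (a Lower / 2 + sqrt 3 / 2 * wv (b Lower) (d Lower) \<theta>)
    = (k + a Upper / 2 + a Lower / 2) + sqrt 3 / 2 * ((b Upper + b Lower) * cos \<theta> + (d Upper + d Lower) * sin \<theta>)" for \<theta>
    by (simp add: wv_def algebra_simps)
  then have "?G Disk (\<gamma> c \<theta>) + ?G Upper (\<gamma> c \<theta>) + ?G Lower (\<gamma> c \<theta>) = 0" for \<theta>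
    using Gg[of Upper \<theta>] Gg[of Lower \<theta>] s by simp
  from admissible_induced[where G = ?G, OF c CG this] have ad: "admissible c (jac c k a b d)" by (simp only: jac_def)
  have L: "L2_star c i (?f i) \<and> L2 c i (grad c i (?f i))" for i
  proof (cases "i = Disk")
    case True
    have g: "grad c Disk (?f Disk) \<in> borel_measurable borel"
      using wdt_meas(2) ad faces_UNIV by (auto simp: admissible_def)
    have "(\<integral>\<^sup>+p. ennreal ((norm (grad c Disk (?f Disk) p))^2) \<partial>area c Disk) < \<infinity>"
      by (rule nn_integral_area_Disk_finite[where B = 0]) (use jac_Disk(2)[OF c, of k a b d] in auto)
    moreover have "L2_star c Disk (?f Disk)"
      by (rule bounded_L2_star[OF c rep_meas, where B = "\<bar>k\<bar>"]) (use jac_Disk(1)[OF c, of k a b d] in auto)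
    ultimately show ?thesis using g True by (simp add: L2_def)
  next
    case False
    note J = jac_cat[OF c False, of k a b d]
    have w: "weakly_differentiable c i (?f i)" using ad faces_UNIV by (auto simp: admissible_def)
    let ?C = "\<bar>a i\<bar> + \<bar>b i\<bar> + \<bar>d i\<bar>"
    have "AE p in cyl {0..}. \<bar>?f i p\<bar> \<le> ?C" using J(1) by eventually_elim (simp only: KK_bound)
    then have "L2_star c i (?f i)" by (intro bounded_L2_star[OF c rep_meas]) (simp only: AE_area_cat[OF c False])
    moreover have "sqi (cyl {0..}) (g1 c i (?f i))"
    proof (rule dec_sqi(2)[OF wdt_meas(3)[OF w]])
      show "AE p in cyl {0..}. \<bar>g1 c i (?f i) p\<bar> \<le> (4 * ?C) * exp (- fst p)" using J(2) by eventually_elim (simp only: KK_decay)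
    qed
    moreover have "sqi (cyl {0..}) (g2 c i (?f i))"
    proof (rule dec_sqi(2)[OF wdt_meas(4)[OF w]])
      show "AE p in cyl {0..}. \<bar>g2 c i (?f i) p\<bar> \<le> (4 * ?C) * exp (- fst p)" using J(3) by eventually_elim (simp only: KK_decay)
    qed
    ultimately show ?thesis using L2_grad_cat[OF c False w] by blast
  qed
  then show ?thesis using ad by (simp add: weighted_space_def)
qed

text \<open>Against Jacobi fields only the integrals of the three traces survive. This one formula
  yields both the hyperplane containing the null space and the vanishing of the form on
  translations.\<close>

lemma index_form_jac:
  assumes c: "c > 0" and t: "tame c \<phi>" "tame c (jac c k a b d)"
  shows "index_form c \<phi> (jac c k a b d)
    = k * (\<integral>\<theta>. tr c \<phi> Disk \<theta> \<partial>circ) - a Upper * (\<integral>\<theta>. tr c \<phi> Upper \<theta> \<partial>circ) - a Lower * (\<integral>\<theta>. tr c \<phi> Lower \<theta> \<partial>circ)"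
proof -
  let ?j = "jac c k a b d"
  note T = tameD[OF c t(1)] and J = tameD[OF c t(2)]
  have trm: "tr c \<phi> i \<in> borel_measurable borel" "tr c ?j i \<in> borel_measurable borel" for i
    using sqiD(1)[OF T(3)] sqiD(1)[OF J(3)] by auto
  have cf: "cat_form c i \<phi> ?j = - a i * (\<integral>\<theta>. tr c \<phi> i \<theta> \<partial>circ)" if i: "i \<noteq> Disk" for i
  proof -
    note E = jac_cat[OF c i, of k a b d] and Mf = wdt_meas[OF T(1), of i] and Mg = wdt_meas[OF J(1), of i]
    have sem: "(\<lambda>p::real\<times>real. 2 * (se (fst p))^2) \<in> borel_measurable borel" by (rule measurable_fst_comp) simp
    have 1: "(\<integral>p. g1 c i (rep_variation \<phi> i) p * g1 c i (rep_variation ?j i) p \<partial>cyl {0..}) = (\<integral>p. g1 c i (rep_variation \<phi> i) p * KK1 (a i) (b i) (d i) p \<partial>cyl {0..})"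
      by (rule integral_cong_AE)
        (use E(2) in \<open>auto simp only: measurable_cyl intro!: borel_measurable_times Mf Mg KK_meas\<close>)
    have 2: "(\<integral>p. g2 c i (rep_variation \<phi> i) p * g2 c i (rep_variation ?j i) p \<partial>cyl {0..}) = (\<integral>p. g2 c i (rep_variation \<phi> i) p * KK2 (a i) (b i) (d i) p \<partial>cyl {0..})"
      by (rule integral_cong_AE)
        (use E(3) in \<open>auto simp only: measurable_cyl intro!: borel_measurable_times Mf Mg KK_meas\<close>)
    have 3: "(\<integral>p. 2 * (se (fst p))^2 * rep_variation \<phi> i p * rep_variation ?j i p \<partial>cyl {0..}) = (\<integral>p. 2 * (se (fst p))^2 * rep_variation \<phi> i p * KK (a i) (b i) (d i) p \<partial>cyl {0..})"
      by (rule integral_cong_AE)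
        (use E(1) in \<open>auto simp only: measurable_cyl intro!: borel_measurable_times[OF borel_measurable_times[OF sem]] rep_meas KK_meas\<close>)
    have m0: "(\<lambda>\<theta>. KK (a i) (b i) (d i) (0, \<theta>)) \<in> borel_measurable borel" unfolding KK_0 wv_def by measurable
    have 4: "(\<integral>\<theta>. tr c \<phi> i \<theta> * tr c ?j i \<theta> \<partial>circ) = (\<integral>\<theta>. tr c \<phi> i \<theta> * KK (a i) (b i) (d i) (0, \<theta>) \<partial>circ)"
      by (rule integral_cong_AE)
        (use E(4) in \<open>auto simp only: measurable_circ intro!: borel_measurable_times trm m0\<close>)
    show ?thesis unfolding cat_form_def Let_def 1 2 3 4 by (rule cat_pairing(4)[OF T(6)[OF i]])
  qed
  have "(\<integral>p. grad c Disk (rep_variation \<phi> Disk) p \<bullet> grad c Disk (rep_variation ?j Disk) p \<partial>area c Disk) = 0"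
    by (rule integral_eq_zero_AE) (use jac_Disk(2)[OF c, of k a b d] in auto)
  moreover have "(\<integral>\<theta>. tr c \<phi> Disk \<theta> * tr c ?j Disk \<theta> \<partial>circ) = (\<integral>\<theta>. k * tr c \<phi> Disk \<theta> \<partial>circ)"
    by (rule integral_cong_AE)
      (use jac_Disk(3)[OF c, of k a b d] in \<open>auto simp only: measurable_circ mult.commute intro!: borel_measurable_times borel_measurable_const trm\<close>)
  ultimately show ?thesis unfolding index_form_eq[OF c t] cf[OF face.distinct(2)] cf[OF face.distinct(4)] by simp
qed

section \<open>Nullity\<close>

lemma wv_zero: assumes "AE \<theta> in circ. wv b d \<theta> = 0" shows "b = 0" "d = 0"
proof -
  have "((\<lambda>\<theta>. (wv b d \<theta>)^2) has_integral
     (b^2 * (2 * pi + sin (2 * pi) * cos (2 * pi)) / 2 + d^2 * (2 * pi - sin (2 * pi) * cos (2 * pi)) / 2 + b * d * (sin (2 * pi))^2)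
     - (b^2 * (0 + sin 0 * cos 0) / 2 + d^2 * (0 - sin 0 * cos 0) / 2 + b * d * (sin 0)^2)) {0..2 * pi}"
  proof (rule fundamental_theorem_of_calculus)
    fix \<theta> :: real
    have c1: "cos \<theta> * cos \<theta> = 1 - sin \<theta> * sin \<theta>" using sin_cos_squared_add[of \<theta>] by (simp add: power2_eq_square)
    have e: "(b * C + d * S) * (b * C + d * S) = b * b * (1 + (C * C - S * S)) / 2 + d * d * (1 - (C * C - S * S)) / 2 + b * d * (2 * S * C)"
      if "C * C = 1 - S * S" for C S :: real
    proof -
      have "(b * C + d * S) * (b * C + d * S) = b * b * (C * C) + d * d * (S * S) + 2 * b * d * S * C" by (simp add: algebra_simps)
      then show ?thesis unfolding that by (simp add: algebra_simps)
    qed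
    from e[OF c1] have "(wv b d \<theta>)^2 = b^2 * (1 + (cos \<theta> * cos \<theta> - sin \<theta> * sin \<theta>)) / 2 + d^2 * (1 - (cos \<theta> * cos \<theta> - sin \<theta> * sin \<theta>)) / 2 + b * d * (2 * sin \<theta> * cos \<theta>)"
      unfolding wv_def power2_eq_square .
    then show "((\<lambda>\<theta>. b^2 * (\<theta> + sin \<theta> * cos \<theta>) / 2 + d^2 * (\<theta> - sin \<theta> * cos \<theta>) / 2 + b * d * (sin \<theta>)^2) has_vector_derivative (wv b d \<theta>)^2) (at \<theta> within {0..2 * pi})"
      unfolding has_real_derivative_iff_has_vector_derivative[symmetric]
      by (auto intro!: derivative_eq_intros simp: field_simps)
  qed simp
  then have "integral {0..2 * pi} (\<lambda>\<theta>. (wv b d \<theta>)^2) = pi * (b^2 + d^2)"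
    by (simp add: integral_unique algebra_simps)
  moreover have "(\<integral>\<theta>. (wv b d \<theta>)^2 \<partial>circ) = integral {0..2 * pi} (\<lambda>\<theta>. (wv b d \<theta>)^2)"
    by (rule integral_circ_eq) (auto simp: wv_def[abs_def] intro!: continuous_intros)
  moreover have "(\<integral>\<theta>. (wv b d \<theta>)^2 \<partial>circ) = 0" by (rule integral_eq_zero_AE) (use assms in auto)
  ultimately have "b^2 + d^2 = 0" by simp
  then show "b = 0" "d = 0" by (simp_all add: sum_power2_eq_zero_iff)
qed

lemma trace_sum:
  assumes c: "c > 0" and t: "tame c \<phi>"
  shows "(\<integral>\<theta>. tr c \<phi> Disk \<theta> \<partial>circ) + (\<integral>\<theta>. tr c \<phi> Upper \<theta> \<partial>circ) + (\<integral>\<theta>. tr c \<phi> Lower \<theta> \<partial>circ) = 0"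
proof -
  note T = tameD[OF c t]
  have i: "integrable circ (tr c \<phi> i)" for i by (rule sqi_integrable[OF finite_circ T(3)])
  have "(\<integral>\<theta>. tr c \<phi> Disk \<theta> + tr c \<phi> Upper \<theta> + tr c \<phi> Lower \<theta> \<partial>circ) = 0" by (rule integral_eq_zero_AE[OF T(5)])
  then show ?thesis using i by simp
qed

section \<open>The index form as a sum of squares\<close>

definition rem0 :: "real \<Rightarrow> face \<Rightarrow> variation \<Rightarrow> real" where
  "rem0 c i \<phi> = (\<integral>p. (mean (g1 c i (rep_variation \<phi> i)) (fst p) - h0 (fst p) * mean (rep_variation \<phi> i) (fst p))^2 \<partial>cyl {0..})"

definition rem1 :: "real \<Rightarrow> face \<Rightarrow> variation \<Rightarrow> real" where
  "rem1 c i \<phi> = (let f = rep_variation \<phi> i in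
     (\<integral>p. (g1 c i f p - mean (g1 c i f) (fst p) + th (fst p) * (f p - mean f (fst p)))^2 \<partial>cyl {0..}))"

definition remW :: "real \<Rightarrow> face \<Rightarrow> variation \<Rightarrow> real" where
  "remW c i \<phi> = (let f = rep_variation \<phi> i in
     (\<integral>p. (g2 c i f p)^2 \<partial>cyl {0..}) - (\<integral>p. (f p - mean f (fst p))^2 \<partial>cyl {0..}))"

lemma cat_form_diag:
  assumes c: "c > 0" and t: "tame c \<phi>" and i: "i \<noteq> Disk"
  shows "cat_form c i \<phi> \<phi> = rem0 c i \<phi> + rem1 c i \<phi> + remW c i \<phi> - (\<integral>\<theta>. tr c \<phi> i \<theta> \<partial>circ)^2 / pi"
    "rem0 c i \<phi> \<ge> 0" "rem1 c i \<phi> \<ge> 0" "remW c i \<phi> \<ge> 0"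
proof -
  note C = tameD(6)[OF c t i]
  have "(\<integral>p. 2 * (se (fst p))^2 * rep_variation \<phi> i p * rep_variation \<phi> i p \<partial>cyl {0..}) = (\<integral>p. 2 * (se (fst p) * rep_variation \<phi> i p)^2 \<partial>cyl {0..})"
    by (intro Bochner_Integration.integral_cong) (simp_all add: power2_eq_square)
  then show "cat_form c i \<phi> \<phi> = rem0 c i \<phi> + rem1 c i \<phi> + remW c i \<phi> - (\<integral>\<theta>. tr c \<phi> i \<theta> \<partial>circ)^2 / pi"
    unfolding cat_form_def rem0_def rem1_def remW_def Let_def using cat_identity[OF C]
    by (simp add: power2_eq_square[symmetric])
  show "rem0 c i \<phi> \<ge> 0" "rem1 c i \<phi> \<ge> 0" by (simp_all add: rem0_def rem1_def Let_def integral_nonneg)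
  show "remW c i \<phi> \<ge> 0" using cat_perp_sqi(4)[OF C] by (simp add: remW_def Let_def)
qed

text \<open>With U the common integral on the catenoids, the integral on the disk is -2 U. Splitting
  off the mean there releases (2 U)^2 / (2 \<pi>), which is exactly the sum of the two deficits U^2
  / \<pi>.\<close>

lemma index_form_sum_of_squares:
  assumes c: "c > 0" and t: "tame c \<phi>" and eq: "(\<integral>\<theta>. tr c \<phi> Upper \<theta> \<partial>circ) = (\<integral>\<theta>. tr c \<phi> Lower \<theta> \<partial>circ)"
  shows "index_form c \<phi> \<phi> = (\<integral>p. (norm (grad c Disk (rep_variation \<phi> Disk) p))^2 \<partial>area c Disk)
    + (\<integral>\<theta>. (tr c \<phi> Disk \<theta> - (\<integral>\<theta>. tr c \<phi> Disk \<theta> \<partial>circ) / (2 * pi))^2 \<partial>circ)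
    + (rem0 c Upper \<phi> + rem1 c Upper \<phi> + remW c Upper \<phi>) + (rem0 c Lower \<phi> + rem1 c Lower \<phi> + remW c Lower \<phi>)"
proof -
  define U where "U = (\<integral>\<theta>. tr c \<phi> Lower \<theta> \<partial>circ)"
  have D: "(\<integral>\<theta>. tr c \<phi> Disk \<theta> \<partial>circ) = - 2 * U" using trace_sum[OF c t] eq by (simp add: U_def)
  have "(\<integral>\<theta>. (tr c \<phi> Disk \<theta> - (\<integral>\<theta>. tr c \<phi> Disk \<theta> \<partial>circ) / (2 * pi))^2 \<partial>circ) = (\<integral>\<theta>. (tr c \<phi> Disk \<theta>)^2 \<partial>circ) - (- 2 * U)^2 / (2 * pi)"
    using circ_mean_split[OF tameD(3)[OF c t, of Disk]] unfolding D .
  also have "(- 2 * U)^2 / (2 * pi) = U^2 / pi + U^2 / pi" by (simp add: power2_eq_square)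
  finally show ?thesis
    unfolding index_form_eq[OF c t t] cat_form_diag(1)[OF c t face.distinct(2)] cat_form_diag(1)[OF c t face.distinct(4)] eq
      power2_norm_eq_inner power2_eq_square[symmetric] U_def[symmetric] by simp
qed

lemma index_form_nonneg:
  assumes c: "c > 0" and t: "tame c \<phi>" and eq: "(\<integral>\<theta>. tr c \<phi> Upper \<theta> \<partial>circ) = (\<integral>\<theta>. tr c \<phi> Lower \<theta> \<partial>circ)"
  shows "index_form c \<phi> \<phi> \<ge> 0"
  unfolding index_form_sum_of_squares[OF assms]
  using cat_form_diag(2-4)[OF c t face.distinct(2)] cat_form_diag(2-4)[OF c t face.distinct(4)]
  by (intro add_nonneg_nonneg integral_nonneg) simp_all

text \<open>The gradient vanishes, so on every strip away from the centre f equals the constant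
  extension of its trace, which is k; the strips exhaust the disk up to a null set.\<close>

lemma harmonic_disk_constant:
  assumes c: "c > 0" and w: "wdt c Disk f u" and L: "L2 c Disk (grad c Disk f)"
    and g: "(\<integral>p. (norm (grad c Disk f p))^2 \<partial>area c Disk) = 0" and u: "AE \<theta> in circ. u \<theta> = k"
  shows "AE p in area c Disk. f p = k"
proof -
  have "integrable (area c Disk) (\<lambda>p. (norm (grad c Disk f p))^2)"
    using L by (auto simp: L2_def integrable_iff_bounded measurable_area)
  then have "AE p in area c Disk. (norm (grad c Disk f p))^2 = 0"
    using g by (subst (asm) integral_nonneg_eq_0_iff_AE) auto
  then have g0: "AE p in area c Disk. g1 c Disk f p = 0" by eventually_elim (simp add: g1_def)
  have "AE p in cyl {0..1}. e \<le> fst p \<longrightarrow> f p = k" if e: "0 < e" "e < 1" for e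
  proof -
    have "AE p in cyl {e..1}. g1 c Disk f p = 0" by (rule AE_strip[OF c g0]) (use e in \<open>auto simp: Idom_def\<close>)
    with trace_wk_disk[OF c w e] have "AE p in cyl {e..1}. f p = u (snd p)"
      by (intro wkt_flat[where e = 1 and f = f]) (use e in auto)
    moreover have "AE p in cyl {e..1}. u (snd p) = k" by (rule AE_cyl_snd[OF _ u]) simp
    ultimately have "AE p in cyl {e..1}. f p = k" by eventually_elim simp
    then show ?thesis by (subst AE_cyl, simp, subst (asm) AE_cyl, simp) (auto elim!: eventually_mono)
  qed
  \<comment> \<open>The radii 1 / (2 + n) are at most 1/2, as the strips must have an inner end
    strictly below 1.\<close>
  then have "AE p in cyl {0..1}. \<forall>n. 1 / (2 + real n) \<le> fst p \<longrightarrow> f p = k"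
    unfolding AE_all_countable by simp
  then have "AE p in area c Disk. \<forall>n. 1 / (2 + real n) \<le> fst p \<longrightarrow> f p = k"
    unfolding AE_area[OF c] Idom_def face.case .
  with AE_area_fst_pos[OF c] show ?thesis
  proof eventually_elim
    case (elim p)
    obtain n where "inverse (real (Suc n)) < fst p" using reals_Archimedean[of "fst p"] elim(1) by auto
    moreover have "1 / (2 + real n) \<le> inverse (real (Suc n))" by (simp add: field_simps)
    ultimately show ?case using elim(2) by (meson less_imp_le order_trans)
  qed
qed

text \<open>The translations. With upward normals on both catenoids the disk carries the downward
  normal, hence the -a. The horizontal components of the two catenoid normals are opposite, and that
  of the disk normal is zero.\<close>

definition null_jac :: "real \<Rightarrow> real \<Rightarrow> real \<Rightarrow> real \<Rightarrow> variation" where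
  "null_jac c a b d = jac c (- a) (\<lambda>_. a) (\<lambda>i. if i = Upper then b else - b) (\<lambda>i. if i = Upper then d else - d)"

lemma null_jac_Disk:
  assumes c: "c > 0"
  shows "AE p in area c Disk. rep_variation (null_jac c a b d) Disk p = - a" "AE \<theta> in circ. tr c (null_jac c a b d) Disk \<theta> = - a"
  unfolding null_jac_def by (rule jac_Disk[OF c])+

lemma null_jac_cat:
  assumes c: "c > 0" and i: "i \<noteq> Disk"
  shows "AE p in cyl {0..}. rep_variation (null_jac c a b d) i p = KK a (if i = Upper then b else - b) (if i = Upper then d else - d) p"
    "AE \<theta> in circ. tr c (null_jac c a b d) i \<theta> = KK a (if i = Upper then b else - b) (if i = Upper then d else - d) (0, \<theta>)"
  unfolding null_jac_def by (rule jac_cat[OF c i])+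

lemma null_jac_weighted: "c > 0 \<Longrightarrow> null_jac c a b d \<in> weighted_space c"
  unfolding null_jac_def by (rule jac_weighted) auto

text \<open>Equality in all squares gives the field on each face up to constants. The coefficients
  of \<open>th\<close> agree on the catenoids because the trace integrals do; admissibility relates
  the horizontal coefficients.\<close>

lemma index_form_zero:
  assumes c: "c > 0" and t: "tame c \<phi>" and eq: "(\<integral>\<theta>. tr c \<phi> Upper \<theta> \<partial>circ) = (\<integral>\<theta>. tr c \<phi> Lower \<theta> \<partial>circ)"
    and z: "index_form c \<phi> \<phi> = 0"
  shows "\<exists>a b d. \<phi> = null_jac c a b d"
proof -
  note T = tameD[OF c t] and Up = cat_form_diag(2-4)[OF c t face.distinct(2)] and Lo = cat_form_diag(2-4)[OF c t face.distinct(4)]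
  have "0 \<le> (\<integral>p. (norm (grad c Disk (rep_variation \<phi> Disk) p))^2 \<partial>area c Disk)"
    "0 \<le> (\<integral>\<theta>. (tr c \<phi> Disk \<theta> - (\<integral>\<theta>. tr c \<phi> Disk \<theta> \<partial>circ) / (2 * pi))^2 \<partial>circ)"
    by (simp_all add: integral_nonneg)
  with z Up Lo have G: "(\<integral>p. (norm (grad c Disk (rep_variation \<phi> Disk) p))^2 \<partial>area c Disk) = 0"
    and M: "(\<integral>\<theta>. (tr c \<phi> Disk \<theta> - (\<integral>\<theta>. tr c \<phi> Disk \<theta> \<partial>circ) / (2 * pi))^2 \<partial>circ) = 0"
    and R: "rem0 c Upper \<phi> = 0" "rem1 c Upper \<phi> = 0" "remW c Upper \<phi> = 0" "rem0 c Lower \<phi> = 0" "rem1 c Lower \<phi> = 0" "remW c Lower \<phi> = 0"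
    unfolding index_form_sum_of_squares[OF c t eq] by linarith+
  define a where "a = (\<integral>\<theta>. tr c \<phi> Upper \<theta> \<partial>circ) / pi"
  have U: "(\<integral>\<theta>. tr c \<phi> i \<theta> \<partial>circ) = a * pi" if "i \<noteq> Disk" for i using that eq by (cases i) (auto simp: a_def)
  have D: "(\<integral>\<theta>. tr c \<phi> Disk \<theta> \<partial>circ) / (2 * pi) = - a" using trace_sum[OF c t] U[of Upper] U[of Lower] by (simp add: field_simps)
  have uD: "AE \<theta> in circ. tr c \<phi> Disk \<theta> = - a"
    using sqi_zero_AE[OF sqi_diff[OF T(3) sqi_circ_const] M] unfolding D by eventually_elim simp
  have fD: "AE p in area c Disk. rep_variation \<phi> Disk p = - a"
    by (rule harmonic_disk_constant[OF c T(2) T(4) G uD])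
  have E: "\<exists>B C. (AE p in cyl {0..}. rep_variation \<phi> i p = KK a B C p) \<and> (AE \<theta> in circ. tr c \<phi> i \<theta> = a / 2 + sqrt 3 / 2 * wv B C \<theta>)"
    if i: "i \<noteq> Disk" and r: "rem0 c i \<phi> = 0" "rem1 c i \<phi> = 0" "remW c i \<phi> = 0" for i
  proof -
    obtain B C where "AE p in cyl {0..}. rep_variation \<phi> i p = a * pi / pi * th (fst p) + se (fst p) * (B * cos (snd p) + C * sin (snd p))"
      "AE \<theta> in circ. tr c \<phi> i \<theta> = a * pi / (2 * pi) + sqrt 3 / 2 * (B * cos \<theta> + C * sin \<theta>)"
      using cat_equality[OF T(6)[OF i]] r unfolding U[OF i] rem0_def rem1_def remW_def Let_def by auto
    then show ?thesis by (auto simp: KK_def wv_def)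
  qed
  obtain B C where BC: "AE p in cyl {0..}. rep_variation \<phi> Upper p = KK a B C p" "AE \<theta> in circ. tr c \<phi> Upper \<theta> = a / 2 + sqrt 3 / 2 * wv B C \<theta>"
    using E[OF _ R(1-3)] by auto
  obtain B' C' where BC': "AE p in cyl {0..}. rep_variation \<phi> Lower p = KK a B' C' p" "AE \<theta> in circ. tr c \<phi> Lower \<theta> = a / 2 + sqrt 3 / 2 * wv B' C' \<theta>"
    using E[OF _ R(4-6)] by auto
  \<comment> \<open>In the sum of the three traces the constants a/2 + a/2 - a cancel, and a first
    harmonic that vanishes almost everywhere is left.\<close>
  have "AE \<theta> in circ. wv (B + B') (C + C') \<theta> = 0"
    using T(5) uD BC(2) BC'(2)
  proof eventually_elim
    case (elim \<theta>)
    have "wv (B + B') (C + C') \<theta> = wv B C \<theta> + wv B' C' \<theta>" by (simp add: wv_def algebra_simps)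
    moreover have "sqrt 3 / 2 * (wv B C \<theta> + wv B' C' \<theta>) = 0" using elim by (simp add: algebra_simps)
    ultimately show ?case by simp
  qed
  from wv_zero[OF this] have B': "B' = - B" "C' = - C" by auto
  have "\<phi> = null_jac c a B C"
  proof (rule variation_eqI[OF c])
    fix i
    show "AE p in area c i. rep_variation \<phi> i p = rep_variation (null_jac c a B C) i p"
    proof (cases "i = Disk")
      case True
      show ?thesis unfolding True using fD null_jac_Disk(1)[OF c, of a B C] by eventually_elim simp
    next
      case False
      have "AE p in cyl {0..}. rep_variation \<phi> i p = KK a (if i = Upper then B else - B) (if i = Upper then C else - C) p"
        using False BC(1) BC'(1) unfolding B' by (cases i) auto
      then show ?thesis unfolding AE_area_cat[OF c False] using null_jac_cat(1)[OF c False, of a B C] by eventually_elim simp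
    qed
  qed
  then show ?thesis by blast
qed

lemma index_form_commute: "index_form c \<phi> \<psi> = index_form c \<psi> \<phi>"
  unfolding index_form_def Let_def by (simp add: inner_commute mult.commute mult.left_commute)

lemma null_space_eq:
  assumes c: "c > 0"
  shows "null_space c = range (\<lambda>(a, b, d). null_jac c a b d)"
proof
  show "null_space c \<subseteq> range (\<lambda>(a, b, d). null_jac c a b d)"
  proof
    fix \<phi> assume "\<phi> \<in> null_space c"
    then have w: "\<phi> \<in> weighted_space c" and n: "\<And>\<psi>. \<psi> \<in> weighted_space c \<Longrightarrow> index_form c \<phi> \<psi> = 0"
      by (auto simp: null_space_def)
    note t = weighted_tame[OF c w]
    let ?a = "\<lambda>i. if i = Upper then 1 else - 1 :: real"
    have j: "jac c 0 ?a (\<lambda>_. 0) (\<lambda>_. 0) \<in> weighted_space c" by (rule jac_weighted[OF c]) auto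
    have "(\<integral>\<theta>. tr c \<phi> Upper \<theta> \<partial>circ) = (\<integral>\<theta>. tr c \<phi> Lower \<theta> \<partial>circ)"
      using n[OF j] unfolding index_form_jac[OF c t weighted_tame[OF c j]] by simp
    from index_form_zero[OF c t this n[OF w]] obtain a b d where "\<phi> = (\<lambda>(a, b, d). null_jac c a b d) (a, b, d)" by auto
    then show "\<phi> \<in> range (\<lambda>(a, b, d). null_jac c a b d)" by (rule range_eqI)
  qed
  show "range (\<lambda>(a, b, d). null_jac c a b d) \<subseteq> null_space c"
  \<comment> \<open>The pairing with a translation is -a times the sum of the three trace integrals,
    which is zero for every admissible field.\<close>
  proof (clarsimp simp: null_space_def null_jac_weighted[OF c])
    fix a b d \<psi> assume "\<psi> \<in> weighted_space c"
    then have t: "tame c \<psi>" by (rule weighted_tame[OF c])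
    have D: "(\<integral>\<theta>. tr c \<psi> Disk \<theta> \<partial>circ) = - (\<integral>\<theta>. tr c \<psi> Upper \<theta> \<partial>circ) - (\<integral>\<theta>. tr c \<psi> Lower \<theta> \<partial>circ)"
      using trace_sum[OF c t] by linarith
    have "index_form c \<psi> (null_jac c a b d) = 0"
      unfolding null_jac_def index_form_jac[OF c t weighted_tame[OF c null_jac_weighted[OF c], unfolded null_jac_def]] D
      by (simp add: right_diff_distrib)
    then show "index_form c (null_jac c a b d) \<psi> = 0" by (subst index_form_commute)
  qed
qed

lemma trace_linear:
  assumes c: "c > 0" and t: "tame c \<phi>" "tame c \<psi>" "tame c (\<alpha> *\<^sub>R \<phi> + \<beta> *\<^sub>R \<psi>)"
  shows "AE \<theta> in circ. tr c (\<alpha> *\<^sub>R \<phi> + \<beta> *\<^sub>R \<psi>) i \<theta> = \<alpha> * tr c \<phi> i \<theta> + \<beta> * tr c \<psi> i \<theta>"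
  by (rule trace_combination[OF c tameD(2)[OF c t(1)] tameD(2)[OF c t(2)] tameD(2)[OF c t(3)] rep_combination[OF c]])

lemma trace_zero: assumes c: "c > 0" and t: "tame c \<phi>" and z: "\<phi> = 0" shows "AE \<theta> in circ. tr c \<phi> i \<theta> = 0"
proof -
  have 0: "0 *\<^sub>R \<phi> + 0 *\<^sub>R \<phi> = \<phi>" using z by simp
  have "AE \<theta> in circ. tr c (0 *\<^sub>R \<phi> + 0 *\<^sub>R \<phi>) i \<theta> = 0 * tr c \<phi> i \<theta> + 0 * tr c \<phi> i \<theta>"
    by (rule trace_linear[OF c t t]) (simp only: 0 t)
  then show ?thesis unfolding 0 by simp
qed

lemma null_jac_linear:
  assumes c: "c > 0"
  shows "\<alpha> *\<^sub>R null_jac c a b d + \<beta> *\<^sub>R null_jac c a' b' d' = null_jac c (\<alpha> * a + \<beta> * a') (\<alpha> * b + \<beta> * b') (\<alpha> * d + \<beta> * d')"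
proof (rule variation_eqI[OF c])
  fix i
  show "AE p in area c i. rep_variation (\<alpha> *\<^sub>R null_jac c a b d + \<beta> *\<^sub>R null_jac c a' b' d') i p
    = rep_variation (null_jac c (\<alpha> * a + \<beta> * a') (\<alpha> * b + \<beta> * b') (\<alpha> * d + \<beta> * d')) i p"
  proof (cases "i = Disk")
    case True
    note J = null_jac_Disk(1)[OF c]
    show ?thesis unfolding True using rep_combination[OF c, where i = Disk and \<alpha> = \<alpha> and \<beta> = \<beta> and \<phi> = "null_jac c a b d" and \<psi> = "null_jac c a' b' d'"] J[of a b d] J[of a' b' d'] J[of "\<alpha> * a + \<beta> * a'" "\<alpha> * b + \<beta> * b'" "\<alpha> * d + \<beta> * d'"]
      by eventually_elim simp
  next
    case False
    note J = null_jac_cat(1)[OF c False]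
    show ?thesis unfolding AE_area_cat[OF c False]
      using rep_combination[OF c, where i = i and \<alpha> = \<alpha> and \<beta> = \<beta> and \<phi> = "null_jac c a b d" and \<psi> = "null_jac c a' b' d'", unfolded AE_area_cat[OF c False]] J[of a b d] J[of a' b' d'] J[of "\<alpha> * a + \<beta> * a'" "\<alpha> * b + \<beta> * b'" "\<alpha> * d + \<beta> * d'"]
      by eventually_elim (auto simp: KK_def wv_def algebra_simps)
  qed
qed

text \<open>The traces suffice: the one on the disk gives a, and then the one on the upper catenoid
  is a multiple of the first harmonic with coefficients b and d.\<close>

lemma null_jac_zero: assumes c: "c > 0" and z: "null_jac c a b d = 0" shows "a = 0 \<and> b = 0 \<and> d = 0"
proof -
  note Z = trace_zero[OF c weighted_tame[OF c null_jac_weighted[OF c]] z]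
  have nz: "a = 0" if "AE \<theta> in circ. a = 0" for a :: real
  proof -
    have "(\<integral>\<theta>. a \<partial>circ) = 0" by (rule integral_eq_zero_AE[OF that])
    then show ?thesis by simp
  qed
  have "AE \<theta> in circ. a = 0"
    using Z[of Disk] null_jac_Disk(2)[OF c, of a b d] by eventually_elim simp
  then have a: "a = 0" by (rule nz)
  have "AE \<theta> in circ. wv b d \<theta> = 0"
    using Z[of Upper] null_jac_cat(2)[OF c face.distinct(2), of a b d] by eventually_elim (simp add: KK_0 a)
  then show ?thesis using a wv_zero by blast
qed

lemma nullity_eq: assumes c: "c > 0" shows "nullity c = 3"
proof -
  let ?f = "\<lambda>(a, b, d). null_jac c a b d"
  have lin: "linear ?f"
  proof (rule linearI)
    show "?f (x + y) = ?f x + ?f y" for x y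
      using null_jac_linear[OF c, of 1 "fst x" "fst (snd x)" "snd (snd x)" 1 "fst y" "fst (snd y)" "snd (snd y)"]
      by (simp add: case_prod_beta)
    show "?f (r *\<^sub>R x) = r *\<^sub>R ?f x" for r x
      using null_jac_linear[OF c, of r "fst x" "fst (snd x)" "snd (snd x)" 0 "fst x" "fst (snd x)" "snd (snd x)"]
      by (simp add: case_prod_beta)
  qed
  moreover have "inj ?f"
    unfolding linear_injective_0[OF lin] using null_jac_zero[OF c] by (auto simp: zero_prod_def)
  ultimately have "dim (range ?f) = dim (UNIV :: (real \<times> real \<times> real) set)"
    by (intro dim_image_eq) auto
  then show ?thesis unfolding nullity_def null_space_eq[OF c] by simp
qed

section \<open>Morse index\<close>

text \<open>Opposite tents on the catenoids, long enough for the boundary term to win.\<close>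

definition bump :: "real \<Rightarrow> real \<Rightarrow> variation" where
  "bump c r = induced c (\<lambda>i x. (r * sgf i) * (max 0 (1 - sgf i / (16 * c) * x $ 3))^2)"

text \<open>This is why the tent is squared: the positive part alone has a corner.\<close>

lemma C1_bump: "C1 (\<lambda>x. (r * sgf i) * (max 0 (1 - sgf i / (16 * c) * x $ 3))^2)"
  by (intro C1_mult C1_const C1_max0_sq C1_diff_const(1) C1_linear_nth)

lemma bump_X:
  assumes "c > 0"
  shows "(r * sgf i) * (max 0 (1 - sgf i / (16 * c) * X c i p $ 3))^2 = (r * sgf i) * (max 0 (1 - fst p / 16))^2"
proof (cases "i = Disk")
  case True
  then show ?thesis by (simp add: sgf_def)
next
  case False
  have "sgf i / (16 * c) * (c * (sgf i * fst p)) = (sgf i)^2 * fst p / 16" using assms by (simp add: power2_eq_square)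
  also have "\<dots> = fst p / 16" unfolding rr_cat(4)[OF False] by simp
  finally have e: "sgf i / (16 * c) * (c * (sgf i * fst p)) = fst p / 16" .
  show ?thesis unfolding X_nth e ..
qed

lemma bump:
  assumes c: "c > 0"
  shows "AE p in area c i. rep_variation (bump c r) i p = (r * sgf i) * (max 0 (1 - fst p / 16))^2"
    "AE p in area c i. g1 c i (rep_variation (bump c r) i) p = - (r * sgf i / 8) * max 0 (1 - fst p / 16)"
    "AE p in area c i. g2 c i (rep_variation (bump c r) i) p = 0"
    "AE \<theta> in circ. tr c (bump c r) i \<theta> = r * sgf i"
    "admissible c (bump c r)"
proof -
  let ?G = "\<lambda>i x. (r * sgf i) * (max 0 (1 - sgf i / (16 * c) * x $ 3))^2"
  have CG: "C1 (?G j)" for j by (rule C1_bump)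
  have Gg: "?G i (\<gamma> c \<theta>) = r * sgf i" for i \<theta>
    unfolding gamma_X[of c \<theta> i] bump_X[OF c] by (cases i) (simp_all add: bnd_def sgf_def)
  note I = induced[where G = ?G and i = i, OF c CG, folded bump_def]
  show "AE p in area c i. rep_variation (bump c r) i p = (r * sgf i) * (max 0 (1 - fst p / 16))^2"
    using I(1) unfolding bump_X[OF c] .
  show "AE \<theta> in circ. tr c (bump c r) i \<theta> = r * sgf i" using I(3) unfolding Gg .
  have "((\<lambda>t. (r * sgf i) * (max 0 (1 - fst (t, \<theta>) / 16))^2) has_real_derivative - (r * sgf i / 8) * max 0 (1 - fst (t, \<theta>) / 16)) (at t)" for t \<theta> :: real
  proof -
    have "((\<lambda>t. 1 - t / 16) has_real_derivative - (1 / 16)) (at t)" by (auto intro!: derivative_eq_intros)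
    from DERIV_cmult[OF DERIV_chain2[OF max0_sq_deriv this], of "r * sgf i"] show ?thesis by (simp add: mult_ac)
  qed
  moreover have "((\<lambda>\<theta>. (r * sgf i) * (max 0 (1 - fst (t, \<theta>) / 16))^2) has_real_derivative 0) (at \<theta>)" for t \<theta> :: real
    by simp
  ultimately have D: "AE p in area c i. g1 c i (rep_variation (bump c r) i) p = - (r * sgf i / 8) * max 0 (1 - fst p / 16)"
    "AE p in area c i. g2 c i (rep_variation (bump c r) i) p = 0"
    using induced_partials[where G = ?G and i = i and ?f1.0 = "\<lambda>p. - (r * sgf i / 8) * max 0 (1 - fst p / 16)" and ?f2.0 = "\<lambda>_. 0",
        OF c CG, folded bump_def, unfolded bump_X[OF c]] by blast+
  show "AE p in area c i. g1 c i (rep_variation (bump c r) i) p = - (r * sgf i / 8) * max 0 (1 - fst p / 16)"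
    "AE p in area c i. g2 c i (rep_variation (bump c r) i) p = 0" by (rule D)+
  have "?G Disk (\<gamma> c \<theta>) + ?G Upper (\<gamma> c \<theta>) + ?G Lower (\<gamma> c \<theta>) = 0" for \<theta> unfolding Gg by (simp add: sgf_def)
  from admissible_induced[where G = ?G, OF c CG this] show "admissible c (bump c r)" by (simp only: bump_def)
qed

text \<open>The constant exp 16 pays for the support of the tent, which ends at t = 16.\<close>

lemma tent_bounds:
  fixes t :: real
  assumes "t \<ge> 0" shows "max 0 (1 - t / 16) \<le> 1" "max 0 (1 - t / 16) \<le> exp 16 * exp (- t)"
proof -
  show 1: "max 0 (1 - t / 16) \<le> 1" using assms by simp
  show "max 0 (1 - t / 16) \<le> exp 16 * exp (- t)"
  proof (cases "t \<ge> 16")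
    case False
    then have "1 \<le> exp (16 - t)" by simp
    also have "\<dots> = exp 16 * exp (- t)" by (simp add: exp_add[symmetric])
    finally show ?thesis using 1 by linarith
  qed simp
qed

lemma bump_Disk: assumes c: "c > 0"
  shows "AE p in area c Disk. rep_variation (bump c r) Disk p = 0" "AE p in area c Disk. grad c Disk (rep_variation (bump c r) Disk) p = 0"
proof -
  show z: "AE p in area c Disk. rep_variation (bump c r) Disk p = 0"
    using bump(1)[OF c, where i = Disk and r = r] by (simp add: sgf_def)
  show "AE p in area c Disk. grad c Disk (rep_variation (bump c r) Disk) p = 0"
    using explicit(4)[OF c C1_const rep_meas z] unfolding surface_gradient_const .
qed

lemma bump_W12: assumes c: "c > 0" shows "bump c r \<in> W12_compact c"
proof -
  let ?f = "\<lambda>i. rep_variation (bump c r) i" and ?m = "\<lambda>t. max 0 (1 - t / 16) :: real"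
  have w: "weakly_differentiable c i (?f i)" for i using bump(5)[OF c] faces_UNIV by (auto simp: admissible_def)
  have "L2 c i (?f i) \<and> L2 c i (grad c i (?f i)) \<and> (\<exists>R. AE p in area c i. R < norm (X c i p) \<longrightarrow> ?f i p = 0)" for i
  proof (cases "i = Disk")
    case True
    note D = bump_Disk[OF c, of r]
    have "L2 c Disk (?f Disk)"
      unfolding L2_def by (intro conjI rep_meas nn_integral_area_Disk_finite[where B = 0]) (use D(1) in auto)
    moreover have "L2 c Disk (grad c Disk (?f Disk))"
      unfolding L2_def by (intro conjI wdt_meas(2)[OF w] nn_integral_area_Disk_finite[where B = 0]) (use D(2) in auto)
    moreover have "AE p in area c Disk. 0 < norm (X c Disk p) \<longrightarrow> ?f Disk p = 0" using D(1) by eventually_elim simp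
    ultimately show ?thesis unfolding True by blast
  next
    case False
    note A = AE_area_cat[OF c False] and s2 = rr_cat(4)[OF False]
    have "\<bar>sgf i\<bar> = 1" using s2 by (simp add: abs_square_eq_1)
    have g1: "sqi (cyl {0..}) (g1 c i (?f i))"
    proof (rule dec_sqi(2)[OF wdt_meas(3)[OF w]])
      show "AE p in cyl {0..}. \<bar>g1 c i (?f i) p\<bar> \<le> (\<bar>r\<bar> * exp 16) * exp (- fst p)"
        using bump(2)[OF c, where i = i and r = r, unfolded A] AE_cyl_inf
      proof eventually_elim
        case (elim p)
        have "\<bar>r\<bar> / 8 * ?m (fst p) \<le> \<bar>r\<bar> * (exp 16 * exp (- fst p))"
          using tent_bounds(2)[OF elim(2)] by (intro mult_mono) auto
        then show ?case unfolding elim(1) using \<open>\<bar>sgf i\<bar> = 1\<close> by (simp add: abs_mult mult.assoc)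
      qed
    qed
    have g2: "sqi (cyl {0..}) (g2 c i (?f i))"
    proof (rule dec_sqi(2)[OF wdt_meas(4)[OF w], where C = 0])
      show "AE p in cyl {0..}. \<bar>g2 c i (?f i) p\<bar> \<le> 0 * exp (- fst p)"
        using bump(3)[OF c, where i = i and r = r, unfolded A] by eventually_elim simp
    qed
    let ?B = "(c * r)^2 * (2 * exp 16)^2 * exp 16"
    have m: "(\<lambda>p. ennreal ((norm (?f i p))^2)) \<in> borel_measurable borel" using rep_meas by measurable
    have "(\<integral>\<^sup>+p. ennreal ((norm (?f i p))^2) \<partial>area c i) = (\<integral>\<^sup>+p. ennreal (dens c i (fst p)) * ennreal ((norm (?f i p))^2) \<partial>cyl {0..})"
      unfolding nn_integral_area[OF m] Idom_cat[OF False] ..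
    also have "\<dots> \<le> (\<integral>\<^sup>+p. ennreal (?B * exp (- fst p)) \<partial>cyl {0..})"
    proof (rule nn_integral_mono_AE)
      show "AE p in cyl {0..}. ennreal (dens c i (fst p)) * ennreal ((norm (?f i p))^2) \<le> ennreal (?B * exp (- fst p))"
        using bump(1)[OF c, where i = i and r = r, unfolded A] AE_cyl_inf
      proof eventually_elim
        case (elim p)
        define K M where "K = 1 / se (fst p)" and "M = ?m (fst p)"
        note M = tent_bounds[OF elim(2), folded M_def]
        have K0: "0 \<le> K" using se_pos[of "fst p"] by (simp add: K_def)
        have M0: "0 \<le> M" by (simp add: M_def)
        have "K * M \<le> 2 * exp (fst p) * (exp 16 * exp (- fst p))"
          unfolding K_def by (intro mult_mono inv_se_bounds(2)[OF elim(2)] M(2)) (use M0 in auto)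
        also have "\<dots> = 2 * exp 16" by (simp add: exp_minus)
        finally have "(K * M)^2 \<le> (2 * exp 16)^2" using K0 M0 by (intro power_mono) auto
        moreover have "M * M \<le> exp 16 * exp (- fst p)" using mult_left_le[OF M(1) M0] M(2) by linarith
        ultimately have "(K * M)^2 * (M * M) \<le> (2 * exp 16)^2 * (exp 16 * exp (- fst p))" by (rule mult_mono) (use M0 in auto)
        then have "(c * r)^2 * ((K * M)^2 * (M * M)) \<le> (c * r)^2 * ((2 * exp 16)^2 * (exp 16 * exp (- fst p)))"
          by (intro mult_left_mono) auto
        moreover have "dens c i (fst p) * (?f i p)^2 = (c * r)^2 * ((K * M)^2 * (M * M)) * (sgf i)^2"
          unfolding elim(1) dens_cat[OF False] M_def[symmetric] by (simp add: K_def power2_eq_square)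
        ultimately have "dens c i (fst p) * (?f i p)^2 \<le> ?B * exp (- fst p)" unfolding s2 by (simp only: mult.assoc mult_1_right)
        moreover have "0 \<le> dens c i (fst p)" by (simp add: dens_cat[OF False])
        ultimately show ?case by (simp add: ennreal_mult[symmetric] ennreal_leI)
      qed
    qed
    also have "\<dots> < \<infinity>"
    proof -
      have em: "(\<lambda>t::real. exp (- t)) \<in> borel_measurable borel" by measurable
      have "integrable (cyl {0..}) (\<lambda>p. exp (- fst p))" by (simp add: cyl_fst(1)[OF _ em] integrable_exp_neg)
      from integrable_mult_right[OF this, of ?B] show ?thesis
        by (subst (asm) integrable_iff_bounded) (simp add: abs_mult)
    qed
    finally have f2: "L2 c i (?f i)" unfolding L2_def using rep_meas by blast
    have "AE p in area c i. c * (2 * exp 16 + 16) < norm (X c i p) \<longrightarrow> ?f i p = 0"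
      using bump(1)[OF c, where i = i and r = r, unfolded A] AE_cyl_inf unfolding A
    proof eventually_elim
      case (elim p)
      have "norm (X c i p) \<le> c * (2 * exp 16 + 16)" if f: "fst p < 16"
      proof -
        define K where "K = 1 / se (fst p)"
        have K: "0 \<le> K" "K \<le> 2 * exp (fst p)" using inv_se_bounds(2)[OF elim(2)] se_pos[of "fst p"] by (auto simp: K_def)
        have "exp (fst p) \<le> exp 16" using f by simp
        with K have K2: "K + fst p \<le> 2 * exp 16 + 16" using f by linarith
        have "K^2 + (fst p)^2 \<le> (K + fst p)^2" using K(1) elim(2) by (simp add: power2_sum)
        then have "(norm (X c i p))^2 \<le> (c * (K + fst p))^2"
          unfolding norm_X_cat[OF False] K_def[symmetric] power_mult_distrib by (intro mult_left_mono) auto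
        then have "norm (X c i p) \<le> c * (K + fst p)" by (rule power2_le_imp_le) (use c K(1) elim(2) in simp)
        also have "\<dots> \<le> c * (2 * exp 16 + 16)" using K2 c by (intro mult_left_mono) auto
        finally show ?thesis .
      qed
      then show ?case unfolding elim(1) by (cases "fst p < 16") auto
    qed
    then show ?thesis using f2 g1 g2 L2_grad_cat[OF c False w] by blast
  qed
  then show ?thesis using bump(5)[OF c] by (simp add: W12_compact_def)
qed

text \<open>The slope is at most r/8 in absolute value on a length of 16, so the Dirichlet integral
  is at most 2 \<pi> 16 r^2 / 64 = \<pi> r^2 / 2. The boundary term is \<pi> r^2, half of the
  integral of r^2 over the circle, and the potential only helps.\<close>

lemma bump_cat_form:
  assumes c: "c > 0" and i: "i \<noteq> Disk" shows "cat_form c i (bump c r) (bump c r) \<le> - (r^2 * pi / 2)"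
proof -
  let ?f = "rep_variation (bump c r) i"
  note A = AE_area_cat[OF c i] and t = W12_tame[OF c bump_W12[OF c, of r]]
  note C = catD[OF tameD(6)[OF c t i]]
  have s2: "(sgf i)^2 = 1" by (rule rr_cat(4)[OF i])
  have "(\<integral>p. g1 c i ?f p * g1 c i ?f p \<partial>cyl {0..}) \<le> (\<integral>p. indicator {0..16} (fst p) * (r^2 / 64) \<partial>cyl {0..})"
  proof (rule integral_mono_AE)
    show "integrable (cyl {0..}) (\<lambda>p. g1 c i ?f p * g1 c i ?f p)" using sqi_mult_integrable[OF C(3) C(3)] .
    show "integrable (cyl {0..}) (\<lambda>p. indicator {0..16} (fst p) * (r^2 / 64))"
      by (subst integrable_cyl_subset(1)[symmetric]) (auto intro: finite_measure.integrable_const[OF finite_cyl])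
    show "AE p in cyl {0..}. g1 c i ?f p * g1 c i ?f p \<le> indicator {0..16} (fst p) * (r^2 / 64)"
      using bump(2)[OF c, where i = i and r = r, unfolded A] AE_cyl_inf
    proof eventually_elim
      case (elim p)
      have "g1 c i ?f p * g1 c i ?f p = (r^2 * (sgf i)^2 / 64) * (max 0 (1 - fst p / 16))^2"
        unfolding elim(1) by (simp add: power2_eq_square)
      also have "\<dots> = r^2 / 64 * (max 0 (1 - fst p / 16))^2" unfolding s2 by simp
      also have "\<dots> \<le> indicator {0..16} (fst p) * (r^2 / 64)"
      proof (cases "fst p \<le> 16")
        case True
        have "r^2 / 64 * (max 0 (1 - fst p / 16))^2 \<le> r^2 / 64 * 1"
          using tent_bounds(1)[OF elim(2)] by (intro mult_left_mono power_le_one) auto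
        then show ?thesis using True elim(2) by simp
      qed simp
      finally show ?case .
    qed
  qed
  also have "\<dots> = (\<integral>p. r^2 / 64 \<partial>cyl {0..16})" by (rule integrable_cyl_subset(2)[symmetric]) auto
  also have "\<dots> = 2 * pi * (\<integral>t. r^2 / 64 \<partial>lbI {0..16})"
    by (rule cyl_fst(2)) (auto intro: finite_measure.integrable_const[OF finite_lbI])
  also have "(\<integral>t. r^2 / 64 \<partial>lbI {0..16}) = r^2 / 64 * 16 - r^2 / 64 * 0"
    by (rule integral_lbI_FTC) (auto intro!: derivative_eq_intros)
  finally have 1: "(\<integral>p. g1 c i ?f p * g1 c i ?f p \<partial>cyl {0..}) \<le> pi * r^2 / 2" by simp
  have 2: "(\<integral>p. g2 c i ?f p * g2 c i ?f p \<partial>cyl {0..}) = 0"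
    by (rule integral_eq_zero_AE) (use bump(3)[OF c, where i = i and r = r, unfolded A] in auto)
  have 3: "0 \<le> (\<integral>p. 2 * (se (fst p))^2 * ?f p * ?f p \<partial>cyl {0..})"
    by (intro Bochner_Integration.integral_nonneg) (simp add: mult.assoc)
  have "(\<integral>\<theta>. tr c (bump c r) i \<theta> * tr c (bump c r) i \<theta> \<partial>circ) = (\<integral>\<theta>. r^2 \<partial>circ)"
  proof (rule integral_cong_AE)
    show "AE \<theta> in circ. tr c (bump c r) i \<theta> * tr c (bump c r) i \<theta> = r^2"
      using bump(4)[OF c, where i = i and r = r]
    proof eventually_elim
      case (elim \<theta>)
      have "r * sgf i * (r * sgf i) = r^2 * (sgf i)^2" by (simp add: power2_eq_square)
      then show ?case unfolding elim s2 by simp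
    qed
  qed (use sqiD(1)[OF C(6)] in auto)
  then have 4: "(\<integral>\<theta>. tr c (bump c r) i \<theta> * tr c (bump c r) i \<theta> \<partial>circ) = 2 * pi * r^2" by simp
  have "r^2 * pi = pi * r^2" by (rule mult.commute)
  then show ?thesis using 1 3 unfolding cat_form_def Let_def 2 4 by linarith
qed

lemma bump_index_form: assumes c: "c > 0" and r: "r \<noteq> 0" shows "index_form c (bump c r) (bump c r) < 0"
proof -
  note t = W12_tame[OF c bump_W12[OF c, of r]]
  have 1: "(\<integral>p. grad c Disk (rep_variation (bump c r) Disk) p \<bullet> grad c Disk (rep_variation (bump c r) Disk) p \<partial>area c Disk) = 0"
    by (intro integral_eq_zero_AE) (use bump_Disk(2)[OF c, of r] in auto)
  have 2: "(\<integral>\<theta>. tr c (bump c r) Disk \<theta> * tr c (bump c r) Disk \<theta> \<partial>circ) = 0"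
    by (intro integral_eq_zero_AE) (use bump(4)[OF c, where i = Disk and r = r] in \<open>auto simp: sgf_def\<close>)
  have "0 < r^2 * pi" using r by simp
  then show ?thesis
    unfolding index_form_eq[OF c t t] 1 2
    using bump_cat_form[OF c face.distinct(2), of r] bump_cat_form[OF c face.distinct(4), of r] by linarith
qed

lemma bump_scale: assumes c: "c > 0" shows "r *\<^sub>R bump c 1 = bump c r"
proof (rule variation_eqI[OF c])
  fix i
  show "AE p in area c i. rep_variation (r *\<^sub>R bump c 1) i p = rep_variation (bump c r) i p"
    using rep_combination[OF c, where i = i and \<alpha> = r and \<beta> = 0 and \<phi> = "bump c 1" and \<psi> = "bump c 1"] bump(1)[OF c, where i = i and r = 1] bump(1)[OF c, where i = i and r = r]
    by eventually_elim simp
qed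

lemma bump_nonzero: assumes c: "c > 0" shows "bump c 1 \<noteq> 0"
proof
  assume z: "bump c 1 = 0"
  have "AE \<theta> in circ. (1::real) = 0"
    using bump(4)[OF c, where i = Upper and r = 1] trace_zero[OF c W12_tame[OF c bump_W12[OF c]] z, of Upper]
    by eventually_elim (simp add: sgf_def)
  then have "(\<integral>\<theta>. 1 \<partial>circ) = (0::real)" by (rule integral_eq_zero_AE)
  then show False by simp
qed

text \<open>The difference \<open>?l\<close> of the trace integrals on the two catenoids is linear
  on S. Two independent elements would have a nonzero combination in its kernel, where the form is
  nonnegative.\<close>

lemma negative_subspace_dim:
  assumes c: "c > 0" and S: "subspace S" "S \<subseteq> W12_compact c" and neg: "\<And>\<phi>. \<phi> \<in> S \<Longrightarrow> \<phi> \<noteq> 0 \<Longrightarrow> index_form c \<phi> \<phi> < 0"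
  shows "dim S \<le> 1"
proof (rule ccontr)
  assume "\<not> dim S \<le> 1"
  obtain B where B: "B \<subseteq> S" "independent B" "card B = dim S" using basis_exists[of S] by metis
  obtain T where "T \<subseteq> B" "card T = 2" using obtain_subset_with_card_n[of 2 B] B(3) \<open>\<not> dim S \<le> 1\<close> by auto
  moreover from this obtain x y where "T = {x, y}" "x \<noteq> y" by (auto simp: card_2_iff)
  ultimately have xy: "x \<in> S" "y \<in> S" "x \<noteq> y" "independent {x, y}"
    using B(1) independent_mono[OF B(2)] by auto
  have t: "tame c \<phi>" if "\<phi> \<in> S" for \<phi> using W12_tame[OF c] S(2) that by blast
  let ?l = "\<lambda>\<phi>. (\<integral>\<theta>. tr c \<phi> Upper \<theta> \<partial>circ) - (\<integral>\<theta>. tr c \<phi> Lower \<theta> \<partial>circ)"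
  \<comment> \<open>The combination l(y) x - l(x) y lies in the kernel. If both values vanish it
    would be zero, so x itself is taken.\<close>
  define \<alpha> \<beta> where "\<alpha> = (if ?l y = 0 \<and> ?l x = 0 then 1 else ?l y)" and "\<beta> = - ?l x"
  define z where "z = \<alpha> *\<^sub>R x + \<beta> *\<^sub>R y"
  have zS: "z \<in> S" unfolding z_def using S(1) xy by (intro subspace_add subspace_scale)
  have "z \<noteq> 0"
  proof
    assume "z = 0"
    have "\<alpha> = 0 \<and> \<beta> = 0"
    proof (rule ccontr)
      assume n: "\<not> (\<alpha> = 0 \<and> \<beta> = 0)"
      have "(\<Sum>v\<in>{x, y}. (if v = x then \<alpha> else \<beta>) *\<^sub>R v) = 0" using xy(3) \<open>z = 0\<close> by (simp add: z_def)
      then have "dependent {x, y}"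
        unfolding dependent_finite[OF finite.insertI[OF finite.insertI[OF finite.emptyI]]]
        using n xy(3) by (intro exI[of _ "\<lambda>v. if v = x then \<alpha> else \<beta>"]) auto
      then show False using xy(4) by blast
    qed
    then show False by (auto simp: \<alpha>_def \<beta>_def split: if_splits)
  qed
  have int: "(\<integral>\<theta>. tr c z i \<theta> \<partial>circ) = \<alpha> * (\<integral>\<theta>. tr c x i \<theta> \<partial>circ) + \<beta> * (\<integral>\<theta>. tr c y i \<theta> \<partial>circ)" for i
  proof -
    have i: "integrable circ (tr c \<phi> i)" if "\<phi> \<in> S" for \<phi> by (rule sqi_integrable[OF finite_circ tameD(3)[OF c t[OF that]]])
    have "(\<integral>\<theta>. tr c z i \<theta> \<partial>circ) = (\<integral>\<theta>. \<alpha> * tr c x i \<theta> + \<beta> * tr c y i \<theta> \<partial>circ)"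
    proof (rule integral_cong_AE)
      show "AE \<theta> in circ. tr c z i \<theta> = \<alpha> * tr c x i \<theta> + \<beta> * tr c y i \<theta>"
        using trace_linear[OF c t[OF xy(1)] t[OF xy(2)] t[OF zS[unfolded z_def]]] unfolding z_def .
    qed (use borel_measurable_integrable[OF i[OF zS]] borel_measurable_integrable[OF i[OF xy(1)]] borel_measurable_integrable[OF i[OF xy(2)]] in auto)
    then show ?thesis using i[OF xy(1)] i[OF xy(2)] by simp
  qed
  have "?l z = \<alpha> * ?l x + \<beta> * ?l y" unfolding int by (simp add: algebra_simps)
  also have "\<dots> = 0" by (simp add: \<alpha>_def \<beta>_def algebra_simps)
  finally have "index_form c z z \<ge> 0" by (intro index_form_nonneg[OF c t[OF zS]]) simp
  then show False using neg[OF zS \<open>z \<noteq> 0\<close>] by simp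
qed

lemma morse_index_eq: assumes c: "c > 0" shows "morse_index c = 1"
  unfolding morse_index_def
proof (rule antisym)
  let ?A = "{enat (dim S) | S. subspace S \<and> S \<subseteq> W12_compact c \<and> (\<forall>\<phi>\<in>S. \<phi> \<noteq> 0 \<longrightarrow> index_form c \<phi> \<phi> < 0)}"
  show "Sup ?A \<le> 1"
  proof (rule Sup_least)
    fix n assume "n \<in> ?A"
    then obtain S where n: "n = enat (dim S)" and S: "subspace S" "S \<subseteq> W12_compact c" "\<forall>\<phi>\<in>S. \<phi> \<noteq> 0 \<longrightarrow> index_form c \<phi> \<phi> < 0"
      unfolding mem_Collect_eq by (elim exE conjE)
    have "dim S \<le> 1" by (rule negative_subspace_dim[OF c S(1,2)]) (use S(3) in blast)
    then show "n \<le> 1" by (simp add: n one_enat_def)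
  qed
  \<comment> \<open>The multiples of one bump are again bumps, with amplitude r; hence the amplitude
    as a parameter.\<close>
  have sp: "span {bump c 1} = range (bump c)" unfolding span_singleton bump_scale[OF c] ..
  have b0: "bump c 0 = 0" using bump_scale[OF c, of 0] by simp
  have "\<forall>\<phi>\<in>span {bump c 1}. \<phi> \<noteq> 0 \<longrightarrow> index_form c \<phi> \<phi> < 0"
  proof (intro ballI impI)
    fix \<phi> assume "\<phi> \<in> span {bump c 1}" "\<phi> \<noteq> 0"
    then obtain r where r: "\<phi> = bump c r" unfolding sp by (elim rangeE)
    then have "r \<noteq> 0" using \<open>\<phi> \<noteq> 0\<close> b0 by auto
    then show "index_form c \<phi> \<phi> < 0" unfolding r by (rule bump_index_form[OF c])
  qed
  moreover have "span {bump c 1} \<subseteq> W12_compact c" unfolding sp using bump_W12[OF c] by blast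
  ultimately have "enat (dim (span {bump c 1})) \<in> ?A" using subspace_span[of "{bump c 1}"] by blast
  then have "enat (dim (span {bump c 1})) \<le> Sup ?A" by (rule Sup_upper)
  moreover have "dim (span {bump c 1}) = 1"
    using bump_nonzero[OF c] by (simp add: dim_eq_card_independent dim_span)
  ultimately show "1 \<le> Sup ?A" by (simp only: one_enat_def)
qed

theorem theorem4p3:
  fixes c :: real
  assumes "c > 0"
  shows "morse_index c = 1 \<and> nullity c = 3"
  using morse_index_eq[OF assms] nullity_eq[OF assms] by blast

end
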